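(* Let $\mathbb{F}$ be an algebraically closed field, let $\mathcal{A}$ be a finite dimensional nonassociative algebra over $\mathbb{F}$ such that the automorphism group scheme $\mathbf{Aut}(\mathcal{A})$ is smooth, let $\mathbb{K}/\mathbb{F}$ be a field extension with $\mathbb{K}$ algebraically closed, and let $G$ be a finitely generated abelian group. Put $\mathcal{A}_{\mathbb{K}}:=\mathcal{A}\otimes_{\mathbb{F}}\mathbb{K}$. For a $G$-grading $\Gamma$ denote by $[\Gamma]$ its isomorphism class, and for a $G$-grading $\Gamma$ on $\mathcal{A}$ denote by $\Gamma_{\mathbb{K}}$ the $G$-grading on $\mathcal{A}_{\mathbb{K}}$ obtained by extension of scalars. Then the map $$\{\text{isomorphism classes of } G\text{-gradings on } \mathcal{A}\}\longrightarrow \{\text{isomorphism classes of } G\text{-gradings on } \mathcal{A}_{\mathbb{K}}\},\qquad [\Gamma]\mapsto[\Gamma_{\mathbb{K}}],$$ is a bijection.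
   Context: "Nonassociative algebra" over a field $\mathbb{F}$ means a vector space with a bilinear product, not necessarily associative (nor unital). $\mathbf{Aut}(\mathcal{A})$ is the affine group scheme over $\mathbb{F}$ given by the functor $R\mapsto \mathrm{Aut}_R(\mathcal{A}\otimes_{\mathbb{F}}R)$ (automorphisms as $R$-algebras) from unital commutative associative $\mathbb{F}$-algebras to groups; $\mathrm{Aut}(\mathcal{A})=\mathbf{Aut}(\mathcal{A})(\mathbb{F})$. For an abelian group $G$ (written multiplicatively), a $G$-grading on an algebra $\mathcal{A}$ over a field is a vector space decomposition $\Gamma:\mathcal{A}=\bigoplus_{g\in G}\mathcal{A}_g$ with $\mathcal{A}_g\mathcal{A}_h\subseteq\mathcal{A}_{gh}$ for all $g,h\in G$ (some $\mathcal{A}_g$ may be zero). Two $G$-gradings $\Gamma:\mathcal{A}=\bigoplus_{g\in G}\mathcal{A}_g$ and $\Gamma':\mathcal{A}=\bigoplus_{g\in G}\mathcal{A}'_g$ on the same algebra are isomorphic if there is an algebra automorphism $\varphi\in\mathrm{Aut}(\mathcal{A})$ with $\varphi(\mathcal{A}_g)=\mathcal{A}'_g$ for all $g\in G$. The extended grading $\Gamma_{\mathbb{K}}$ on the $\mathbb{K}$-algebra $\mathcal{A}_{\mathbb{K}}$ has homogeneous components $(\mathcal{A}_{\mathbb{K}})_g=\mathcal{A}_g\otimes_{\mathbb{F}}\mathbb{K}$; gradings and isomorphisms on $\mathcal{A}_{\mathbb{K}}$ are over $\mathbb{K}$. *)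

theory Defs
  imports "HOL-Algebra.Algebra"
begin

text \<open>
  The record \<^typ>\<open>('f, 'a) module\<close> extends \<^typ>\<open>'a ring\<close>, so it already carries a product; its field
  \<^const>\<open>one\<close> is ignored throughout when the record is used as a nonassociative algebra.
\<close>

locale nonassoc_algebra = module R A for R (structure) and A (structure) +
  assumes prod_closed: "\<lbrakk>x \<in> carrier A; y \<in> carrier A\<rbrakk> \<Longrightarrow> x \<otimes>\<^bsub>A\<^esub> y \<in> carrier A"
    and prod_l_distr: "\<lbrakk>x \<in> carrier A; y \<in> carrier A; z \<in> carrier A\<rbrakk>
      \<Longrightarrow> (x \<oplus>\<^bsub>A\<^esub> y) \<otimes>\<^bsub>A\<^esub> z = x \<otimes>\<^bsub>A\<^esub> z \<oplus>\<^bsub>A\<^esub> y \<otimes>\<^bsub>A\<^esub> z"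
    and prod_r_distr: "\<lbrakk>x \<in> carrier A; y \<in> carrier A; z \<in> carrier A\<rbrakk>
      \<Longrightarrow> z \<otimes>\<^bsub>A\<^esub> (x \<oplus>\<^bsub>A\<^esub> y) = z \<otimes>\<^bsub>A\<^esub> x \<oplus>\<^bsub>A\<^esub> z \<otimes>\<^bsub>A\<^esub> y"
    and prod_smult_l: "\<lbrakk>c \<in> carrier R; x \<in> carrier A; y \<in> carrier A\<rbrakk>
      \<Longrightarrow> (c \<odot>\<^bsub>A\<^esub> x) \<otimes>\<^bsub>A\<^esub> y = c \<odot>\<^bsub>A\<^esub> (x \<otimes>\<^bsub>A\<^esub> y)"
    and prod_smult_r: "\<lbrakk>c \<in> carrier R; x \<in> carrier A; y \<in> carrier A\<rbrakk>
      \<Longrightarrow> x \<otimes>\<^bsub>A\<^esub> (c \<odot>\<^bsub>A\<^esub> y) = c \<odot>\<^bsub>A\<^esub> (x \<otimes>\<^bsub>A\<^esub> y)"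

definition fin_dim :: "('f, 'm) ring_scheme \<Rightarrow> ('f, 'a, 'n) module_scheme \<Rightarrow> bool" where
  "fin_dim F A \<longleftrightarrow> (\<exists>S. finite S \<and> S \<subseteq> carrier A \<and>
     (\<forall>a \<in> carrier A. \<exists>c \<in> S \<rightarrow> carrier F. a = (\<Oplus>\<^bsub>A\<^esub>s\<in>S. c s \<odot>\<^bsub>A\<^esub> s)))"

definition algebra_auts :: "('r, 'm) ring_scheme \<Rightarrow> ('r, 'a, 'n) module_scheme \<Rightarrow> ('a \<Rightarrow> 'a) set" where
  "algebra_auts R A = {\<phi> \<in> Bij (carrier A).
     (\<forall>x \<in> carrier A. \<forall>y \<in> carrier A. \<phi> (x \<oplus>\<^bsub>A\<^esub> y) = \<phi> x \<oplus>\<^bsub>A\<^esub> \<phi> y) \<and>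
     (\<forall>c \<in> carrier R. \<forall>x \<in> carrier A. \<phi> (c \<odot>\<^bsub>A\<^esub> x) = c \<odot>\<^bsub>A\<^esub> \<phi> x) \<and>
     (\<forall>x \<in> carrier A. \<forall>y \<in> carrier A. \<phi> (x \<otimes>\<^bsub>A\<^esub> y) = \<phi> x \<otimes>\<^bsub>A\<^esub> \<phi> y)}"

text \<open>
  For an \<open>F\<close>-module \<open>A\<close> and an \<open>F\<close>-algebra \<open>R\<close>, the tensor product of \<open>A\<close> and \<open>R\<close> over \<open>F\<close> is the free
  abelian group on \<open>A \<times> R\<close> modulo the subgroup generated by the usual relations.
\<close>

definition tensor_free ::
  "('f, 'a, 'n) module_scheme \<Rightarrow> ('f, 'r, 'p) module_scheme \<Rightarrow> ('a \<times> 'r \<Rightarrow>\<^sub>0 int) monoid" where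
  "tensor_free A R = free_Abelian_group (carrier A \<times> carrier R)"

definition tensor_rels ::
  "('f, 'm) ring_scheme \<Rightarrow> ('f, 'a, 'n) module_scheme \<Rightarrow> ('f, 'r, 'p) module_scheme
    \<Rightarrow> ('a \<times> 'r \<Rightarrow>\<^sub>0 int) set" where
  "tensor_rels F A R =
     {frag_of (a \<oplus>\<^bsub>A\<^esub> b, r) - frag_of (a, r) - frag_of (b, r) |a b r.
        a \<in> carrier A \<and> b \<in> carrier A \<and> r \<in> carrier R} \<union>
     {frag_of (a, r \<oplus>\<^bsub>R\<^esub> s) - frag_of (a, r) - frag_of (a, s) |a r s.
        a \<in> carrier A \<and> r \<in> carrier R \<and> s \<in> carrier R} \<union>
     {frag_of (c \<odot>\<^bsub>A\<^esub> a, r) - frag_of (a, c \<odot>\<^bsub>R\<^esub> r) |c a r.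
        c \<in> carrier F \<and> a \<in> carrier A \<and> r \<in> carrier R}"

definition tensor_null ::
  "('f, 'm) ring_scheme \<Rightarrow> ('f, 'a, 'n) module_scheme \<Rightarrow> ('f, 'r, 'p) module_scheme
    \<Rightarrow> ('a \<times> 'r \<Rightarrow>\<^sub>0 int) set" where
  "tensor_null F A R = generate (tensor_free A R) (tensor_rels F A R)"

definition tensor_class ::
  "('f, 'm) ring_scheme \<Rightarrow> ('f, 'a, 'n) module_scheme \<Rightarrow> ('f, 'r, 'p) module_scheme
    \<Rightarrow> ('a \<times> 'r \<Rightarrow>\<^sub>0 int) \<Rightarrow> ('a \<times> 'r \<Rightarrow>\<^sub>0 int) set" where
  "tensor_class F A R u = tensor_null F A R #>\<^bsub>tensor_free A R\<^esub> u"

definition pure_tensor ::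
  "('f, 'm) ring_scheme \<Rightarrow> ('f, 'a, 'n) module_scheme \<Rightarrow> ('f, 'r, 'p) module_scheme
    \<Rightarrow> 'a \<Rightarrow> 'r \<Rightarrow> ('a \<times> 'r \<Rightarrow>\<^sub>0 int) set" where
  "pure_tensor F A R a r = tensor_class F A R (frag_of (a, r))"

text \<open>
  Product \<open>(a \<otimes> r)(b \<otimes> s) = ab \<otimes> rs\<close> and scalar action \<open>s(a \<otimes> r) = a \<otimes> sr\<close>, extended additively to the
  free group and then (as for \<^const>\<open>rcoset_mult\<close>) applied to representatives of the cosets.
\<close>

definition frag_prod ::
  "('f, 'a, 'n) module_scheme \<Rightarrow> ('f, 'r, 'p) module_scheme
    \<Rightarrow> ('a \<times> 'r \<Rightarrow>\<^sub>0 int) \<Rightarrow> ('a \<times> 'r \<Rightarrow>\<^sub>0 int) \<Rightarrow> ('a \<times> 'r \<Rightarrow>\<^sub>0 int)" where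
  "frag_prod A R u v =
     frag_extend (\<lambda>(a, r). frag_extend (\<lambda>(b, s). frag_of (a \<otimes>\<^bsub>A\<^esub> b, r \<otimes>\<^bsub>R\<^esub> s)) v) u"

definition frag_map2 :: "('r \<Rightarrow> 's) \<Rightarrow> ('a \<times> 'r \<Rightarrow>\<^sub>0 int) \<Rightarrow> ('a \<times> 's \<Rightarrow>\<^sub>0 int)" where
  "frag_map2 h = frag_extend (\<lambda>(a, r). frag_of (a, h r))"

definition extend_scalars ::
  "('f, 'm) ring_scheme \<Rightarrow> ('f, 'a, 'n) module_scheme \<Rightarrow> ('f, 'r, 'p) module_scheme
    \<Rightarrow> ('r, ('a \<times> 'r \<Rightarrow>\<^sub>0 int) set) module" where
  "extend_scalars F A R =
     \<lparr>carrier = carrier (tensor_free A R Mod tensor_null F A R),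
      monoid.mult = (\<lambda>U V. \<Union>u\<in>U. \<Union>v\<in>V. tensor_class F A R (frag_prod A R u v)),
      one = pure_tensor F A R \<one>\<^bsub>A\<^esub> \<one>\<^bsub>R\<^esub>,
      ring.zero = \<one>\<^bsub>tensor_free A R Mod tensor_null F A R\<^esub>,
      ring.add = (\<otimes>\<^bsub>tensor_free A R Mod tensor_null F A R\<^esub>),
      smult = (\<lambda>s U. \<Union>u\<in>U. tensor_class F A R (frag_map2 (\<lambda>r. s \<otimes>\<^bsub>R\<^esub> r) u))\<rparr>"

text \<open>The map \<open>id \<otimes> h\<close> from \<open>A \<otimes> R\<close> to \<open>A \<otimes> S\<close>; here \<open>R\<close> enters only through the coset \<open>U\<close>.\<close>

definition tensor_map ::
  "('f, 'm) ring_scheme \<Rightarrow> ('f, 'a, 'n) module_scheme \<Rightarrow> ('f, 's, 'p) module_scheme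
    \<Rightarrow> ('r \<Rightarrow> 's) \<Rightarrow> ('a \<times> 'r \<Rightarrow>\<^sub>0 int) set \<Rightarrow> ('a \<times> 's \<Rightarrow>\<^sub>0 int) set" where
  "tensor_map F A S h U = (\<Union>u\<in>U. tensor_class F A S (frag_map2 h u))"

definition algebra_homs ::
  "('f, 'm) ring_scheme \<Rightarrow> ('f, 'r, 'p) module_scheme \<Rightarrow> ('f, 's, 'q) module_scheme
    \<Rightarrow> ('r \<Rightarrow> 's) set" where
  "algebra_homs F R S = {h \<in> ring_hom R S.
     \<forall>c \<in> carrier F. \<forall>r \<in> carrier R. h (c \<odot>\<^bsub>R\<^esub> r) = c \<odot>\<^bsub>S\<^esub> h r}"

definition Aut_scheme ::
  "('f, 'm) ring_scheme \<Rightarrow> ('f, 'a, 'n) module_scheme \<Rightarrow> ('f, 'r, 'p) module_scheme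
    \<Rightarrow> (('a \<times> 'r \<Rightarrow>\<^sub>0 int) set \<Rightarrow> ('a \<times> 'r \<Rightarrow>\<^sub>0 int) set) set" where
  "Aut_scheme F A R = algebra_auts R (extend_scalars F A R)"

text \<open>
  \<open>Aut_scheme_map F A R S h \<phi> \<psi>\<close> says that the group homomorphism from \<open>Aut_scheme F A R\<close> to
  \<open>Aut_scheme F A S\<close> induced by \<open>h\<close> sends \<open>\<phi>\<close> to \<open>\<psi>\<close>. The square below determines \<open>\<psi>\<close>, since \<open>A \<otimes> S\<close> is
  spanned over \<open>S\<close> by the image of \<open>A \<otimes> R\<close>.
\<close>

definition Aut_scheme_map ::
  "('f, 'm) ring_scheme \<Rightarrow> ('f, 'a, 'n) module_scheme \<Rightarrow> ('f, 'r, 'p) module_scheme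
    \<Rightarrow> ('f, 's, 'q) module_scheme \<Rightarrow> ('r \<Rightarrow> 's)
    \<Rightarrow> (('a \<times> 'r \<Rightarrow>\<^sub>0 int) set \<Rightarrow> ('a \<times> 'r \<Rightarrow>\<^sub>0 int) set)
    \<Rightarrow> (('a \<times> 's \<Rightarrow>\<^sub>0 int) set \<Rightarrow> ('a \<times> 's \<Rightarrow>\<^sub>0 int) set) \<Rightarrow> bool" where
  "Aut_scheme_map F A R S h \<phi> \<psi> \<longleftrightarrow>
     \<phi> \<in> Aut_scheme F A R \<and> \<psi> \<in> Aut_scheme F A S \<and>
     (\<forall>t \<in> carrier (extend_scalars F A R). \<psi> (tensor_map F A S h t) = tensor_map F A S h (\<phi> t))"

text \<open>
  Smooth means locally of finite presentation and formally smooth: points lift along every surjection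
  of commutative \<open>F\<close>-algebras whose kernel has square zero. For finite dimensional \<open>A\<close> over a field
  the first condition always holds, because the automorphism group scheme is then a closed subscheme
  of a general linear group; so only the lifting property is imposed.

  A quantifier in a formula cannot range over types, so the test algebras have their elements in
  one fixed type. Elements of the type used here are sets of polynomials over \<open>F\<close> in the variables
  \<open>X\<^sub>0, X\<^sub>1, \<dots>\<close> (a function from \<^typ>\<open>nat multiset\<close> gives the coefficients), so every quotient of a
  polynomial ring in countably many variables occurs. This loses nothing: if the scheme is
  represented by \<open>P / J\<close> with \<open>P\<close> a polynomial ring in finitely many variables, then lifting the
  identity of \<open>P / J\<close> along \<open>P / J\<^sup>2 \<rightarrow> P / J\<close> gives the lifting property for arbitrary test algebras.
\<close>

type_synonym 'f test_algebra = "('f, (nat multiset \<Rightarrow> 'f) set) module"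

definition smooth_Aut_scheme ::
  "('f, 'm) ring_scheme \<Rightarrow> ('f, 'a, 'n) module_scheme \<Rightarrow> bool" where
  "smooth_Aut_scheme F A \<longleftrightarrow>
     (\<forall>(R :: 'f test_algebra) (S :: 'f test_algebra) h.
        algebra F R \<longrightarrow> algebra F S \<longrightarrow> h \<in> algebra_homs F R S \<longrightarrow> h ` carrier R = carrier S \<longrightarrow>
        (\<forall>x \<in> carrier R. \<forall>y \<in> carrier R. h x = \<zero>\<^bsub>S\<^esub> \<longrightarrow> h y = \<zero>\<^bsub>S\<^esub> \<longrightarrow> x \<otimes>\<^bsub>R\<^esub> y = \<zero>\<^bsub>R\<^esub>) \<longrightarrow>
        (\<forall>\<psi> \<in> Aut_scheme F A S. \<exists>\<phi>. Aut_scheme_map F A R S h \<phi> \<psi>))"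

text \<open>
  A grading is a family of subspaces, \<open>undefined\<close> outside \<^term>\<open>carrier G\<close> so that equal gradings
  are equal functions. \<open>G\<close> may be infinite: directness of the sum is uniqueness of decompositions
  with finite support.
\<close>

definition gradings ::
  "('g, 'l) monoid_scheme \<Rightarrow> ('f, 'm) ring_scheme \<Rightarrow> ('f, 'a, 'n) module_scheme
    \<Rightarrow> ('g \<Rightarrow> 'a set) set" where
  "gradings G F A = {\<Gamma> \<in> extensional (carrier G).
     (\<forall>g \<in> carrier G. submodule (\<Gamma> g) F A) \<and>
     (\<forall>a \<in> carrier A. \<exists>!x. x \<in> (\<Pi>\<^sub>E g \<in> carrier G. \<Gamma> g) \<and>
        finite {g \<in> carrier G. x g \<noteq> \<zero>\<^bsub>A\<^esub>} \<and>
        a = (\<Oplus>\<^bsub>A\<^esub>g \<in> {g \<in> carrier G. x g \<noteq> \<zero>\<^bsub>A\<^esub>}. x g)) \<and>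
     (\<forall>g \<in> carrier G. \<forall>h \<in> carrier G. \<forall>x \<in> \<Gamma> g. \<forall>y \<in> \<Gamma> h. x \<otimes>\<^bsub>A\<^esub> y \<in> \<Gamma> (g \<otimes>\<^bsub>G\<^esub> h))}"

definition grading_iso ::
  "('g, 'l) monoid_scheme \<Rightarrow> ('f, 'm) ring_scheme \<Rightarrow> ('f, 'a, 'n) module_scheme
    \<Rightarrow> (('g \<Rightarrow> 'a set) \<times> ('g \<Rightarrow> 'a set)) set" where
  "grading_iso G F A = {(\<Gamma>, \<Gamma>'). \<Gamma> \<in> gradings G F A \<and> \<Gamma>' \<in> gradings G F A \<and>
     (\<exists>\<phi> \<in> algebra_auts F A. \<forall>g \<in> carrier G. \<phi> ` \<Gamma> g = \<Gamma>' g)}"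

abbreviation grading_classes ::
  "('g, 'l) monoid_scheme \<Rightarrow> ('f, 'm) ring_scheme \<Rightarrow> ('f, 'a, 'n) module_scheme
    \<Rightarrow> ('g \<Rightarrow> 'a set) set set" where
  "grading_classes G F A \<equiv> gradings G F A // grading_iso G F A"

text \<open>The component of degree \<open>g\<close> is the image of \<open>\<Gamma> g \<otimes> K\<close> in \<open>A \<otimes> K\<close>.\<close>

definition extend_grading ::
  "('g, 'l) monoid_scheme \<Rightarrow> ('f, 'm) ring_scheme \<Rightarrow> ('f, 'a, 'n) module_scheme
    \<Rightarrow> ('f, 'k, 'p) module_scheme \<Rightarrow> ('g \<Rightarrow> 'a set) \<Rightarrow> ('g \<Rightarrow> ('a \<times> 'k \<Rightarrow>\<^sub>0 int) set set)" where
  "extend_grading G F A K \<Gamma> = (\<lambda>g \<in> carrier G.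
     generate (add_monoid (extend_scalars F A K)) {pure_tensor F A K a k |a k. a \<in> \<Gamma> g \<and> k \<in> carrier K})"

definition extend_class ::
  "('g, 'l) monoid_scheme \<Rightarrow> ('f, 'm) ring_scheme \<Rightarrow> ('f, 'a, 'n) module_scheme
    \<Rightarrow> ('f, 'k, 'p) module_scheme \<Rightarrow> ('g \<Rightarrow> 'a set) set
    \<Rightarrow> ('g \<Rightarrow> ('a \<times> 'k \<Rightarrow>\<^sub>0 int) set set) set" where
  "extend_class G F A K C =
     (\<Union>\<Gamma>\<in>C. grading_iso G K (extend_scalars F A K) `` {extend_grading G F A K \<Gamma>})"

definition finitely_generated_group :: "('g, 'l) monoid_scheme \<Rightarrow> bool" where
  "finitely_generated_group G \<longleftrightarrow>
     (\<exists>S. finite S \<and> S \<subseteq> carrier G \<and> generate G S = carrier G)"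

end

theory Submission
  imports Defs
begin

text \<open>
  Write \<open>A\<^sub>R\<close> for \<open>A \<otimes> R\<close>. Choose a basis of \<open>A\<close>. A \<open>G\<close>-grading of \<open>A\<^sub>R\<close> is the same as a family of projections, that is, of
  matrices \<open>E g\<close> over \<open>R\<close> (almost all zero) that satisfies certain polynomial equations; an isomorphism of gradings is
  an invertible matrix \<open>M\<close> that respects the multiplication and satisfies \<open>M (E g) = (E' g) M\<close>. So both halves of
  the theorem are about solving polynomial equations (theorems \<open>grading_iso_iff\<close> and \<open>extend_mgrading\<close>).

  Injectivity: if two gradings over \<open>F\<close> become isomorphic over \<open>K\<close>, the entries of the isomorphism generate
  a finitely generated \<open>F\<close>-subalgebra of \<open>K\<close>. It has an \<open>F\<close>-point (\<open>specialization\<close>), and the image of the isomorphism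
  under this point is an isomorphism over \<open>F\<close> (\<open>isomorphism_descends\<close>).

  Surjectivity: let \<open>E\<close> be the projections of a grading of \<open>A\<^sub>K\<close>, let \<open>B\<close> be the finitely generated \<open>F\<close>-algebra generated by their
  entries, let \<open>\<epsilon>\<close> be an \<open>F\<close>-point of \<open>B\<close> with kernel \<open>I\<close>, and let \<open>E0\<close> be the image of \<open>E\<close> under \<open>\<epsilon>\<close>,
  a grading over \<open>F\<close>. It is to be shown that \<open>E\<close> and \<open>E0\<close> are isomorphic over \<open>K\<close>; this is \<open>grading_descends\<close>. In geometric terms
  \<open>E\<close> is a family of gradings over the integral scheme \<open>Spec B\<close>, and smoothness makes it trivial on
  the infinitesimal neighbourhoods of the point \<open>\<epsilon>\<close>:

  \<^item> The two gradings agree over \<open>B/I\<close>. If they are isomorphic over \<open>B/I\<^sup>m\<close>, they are so over \<open>B/I\<^bsup>m+1\<^esup>\<close> (\<open>lift_isomorphism\<close>):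
    the kernel of the map between these rings squares to zero, so by smoothness the isomorphism lifts to an automorphism, which reduces the
    problem to two families of projections \<open>e\<close> and \<open>e'\<close> that agree modulo a square-zero ideal. Then \<open>\<Sum> e g e' g\<close>, the sum over all \<open>g\<close>, is
    an automorphism that intertwines them (\<open>gtrans_mult\<close>).

  \<^item> By Krull's intersection theorem (\<open>krull_intersection\<close>) the maps from \<open>B\<close> to the \<open>B/I\<^sup>m\<close> are jointly injective. The solutions
    found over the \<open>B/I\<^sup>m\<close> are one solution in the product of these rings. Modulo a prime ideal
    that contains no nonzero element of \<open>B\<close>, the product becomes a domain over \<open>B\<close>, and the subring generated by \<open>B\<close> and the
    solution maps to the algebraically closed field \<open>K\<close> over \<open>B\<close> (\<open>combine_points\<close>). This gives an isomorphism over \<open>K\<close>.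

  The last step replaces constructibility of images or an approximation theorem: the solutions need not be compatible,
  and no dimension theory enters. Points with values in algebraically closed fields come in both halves from one fact
  (\<open>extend_hom\<close>): for domains \<open>B \<subseteq> C\<close> with \<open>C\<close> finitely generated over \<open>B\<close>, homomorphisms from \<open>B\<close>
  to an algebraically closed field that do not kill a certain nonzero element of \<open>B\<close> extend to \<open>C\<close>.
\<close>

section \<open>Rings generated by an element over a subring\<close>

text \<open>
  The subring \<open>B[z]\<close> of \<open>D\<close>, where \<open>B\<close> is a subring of \<open>D\<close> (a subset of its carrier): the values
  at \<open>z\<close> of the polynomials over \<open>B\<close>.
\<close>

definition adjoin :: "('d, 'm) ring_scheme \<Rightarrow> 'd set \<Rightarrow> 'd \<Rightarrow> 'd set" where
  "adjoin D B z = UnivPoly.eval (D\<lparr>carrier := B\<rparr>) D id z ` carrier (UP (D\<lparr>carrier := B\<rparr>))"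

lemma subring_finsum_closed:
  assumes "ring D" "subring H D" "f \<in> A \<rightarrow> H"
  shows "finsum D f A \<in> H"
proof -
  interpret ring D by fact
  show ?thesis using assms(3)
  proof (induction A rule: infinite_finite_induct)
    case (insert x F)
    then have "f \<in> F \<rightarrow> carrier D" "f x \<in> carrier D"
      using subringE(1)[OF assms(2)] by auto
    with insert show ?case by (auto simp: subringE(7)[OF assms(2)])
  qed (use subringE(2)[OF assms(2)] in auto)
qed

lemma subring_pow_closed:
  assumes "ring D" "subring H D" "x \<in> H"
  shows "x [^]\<^bsub>D\<^esub> (i::nat) \<in> H"
proof -
  interpret ring D by fact
  show ?thesis using assms by (induction i) (auto simp: subringE)
qed

lemma cring_subring:
  assumes "cring D" "subring B D" shows "cring (D\<lparr>carrier := B\<rparr>)"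
proof -
  interpret cring D by fact
  show ?thesis using assms subcringI' subcring_iff subringE(1) by metis
qed

lemma UP_eval_interp:
  assumes "cring D" "subring B D" "cring L" "h \<in> ring_hom (D\<lparr>carrier := B\<rparr>) L"
  shows "UP_pre_univ_prop (D\<lparr>carrier := B\<rparr>) L h"
  using assms cring_subring[OF assms(1,2)]
  by (simp add: UP_pre_univ_prop_def UP_cring_def ring_hom_cring_def ring_hom_cring_axioms_def)

lemma id_subring_hom: "subring B D \<Longrightarrow> id \<in> ring_hom (D\<lparr>carrier := B\<rparr>) D"
  by (rule ring_hom_memI) (auto dest: subringE(1))

lemma eval_hom_sub:
  assumes "cring D" "subring B D" "cring L" "h \<in> ring_hom (D\<lparr>carrier := B\<rparr>) L" "z \<in> carrier L"
  shows "UnivPoly.eval (D\<lparr>carrier := B\<rparr>) L h z \<in> ring_hom (UP (D\<lparr>carrier := B\<rparr>)) L"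
  using UP_pre_univ_prop.eval_ring_hom[OF UP_eval_interp[OF assms(1-4)] assms(5)] .

lemma UP_sub_cring:
  assumes "cring D" "subring B D" shows "cring (UP (D\<lparr>carrier := B\<rparr>))"
  using UP_cring.UP_cring[OF UP_cring.intro[OF cring_subring[OF assms]]] .

lemma adjoin_subring:
  assumes "cring D" "subring B D" "z \<in> carrier D"
  shows "subring (adjoin D B z) D"
proof -
  interpret cring D by fact
  interpret P: cring "UP (D\<lparr>carrier := B\<rparr>)" using UP_sub_cring[OF assms(1,2)] .
  interpret ring_hom_ring "UP (D\<lparr>carrier := B\<rparr>)" D "UnivPoly.eval (D\<lparr>carrier := B\<rparr>) D id z"
    using eval_hom_sub[OF assms(1,2,1) id_subring_hom[OF assms(2)] assms(3)]
    by unfold_locales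
  show ?thesis unfolding adjoin_def
    using img_is_subring[OF P.carrier_is_subring] .
qed

lemma adjoin_incl:
  assumes "cring D" "subring B D" "z \<in> carrier D" shows "B \<subseteq> adjoin D B z"
proof
  fix b assume b: "b \<in> B"
  interpret UP_pre_univ_prop "D\<lparr>carrier := B\<rparr>" D id "UP (D\<lparr>carrier := B\<rparr>)"
    using UP_eval_interp[OF assms(1,2,1) id_subring_hom[OF assms(2)]] by simp
  have "UnivPoly.eval (D\<lparr>carrier := B\<rparr>) D id z (up_ring.monom (UP (D\<lparr>carrier := B\<rparr>)) b 0) = b"
    using eval_const[OF assms(3), of b] b by simp
  moreover have "up_ring.monom (UP (D\<lparr>carrier := B\<rparr>)) b 0 \<in> carrier (UP (D\<lparr>carrier := B\<rparr>))"
    using b by simp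
  ultimately show "b \<in> adjoin D B z" unfolding adjoin_def by (metis imageI)
qed

lemma adjoin_mem:
  assumes "cring D" "subring B D" "z \<in> carrier D" shows "z \<in> adjoin D B z"
proof -
  interpret UP_pre_univ_prop "D\<lparr>carrier := B\<rparr>" D id "UP (D\<lparr>carrier := B\<rparr>)"
    using UP_eval_interp[OF assms(1,2,1) id_subring_hom[OF assms(2)]] by simp
  have "UnivPoly.eval (D\<lparr>carrier := B\<rparr>) D id z (up_ring.monom (UP (D\<lparr>carrier := B\<rparr>)) \<one>\<^bsub>D\<^esub> 1) = z"
    using eval_monom1[OF assms(3)] by simp
  moreover have "up_ring.monom (UP (D\<lparr>carrier := B\<rparr>)) \<one>\<^bsub>D\<^esub> 1 \<in> carrier (UP (D\<lparr>carrier := B\<rparr>))"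
    using monom_closed[of "\<one>\<^bsub>D\<^esub>" 1] subringE(3)[OF assms(2)] by simp
  ultimately show ?thesis unfolding adjoin_def by (metis imageI)
qed

lemma adjoin_minimal:
  assumes "cring D" "subring B D" "z \<in> carrier D" "subring H D" "B \<subseteq> H" "z \<in> H"
  shows "adjoin D B z \<subseteq> H"
proof
  interpret D: cring D by fact
  interpret UP_pre_univ_prop "D\<lparr>carrier := B\<rparr>" D id "UP (D\<lparr>carrier := B\<rparr>)"
    using UP_eval_interp[OF assms(1,2,1) id_subring_hom[OF assms(2)]] by simp
  fix x assume "x \<in> adjoin D B z"
  then obtain p where p: "p \<in> carrier (UP (D\<lparr>carrier := B\<rparr>))"
    "x = UnivPoly.eval (D\<lparr>carrier := B\<rparr>) D id z p" by (auto simp: adjoin_def)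
  have "up_ring.coeff (UP (D\<lparr>carrier := B\<rparr>)) p i \<in> H" for i
    using coeff_closed[OF p(1), of i] assms(5) by auto
  then show "x \<in> H" unfolding p(2) eval_on_carrier[OF p(1)]
    by (intro subring_finsum_closed[OF D.ring_axioms assms(4)])
       (auto simp: subringE(6)[OF assms(4)] subring_pow_closed[OF D.ring_axioms assms(4,6)])
qed

text \<open>
  A homomorphism that vanishes on the kernel of \<open>f\<close> factors through the image of \<open>f\<close>.
\<close>

lemma ring_hom_factor:
  assumes "ring P" "ring D" "ring L" "f \<in> ring_hom P D" "g \<in> ring_hom P L"
    and ker: "\<And>p. p \<in> carrier P \<Longrightarrow> f p = \<zero>\<^bsub>D\<^esub> \<Longrightarrow> g p = \<zero>\<^bsub>L\<^esub>"
  shows "\<exists>h \<in> ring_hom (D\<lparr>carrier := f ` carrier P\<rparr>) L. \<forall>p \<in> carrier P. h (f p) = g p"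
proof -
  interpret P: ring P by fact
  interpret D: ring D by fact
  interpret L: ring L by fact
  interpret f: ring_hom_ring P D f using assms by unfold_locales
  interpret g: ring_hom_ring P L g using assms by unfold_locales
  define h where "h = g \<circ> inv_into (carrier P) f"
  have h: "h (f p) = g p" if p: "p \<in> carrier P" for p
  proof -
    let ?q = "inv_into (carrier P) f (f p)"
    have q: "?q \<in> carrier P" "f ?q = f p"
      using p by (auto intro: inv_into_into f_inv_into_f)
    then have "f (?q \<ominus>\<^bsub>P\<^esub> p) = \<zero>\<^bsub>D\<^esub>"
      using p by (simp add: P.minus_eq D.r_neg)
    then have "g (?q \<ominus>\<^bsub>P\<^esub> p) = \<zero>\<^bsub>L\<^esub>" using ker p q by simp
    then have "g ?q \<ominus>\<^bsub>L\<^esub> g p = \<zero>\<^bsub>L\<^esub>" using p q by (simp add: P.minus_eq L.minus_eq)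
    then show ?thesis using p q by (simp add: h_def)
  qed
  have "h \<in> ring_hom (D\<lparr>carrier := f ` carrier P\<rparr>) L"
    by (rule ring_hom_memI)
       (auto simp: h simp flip: f.hom_mult f.hom_add f.hom_one)
  with h show ?thesis by blast
qed

section \<open>Roots in algebraically closed fields\<close>

lemma list_eval_finsum:
  fixes k :: nat
  assumes "cring L" "\<And>i. i \<le> k \<Longrightarrow> f i \<in> carrier L" "x \<in> carrier L"
  shows "ring.eval L (map f (rev [0..<Suc k])) x = (\<Oplus>\<^bsub>L\<^esub>i\<in>{..k}. f i \<otimes>\<^bsub>L\<^esub> x [^]\<^bsub>L\<^esub> i)"
  using assms(2)
proof (induction k)
  interpret cring L by fact
  case 0 then show ?case using assms by simp
next
  interpret cring L by fact
  case (Suc k)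
  have "map f (rev [0..<Suc (Suc k)]) = f (Suc k) # map f (rev [0..<Suc k])" by simp
  then show ?case using Suc assms(3) by (simp del: upt_Suc add: Pi_def)
qed

lemma algebraically_closed_root:
  fixes k :: nat
  assumes "algebraically_closed L" "\<And>i. i \<le> k \<Longrightarrow> f i \<in> carrier L" "k \<ge> 1" "f k \<noteq> \<zero>\<^bsub>L\<^esub>"
  shows "\<exists>x \<in> carrier L. (\<Oplus>\<^bsub>L\<^esub>i\<in>{..k}. f i \<otimes>\<^bsub>L\<^esub> x [^]\<^bsub>L\<^esub> i) = \<zero>\<^bsub>L\<^esub>"
proof -
  interpret algebraically_closed L by fact
  let ?p = "map f (rev [0..<Suc k])"
  have p: "?p = f k # map f (rev [0..<k])" by simp
  have "?p \<in> carrier (poly_ring L)"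
    using assms(2,4) unfolding univ_poly_def polynomial_def by auto
  then have "size (roots ?p) = Polynomials.degree ?p"
    using roots_over_carrier by (simp add: splitted_def)
  then have "size (roots ?p) = k" by simp
  then have "size (roots ?p) \<noteq> 0" using assms(3) by simp
  then obtain x where "x \<in># roots ?p" by (metis multiset_nonemptyE size_empty)
  then have "is_root ?p x" using \<open>?p \<in> carrier (poly_ring L)\<close> roots_mem_iff_is_root by blast
  then show ?thesis
    using list_eval_finsum[where f = f and k = k and x = x, OF is_cring assms(2)]
    unfolding is_root_def by metis
qed

lemma (in abelian_group) add_minus_zeroD:
  assumes "s \<in> carrier G" "a \<in> carrier G" "u \<in> carrier G" "s \<oplus> (a \<ominus> u) = \<zero>"
  shows "s \<oplus> a = u"
proof -
  have "(s \<oplus> a) \<oplus> \<ominus> u = \<zero>" using assms by (simp add: minus_eq a_assoc)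
  then have "\<ominus> (\<ominus> u) = s \<oplus> a" using assms by (intro minus_equality) auto
  then show ?thesis using assms by simp
qed

lemma algebraically_closed_nonroot:
  fixes k :: nat
  assumes "algebraically_closed L" "\<And>i. i \<le> k \<Longrightarrow> f i \<in> carrier L" "f k \<noteq> \<zero>\<^bsub>L\<^esub>"
  shows "\<exists>x \<in> carrier L. (\<Oplus>\<^bsub>L\<^esub>i\<in>{..k}. f i \<otimes>\<^bsub>L\<^esub> x [^]\<^bsub>L\<^esub> i) \<noteq> \<zero>\<^bsub>L\<^esub>"
proof (cases k)
  interpret algebraically_closed L by fact
  case 0
  then show ?thesis using assms by (intro bexI[of _ "\<zero>\<^bsub>L\<^esub>"]) auto
next
  interpret algebraically_closed L by fact
  case (Suc m)
  define g where "g = f(0 := f 0 \<ominus>\<^bsub>L\<^esub> \<one>\<^bsub>L\<^esub>)"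
  have "\<exists>x \<in> carrier L. (\<Oplus>\<^bsub>L\<^esub>i\<in>{..k}. g i \<otimes>\<^bsub>L\<^esub> x [^]\<^bsub>L\<^esub> i) = \<zero>\<^bsub>L\<^esub>"
    by (rule algebraically_closed_root[OF assms(1)]) (use assms Suc in \<open>auto simp: g_def\<close>)
  then obtain x where x: "x \<in> carrier L" "(\<Oplus>\<^bsub>L\<^esub>i\<in>{..k}. g i \<otimes>\<^bsub>L\<^esub> x [^]\<^bsub>L\<^esub> i) = \<zero>\<^bsub>L\<^esub>" by blast
  have "(\<Oplus>\<^bsub>L\<^esub>i\<in>{..k}. f i \<otimes>\<^bsub>L\<^esub> x [^]\<^bsub>L\<^esub> i)
      = (\<Oplus>\<^bsub>L\<^esub>i\<in>{..m}. f (Suc i) \<otimes>\<^bsub>L\<^esub> x [^]\<^bsub>L\<^esub> Suc i) \<oplus>\<^bsub>L\<^esub> f 0"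
    using x(1) assms(2) unfolding Suc by (subst finsum_Suc2) (auto simp: Suc)
  moreover have "(\<Oplus>\<^bsub>L\<^esub>i\<in>{..k}. g i \<otimes>\<^bsub>L\<^esub> x [^]\<^bsub>L\<^esub> i)
      = (\<Oplus>\<^bsub>L\<^esub>i\<in>{..m}. f (Suc i) \<otimes>\<^bsub>L\<^esub> x [^]\<^bsub>L\<^esub> Suc i) \<oplus>\<^bsub>L\<^esub> (f 0 \<ominus>\<^bsub>L\<^esub> \<one>\<^bsub>L\<^esub>)"
    using x(1) assms(2) unfolding Suc by (subst finsum_Suc2) (auto simp: Suc g_def)
  moreover have "(\<Oplus>\<^bsub>L\<^esub>i\<in>{..m}. f (Suc i) \<otimes>\<^bsub>L\<^esub> x [^]\<^bsub>L\<^esub> Suc i) \<in> carrier L"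
    using x(1) assms(2) Suc by (intro finsum_closed) auto
  moreover have "f 0 \<in> carrier L" using assms(2) by simp
  ultimately have "(\<Oplus>\<^bsub>L\<^esub>i\<in>{..k}. f i \<otimes>\<^bsub>L\<^esub> x [^]\<^bsub>L\<^esub> i) = \<one>\<^bsub>L\<^esub>"
    using x(2) add_minus_zeroD by (metis one_closed)
  then show ?thesis using x(1) zero_not_one by metis
qed

section \<open>Extending homomorphisms into algebraically closed fields\<close>

lemma (in "domain") nat_pow_nonzero:
  assumes "x \<in> carrier R" "x \<noteq> \<zero>" shows "x [^] (k::nat) \<noteq> \<zero>"
  using assms by (induction k) (auto simp: integral_iff)


text \<open>
  The next lemmas extend a homomorphism \<open>h\<close> from \<open>B\<close> to \<open>B[z]\<close> without killing a given
  \<open>d \<noteq> 0\<close>. The obstruction is one element \<open>b \<noteq> 0\<close> of \<open>B\<close>, independent of \<open>h\<close>: it suffices that \<open>h b \<noteq> 0\<close>.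
  If \<open>z\<close> is transcendental over \<open>B\<close>, then \<open>b\<close> is the leading coefficient of the polynomial that
  represents \<open>d\<close>, and \<open>z\<close> can be sent to any element where the image of that polynomial does not vanish.
\<close>

lemma extend_hom_transcendental:
  assumes "domain D" "subring B D" "z \<in> carrier D" "d \<in> adjoin D B z" "d \<noteq> \<zero>\<^bsub>D\<^esub>"
    and trans: "\<And>p. p \<in> carrier (UP (D\<lparr>carrier := B\<rparr>)) \<Longrightarrow>
      UnivPoly.eval (D\<lparr>carrier := B\<rparr>) D id z p = \<zero>\<^bsub>D\<^esub> \<Longrightarrow> p = \<zero>\<^bsub>UP (D\<lparr>carrier := B\<rparr>)\<^esub>"
  shows "\<exists>b \<in> B. b \<noteq> \<zero>\<^bsub>D\<^esub> \<and> (\<forall>(L :: ('l, 'n) ring_scheme) h. algebraically_closed L \<longrightarrow>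
    h \<in> ring_hom (D\<lparr>carrier := B\<rparr>) L \<longrightarrow> h b \<noteq> \<zero>\<^bsub>L\<^esub> \<longrightarrow>
    (\<exists>h' \<in> ring_hom (D\<lparr>carrier := adjoin D B z\<rparr>) L. (\<forall>x \<in> B. h' x = h x) \<and> h' d \<noteq> \<zero>\<^bsub>L\<^esub>))"
proof -
  interpret D: "domain" D by fact
  let ?Bd = "D\<lparr>carrier := B\<rparr>"
  let ?P = "UP ?Bd"
  let ?ev = "UnivPoly.eval ?Bd D id z"
  interpret P: cring ?P using UP_sub_cring[OF D.is_cring assms(2)] .
  interpret E: UP_pre_univ_prop ?Bd D id ?P
    using UP_eval_interp[OF D.is_cring assms(2) D.is_cring id_subring_hom[OF assms(2)]] by simp
  obtain p where p: "p \<in> carrier ?P" "d = ?ev p" using assms(4) by (auto simp: adjoin_def)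
  have ev: "?ev \<in> ring_hom ?P D" using E.eval_ring_hom[OF assms(3)] .
  have "p \<noteq> \<zero>\<^bsub>?P\<^esub>"
    using p(2) assms(5) ring_hom_zero[OF ev P.ring_axioms D.ring_axioms] by auto
  let ?k = "deg ?Bd p"
  let ?b = "up_ring.coeff ?P p ?k"
  have b: "?b \<in> B" "?b \<noteq> \<zero>\<^bsub>D\<^esub>"
    using E.coeff_closed[OF p(1), of ?k] E.lcoeff_nonzero2[OF p(1) \<open>p \<noteq> \<zero>\<^bsub>?P\<^esub>\<close>] by auto
  show ?thesis
  proof (intro bexI[OF _ b(1)] conjI allI impI)
    fix L :: "('l, 'n) ring_scheme" and h
    assume L: "algebraically_closed L" and h: "h \<in> ring_hom ?Bd L" and nz: "h ?b \<noteq> \<zero>\<^bsub>L\<^esub>"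
    interpret L: algebraically_closed L by fact
    interpret EL: UP_pre_univ_prop ?Bd L h ?P
      using UP_eval_interp[OF D.is_cring assms(2) L.is_cring h] by simp
    obtain x where x: "x \<in> carrier L"
      "(\<Oplus>\<^bsub>L\<^esub>i\<in>{..?k}. h (up_ring.coeff ?P p i) \<otimes>\<^bsub>L\<^esub> x [^]\<^bsub>L\<^esub> i) \<noteq> \<zero>\<^bsub>L\<^esub>"
      using algebraically_closed_nonroot[OF L, of ?k "\<lambda>i. h (up_ring.coeff ?P p i)"]
        nz EL.hom_closed E.coeff_closed[OF p(1)] by auto
    have "\<exists>h' \<in> ring_hom (D\<lparr>carrier := ?ev ` carrier ?P\<rparr>) L.
        \<forall>q \<in> carrier ?P. h' (?ev q) = UnivPoly.eval ?Bd L h x q"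
      using EL.eval_ring_hom[OF x(1)] ring_hom_zero[OF EL.eval_ring_hom[OF x(1)] P.ring_axioms L.ring_axioms]
      by (intro ring_hom_factor[OF P.ring_axioms D.ring_axioms L.ring_axioms ev]) (auto dest!: trans)
    then obtain h' where h': "h' \<in> ring_hom (D\<lparr>carrier := ?ev ` carrier ?P\<rparr>) L"
      "\<And>q. q \<in> carrier ?P \<Longrightarrow> h' (?ev q) = UnivPoly.eval ?Bd L h x q" by blast
    have "UnivPoly.eval ?Bd L h x p = (\<Oplus>\<^bsub>L\<^esub>i\<in>{..?k}. h (up_ring.coeff ?P p i) \<otimes>\<^bsub>L\<^esub> x [^]\<^bsub>L\<^esub> i)"
      by (rule UP.eval_on_carrier[OF p(1)])
    then have "h' d \<noteq> \<zero>\<^bsub>L\<^esub>" using h'(2)[OF p(1)] x(2) p(2) by simp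
    moreover have "h' y = h y" if "y \<in> B" for y
      using h'(2)[of "up_ring.monom ?P y 0"] that E.eval_const[OF assms(3), of y]
        EL.eval_const[OF x(1), of y] by simp
    ultimately show "\<exists>h' \<in> ring_hom (D\<lparr>carrier := adjoin D B z\<rparr>) L. (\<forall>x \<in> B. h' x = h x) \<and> h' d \<noteq> \<zero>\<^bsub>L\<^esub>"
      using h'(1) unfolding adjoin_def by blast
  qed (use b in auto)
qed

text \<open>
  If \<open>z\<close> is algebraic over \<open>B\<close>, every \<open>d \<noteq> 0\<close> of \<open>B[z]\<close> has a multiple that is a nonzero element
  of \<open>B\<close>. It is found among the multiples \<open>r(z) \<noteq> 0\<close> of \<open>d\<close> with \<open>r\<close> of least degree: division of a minimal
  polynomial \<open>p\<close> by \<open>r\<close> shows that this degree is zero.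
\<close>

lemma adjoin_algebraic_multiple:
  assumes "domain D" "subring B D" "z \<in> carrier D" "d \<in> adjoin D B z" "d \<noteq> \<zero>\<^bsub>D\<^esub>"
    and p: "p \<in> carrier (UP (D\<lparr>carrier := B\<rparr>))" "p \<noteq> \<zero>\<^bsub>UP (D\<lparr>carrier := B\<rparr>)\<^esub>"
      "UnivPoly.eval (D\<lparr>carrier := B\<rparr>) D id z p = \<zero>\<^bsub>D\<^esub>"
    and min: "\<And>q. q \<in> carrier (UP (D\<lparr>carrier := B\<rparr>)) \<Longrightarrow>
      UnivPoly.eval (D\<lparr>carrier := B\<rparr>) D id z q = \<zero>\<^bsub>D\<^esub> \<Longrightarrow>
      deg (D\<lparr>carrier := B\<rparr>) q < deg (D\<lparr>carrier := B\<rparr>) p \<Longrightarrow> q = \<zero>\<^bsub>UP (D\<lparr>carrier := B\<rparr>)\<^esub>"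
  shows "\<exists>e \<in> adjoin D B z. d \<otimes>\<^bsub>D\<^esub> e \<in> B \<and> d \<otimes>\<^bsub>D\<^esub> e \<noteq> \<zero>\<^bsub>D\<^esub>"
proof -
  interpret D: "domain" D by fact
  let ?Bd = "D\<lparr>carrier := B\<rparr>"
  let ?P = "UP ?Bd"
  let ?ev = "UnivPoly.eval ?Bd D id z"
  interpret P: cring ?P using UP_sub_cring[OF D.is_cring assms(2)] .
  interpret E: UP_pre_univ_prop ?Bd D id ?P
    using UP_eval_interp[OF D.is_cring assms(2) D.is_cring id_subring_hom[OF assms(2)]] by simp
  interpret Bd: "domain" ?Bd using D.subring_is_domain[OF assms(2)] .
  have Bm: "monoid ?Bd" using ring.is_monoid[OF D.subring_is_ring[OF assms(2)]] .
  interpret PD: UP_domain ?Bd ?P by unfold_locales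
  have ev: "?ev \<in> ring_hom ?P D" using E.eval_ring_hom[OF assms(3)] .
  interpret ev: ring_hom_cring ?P D ?ev by unfold_locales (rule ev)
  have A: "subring (adjoin D B z) D" using adjoin_subring[OF D.is_cring assms(2,3)] .
  have AD: "adjoin D B z \<subseteq> carrier D" using subringE(1)[OF A] .
  have d: "d \<in> carrier D" using assms(4) AD by blast
  define Q where "Q = (\<lambda>r. r \<in> carrier ?P \<and> ?ev r \<noteq> \<zero>\<^bsub>D\<^esub> \<and> (\<exists>e \<in> adjoin D B z. ?ev r = d \<otimes>\<^bsub>D\<^esub> e))"
  obtain f where f: "f \<in> carrier ?P" "d = ?ev f" using assms(4) by (auto simp: adjoin_def)
  have "Q f" unfolding Q_def using f assms(5) d
    by (auto intro!: bexI[of _ "\<one>\<^bsub>D\<^esub>"] simp: subringE(3)[OF A])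
  then obtain r where r: "Q r" "\<And>s. Q s \<Longrightarrow> deg ?Bd r \<le> deg ?Bd s"
    using ex_has_least_nat[of Q f "deg ?Bd"] by blast
  have rP: "r \<in> carrier ?P" using r(1) by (simp add: Q_def)
  have r0: "r \<noteq> \<zero>\<^bsub>?P\<^esub>" using r(1) by (auto simp: Q_def)
  obtain e where e: "e \<in> adjoin D B z" "?ev r = d \<otimes>\<^bsub>D\<^esub> e" "?ev r \<noteq> \<zero>\<^bsub>D\<^esub>"
    using r(1) by (auto simp: Q_def)
  let ?a = "up_ring.coeff ?P r (deg ?Bd r)"
  have a: "?a \<in> B" "?a \<noteq> \<zero>\<^bsub>D\<^esub>" using E.coeff_closed[OF rP] E.lcoeff_nonzero2[OF rP r0] by auto
  have "deg ?Bd r = 0"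
  proof (rule ccontr)
    assume deg: "deg ?Bd r \<noteq> 0"
    let ?c = "up_ring.coeff ?P p (deg ?Bd p)"
    have c: "?c \<in> B" "?c \<noteq> \<zero>\<^bsub>D\<^esub>" using E.coeff_closed[OF p(1)] E.lcoeff_nonzero2[OF p(1,2)] by auto
    \<comment> \<open>a remainder of \<open>r\<close> modulo \<open>p\<close> has degree below that of \<open>p\<close>\<close>
    have small: "deg ?Bd r < deg ?Bd p"
    proof (rule ccontr)
      assume n: "\<not> deg ?Bd r < deg ?Bd p"
      obtain q s and k :: nat where q: "q \<in> carrier ?P" "s \<in> carrier ?P"
        "?c [^]\<^bsub>?Bd\<^esub> k \<odot>\<^bsub>?P\<^esub> r = p \<otimes>\<^bsub>?P\<^esub> q \<oplus>\<^bsub>?P\<^esub> s" "s = \<zero>\<^bsub>?P\<^esub> \<or> deg ?Bd s < deg ?Bd p"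
        using E.long_div_theorem[OF p(1) rP p(2)] by blast
      let ?ck = "?c [^]\<^bsub>?Bd\<^esub> k"
      have ck: "?ck \<in> B" "?ck \<noteq> \<zero>\<^bsub>D\<^esub>"
        using monoid.nat_pow_closed[OF Bm, of ?c k] Bd.nat_pow_nonzero c by auto
      have "?ck \<odot>\<^bsub>?P\<^esub> r = up_ring.monom ?P ?ck 0 \<otimes>\<^bsub>?P\<^esub> r"
        using E.monom_mult_is_smult[of ?ck r] ck rP by simp
      then have "?ev (?ck \<odot>\<^bsub>?P\<^esub> r) = ?ck \<otimes>\<^bsub>D\<^esub> ?ev r"
        using E.eval_const[OF assms(3), of ?ck] ck rP by simp
      moreover have "?ev (?ck \<odot>\<^bsub>?P\<^esub> r) = ?ev s"
        unfolding q(3) using q(1,2) p by simp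
      ultimately have s: "?ev s = ?ck \<otimes>\<^bsub>D\<^esub> ?ev r" by simp
      have ckD: "?ck \<in> adjoin D B z" "?ck \<in> carrier D"
        using adjoin_incl[OF D.is_cring assms(2,3)] ck subringE(1)[OF assms(2)] by auto
      have "?ev s \<noteq> \<zero>\<^bsub>D\<^esub>" unfolding s using ck ckD e(3) rP by (simp add: D.integral_iff)
      moreover have "?ev s = d \<otimes>\<^bsub>D\<^esub> (?ck \<otimes>\<^bsub>D\<^esub> e)"
        unfolding s e(2) using d ckD e(1) AD by (simp add: D.m_lcomm subsetD)
      ultimately have "Q s" unfolding Q_def using q(2) subringE(6)[OF A ckD(1) e(1)] by blast
      then have "deg ?Bd r \<le> deg ?Bd s" "s \<noteq> \<zero>\<^bsub>?P\<^esub>" using r(2) \<open>?ev s \<noteq> \<zero>\<^bsub>D\<^esub>\<close> by auto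
      with q(4) n show False by simp
    qed
    obtain q s and k :: nat where q: "q \<in> carrier ?P" "s \<in> carrier ?P"
      "?a [^]\<^bsub>?Bd\<^esub> k \<odot>\<^bsub>?P\<^esub> p = r \<otimes>\<^bsub>?P\<^esub> q \<oplus>\<^bsub>?P\<^esub> s" "s = \<zero>\<^bsub>?P\<^esub> \<or> deg ?Bd s < deg ?Bd r"
      using E.long_div_theorem[OF rP p(1) r0] by blast
    let ?ak = "?a [^]\<^bsub>?Bd\<^esub> k"
    have ak: "?ak \<in> B" "?ak \<noteq> \<zero>\<^bsub>D\<^esub>"
      using monoid.nat_pow_closed[OF Bm, of ?a k] Bd.nat_pow_nonzero a by auto
    have akD: "?ak \<in> carrier D" using ak subringE(1)[OF assms(2)] by auto
    have "?ak \<odot>\<^bsub>?P\<^esub> p = up_ring.monom ?P ?ak 0 \<otimes>\<^bsub>?P\<^esub> p"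
      using E.monom_mult_is_smult[of ?ak p] ak p(1) by simp
    then have "?ev (?ak \<odot>\<^bsub>?P\<^esub> p) = \<zero>\<^bsub>D\<^esub>"
      using E.eval_const[OF assms(3), of ?ak] ak p akD by simp
    then have sum0: "?ev r \<otimes>\<^bsub>D\<^esub> ?ev q \<oplus>\<^bsub>D\<^esub> ?ev s = \<zero>\<^bsub>D\<^esub>"
      unfolding q(3) using q(1,2) rP by simp
    have evq: "?ev q \<in> adjoin D B z" using q(1) by (simp add: adjoin_def)
    have s: "?ev s = d \<otimes>\<^bsub>D\<^esub> (\<ominus>\<^bsub>D\<^esub> (e \<otimes>\<^bsub>D\<^esub> ?ev q))"
    proof -
      have m: "?ev r \<in> carrier D" "?ev q \<in> carrier D" "?ev s \<in> carrier D" "e \<in> carrier D"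
        using rP q(1,2) e(1) AD by auto
      have "?ev s \<oplus>\<^bsub>D\<^esub> ?ev r \<otimes>\<^bsub>D\<^esub> ?ev q = \<zero>\<^bsub>D\<^esub>"
        using sum0 D.a_comm[of "?ev s" "?ev r \<otimes>\<^bsub>D\<^esub> ?ev q"] m by simp
      then have "\<ominus>\<^bsub>D\<^esub> (?ev r \<otimes>\<^bsub>D\<^esub> ?ev q) = ?ev s"
        using m by (intro D.minus_equality) auto
      moreover have "?ev r \<otimes>\<^bsub>D\<^esub> ?ev q = d \<otimes>\<^bsub>D\<^esub> (e \<otimes>\<^bsub>D\<^esub> ?ev q)"
        using D.m_assoc[OF d m(4,2)] e(2) by simp
      ultimately show ?thesis using D.r_minus[of d "e \<otimes>\<^bsub>D\<^esub> ?ev q"] d m by simp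
    qed
    have "s = \<zero>\<^bsub>?P\<^esub>"
    proof (rule ccontr)
      assume s0: "s \<noteq> \<zero>\<^bsub>?P\<^esub>"
      show False
      proof (cases "?ev s = \<zero>\<^bsub>D\<^esub>")
        case True
        then show False using min[OF q(2)] s0 q(4) small by simp
      next
        case False
        then have "Q s" unfolding Q_def
          using q(2) s subringE(5)[OF A subringE(6)[OF A e(1) evq]] by blast
        then show False using r(2)[of s] q(4) s0 by simp
      qed
    qed
    then have evq0: "?ev q = \<zero>\<^bsub>D\<^esub>"
      using sum0 e(3) rP q(1) by (simp add: D.integral_iff)
    have akp: "?ak \<odot>\<^bsub>?P\<^esub> p = r \<otimes>\<^bsub>?P\<^esub> q" using q(3) \<open>s = \<zero>\<^bsub>?P\<^esub>\<close> rP q(1) by simp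
    have q0: "q \<noteq> \<zero>\<^bsub>?P\<^esub>"
    proof
      assume "q = \<zero>\<^bsub>?P\<^esub>"
      then have "?ak \<odot>\<^bsub>?P\<^esub> p = \<zero>\<^bsub>?P\<^esub>" using akp rP by simp
      then have "up_ring.coeff ?P (?ak \<odot>\<^bsub>?P\<^esub> p) (deg ?Bd p) = \<zero>\<^bsub>D\<^esub>" by simp
      then have "?ak \<otimes>\<^bsub>D\<^esub> ?c = \<zero>\<^bsub>D\<^esub>" using E.coeff_smult[of ?ak p] ak p(1) by simp
      then show False using ak akD c subringE(1)[OF assms(2)] by (auto simp: D.integral_iff)
    qed
    have "deg ?Bd (r \<otimes>\<^bsub>?P\<^esub> q) = deg ?Bd r + deg ?Bd q"
      using PD.deg_mult[OF r0 q0 rP q(1)] .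
    moreover have "deg ?Bd (r \<otimes>\<^bsub>?P\<^esub> q) = deg ?Bd p"
      unfolding akp[symmetric] using PD.deg_smult[of ?ak p] ak p(1) by simp
    ultimately have "deg ?Bd q < deg ?Bd p" using deg by simp
    then show False using min[OF q(1) evq0] q0 by simp
  qed
  then have "?ev r = ?a"
    using E.eval_on_carrier[OF rP, of D id z] a subringE(1)[OF assms(2)] by auto
  then show ?thesis using e a by (intro bexI[of _ e]) auto
qed

text \<open>
  For algebraic \<open>z\<close> the element \<open>b\<close> is the product of the leading coefficient of a polynomial \<open>p\<close> of
  least degree with root \<open>z\<close> and of a multiple of \<open>d\<close> in \<open>B\<close>. The image of \<open>p\<close> under \<open>h\<close> keeps its degree,
  so it has a root, and \<open>z\<close> can be sent to it.
\<close>

lemma extend_hom_algebraic: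
  assumes "domain D" "subring B D" "z \<in> carrier D" "d \<in> adjoin D B z" "d \<noteq> \<zero>\<^bsub>D\<^esub>"
    and alg: "p0 \<in> carrier (UP (D\<lparr>carrier := B\<rparr>))" "p0 \<noteq> \<zero>\<^bsub>UP (D\<lparr>carrier := B\<rparr>)\<^esub>"
      "UnivPoly.eval (D\<lparr>carrier := B\<rparr>) D id z p0 = \<zero>\<^bsub>D\<^esub>"
  shows "\<exists>b \<in> B. b \<noteq> \<zero>\<^bsub>D\<^esub> \<and> (\<forall>(L :: ('l, 'n) ring_scheme) h. algebraically_closed L \<longrightarrow>
    h \<in> ring_hom (D\<lparr>carrier := B\<rparr>) L \<longrightarrow> h b \<noteq> \<zero>\<^bsub>L\<^esub> \<longrightarrow>
    (\<exists>h' \<in> ring_hom (D\<lparr>carrier := adjoin D B z\<rparr>) L. (\<forall>x \<in> B. h' x = h x) \<and> h' d \<noteq> \<zero>\<^bsub>L\<^esub>))"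
proof -
  interpret D: "domain" D by fact
  let ?Bd = "D\<lparr>carrier := B\<rparr>"
  let ?P = "UP ?Bd"
  let ?ev = "UnivPoly.eval ?Bd D id z"
  interpret P: cring ?P using UP_sub_cring[OF D.is_cring assms(2)] .
  interpret E: UP_pre_univ_prop ?Bd D id ?P
    using UP_eval_interp[OF D.is_cring assms(2) D.is_cring id_subring_hom[OF assms(2)]] by simp
  interpret Bd: "domain" ?Bd using D.subring_is_domain[OF assms(2)] .
  have Bm: "monoid ?Bd" using ring.is_monoid[OF D.subring_is_ring[OF assms(2)]] .
  have ev: "?ev \<in> ring_hom ?P D" using E.eval_ring_hom[OF assms(3)] .
  interpret ev: ring_hom_cring ?P D ?ev by unfold_locales (rule ev)
  define Z where "Z = (\<lambda>q. q \<in> carrier ?P \<and> q \<noteq> \<zero>\<^bsub>?P\<^esub> \<and> ?ev q = \<zero>\<^bsub>D\<^esub>)"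
  have "Z p0" using alg by (simp add: Z_def)
  then obtain p where "Z p" and min': "\<And>s. Z s \<Longrightarrow> deg ?Bd p \<le> deg ?Bd s"
    using ex_has_least_nat[of Z p0 "deg ?Bd"] by blast
  then have p: "p \<in> carrier ?P" "p \<noteq> \<zero>\<^bsub>?P\<^esub>" "?ev p = \<zero>\<^bsub>D\<^esub>" by (auto simp: Z_def)
  have min: "q = \<zero>\<^bsub>?P\<^esub>" if "q \<in> carrier ?P" "?ev q = \<zero>\<^bsub>D\<^esub>" "deg ?Bd q < deg ?Bd p" for q
    using min'[of q] that by (auto simp: Z_def)
  have BD: "B \<subseteq> carrier D" using subringE(1)[OF assms(2)] .
  have A: "subring (adjoin D B z) D" using adjoin_subring[OF D.is_cring assms(2,3)] .
  have AD: "adjoin D B z \<subseteq> carrier D" using subringE(1)[OF A] .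
  have BA: "B \<subseteq> adjoin D B z" using adjoin_incl[OF D.is_cring assms(2,3)] .
  let ?k = "deg ?Bd p"
  let ?c = "up_ring.coeff ?P p ?k"
  have c: "?c \<in> B" "?c \<noteq> \<zero>\<^bsub>D\<^esub>" using E.coeff_closed[OF p(1)] E.lcoeff_nonzero2[OF p(1,2)] by auto
  have k: "?k \<ge> 1"
  proof (rule ccontr)
    assume "\<not> ?k \<ge> 1"
    then have "?k = 0" by simp
    then have "?ev p = ?c" using E.eval_on_carrier[OF p(1), of D id z] c BD by auto
    with p(3) c show False by simp
  qed
  obtain e where e: "e \<in> adjoin D B z" "d \<otimes>\<^bsub>D\<^esub> e \<in> B" "d \<otimes>\<^bsub>D\<^esub> e \<noteq> \<zero>\<^bsub>D\<^esub>"
    using adjoin_algebraic_multiple[OF assms(1-5) p min] by blast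
  let ?b = "?c \<otimes>\<^bsub>D\<^esub> (d \<otimes>\<^bsub>D\<^esub> e)"
  have b: "?b \<in> B" using subringE(6)[OF assms(2) c(1) e(2)] .
  have b0: "?b \<noteq> \<zero>\<^bsub>D\<^esub>" using c e BD by (metis D.integral_iff subsetD)
  show ?thesis
  proof (intro bexI[OF _ b] conjI b0 allI impI)
    fix L :: "('l, 'n) ring_scheme" and h
    assume L: "algebraically_closed L" and h: "h \<in> ring_hom ?Bd L" and nz: "h ?b \<noteq> \<zero>\<^bsub>L\<^esub>"
    interpret L: algebraically_closed L by fact
    interpret EL: UP_pre_univ_prop ?Bd L h ?P
      using UP_eval_interp[OF D.is_cring assms(2) L.is_cring h] by simp
    have "h ?b = h ?c \<otimes>\<^bsub>L\<^esub> h (d \<otimes>\<^bsub>D\<^esub> e)" using EL.hom_mult[of ?c "d \<otimes>\<^bsub>D\<^esub> e"] c e by simp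
    with nz have hc: "h ?c \<noteq> \<zero>\<^bsub>L\<^esub>" "h (d \<otimes>\<^bsub>D\<^esub> e) \<noteq> \<zero>\<^bsub>L\<^esub>"
      using EL.hom_closed[of ?c] EL.hom_closed[of "d \<otimes>\<^bsub>D\<^esub> e"] c e by auto
    obtain x where x: "x \<in> carrier L"
      "(\<Oplus>\<^bsub>L\<^esub>i\<in>{..?k}. h (up_ring.coeff ?P p i) \<otimes>\<^bsub>L\<^esub> x [^]\<^bsub>L\<^esub> i) = \<zero>\<^bsub>L\<^esub>"
      using algebraically_closed_root[OF L, of ?k "\<lambda>i. h (up_ring.coeff ?P p i)"]
        hc EL.hom_closed E.coeff_closed[OF p(1)] k by auto
    let ?g = "UnivPoly.eval ?Bd L h x"
    have g: "?g \<in> ring_hom ?P L" using EL.eval_ring_hom[OF x(1)] .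
    interpret g: ring_hom_cring ?P L ?g by unfold_locales (rule g)
    have gp: "?g p = \<zero>\<^bsub>L\<^esub>" using x(2) UP.eval_on_carrier[OF p(1), of L h x] by simp
    have ker: "?g f = \<zero>\<^bsub>L\<^esub>" if f: "f \<in> carrier ?P" "?ev f = \<zero>\<^bsub>D\<^esub>" for f
    proof -
      obtain q s and m :: nat where q: "q \<in> carrier ?P" "s \<in> carrier ?P"
        "?c [^]\<^bsub>?Bd\<^esub> m \<odot>\<^bsub>?P\<^esub> f = p \<otimes>\<^bsub>?P\<^esub> q \<oplus>\<^bsub>?P\<^esub> s" "s = \<zero>\<^bsub>?P\<^esub> \<or> deg ?Bd s < deg ?Bd p"
        using E.long_div_theorem[OF p(1) f(1) p(2)] by blast
      let ?ck = "?c [^]\<^bsub>?Bd\<^esub> m"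
      have ck: "?ck \<in> B" using monoid.nat_pow_closed[OF Bm, of ?c m] c by simp
      have eq: "?ck \<odot>\<^bsub>?P\<^esub> f = up_ring.monom ?P ?ck 0 \<otimes>\<^bsub>?P\<^esub> f"
        using E.monom_mult_is_smult[of ?ck f] ck f(1) by simp
      then have "?ev (?ck \<odot>\<^bsub>?P\<^esub> f) = \<zero>\<^bsub>D\<^esub>"
        using E.eval_const[OF assms(3), of ?ck] ck f subsetD[OF BD ck] by simp
      then have "?ev s = \<zero>\<^bsub>D\<^esub>" unfolding q(3) using q(1,2) p by simp
      then have "s = \<zero>\<^bsub>?P\<^esub>" using min[OF q(2)] q(4) by blast
      then have "?g (?ck \<odot>\<^bsub>?P\<^esub> f) = \<zero>\<^bsub>L\<^esub>" unfolding q(3) using q(1,2) p gp by simp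
      then have "h ?ck \<otimes>\<^bsub>L\<^esub> ?g f = \<zero>\<^bsub>L\<^esub>"
        unfolding eq using EL.eval_const[OF x(1), of ?ck] ck f by simp
      moreover have "h ?ck = h ?c [^]\<^bsub>L\<^esub> m" using EL.hom_pow[of ?c m] c by simp
      then have "h ?ck \<noteq> \<zero>\<^bsub>L\<^esub>" using L.nat_pow_nonzero[of "h ?c"] hc EL.hom_closed[of ?c] c by simp
      ultimately show ?thesis using EL.hom_closed[of ?ck] ck g.hom_closed[OF f(1)] by (simp add: L.integral_iff)
    qed
    have "\<exists>h' \<in> ring_hom (D\<lparr>carrier := ?ev ` carrier ?P\<rparr>) L. \<forall>q \<in> carrier ?P. h' (?ev q) = ?g q"
      by (intro ring_hom_factor[OF P.ring_axioms D.ring_axioms L.ring_axioms ev g ker])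
    then obtain h' where h': "h' \<in> ring_hom (D\<lparr>carrier := adjoin D B z\<rparr>) L"
      "\<And>q. q \<in> carrier ?P \<Longrightarrow> h' (?ev q) = ?g q" unfolding adjoin_def by blast
    have hB: "h' y = h y" if "y \<in> B" for y
      using h'(2)[of "up_ring.monom ?P y 0"] that E.eval_const[OF assms(3), of y]
        EL.eval_const[OF x(1), of y] by simp
    have "h' d \<noteq> \<zero>\<^bsub>L\<^esub>"
    proof
      assume "h' d = \<zero>\<^bsub>L\<^esub>"
      then have "h' (d \<otimes>\<^bsub>D\<^esub> e) = \<zero>\<^bsub>L\<^esub>"
        using ring_hom_mult[OF h'(1), of d e] ring_hom_closed[OF h'(1), of e] assms(4) e(1) by simp
      with hB[OF e(2)] hc show False by simp
    qed
    then show "\<exists>h' \<in> ring_hom (D\<lparr>carrier := adjoin D B z\<rparr>) L. (\<forall>x \<in> B. h' x = h x) \<and> h' d \<noteq> \<zero>\<^bsub>L\<^esub>"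
      by (intro bexI[OF _ h'(1)] conjI ballI hB)
  qed
qed

lemma extend_hom_step:
  assumes "domain D" "subring B D" "z \<in> carrier D" "d \<in> adjoin D B z" "d \<noteq> \<zero>\<^bsub>D\<^esub>"
  shows "\<exists>b \<in> B. b \<noteq> \<zero>\<^bsub>D\<^esub> \<and> (\<forall>(L :: ('l, 'n) ring_scheme) h. algebraically_closed L \<longrightarrow>
    h \<in> ring_hom (D\<lparr>carrier := B\<rparr>) L \<longrightarrow> h b \<noteq> \<zero>\<^bsub>L\<^esub> \<longrightarrow>
    (\<exists>h' \<in> ring_hom (D\<lparr>carrier := adjoin D B z\<rparr>) L. (\<forall>x \<in> B. h' x = h x) \<and> h' d \<noteq> \<zero>\<^bsub>L\<^esub>))"
proof (cases "\<exists>p0 \<in> carrier (UP (D\<lparr>carrier := B\<rparr>)). p0 \<noteq> \<zero>\<^bsub>UP (D\<lparr>carrier := B\<rparr>)\<^esub> \<and>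
    UnivPoly.eval (D\<lparr>carrier := B\<rparr>) D id z p0 = \<zero>\<^bsub>D\<^esub>")
  case True
  then obtain p0 where p0: "p0 \<in> carrier (UP (D\<lparr>carrier := B\<rparr>))" "p0 \<noteq> \<zero>\<^bsub>UP (D\<lparr>carrier := B\<rparr>)\<^esub>"
    "UnivPoly.eval (D\<lparr>carrier := B\<rparr>) D id z p0 = \<zero>\<^bsub>D\<^esub>" by metis
  show ?thesis by (rule extend_hom_algebraic[OF assms p0])
next
  case False
  show ?thesis by (rule extend_hom_transcendental[OF assms]) (use False in metis)
qed

text \<open>
  The subring of \<open>D\<close> generated over \<open>B\<close> by the elements of a list.
\<close>

fun adjoins :: "('d, 'm) ring_scheme \<Rightarrow> 'd set \<Rightarrow> 'd list \<Rightarrow> 'd set" where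
  "adjoins D B [] = B"
| "adjoins D B (z # zs) = adjoin D (adjoins D B zs) z"

lemma adjoins_subring:
  assumes "cring D" "subring B D" "set zs \<subseteq> carrier D"
  shows "subring (adjoins D B zs) D"
  using assms by (induction zs) (auto intro!: adjoin_subring)

lemma adjoins_incl:
  assumes "cring D" "subring B D" "set zs \<subseteq> carrier D"
  shows "B \<union> set zs \<subseteq> adjoins D B zs"
  using assms(3)
proof (induction zs)
  case (Cons z zs)
  then show ?case
    using adjoin_incl[OF assms(1) adjoins_subring[OF assms(1,2)], of zs z]
      adjoin_mem[OF assms(1) adjoins_subring[OF assms(1,2)], of zs z] by auto
qed simp

lemma adjoins_minimal:
  assumes "cring D" "subring B D" "set zs \<subseteq> carrier D" "subring H D" "B \<union> set zs \<subseteq> H"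
  shows "adjoins D B zs \<subseteq> H"
  using assms(3,5)
proof (induction zs)
  case (Cons z zs)
  then show ?case
    using adjoin_minimal[OF assms(1) adjoins_subring[OF assms(1,2)] _ assms(4), of zs z] by auto
qed simp

theorem extend_hom:
  assumes "domain D" "subring B D" "set zs \<subseteq> carrier D" "d \<in> adjoins D B zs" "d \<noteq> \<zero>\<^bsub>D\<^esub>"
  shows "\<exists>b \<in> B. b \<noteq> \<zero>\<^bsub>D\<^esub> \<and> (\<forall>(L :: ('l, 'n) ring_scheme) h. algebraically_closed L \<longrightarrow>
    h \<in> ring_hom (D\<lparr>carrier := B\<rparr>) L \<longrightarrow> h b \<noteq> \<zero>\<^bsub>L\<^esub> \<longrightarrow>
    (\<exists>h' \<in> ring_hom (D\<lparr>carrier := adjoins D B zs\<rparr>) L. (\<forall>x \<in> B. h' x = h x) \<and> h' d \<noteq> \<zero>\<^bsub>L\<^esub>))"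
  using assms(3-5)
proof (induction zs arbitrary: d)
  case Nil
  then show ?case by auto
next
  case (Cons z zs)
  interpret D: "domain" D by fact
  have sub: "subring (adjoins D B zs) D" "B \<subseteq> adjoins D B zs"
    using adjoins_subring[OF D.is_cring assms(2), of zs] adjoins_incl[OF D.is_cring assms(2), of zs] Cons by auto
  obtain c where c: "c \<in> adjoins D B zs" "c \<noteq> \<zero>\<^bsub>D\<^esub>" and
    cl: "\<And>(L :: ('l, 'n) ring_scheme) h. algebraically_closed L \<Longrightarrow>
    h \<in> ring_hom (D\<lparr>carrier := adjoins D B zs\<rparr>) L \<Longrightarrow> h c \<noteq> \<zero>\<^bsub>L\<^esub> \<Longrightarrow>
    \<exists>h' \<in> ring_hom (D\<lparr>carrier := adjoins D B (z # zs)\<rparr>) L. (\<forall>x \<in> adjoins D B zs. h' x = h x) \<and> h' d \<noteq> \<zero>\<^bsub>L\<^esub>"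
    using extend_hom_step[OF assms(1) sub(1), of z d, where 'l='l and 'n='n] Cons.prems by auto
  from Cons.IH[OF _ c] Cons.prems(1)
  obtain b where b: "b \<in> B" "b \<noteq> \<zero>\<^bsub>D\<^esub>" and
    bl: "\<And>(L :: ('l, 'n) ring_scheme) h. algebraically_closed L \<Longrightarrow>
    h \<in> ring_hom (D\<lparr>carrier := B\<rparr>) L \<Longrightarrow> h b \<noteq> \<zero>\<^bsub>L\<^esub> \<Longrightarrow>
    \<exists>h' \<in> ring_hom (D\<lparr>carrier := adjoins D B zs\<rparr>) L. (\<forall>x \<in> B. h' x = h x) \<and> h' c \<noteq> \<zero>\<^bsub>L\<^esub>"
    by auto
  show ?case
  proof (intro bexI[OF _ b(1)] conjI b(2) allI impI)
    fix L :: "('l, 'n) ring_scheme" and h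
    assume h: "algebraically_closed L" "h \<in> ring_hom (D\<lparr>carrier := B\<rparr>) L" "h b \<noteq> \<zero>\<^bsub>L\<^esub>"
    from bl[OF h] obtain h1 where h1: "h1 \<in> ring_hom (D\<lparr>carrier := adjoins D B zs\<rparr>) L"
      "\<forall>x \<in> B. h1 x = h x" "h1 c \<noteq> \<zero>\<^bsub>L\<^esub>" by blast
    from cl[OF h(1) h1(1,3)] h1(2) sub(2)
    show "\<exists>h' \<in> ring_hom (D\<lparr>carrier := adjoins D B (z # zs)\<rparr>) L. (\<forall>x \<in> B. h' x = h x) \<and> h' d \<noteq> \<zero>\<^bsub>L\<^esub>"
      by (metis subsetD)
  qed
qed

section \<open>The ascending chain condition for finitely generated subrings\<close>

text \<open>
  \<open>I\<close> is an ideal of the subring \<open>B\<close> of \<open>D\<close>. This avoids the structure with carrier \<open>B\<close>; closure under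
  negation follows from multiplication by \<open>- 1\<close>.
\<close>

definition sideal :: "('d, 'm) ring_scheme \<Rightarrow> 'd set \<Rightarrow> 'd set \<Rightarrow> bool" where
  "sideal D B I \<longleftrightarrow> I \<subseteq> B \<and> \<zero>\<^bsub>D\<^esub> \<in> I \<and> (\<forall>x \<in> I. \<forall>y \<in> I. x \<oplus>\<^bsub>D\<^esub> y \<in> I) \<and>
     (\<forall>b \<in> B. \<forall>x \<in> I. b \<otimes>\<^bsub>D\<^esub> x \<in> I)"

lemma sideal_ideal:
  assumes "cring D" "subring B D" "sideal D B I"
  shows "ideal I (D\<lparr>carrier := B\<rparr>)"
proof -
  interpret D: cring D by fact
  interpret Bd: cring "D\<lparr>carrier := B\<rparr>" using cring_subring[OF assms(1,2)] .
  have I: "I \<subseteq> B" "\<zero>\<^bsub>D\<^esub> \<in> I" "\<And>x y. x \<in> I \<Longrightarrow> y \<in> I \<Longrightarrow> x \<oplus>\<^bsub>D\<^esub> y \<in> I"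
    "\<And>b x. b \<in> B \<Longrightarrow> x \<in> I \<Longrightarrow> b \<otimes>\<^bsub>D\<^esub> x \<in> I"
    using assms(3) by (auto simp: sideal_def)
  have BD: "B \<subseteq> carrier D" using subringE(1)[OF assms(2)] .
  have neg: "\<ominus>\<^bsub>D\<^esub> x \<in> I" if "x \<in> I" for x
    using I(4)[OF subringE(5)[OF assms(2) subringE(3)[OF assms(2)]] that] that I(1) BD
    by (metis D.l_minus D.l_one D.one_closed subsetD)
  have neg': "inv\<^bsub>add_monoid (D\<lparr>carrier := B\<rparr>)\<^esub> x = \<ominus>\<^bsub>D\<^esub> x" if "x \<in> I" for x
  proof -
    have x: "x \<in> B" "\<ominus>\<^bsub>D\<^esub> x \<in> B" using that I(1) subringE(5)[OF assms(2)] by auto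
    have "\<ominus>\<^bsub>D\<lparr>carrier := B\<rparr>\<^esub> x = \<ominus>\<^bsub>D\<^esub> x"
      using x BD D.l_neg[of x] by (intro Bd.minus_equality) auto
    then show ?thesis by (simp add: a_inv_def)
  qed
  have sg: "subgroup I (add_monoid (D\<lparr>carrier := B\<rparr>))"
    using I neg neg' by (intro Bd.add.group_axioms[THEN group.subgroupI]) auto
  show ?thesis
    by (rule idealI[OF Bd.ring_axioms sg]) (use I BD D.m_comm in \<open>simp_all add: subset_iff, metis+\<close>)
qed

lemma sideal_diff:
  assumes "cring D" "subring B D" "sideal D B I" "x \<in> I" "y \<in> I"
  shows "x \<ominus>\<^bsub>D\<^esub> y \<in> I"
proof -
  interpret D: cring D by fact
  have y: "y \<in> carrier D" using assms(3,5) subringE(1)[OF assms(2)] by (auto simp: sideal_def)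
  have "\<ominus>\<^bsub>D\<^esub> \<one>\<^bsub>D\<^esub> \<otimes>\<^bsub>D\<^esub> y \<in> I"
    using assms(3,5) subringE(3,5)[OF assms(2)] by (auto simp: sideal_def)
  then have "\<ominus>\<^bsub>D\<^esub> y \<in> I" using y by (simp add: D.l_minus)
  then show ?thesis using assms(3,4) by (auto simp: sideal_def D.minus_eq)
qed

text \<open>
  The subring \<open>B\<close> of \<open>D\<close> is Noetherian.
\<close>

definition acc :: "('d, 'm) ring_scheme \<Rightarrow> 'd set \<Rightarrow> bool" where
  "acc D B \<longleftrightarrow> (\<forall>J :: nat \<Rightarrow> 'd set. (\<forall>n. sideal D B (J n) \<and> J n \<subseteq> J (Suc n)) \<longrightarrow>
     (\<exists>N. \<forall>n \<ge> N. J n = J N))"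

lemma acc_subfield:
  assumes "cring D" "subfield E D" shows "acc D E"
  unfolding acc_def
proof (intro allI impI)
  fix J :: "nat \<Rightarrow> 'a set" assume J: "\<forall>n. sideal D E (J n) \<and> J n \<subseteq> J (Suc n)"
  interpret D: cring D by fact
  interpret E: field "D\<lparr>carrier := E\<rparr>" using D.subfield_iff(2)[OF assms(2)] .
  have "ideal (J n) (D\<lparr>carrier := E\<rparr>)" for n
    using sideal_ideal[OF assms(1) subfieldE(1)[OF assms(2)]] J by blast
  then have J2: "J n = {\<zero>\<^bsub>D\<^esub>} \<or> J n = E" for n using E.all_ideals by auto
  have mono: "i \<le> j \<Longrightarrow> J i \<subseteq> J j" for i j using J lift_Suc_mono_le[of J] by blast
  show "\<exists>N. \<forall>n \<ge> N. J n = J N"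
  proof (cases "\<exists>N. J N = E")
    case True
    then obtain N where "J N = E" by blast
    then have "\<forall>n \<ge> N. J n = J N" using mono J by (metis sideal_def subset_antisym)
    then show ?thesis by blast
  next
    case False
    then show ?thesis using J2 by blast
  qed
qed

text \<open>
  Hilbert's basis theorem for \<open>B[w]\<close>. For an ideal \<open>J\<close> of \<open>B[w]\<close>, the leading coefficients of the polynomials
  of degree at most \<open>n\<close> with value in \<open>J\<close> at \<open>w\<close> form an ideal of \<open>B\<close>; these ideals determine \<open>J\<close>
  within a chain.
\<close>

lemma acc_adjoin:
  assumes "cring D" "subring B D" "w \<in> carrier D" "acc D B"
  shows "acc D (adjoin D B w)"
proof -
  interpret D: cring D by fact
  let ?Bd = "D\<lparr>carrier := B\<rparr>"
  let ?P = "UP ?Bd"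
  let ?ev = "UnivPoly.eval ?Bd D id w"
  let ?co = "up_ring.coeff ?P"
  let ?A = "adjoin D B w"
  interpret P: cring ?P using UP_sub_cring[OF assms(1,2)] .
  interpret E: UP_pre_univ_prop ?Bd D id ?P
    using UP_eval_interp[OF assms(1,2,1) id_subring_hom[OF assms(2)]] by simp
  have ev: "?ev \<in> ring_hom ?P D" using E.eval_ring_hom[OF assms(3)] .
  interpret ev: ring_hom_cring ?P D ?ev by unfold_locales (rule ev)
  have A: "subring ?A D" using adjoin_subring[OF assms(1-3)] .
  have BA: "B \<subseteq> ?A" using adjoin_incl[OF assms(1-3)] .
  have wA: "w \<in> ?A" using adjoin_mem[OF assms(1-3)] .
  have BD: "B \<subseteq> carrier D" using subringE(1)[OF assms(2)] .
  define W where "W = (\<lambda>J n. {p \<in> carrier ?P. (\<forall>i>n. ?co p i = \<zero>\<^bsub>D\<^esub>) \<and> ?ev p \<in> J})"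
  define lc where "lc = (\<lambda>J n. (\<lambda>p. ?co p n) ` W J n)"
  have lc_ideal: "sideal D B (lc J n)" if J: "sideal D ?A J" for J n
    unfolding sideal_def
  proof (intro conjI ballI)
    show "lc J n \<subseteq> B" using E.coeff_closed by (auto simp: lc_def W_def)
    have "\<zero>\<^bsub>?P\<^esub> \<in> W J n" using J by (simp add: W_def sideal_def)
    then show "\<zero>\<^bsub>D\<^esub> \<in> lc J n" unfolding lc_def by (intro image_eqI) auto
  next
    fix x y assume "x \<in> lc J n" "y \<in> lc J n"
    then obtain p q where p: "p \<in> W J n" "x = ?co p n" and q: "q \<in> W J n" "y = ?co q n"
      by (auto simp: lc_def)
    have "p \<oplus>\<^bsub>?P\<^esub> q \<in> W J n" using p q J by (auto simp: W_def sideal_def)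
    moreover have "x \<oplus>\<^bsub>D\<^esub> y = ?co (p \<oplus>\<^bsub>?P\<^esub> q) n" using p q by (auto simp: W_def)
    ultimately show "x \<oplus>\<^bsub>D\<^esub> y \<in> lc J n" unfolding lc_def by blast
  next
    fix b x assume b: "b \<in> B" and "x \<in> lc J n"
    then obtain p where p: "p \<in> W J n" "x = ?co p n" by (auto simp: lc_def)
    have pP: "p \<in> carrier ?P" using p by (simp add: W_def)
    let ?q = "b \<odot>\<^bsub>?P\<^esub> p"
    have "?q = up_ring.monom ?P b 0 \<otimes>\<^bsub>?P\<^esub> p" using E.monom_mult_is_smult[of b p] b pP by simp
    then have "?ev ?q = b \<otimes>\<^bsub>D\<^esub> ?ev p" using E.eval_const[OF assms(3), of b] b pP by simp
    then have "?ev ?q \<in> J" using J p b BA by (auto simp: W_def sideal_def)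
    then have "?q \<in> W J n" using p b pP BD by (auto simp: W_def)
    moreover have "b \<otimes>\<^bsub>D\<^esub> x = ?co ?q n" using p b pP by simp
    ultimately show "b \<otimes>\<^bsub>D\<^esub> x \<in> lc J n" unfolding lc_def by blast
  qed
  have lc_Suc: "lc J n \<subseteq> lc J (Suc n)" if J: "sideal D ?A J" for J n
  proof
    fix x assume "x \<in> lc J n"
    then obtain p where p: "p \<in> W J n" "x = ?co p n" by (auto simp: lc_def)
    have pP: "p \<in> carrier ?P" using p by (simp add: W_def)
    let ?m = "up_ring.monom ?P \<one>\<^bsub>D\<^esub> 1"
    let ?q = "?m \<otimes>\<^bsub>?P\<^esub> p"
    have one: "\<one>\<^bsub>D\<^esub> \<in> B" using subringE(3)[OF assms(2)] .
    have m: "?m \<in> carrier ?P" using E.monom_closed[of "\<one>\<^bsub>D\<^esub>" 1] one by simp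
    have co: "?co ?q i = (if i \<ge> 1 then ?co p (i - 1) else \<zero>\<^bsub>D\<^esub>)" for i
    proof -
      have co: "?co p j \<in> carrier D" "?co p j \<in> B" for j using E.coeff_closed[OF pP, of j] BD by auto
      show ?thesis
      proof (cases i)
        case 0
        then show ?thesis using E.coeff_mult[OF m pP] co one E.coeff_monom[of "\<one>\<^bsub>D\<^esub>"]
            subringE(2)[OF assms(2)]
          by simp
      next
        case (Suc j)
        then show ?thesis
          using E.coeff_monom_mult[where c = "\<one>\<^bsub>D\<^esub>" and n = 1 and m = j, OF _ pP] one co by simp
      qed
    qed
    have "?ev ?q = w \<otimes>\<^bsub>D\<^esub> ?ev p" using E.eval_monom1[OF assms(3)] m pP by simp
    then have "?ev ?q \<in> J" using J p wA by (auto simp: W_def sideal_def)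
    then have "?q \<in> W J (Suc n)" using m pP p(1) co by (auto simp: W_def)
    moreover have "x = ?co ?q (Suc n)" using p(2) co by simp
    ultimately show "x \<in> lc J (Suc n)" unfolding lc_def by blast
  qed
  have lc_mono: "J \<subseteq> J' \<Longrightarrow> lc J n \<subseteq> lc J' n" for J J' n by (auto simp: lc_def W_def)
  have eq: "J' \<subseteq> J" if J: "sideal D ?A J" "sideal D ?A J'" "J \<subseteq> J'" "\<And>n. lc J' n \<subseteq> lc J n" for J J'
  proof
    fix x assume x: "x \<in> J'"
    have claim: "p \<in> W J' n \<Longrightarrow> ?ev p \<in> J" for p n
    proof (induction n arbitrary: p rule: less_induct)
      case (less n)
      then have pP: "p \<in> carrier ?P" by (simp add: W_def)
      have "?co p n \<in> lc J n" using less.prems J(4)[of n] by (auto simp: lc_def)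
      then obtain q where q: "q \<in> W J n" "?co p n = ?co q n" by (auto simp: lc_def)
      have qP: "q \<in> carrier ?P" using q by (simp add: W_def)
      have qJ: "?ev q \<in> J" using q by (simp add: W_def)
      let ?r = "p \<ominus>\<^bsub>?P\<^esub> q"
      have r: "?r \<in> carrier ?P" using pP qP by simp
      have cD: "?co p j \<in> B" "?co q j \<in> B" for j
        using E.coeff_closed[OF pP, of j] E.coeff_closed[OF qP, of j] by auto
      have pr: "p = ?r \<oplus>\<^bsub>?P\<^esub> q"
        using pP qP by (simp add: P.minus_eq P.a_assoc P.l_neg)
      have cr: "?co ?r i = \<zero>\<^bsub>D\<^esub>" if "i \<ge> n" for i
      proof -
        have rD: "?co ?r i \<in> carrier D" "?co q i \<in> carrier D"
          using E.coeff_closed[OF r, of i] cD BD by auto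
        have "?co p i = ?co q i" using less.prems q that by (cases "i = n") (auto simp: W_def)
        moreover have "?co p i = ?co ?r i \<oplus>\<^bsub>D\<^esub> ?co q i"
          using arg_cong[OF pr, of "\<lambda>u. ?co u i"] E.coeff_add[OF r qP, of i] by simp
        ultimately show ?thesis using rD by simp
      qed
      have evr: "?ev ?r = ?ev p \<ominus>\<^bsub>D\<^esub> ?ev q" using pP qP by (simp add: P.minus_eq D.minus_eq)
      have "?ev p \<in> J'" using less.prems by (simp add: W_def)
      then have evJ': "?ev ?r \<in> J'" unfolding evr
        using sideal_diff[OF assms(1) A J(2)] qJ J(3) by blast
      have "?ev ?r \<in> J"
      proof (cases n)
        case 0
        have "?r = \<zero>\<^bsub>?P\<^esub>" by (rule E.up_eqI) (use r cr 0 in auto)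
        then show ?thesis using J(1) by (simp add: sideal_def)
      next
        case (Suc m)
        have "?r \<in> W J' m" using r cr evJ' Suc by (auto simp: W_def)
        then show ?thesis using less.IH[of m "?r"] Suc by blast
      qed
      moreover have "?ev p = ?ev ?r \<oplus>\<^bsub>D\<^esub> ?ev q"
        unfolding evr using pP qP by (simp add: D.minus_eq D.a_assoc D.l_neg)
      ultimately show ?case using qJ J(1) by (simp add: sideal_def id_def)
    qed
    have "x \<in> ?A" using x J(2) by (auto simp: sideal_def)
    then obtain p where p: "p \<in> carrier ?P" "x = ?ev p" by (auto simp: adjoin_def)
    then have "p \<in> W J' (deg ?Bd p)" using x E.deg_aboveD by (auto simp: W_def)
    then show "x \<in> J" using claim p by blast
  qed
  show ?thesis unfolding acc_def
  proof (intro allI impI)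
    fix J :: "nat \<Rightarrow> 'a set" assume J: "\<forall>n. sideal D ?A (J n) \<and> J n \<subseteq> J (Suc n)"
    then have Ji: "\<And>n. sideal D ?A (J n)" by blast
    have Jm: "i \<le> j \<Longrightarrow> J i \<subseteq> J j" for i j using J lift_Suc_mono_le[of J] by blast
    have lm: "lc (J i) m \<subseteq> lc (J j) n" if "i \<le> j" "m \<le> n" for i j m n
      using lift_Suc_mono_le[of "lc (J i)" m n, OF lc_Suc[OF Ji] that(2)] lc_mono[OF Jm[OF that(1)], of n] by blast
    have diag: "\<forall>n. sideal D B (lc (J n) n) \<and> lc (J n) n \<subseteq> lc (J (Suc n)) (Suc n)"
      using lc_ideal[OF Ji] lm by simp
    obtain N where N: "\<forall>n \<ge> N. lc (J n) n = lc (J N) N"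
      using assms(4)[unfolded acc_def, THEN spec, of "\<lambda>n. lc (J n) n"] diag by blast
    have col: "\<exists>M. \<forall>j \<ge> M. lc (J j) m = lc (J M) m" for m
    proof -
      have "\<forall>j. sideal D B (lc (J j) m) \<and> lc (J j) m \<subseteq> lc (J (Suc j)) m"
        using lc_ideal[OF Ji] lm by simp
      then show ?thesis using assms(4)[unfolded acc_def, THEN spec, of "\<lambda>j. lc (J j) m"] by blast
    qed
    then obtain M where M: "\<And>m j. j \<ge> M m \<Longrightarrow> lc (J j) m = lc (J (M m)) m" by metis
    define Z where "Z = Max (insert N (M ` {..<N}))"
    have XN: "N \<le> Z" unfolding Z_def by (rule Max_ge) auto
    have XM: "m < N \<Longrightarrow> M m \<le> Z" for m unfolding Z_def by (rule Max_ge) auto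
    have "J n \<subseteq> J Z" if n: "n \<ge> Z" for n
    proof (rule eq[OF Ji Ji Jm[OF n]])
      fix m show "lc (J n) m \<subseteq> lc (J Z) m"
      proof (cases "m < N")
        case True
        then have "M m \<le> Z" "M m \<le> n" using XM[OF True] n by auto
        then show ?thesis using M by blast
      next
        case False
        define t where "t = max n m"
        have t: "n \<le> t" "m \<le> t" "N \<le> t" using XN n by (auto simp: t_def)
        have "lc (J n) m \<subseteq> lc (J t) t" by (rule lm[OF t(1,2)])
        also have "\<dots> = lc (J N) N" using N t(3) by blast
        also have "\<dots> \<subseteq> lc (J Z) m" by (rule lm) (use XN False in auto)
        finally show ?thesis .
      qed
    qed
    then show "\<exists>N. \<forall>n \<ge> N. J n = J N" using Jm by (intro exI[of _ Z]) blast
  qed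
qed

lemma acc_adjoins:
  assumes "cring D" "subring B D" "set zs \<subseteq> carrier D" "acc D B"
  shows "acc D (adjoins D B zs)"
  using assms(3) by (induction zs) (auto intro!: acc_adjoin adjoins_subring assms)

section \<open>Krull's intersection theorem\<close>

text \<open>
  For an ideal \<open>I\<close> the set of finite sums of products \<open>x c\<close> with \<open>x \<in> Y\<close> and \<open>c \<in> I\<close>: the product of \<open>I\<close> with
  the ideal generated by \<open>Y\<close>.
\<close>

inductive_set mgen :: "('d, 'm) ring_scheme \<Rightarrow> 'd set \<Rightarrow> 'd set \<Rightarrow> 'd set" for D Y I where
  zero: "\<zero>\<^bsub>D\<^esub> \<in> mgen D Y I"
| step: "\<lbrakk>x \<in> Y; c \<in> I; s \<in> mgen D Y I\<rbrakk> \<Longrightarrow> x \<otimes>\<^bsub>D\<^esub> c \<oplus>\<^bsub>D\<^esub> s \<in> mgen D Y I"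

lemma mgen_sideal:
  assumes "cring D" "subring B D" "sideal D B I" "Y \<subseteq> B"
  shows "mgen D Y I \<subseteq> I" "sideal D B (mgen D Y I)"
proof -
  interpret D: cring D by fact
  have I: "I \<subseteq> B" "\<zero>\<^bsub>D\<^esub> \<in> I" "\<And>x y. x \<in> I \<Longrightarrow> y \<in> I \<Longrightarrow> x \<oplus>\<^bsub>D\<^esub> y \<in> I"
    "\<And>b x. b \<in> B \<Longrightarrow> x \<in> I \<Longrightarrow> b \<otimes>\<^bsub>D\<^esub> x \<in> I"
    using assms(3) by (auto simp: sideal_def)
  have BD: "B \<subseteq> carrier D" using subringE(1)[OF assms(2)] .
  show sub: "mgen D Y I \<subseteq> I"
  proof
    fix s assume "s \<in> mgen D Y I"
    then show "s \<in> I" by induction (use I assms(4) in auto)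
  qed
  have car: "\<And>x. x \<in> Y \<Longrightarrow> x \<in> carrier D" "\<And>x. x \<in> I \<Longrightarrow> x \<in> carrier D"
    "\<And>x. x \<in> mgen D Y I \<Longrightarrow> x \<in> carrier D" "\<And>x. x \<in> B \<Longrightarrow> x \<in> carrier D"
    using sub I(1) BD assms(4) by (simp_all add: subset_iff)
  show "sideal D B (mgen D Y I)"
    unfolding sideal_def
  proof (intro conjI ballI mgen.zero)
    show "mgen D Y I \<subseteq> B" using sub I by blast
  next
    fix x y assume "x \<in> mgen D Y I" and y: "y \<in> mgen D Y I"
    then show "x \<oplus>\<^bsub>D\<^esub> y \<in> mgen D Y I"
    proof induction
      case zero
      then show ?case using car y by simp
    next
      case (step x c s)
      then have "x \<in> carrier D" "c \<in> carrier D" "s \<in> carrier D" "y \<in> carrier D"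
        using car y by simp_all
      then have "x \<otimes>\<^bsub>D\<^esub> c \<oplus>\<^bsub>D\<^esub> s \<oplus>\<^bsub>D\<^esub> y = x \<otimes>\<^bsub>D\<^esub> c \<oplus>\<^bsub>D\<^esub> (s \<oplus>\<^bsub>D\<^esub> y)" by (simp add: D.a_assoc)
      with step show ?case by (simp add: mgen.step)
    qed
  next
    fix b x assume b: "b \<in> B" and "x \<in> mgen D Y I"
    from this(2) show "b \<otimes>\<^bsub>D\<^esub> x \<in> mgen D Y I"
    proof induction
      case zero
      have "b \<in> carrier D" using b BD by blast
      then show ?case by (simp add: mgen.zero)
    next
      case (step x c s)
      then have "x \<in> carrier D" "c \<in> carrier D" "s \<in> carrier D" "b \<in> carrier D"
        using car b by simp_all
      then have "b \<otimes>\<^bsub>D\<^esub> (x \<otimes>\<^bsub>D\<^esub> c \<oplus>\<^bsub>D\<^esub> s) = x \<otimes>\<^bsub>D\<^esub> (b \<otimes>\<^bsub>D\<^esub> c) \<oplus>\<^bsub>D\<^esub> b \<otimes>\<^bsub>D\<^esub> s"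
        by (simp add: D.r_distr D.m_lcomm)
      with step b I(4) show ?case by (simp add: mgen.step)
    qed
  qed
qed

text \<open>
  The powers of the ideal of \<open>B\<close> generated by \<open>Y\<close>, with \<open>B\<close> itself as the power zero.
\<close>

definition ipow :: "('d, 'm) ring_scheme \<Rightarrow> 'd set \<Rightarrow> 'd set \<Rightarrow> nat \<Rightarrow> 'd set" where
  "ipow D Y B n = (mgen D Y ^^ n) B"

lemma ipow_simps [simp]: "ipow D Y B 0 = B" "ipow D Y B (Suc n) = mgen D Y (ipow D Y B n)"
  by (simp_all add: ipow_def)

lemma sideal_self: "subring B D \<Longrightarrow> sideal D B B"
  by (auto simp: sideal_def dest: subringE)

lemma ipow_sideal:
  assumes "cring D" "subring B D" "Y \<subseteq> B"
  shows "sideal D B (ipow D Y B n)"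
proof (induction n)
  case 0
  then show ?case using sideal_self[OF assms(2)] by simp
next
  case (Suc n)
  then show ?case using mgen_sideal(2)[OF assms(1,2) _ assms(3)] by simp
qed

lemma ipow_Suc:
  assumes "cring D" "subring B D" "Y \<subseteq> B"
  shows "ipow D Y B (Suc n) \<subseteq> ipow D Y B n"
  using mgen_sideal(1)[OF assms(1,2) ipow_sideal[OF assms] assms(3)] by simp

lemma ipow_antimono:
  assumes "cring D" "subring B D" "Y \<subseteq> B" "m \<le> n"
  shows "ipow D Y B n \<subseteq> ipow D Y B m"
  using lift_Suc_antimono_le[of "ipow D Y B", OF ipow_Suc[OF assms(1-3)] assms(4)] .

lemma ipow_mult:
  assumes "cring D" "subring B D" "Y \<subseteq> B" "a \<in> ipow D Y B i" "b \<in> ipow D Y B j"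
  shows "a \<otimes>\<^bsub>D\<^esub> b \<in> ipow D Y B (i + j)"
  using assms(4)
proof (induction i arbitrary: a)
  case 0
  then show ?case using ipow_sideal[OF assms(1-3), of j] assms(5) by (auto simp: sideal_def)
next
  interpret D: cring D by fact
  have S: "ipow D Y B n \<subseteq> carrier D" for n
    using ipow_sideal[OF assms(1-3), of n] subringE(1)[OF assms(2)] by (auto simp: sideal_def)
  case (Suc i)
  have "a \<in> mgen D Y (ipow D Y B i)" using Suc.prems by simp
  then show ?case
  proof induction
    case zero
    have "b \<in> carrier D" using S assms(5) by blast
    then show ?case by (simp add: mgen.zero)
  next
    case (step x c s)
    have m: "x \<in> carrier D" "c \<in> carrier D" "s \<in> carrier D" "b \<in> carrier D"
      using S[of i] S[of "Suc i"] S[of j] step assms(3,5) subringE(1)[OF assms(2)] by auto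
    have "(x \<otimes>\<^bsub>D\<^esub> c \<oplus>\<^bsub>D\<^esub> s) \<otimes>\<^bsub>D\<^esub> b = x \<otimes>\<^bsub>D\<^esub> (c \<otimes>\<^bsub>D\<^esub> b) \<oplus>\<^bsub>D\<^esub> s \<otimes>\<^bsub>D\<^esub> b"
      using m by (simp add: D.l_distr D.m_assoc)
    then show ?case using step Suc.IH[of c] by (simp add: mgen.step)
  qed
qed

lemma sideal_finsum_closed:
  assumes "cring D" "subring B D" "sideal D B I" "f \<in> A \<rightarrow> I"
  shows "finsum D f A \<in> I"
proof -
  interpret D: cring D by fact
  have I: "I \<subseteq> carrier D" "\<zero>\<^bsub>D\<^esub> \<in> I" "\<And>x y. x \<in> I \<Longrightarrow> y \<in> I \<Longrightarrow> x \<oplus>\<^bsub>D\<^esub> y \<in> I"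
    using assms(3) subringE(1)[OF assms(2)] by (auto simp: sideal_def)
  show ?thesis using assms(4)
  proof (induction A rule: infinite_finite_induct)
    case (insert x F)
    then have "f \<in> F \<rightarrow> carrier D" "f x \<in> carrier D" using I by auto
    with insert show ?case by (auto simp: I)
  qed (use I in auto)
qed

text \<open>
  The proof uses the Rees algebra. Let \<open>I\<close> be the ideal generated by \<open>xs\<close>, and let \<open>b \<noteq> 0\<close> lie in all its powers. The subring \<open>T0\<close> of the polynomial
  ring generated by \<open>E\<close>, \<open>xs\<close> and the \<open>x X\<close> for \<open>x\<close> in \<open>xs\<close> is Noetherian and contains all \<open>b X\<^sup>n\<close>. So some
  \<open>b X\<^bsup>N+1\<^esup>\<close> is a combination of \<open>b, b X, \<dots>, b X\<^sup>N\<close>. Coefficients of \<open>X\<^sup>n\<close> of elements of \<open>T0\<close> lie in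
  \<open>I\<^sup>n\<close>; comparison of the coefficients of \<open>X\<^bsup>N+1\<^esup>\<close> gives \<open>b = b \<mu>\<close> with \<open>\<mu> \<in> I\<close>, so \<open>\<mu> = 1\<close>.
\<close>

theorem krull_intersection:
  assumes "domain D" "subfield E D" "set xs \<subseteq> carrier D"
    and B: "B = adjoins D E xs"
    and proper: "\<one>\<^bsub>D\<^esub> \<notin> ipow D (set xs) B 1"
    and b: "\<And>n. b \<in> ipow D (set xs) B n"
  shows "b = \<zero>\<^bsub>D\<^esub>"
proof (rule ccontr)
  assume b0: "b \<noteq> \<zero>\<^bsub>D\<^esub>"
  interpret D: "domain" D by fact
  let ?U = "UP D"
  let ?mo = "up_ring.monom ?U"
  let ?co = "up_ring.coeff ?U"
  interpret UR: cring ?U using UP_cring.UP_cring[OF UP_cring.intro[OF D.is_cring]] .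
  interpret U: UP_cring D ?U by unfold_locales
  have E: "subring E D" using subfieldE(1)[OF assms(2)] .
  have Bs: "subring B D" unfolding B using adjoins_subring[OF D.is_cring E assms(3)] .
  have EB: "E \<subseteq> B" and xB: "set xs \<subseteq> B"
    unfolding B using adjoins_incl[OF D.is_cring E assms(3)] by auto
  have BD: "B \<subseteq> carrier D" using subringE(1)[OF Bs] .
  note ideal = ipow_sideal[OF D.is_cring Bs xB]
  have IB: "ipow D (set xs) B n \<subseteq> B" for n using ideal[of n] by (simp add: sideal_def)
  have bD: "b \<in> carrier D" using b[of 0] BD by auto
  define T where "T = {p \<in> carrier ?U. \<forall>n. ?co p n \<in> ipow D (set xs) B n}"
  have T: "subring T ?U"
  proof (rule UR.subringI)
    show "T \<subseteq> carrier ?U" by (auto simp: T_def)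
    show "\<one>\<^bsub>?U\<^esub> \<in> T" using ideal subringE(3)[OF Bs] by (auto simp: T_def sideal_def)
  next
    fix p assume "p \<in> T"
    then have p: "p \<in> carrier ?U" "\<And>n. ?co p n \<in> ipow D (set xs) B n" by (auto simp: T_def)
    have "\<zero>\<^bsub>D\<^esub> \<ominus>\<^bsub>D\<^esub> ?co p n \<in> ipow D (set xs) B n" for n
      using sideal_diff[OF D.is_cring Bs ideal _ p(2)] ideal[of n] by (auto simp: sideal_def)
    then show "\<ominus>\<^bsub>?U\<^esub> p \<in> T" using p(1) by (auto simp: T_def D.minus_eq)
  next
    fix p q assume "p \<in> T" "q \<in> T"
    then have p: "p \<in> carrier ?U" "\<And>n. ?co p n \<in> ipow D (set xs) B n"
      and q: "q \<in> carrier ?U" "\<And>n. ?co q n \<in> ipow D (set xs) B n" by (auto simp: T_def)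
    have "(\<Oplus>\<^bsub>D\<^esub>i \<in> {..n}. ?co p i \<otimes>\<^bsub>D\<^esub> ?co q (n - i)) \<in> ipow D (set xs) B n" for n
    proof (rule sideal_finsum_closed[OF D.is_cring Bs ideal], rule)
      fix i assume "i \<in> {..n}"
      then show "?co p i \<otimes>\<^bsub>D\<^esub> ?co q (n - i) \<in> ipow D (set xs) B n"
        using ipow_mult[OF D.is_cring Bs xB p(2)[of i] q(2)[of "n - i"]] by simp
    qed
    then show "p \<otimes>\<^bsub>?U\<^esub> q \<in> T" using p(1) q(1) by (auto simp: T_def)
    show "p \<oplus>\<^bsub>?U\<^esub> q \<in> T" using p q ideal by (auto simp: T_def sideal_def)
  qed
  define E' where "E' = (\<lambda>a. ?mo a 0) ` E"
  define ws where "ws = map (\<lambda>x. ?mo x 0) xs @ map (\<lambda>x. ?mo x 1) xs"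
  define T0 where "T0 = adjoins ?U E' ws"
  interpret const: ring_hom_ring D ?U "\<lambda>a. ?mo a 0"
    using U.const_ring_hom by unfold_locales
  have "\<one>\<^bsub>?U\<^esub> \<noteq> \<zero>\<^bsub>?U\<^esub>"
  proof
    assume "\<one>\<^bsub>?U\<^esub> = \<zero>\<^bsub>?U\<^esub>"
    then have "?co \<one>\<^bsub>?U\<^esub> 0 = ?co \<zero>\<^bsub>?U\<^esub> 0" by simp
    then show False by simp
  qed
  then have E'f: "subfield E' ?U" unfolding E'_def using const.img_is_subfield[OF assms(2)] by simp
  then have E's: "subring E' ?U" by (rule subfieldE(1))
  have ws: "set ws \<subseteq> carrier ?U" using assms(3) by (auto simp: ws_def)
  have T0s: "subring T0 ?U" unfolding T0_def using adjoins_subring[OF UR.is_cring E's ws] .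
  have T0i: "E' \<subseteq> T0" "set ws \<subseteq> T0" unfolding T0_def using adjoins_incl[OF UR.is_cring E's ws] by auto
  have x1: "x \<in> ipow D (set xs) B 1" if "x \<in> set xs" for x
    using mgen.step[OF that, of "\<one>\<^bsub>D\<^esub>" B "\<zero>\<^bsub>D\<^esub>" D] mgen.zero subringE(3)[OF Bs] that assms(3)
    by (auto simp: subset_iff)
  have "T0 \<subseteq> T" unfolding T0_def
  proof (rule adjoins_minimal[OF UR.is_cring E's ws T])
    have zn: "\<zero>\<^bsub>D\<^esub> \<in> ipow D (set xs) B n" for n using ideal[of n] by (simp add: sideal_def)
    have "?mo a 0 \<in> T" if "a \<in> B" for a
      using that BD zn by (auto simp: T_def)
    moreover have "?mo a 1 \<in> T" if "a \<in> set xs" for a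
      using x1[OF that] assms(3) that zn by (auto simp: T_def subset_iff)
    ultimately show "E' \<union> set ws \<subseteq> T" using EB xB by (auto simp: E'_def ws_def)
  qed
  have B0: "?mo a 0 \<in> T0" if "a \<in> B" for a
  proof -
    let ?H = "{a \<in> carrier D. ?mo a 0 \<in> T0}"
    have "subring ?H D"
    proof (rule D.subringI)
      show "\<one>\<^bsub>D\<^esub> \<in> ?H" using subringE(3)[OF T0s] const.hom_one by simp
    next
      fix h assume "h \<in> ?H"
      then show "\<ominus>\<^bsub>D\<^esub> h \<in> ?H" using subringE(5)[OF T0s, of "?mo h 0"] by simp
    next
      fix h k assume "h \<in> ?H" "k \<in> ?H"
      then show "h \<otimes>\<^bsub>D\<^esub> k \<in> ?H" "h \<oplus>\<^bsub>D\<^esub> k \<in> ?H"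
        using subringE(6,7)[OF T0s, of "?mo h 0" "?mo k 0"] U.monom_mult[of h k 0 0] by simp_all
    qed auto
    then have "B \<subseteq> ?H" unfolding B
      by (rule adjoins_minimal[OF D.is_cring E assms(3)])
         (use T0i subringE(1)[OF E] assms(3) in \<open>auto simp: E'_def ws_def\<close>)
    then show ?thesis using that by blast
  qed
  have mono: "a \<in> ipow D (set xs) B n \<Longrightarrow> ?mo a n \<in> T0" for a n
  proof (induction n arbitrary: a)
    case 0 then show ?case using B0 by simp
  next
    case (Suc n)
    have "a \<in> mgen D (set xs) (ipow D (set xs) B n)" using Suc.prems by simp
    then show ?case
    proof induction
      case zero
      then show ?case using subringE(2)[OF T0s] by simp
    next
      case (step x c s)
      have m: "x \<in> carrier D" "c \<in> carrier D" "s \<in> carrier D"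
        using step(1-3) assms(3) IB[of n] IB[of "Suc n"] BD by auto
      have "?mo x 1 \<in> T0" using T0i step(1) by (auto simp: ws_def)
      then have "?mo x 1 \<otimes>\<^bsub>?U\<^esub> ?mo c n \<in> T0" using Suc.IH[OF step(2)] subringE(6)[OF T0s] by blast
      then have "?mo (x \<otimes>\<^bsub>D\<^esub> c) (Suc n) \<in> T0" using U.monom_mult[OF m(1,2), of 1 n] by simp
      then show ?case using m subringE(7)[OF T0s] step.IH by simp
    qed
  qed
  \<comment> \<open>the ideal of \<open>T0\<close> generated by \<open>b, b X, \<dots>, b X\<^sup>N\<close>\<close>
  define J where "J = rec_nat {r \<otimes>\<^bsub>?U\<^esub> ?mo b 0 | r. r \<in> T0}
    (\<lambda>N J. {u \<oplus>\<^bsub>?U\<^esub> r \<otimes>\<^bsub>?U\<^esub> ?mo b (Suc N) | u r. u \<in> J \<and> r \<in> T0})"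
  have J0: "J 0 = {r \<otimes>\<^bsub>?U\<^esub> ?mo b 0 | r. r \<in> T0}"
    and JS: "J (Suc N) = {u \<oplus>\<^bsub>?U\<^esub> r \<otimes>\<^bsub>?U\<^esub> ?mo b (Suc N) | u r. u \<in> J N \<and> r \<in> T0}" for N
    by (simp_all add: J_def)
  have T0c: "T0 \<subseteq> carrier ?U" using subringE(1)[OF T0s] .
  have z0: "\<zero>\<^bsub>?U\<^esub> \<in> T0" "\<one>\<^bsub>?U\<^esub> \<in> T0" using subringE[OF T0s] by auto
  have mb: "?mo b n \<in> T0" "?mo b n \<in> carrier ?U" for n using mono[OF b, of n] bD by auto
  have Jid: "sideal ?U T0 (J N)" for N
  proof (induction N)
    case 0
    show ?case unfolding sideal_def J0
    proof (intro conjI ballI)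
      show "{r \<otimes>\<^bsub>?U\<^esub> ?mo b 0 | r. r \<in> T0} \<subseteq> T0" using subringE(6)[OF T0s] mb by blast
      show "\<zero>\<^bsub>?U\<^esub> \<in> {r \<otimes>\<^bsub>?U\<^esub> ?mo b 0 | r. r \<in> T0}"
        using z0 mb(2)[of 0] by (intro CollectI exI[of _ "\<zero>\<^bsub>?U\<^esub>"]) simp
    next
      fix x y assume "x \<in> {r \<otimes>\<^bsub>?U\<^esub> ?mo b 0 | r. r \<in> T0}" "y \<in> {r \<otimes>\<^bsub>?U\<^esub> ?mo b 0 | r. r \<in> T0}"
      then obtain r s where "r \<in> T0" "s \<in> T0" "x = r \<otimes>\<^bsub>?U\<^esub> ?mo b 0" "y = s \<otimes>\<^bsub>?U\<^esub> ?mo b 0" by blast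
      then show "x \<oplus>\<^bsub>?U\<^esub> y \<in> {r \<otimes>\<^bsub>?U\<^esub> ?mo b 0 | r. r \<in> T0}"
        using subringE(7)[OF T0s] T0c mb(2)[of 0]
        by (intro CollectI exI[of _ "r \<oplus>\<^bsub>?U\<^esub> s"]) (simp add: UR.l_distr subset_iff)
    next
      fix t x assume "t \<in> T0" "x \<in> {r \<otimes>\<^bsub>?U\<^esub> ?mo b 0 | r. r \<in> T0}"
      then obtain r where "t \<in> T0" "r \<in> T0" "x = r \<otimes>\<^bsub>?U\<^esub> ?mo b 0" by blast
      then show "t \<otimes>\<^bsub>?U\<^esub> x \<in> {r \<otimes>\<^bsub>?U\<^esub> ?mo b 0 | r. r \<in> T0}"
        using subringE(6)[OF T0s] T0c mb(2)[of 0]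
        by (intro CollectI exI[of _ "t \<otimes>\<^bsub>?U\<^esub> r"]) (simp add: UR.m_assoc subset_iff)
    qed
  next
    case (Suc N)
    then have IH: "J N \<subseteq> T0" "\<zero>\<^bsub>?U\<^esub> \<in> J N" "\<And>x y. x \<in> J N \<Longrightarrow> y \<in> J N \<Longrightarrow> x \<oplus>\<^bsub>?U\<^esub> y \<in> J N"
      "\<And>b x. b \<in> T0 \<Longrightarrow> x \<in> J N \<Longrightarrow> b \<otimes>\<^bsub>?U\<^esub> x \<in> J N" by (auto simp: sideal_def)
    note m = mb(2)[of "Suc N"]
    show ?case unfolding sideal_def
    proof (intro conjI ballI)
      show "J (Suc N) \<subseteq> T0" using IH(1) subringE(6,7)[OF T0s] mb(1) unfolding JS by blast
      show "\<zero>\<^bsub>?U\<^esub> \<in> J (Suc N)" unfolding JS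
        using z0 m IH(2) by (intro CollectI exI[of _ "\<zero>\<^bsub>?U\<^esub>"]) simp
    next
      fix x y assume "x \<in> J (Suc N)" "y \<in> J (Suc N)"
      then obtain r s u v where *: "r \<in> T0" "s \<in> T0" "u \<in> J N" "v \<in> J N"
        "x = u \<oplus>\<^bsub>?U\<^esub> r \<otimes>\<^bsub>?U\<^esub> ?mo b (Suc N)" "y = v \<oplus>\<^bsub>?U\<^esub> s \<otimes>\<^bsub>?U\<^esub> ?mo b (Suc N)" unfolding JS by blast
      then have c: "r \<in> carrier ?U" "s \<in> carrier ?U" "u \<in> carrier ?U" "v \<in> carrier ?U"
        using IH(1) T0c by auto
      have "x \<oplus>\<^bsub>?U\<^esub> y = (u \<oplus>\<^bsub>?U\<^esub> v) \<oplus>\<^bsub>?U\<^esub> (r \<oplus>\<^bsub>?U\<^esub> s) \<otimes>\<^bsub>?U\<^esub> ?mo b (Suc N)"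
        using c m *(5,6) by (simp add: UR.l_distr UR.a_ac)
      then show "x \<oplus>\<^bsub>?U\<^esub> y \<in> J (Suc N)" unfolding JS
        using IH(3)[OF *(3,4)] subringE(7)[OF T0s *(1,2)] by blast
    next
      fix t x assume t: "t \<in> T0" and "x \<in> J (Suc N)"
      then obtain r u where *: "r \<in> T0" "u \<in> J N" "x = u \<oplus>\<^bsub>?U\<^esub> r \<otimes>\<^bsub>?U\<^esub> ?mo b (Suc N)" unfolding JS by blast
      then have c: "r \<in> carrier ?U" "t \<in> carrier ?U" "u \<in> carrier ?U" using IH(1) T0c t by auto
      have "t \<otimes>\<^bsub>?U\<^esub> x = t \<otimes>\<^bsub>?U\<^esub> u \<oplus>\<^bsub>?U\<^esub> (t \<otimes>\<^bsub>?U\<^esub> r) \<otimes>\<^bsub>?U\<^esub> ?mo b (Suc N)"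
        using c m *(3) by (simp add: UR.r_distr UR.m_assoc)
      then show "t \<otimes>\<^bsub>?U\<^esub> x \<in> J (Suc N)" unfolding JS
        using IH(4)[OF t *(2)] subringE(6)[OF T0s t *(1)] by blast
    qed
  qed
  have JT: "J N \<subseteq> T0" for N using Jid[of N] by (simp add: sideal_def)
  have Jinc: "J N \<subseteq> J (Suc N)" for N
  proof
    fix u assume u: "u \<in> J N"
    then have "u \<in> carrier ?U" using JT T0c by blast
    then have "u = u \<oplus>\<^bsub>?U\<^esub> \<zero>\<^bsub>?U\<^esub> \<otimes>\<^bsub>?U\<^esub> ?mo b (Suc N)" using mb(2)[of "Suc N"] by simp
    then show "u \<in> J (Suc N)" unfolding JS using u z0(1) by blast
  qed
  have mJ: "?mo b (Suc N) \<in> J (Suc N)" for N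
  proof -
    have "?mo b (Suc N) = \<zero>\<^bsub>?U\<^esub> \<oplus>\<^bsub>?U\<^esub> \<one>\<^bsub>?U\<^esub> \<otimes>\<^bsub>?U\<^esub> ?mo b (Suc N)" using mb(2)[of "Suc N"] by simp
    moreover have "\<zero>\<^bsub>?U\<^esub> \<in> J N" using Jid[of N] by (simp add: sideal_def)
    ultimately show ?thesis unfolding JS using z0(2) by blast
  qed
  have cobm: "\<exists>\<mu> \<in> ipow D (set xs) B 1. ?co (r \<otimes>\<^bsub>?U\<^esub> ?mo b N) n = b \<otimes>\<^bsub>D\<^esub> \<mu>"
    if r: "r \<in> T0" and n: "n > N" for r n N
  proof -
    have rT: "r \<in> T" "r \<in> carrier ?U" using r \<open>T0 \<subseteq> T\<close> T0c by auto
    have "?co (?mo b N \<otimes>\<^bsub>?U\<^esub> r) n = b \<otimes>\<^bsub>D\<^esub> ?co r (n - N)"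
      using U.coeff_monom_mult[OF bD rT(2), where n = N and m = "n - N"] n by simp
    then have "?co (r \<otimes>\<^bsub>?U\<^esub> ?mo b N) n = b \<otimes>\<^bsub>D\<^esub> ?co r (n - N)"
      using UR.m_comm[OF rT(2) mb(2)[of N]] by simp
    moreover have "?co r (n - N) \<in> ipow D (set xs) B (n - N)" using rT by (simp add: T_def)
    then have "?co r (n - N) \<in> ipow D (set xs) B 1"
      by (rule subsetD[OF ipow_antimono[OF D.is_cring Bs xB], rotated]) (use n in simp)
    ultimately show ?thesis by blast
  qed
  have key: "u \<in> J N \<Longrightarrow> n > N \<Longrightarrow> \<exists>\<mu> \<in> ipow D (set xs) B 1. ?co u n = b \<otimes>\<^bsub>D\<^esub> \<mu>" for u n N
  proof (induction N arbitrary: u)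
    case 0
    then show ?case using cobm unfolding J0 by blast
  next
    case (Suc N)
    then obtain r v where *: "r \<in> T0" "v \<in> J N" "u = v \<oplus>\<^bsub>?U\<^esub> r \<otimes>\<^bsub>?U\<^esub> ?mo b (Suc N)" unfolding JS by blast
    obtain \<mu> where mu: "\<mu> \<in> ipow D (set xs) B 1" "?co v n = b \<otimes>\<^bsub>D\<^esub> \<mu>"
      using Suc.IH[OF *(2)] Suc.prems(2) by auto
    obtain \<nu> where nu: "\<nu> \<in> ipow D (set xs) B 1" "?co (r \<otimes>\<^bsub>?U\<^esub> ?mo b (Suc N)) n = b \<otimes>\<^bsub>D\<^esub> \<nu>"
      using cobm[OF *(1) Suc.prems(2)] by blast
    have c: "\<mu> \<in> carrier D" "\<nu> \<in> carrier D" using mu nu IB[of 1] BD by auto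
    have vU: "v \<in> carrier ?U" and rU: "r \<otimes>\<^bsub>?U\<^esub> ?mo b (Suc N) \<in> carrier ?U"
      using *(1,2) JT[of N] T0c mb(2)[of "Suc N"] by auto
    have "?co u n = b \<otimes>\<^bsub>D\<^esub> (\<mu> \<oplus>\<^bsub>D\<^esub> \<nu>)"
      unfolding *(3) U.coeff_add[OF vU rU] mu(2) nu(2) using c bD by (simp add: D.r_distr)
    moreover have "\<mu> \<oplus>\<^bsub>D\<^esub> \<nu> \<in> ipow D (set xs) B 1" using ideal[of 1] mu nu by (simp add: sideal_def)
    ultimately show ?case by blast
  qed
  have "acc ?U T0" unfolding T0_def
    by (rule acc_adjoins[OF UR.is_cring E's ws acc_subfield[OF UR.is_cring E'f]])
  then have "\<exists>N. \<forall>n \<ge> N. J n = J N"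
    unfolding acc_def using Jid Jinc by (elim allE[of _ J]) simp
  then obtain N where "\<forall>n \<ge> N. J n = J N" ..
  then have "J (Suc N) = J N" using le_SucI[OF order_refl] by blast
  then have "?mo b (Suc N) \<in> J N" using mJ by blast
  from key[OF this, of "Suc N"] obtain \<mu> where mu: "\<mu> \<in> ipow D (set xs) B 1" "b = b \<otimes>\<^bsub>D\<^esub> \<mu>"
    using U.coeff_monom[OF bD, of "Suc N" "Suc N"] by auto
  have muD: "\<mu> \<in> carrier D" using mu(1) IB[of 1] BD by blast
  have "\<mu> = \<one>\<^bsub>D\<^esub>" using D.m_lcancel[OF b0 bD muD, of "\<one>\<^bsub>D\<^esub>"] mu(2) bD by simp
  then show False using mu(1) proper by simp
qed

section \<open>Solutions with values in an algebraically closed field\<close>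

lemma (in cring) exists_primeideal_avoiding:
  assumes "C \<subseteq> carrier R" "\<one> \<in> C" "\<zero> \<notin> C" and mult: "\<And>x y. x \<in> C \<Longrightarrow> y \<in> C \<Longrightarrow> x \<otimes> y \<in> C"
  shows "\<exists>I. primeideal I R \<and> I \<inter> C = {}"
proof -
  let ?A = "{I. ideal I R \<and> I \<inter> C = {}}"
  have "\<exists>M \<in> ?A. \<forall>I \<in> ?A. M \<subseteq> I \<longrightarrow> I = M"
  proof (rule subset_Zorn)
    fix Ch assume Ch: "subset.chain ?A Ch"
    then have "subset.chain {I. ideal I R} Ch" by (auto simp: subset.chain_def)
    then have id: "ideal (if Ch = {} then {\<zero>} else \<Union>Ch) R" using chain_Union_is_ideal by blast
    show "\<exists>U \<in> ?A. \<forall>I \<in> Ch. I \<subseteq> U"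
    proof (cases "Ch = {}")
      case True
      then show ?thesis using zeroideal assms(3) by (intro bexI[of _ "{\<zero>}"]) auto
    next
      case False
      then have "\<Union>Ch \<in> ?A" using id Ch by (auto simp: subset.chain_def)
      then show ?thesis by (rule bexI[rotated]) auto
    qed
  qed
  then obtain M where MA: "M \<in> ?A" and max': "\<forall>I \<in> ?A. M \<subseteq> I \<longrightarrow> I = M" ..
  have M: "ideal M R" "M \<inter> C = {}" using MA by auto
  have max: "I = M" if "ideal I R" "I \<inter> C = {}" "M \<subseteq> I" for I
    using max' that by simp
  interpret M: ideal M R by fact
  have meet: "\<exists>m \<in> M. \<exists>r \<in> carrier R. m \<oplus> r \<otimes> a \<in> C" if a: "a \<in> carrier R" "a \<notin> M" for a
  proof -
    let ?I = "M <+>\<^bsub>R\<^esub> PIdl a"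
    have I: "ideal ?I R" using add_ideals[OF M(1) cgenideal_ideal[OF a(1)]] .
    have mem: "m \<oplus> r \<otimes> a \<in> ?I" if "m \<in> M" "r \<in> carrier R" for m r
    proof -
      have "r \<otimes> a \<in> PIdl a" unfolding cgenideal_def using that(2) by blast
      then show ?thesis unfolding set_add_def' using that(1) by blast
    qed
    have "M \<subseteq> ?I"
    proof
      fix m assume "m \<in> M"
      then show "m \<in> ?I" using mem[of m "\<zero>"] a(1) M.Icarr by simp
    qed
    moreover have "a \<in> ?I" using mem[of "\<zero>" "\<one>"] a(1) by simp
    ultimately have "?I \<inter> C \<noteq> {}" using max[OF I] a(2) by blast
    then obtain m u where "m \<in> M" "u \<in> PIdl a" "m \<oplus> u \<in> C" unfolding set_add_def' by blast
    then show ?thesis unfolding cgenideal_def by blast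
  qed
  have "primeideal M R"
  proof (rule primeidealI[OF M(1) is_cring])
    show "carrier R \<noteq> M" using M(2) assms(1,2) by blast
  next
    fix a b assume ab: "a \<in> carrier R" "b \<in> carrier R" "a \<otimes> b \<in> M"
    show "a \<in> M \<or> b \<in> M"
    proof (rule ccontr)
      assume "\<not> (a \<in> M \<or> b \<in> M)"
      then have nM: "a \<notin> M" "b \<notin> M" by auto
      obtain m r where 1: "m \<in> M" "r \<in> carrier R" "m \<oplus> r \<otimes> a \<in> C"
        using meet[OF ab(1) nM(1)] by auto
      obtain n s where 2: "n \<in> M" "s \<in> carrier R" "n \<oplus> s \<otimes> b \<in> C"
        using meet[OF ab(2) nM(2)] by auto
      note * = 1 2
      have c: "m \<in> carrier R" "n \<in> carrier R" using * M.Icarr by auto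
      have "(m \<oplus> r \<otimes> a) \<otimes> (n \<oplus> s \<otimes> b) = m \<otimes> (n \<oplus> s \<otimes> b) \<oplus> ((r \<otimes> a) \<otimes> n \<oplus> (r \<otimes> s) \<otimes> (a \<otimes> b))"
        using *(2,5) ab(1,2) c by (simp add: l_distr r_distr m_ac a_ac)
      also have "\<dots> \<in> M"
      proof (intro M.a_closed)
        show "m \<otimes> (n \<oplus> s \<otimes> b) \<in> M" using * ab c by (intro M.I_r_closed) auto
        show "(r \<otimes> a) \<otimes> n \<in> M" using * ab c by (intro M.I_l_closed) auto
        show "(r \<otimes> s) \<otimes> (a \<otimes> b) \<in> M" using * ab c by (simp add: M.I_l_closed)
      qed
      finally show False using mult[OF *(3,6)] M(2) by blast
    qed
  qed
  then show ?thesis using M(2) by blast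
qed

text \<open>
  The product of a sequence of rings.
\<close>

definition prod_ring :: "(nat \<Rightarrow> ('r, 'm) ring_scheme) \<Rightarrow> (nat \<Rightarrow> 'r) ring" where
  "prod_ring R = \<lparr>carrier = {f. \<forall>n. f n \<in> carrier (R n)},
     monoid.mult = (\<lambda>f g n. f n \<otimes>\<^bsub>R n\<^esub> g n), one = (\<lambda>n. \<one>\<^bsub>R n\<^esub>),
     ring.zero = (\<lambda>n. \<zero>\<^bsub>R n\<^esub>), ring.add = (\<lambda>f g n. f n \<oplus>\<^bsub>R n\<^esub> g n)\<rparr>"

lemma prod_ring_cring:
  assumes "\<And>n. cring (R n)" shows "cring (prod_ring R)"
proof (rule cringI)
  interpret R: cring "R n" for n by fact
  show "abelian_group (prod_ring R)"
  proof (rule abelian_groupI)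
    fix x assume "x \<in> carrier (prod_ring R)"
    then show "\<exists>y\<in>carrier (prod_ring R). y \<oplus>\<^bsub>prod_ring R\<^esub> x = \<zero>\<^bsub>prod_ring R\<^esub>"
      by (intro bexI[of _ "\<lambda>n. \<ominus>\<^bsub>R n\<^esub> x n"]) (auto simp: prod_ring_def R.l_neg)
  qed (auto simp: prod_ring_def R.a_ac)
  show "comm_monoid (prod_ring R)"
    by (rule comm_monoidI) (auto simp: prod_ring_def R.m_ac)
qed (use cring.cring_simprules(13)[OF assms] in \<open>auto simp: prod_ring_def\<close>)

lemma ring_hom_comp:
  assumes "f \<in> ring_hom R S" "g \<in> ring_hom S T" shows "(\<lambda>x. g (f x)) \<in> ring_hom R T"
  using ring_hom_trans[OF assms] by (simp add: comp_def)

lemma FactRing_zero: "\<zero>\<^bsub>R Quot I\<^esub> = I"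
  by (simp add: FactRing_def)

text \<open>
  A system of equations over \<open>B\<close> that has solutions \<open>a n\<close> in all the rings \<open>R n\<close> has a solution in the
  algebraically closed field \<open>K\<close>, if the maps from \<open>B\<close> to the \<open>R n\<close> are jointly injective. The solutions
  give one family \<open>z\<close> in the product ring, and \<open>B\<close> embeds into the product by \<open>\<beta>\<close>. A prime ideal
  that avoids the nonzero elements of the image of \<open>B\<close> makes the product a domain containing \<open>B\<close>, and the subring generated
  by \<open>B\<close> and the \<open>z i\<close> in this domain maps to \<open>K\<close> over \<open>B\<close>. No compatibility between the solutions in
  the different rings is needed.
  
  \<open>S\<close> is the subring generated by \<open>B\<close> and the \<open>z i\<close> in the product, \<open>p n\<close> are the projections, and \<open>g\<close> is the map to \<open>K\<close>.
\<close>

theorem combine_points: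
  fixes K :: "('k, 'm) ring_scheme" and R :: "nat \<Rightarrow> ('r, 'n) ring_scheme" and a :: "nat \<Rightarrow> 'i \<Rightarrow> 'r"
  assumes K: "algebraically_closed K" and B: "subring B K"
    and R: "\<And>n. cring (R n)" and \<rho>: "\<And>n. \<rho> n \<in> ring_hom (K\<lparr>carrier := B\<rparr>) (R n)"
    and inj: "\<And>b. b \<in> B \<Longrightarrow> (\<And>n. \<rho> n b = \<zero>\<^bsub>R n\<^esub>) \<Longrightarrow> b = \<zero>\<^bsub>K\<^esub>"
    and fin: "finite I" and a: "\<And>n i. i \<in> I \<Longrightarrow> a n i \<in> carrier (R n)"
  obtains S :: "(nat \<Rightarrow> 'r) ring" and p :: "nat \<Rightarrow> (nat \<Rightarrow> 'r) \<Rightarrow> 'r" and z \<beta> g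
  where "cring S" "\<And>n. p n \<in> ring_hom S (R n)"
    "\<And>x y. x \<in> carrier S \<Longrightarrow> y \<in> carrier S \<Longrightarrow> (\<And>n. p n x = p n y) \<Longrightarrow> x = y"
    "\<And>i. i \<in> I \<Longrightarrow> z i \<in> carrier S" "\<And>n i. p n (z i) = a n i"
    "\<beta> \<in> ring_hom (K\<lparr>carrier := B\<rparr>) S" "\<And>n b. p n (\<beta> b) = \<rho> n b"
    "g \<in> ring_hom S K" "\<And>b. b \<in> B \<Longrightarrow> g (\<beta> b) = b"
proof -
  interpret K: algebraically_closed K by fact
  interpret R: cring "R n" for n by fact
  let ?Q = "prod_ring R"
  let ?KB = "K\<lparr>carrier := B\<rparr>"
  interpret Q: cring ?Q using prod_ring_cring[OF R] .
  interpret KB: cring ?KB using cring_subring[OF K.is_cring B] .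
  have KBc: "carrier ?KB = B" by simp
  define \<beta> where "\<beta> = (\<lambda>b n. \<rho> n b)"
  define z where "z = (\<lambda>i n. a n i)"
  define p :: "nat \<Rightarrow> (nat \<Rightarrow> 'r) \<Rightarrow> 'r" where "p = (\<lambda>n f. f n)"
  have \<beta>: "\<beta> \<in> ring_hom ?KB ?Q"
    by (rule ring_hom_memI)
       (simp_all add: \<beta>_def prod_ring_def fun_eq_iff ring_hom_closed[OF \<rho>, simplified]
          ring_hom_mult[OF \<rho>, simplified] ring_hom_add[OF \<rho>, simplified] ring_hom_one[OF \<rho>, simplified])
  have zQ: "z i \<in> carrier ?Q" if "i \<in> I" for i using a that by (auto simp: z_def prod_ring_def)
  have \<beta>0: "b = \<zero>\<^bsub>K\<^esub>" if "b \<in> B" "\<beta> b = \<zero>\<^bsub>?Q\<^esub>" for b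
    using inj[OF that(1)] that(2) by (auto simp: \<beta>_def prod_ring_def fun_eq_iff)
  have \<beta>1: "\<beta> \<one>\<^bsub>K\<^esub> = \<one>\<^bsub>?Q\<^esub>" using ring_hom_one[OF \<beta>] by simp
  have BK: "B \<subseteq> carrier K" using subringE(1)[OF B] .
  define C where "C = \<beta> ` (B - {\<zero>\<^bsub>K\<^esub>})"
  have CI: "\<beta> b \<in> C" if "b \<in> B" "b \<noteq> \<zero>\<^bsub>K\<^esub>" for b using that by (simp add: C_def)
  have "\<exists>M. primeideal M ?Q \<and> M \<inter> C = {}"
  proof (rule Q.exists_primeideal_avoiding)
    show "C \<subseteq> carrier ?Q" using ring_hom_closed[OF \<beta>] by (auto simp: C_def)
    show "\<one>\<^bsub>?Q\<^esub> \<in> C" using \<beta>1 subringE(3)[OF B] K.zero_not_one unfolding C_def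
      by (intro image_eqI[of _ _ "\<one>\<^bsub>K\<^esub>"]) auto
    show "\<zero>\<^bsub>?Q\<^esub> \<notin> C"
    proof
      assume "\<zero>\<^bsub>?Q\<^esub> \<in> C"
      then obtain b where "b \<in> B" "b \<noteq> \<zero>\<^bsub>K\<^esub>" "\<beta> b = \<zero>\<^bsub>?Q\<^esub>"
        unfolding C_def by (metis DiffD1 DiffD2 image_iff insertI1)
      then show False using \<beta>0 by blast
    qed
    fix x y assume "x \<in> C" "y \<in> C"
    then obtain b c where bc: "b \<in> B" "b \<noteq> \<zero>\<^bsub>K\<^esub>" "c \<in> B" "c \<noteq> \<zero>\<^bsub>K\<^esub>" "x = \<beta> b" "y = \<beta> c"
      by (auto simp: C_def)
    have "x \<otimes>\<^bsub>?Q\<^esub> y = \<beta> (b \<otimes>\<^bsub>K\<^esub> c)" using ring_hom_mult[OF \<beta>, of b c] bc by simp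
    moreover have "b \<otimes>\<^bsub>K\<^esub> c \<in> B - {\<zero>\<^bsub>K\<^esub>}"
      using bc BK subringE(6)[OF B] by (auto simp: K.integral_iff subset_iff)
    ultimately show "x \<otimes>\<^bsub>?Q\<^esub> y \<in> C" by (auto simp: C_def)
  qed
  then obtain M where M: "primeideal M ?Q" "M \<inter> C = {}" by blast
  interpret M: primeideal M ?Q by fact
  let ?D = "?Q Quot M"
  let ?\<pi> = "(+>\<^bsub>?Q\<^esub>) M"
  interpret D: "domain" ?D using M.quotient_is_domain .
  have \<pi>: "?\<pi> \<in> ring_hom ?Q ?D" using M.rcos_ring_hom .
  interpret \<pi>: ring_hom_ring ?Q ?D ?\<pi> by unfold_locales (rule \<pi>)
  define f where "f = (\<lambda>b. ?\<pi> (\<beta> b))"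
  have f: "f \<in> ring_hom ?KB ?D" unfolding f_def using ring_hom_comp[OF \<beta> \<pi>] .
  interpret f: ring_hom_ring ?KB ?D f by unfold_locales (rule f)
  have f0: "b = \<zero>\<^bsub>K\<^esub>" if b: "b \<in> B" "f b = \<zero>\<^bsub>?D\<^esub>" for b
  proof -
    have bQ: "\<beta> b \<in> carrier ?Q" using ring_hom_closed[OF \<beta>, of b] b(1) by (simp only: KBc)
    have "M +>\<^bsub>?Q\<^esub> \<beta> b = M" using b(2)[unfolded f_def] by (simp only: FactRing_zero)
    then have "\<beta> b \<in> M" by (rule M.rcos_const_imp_mem[OF bQ])
    then have "\<beta> b \<notin> C" using M(2) by (simp add: disjoint_iff)
    then show ?thesis using CI[OF b(1)] by blast
  qed
  let ?B' = "f ` B"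
  have B': "subring ?B' ?D" using f.img_is_subring[OF KB.carrier_is_subring] by simp
  obtain "is" where "is": "set is = I" using finite_list[OF fin] by blast
  define zs where "zs = map z is"
  define zs' where "zs' = map ?\<pi> zs"
  have zsQ: "set zs \<subseteq> carrier ?Q" using zQ "is" by (auto simp: zs_def)
  have zsD: "set zs' \<subseteq> carrier ?D" using zsQ \<pi>.hom_closed by (auto simp: zs'_def)
  have subA: "subring (adjoins ?D ?B' zs') ?D" using adjoins_subring[OF D.is_cring B' zsD] .
  have "\<one>\<^bsub>?D\<^esub> \<in> adjoins ?D ?B' zs'" using subringE(3)[OF subA] .
  from extend_hom[OF D.domain_axioms B' zsD this D.one_not_zero, where 'l = 'k and 'n = 'm]
  obtain b' where b': "b' \<in> ?B'" "b' \<noteq> \<zero>\<^bsub>?D\<^esub>"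
    and ext: "\<forall>(L :: ('k, 'm) ring_scheme) h. algebraically_closed L \<longrightarrow>
      h \<in> ring_hom (?D\<lparr>carrier := ?B'\<rparr>) L \<longrightarrow> h b' \<noteq> \<zero>\<^bsub>L\<^esub> \<longrightarrow>
      (\<exists>h' \<in> ring_hom (?D\<lparr>carrier := adjoins ?D ?B' zs'\<rparr>) L.
        (\<forall>x \<in> ?B'. h' x = h x) \<and> h' \<one>\<^bsub>?D\<^esub> \<noteq> \<zero>\<^bsub>L\<^esub>)"
    by (elim bexE conjE) (rule that)
  have "\<exists>h \<in> ring_hom (?D\<lparr>carrier := f ` carrier ?KB\<rparr>) K. \<forall>b \<in> carrier ?KB. h (f b) = id b"
    by (rule ring_hom_factor[OF KB.ring_axioms D.ring_axioms K.ring_axioms f id_subring_hom[OF B]])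
       (use f0 in auto)
  then obtain h where h: "h \<in> ring_hom (?D\<lparr>carrier := ?B'\<rparr>) K" "\<And>b. b \<in> B \<Longrightarrow> h (f b) = b" by auto
  have "h b' \<noteq> \<zero>\<^bsub>K\<^esub>" using b' h(2) f.hom_zero by auto
  from ext[rule_format, OF K h(1) this]
  obtain h' where h'0: "h' \<in> ring_hom (?D\<lparr>carrier := adjoins ?D ?B' zs'\<rparr>) K"
    "\<forall>x \<in> ?B'. h' x = h x" by (elim bexE conjE) (rule that)
  note h' = h'0(1) h'0(2)[rule_format]
  define SS where "SS = adjoins ?Q (\<beta> ` B) zs"
  interpret \<beta>: ring_hom_ring ?KB ?Q \<beta> by unfold_locales (rule \<beta>)
  have \<beta>B: "subring (\<beta> ` B) ?Q" using \<beta>.img_is_subring[OF KB.carrier_is_subring] by simp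
  have SS: "subring SS ?Q" unfolding SS_def using adjoins_subring[OF Q.is_cring \<beta>B zsQ] .
  have SSQ: "SS \<subseteq> carrier ?Q" using subringE(1)[OF SS] .
  have SSi: "\<beta> ` B \<subseteq> SS" "set zs \<subseteq> SS" unfolding SS_def using adjoins_incl[OF Q.is_cring \<beta>B zsQ] by auto
  let ?H = "{q \<in> carrier ?Q. ?\<pi> q \<in> adjoins ?D ?B' zs'}"
  have H: "subring ?H ?Q"
  proof (rule Q.subringI)
    show "\<one>\<^bsub>?Q\<^esub> \<in> ?H" using subringE(3)[OF subA] by simp
  next
    fix x assume "x \<in> ?H"
    then show "\<ominus>\<^bsub>?Q\<^esub> x \<in> ?H" using subringE(5)[OF subA, of "?\<pi> x"] by simp
  next
    fix x y assume "x \<in> ?H" "y \<in> ?H"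
    then show "x \<otimes>\<^bsub>?Q\<^esub> y \<in> ?H" "x \<oplus>\<^bsub>?Q\<^esub> y \<in> ?H"
      using subringE(6,7)[OF subA, of "?\<pi> x" "?\<pi> y"] by simp_all
  qed auto
  have AI: "?B' \<subseteq> adjoins ?D ?B' zs'" "set zs' \<subseteq> adjoins ?D ?B' zs'"
    using adjoins_incl[OF D.is_cring B' zsD] by auto
  have "SS \<subseteq> ?H" unfolding SS_def
  proof (rule adjoins_minimal[OF Q.is_cring \<beta>B zsQ H])
    have "\<beta> b \<in> ?H" if "b \<in> B" for b
      using AI(1) that ring_hom_closed[OF \<beta>] by (auto simp: f_def)
    moreover have "x \<in> ?H" if "x \<in> set zs" for x
      using AI(2) that zsQ by (auto simp: zs'_def)
    ultimately show "\<beta> ` B \<union> set zs \<subseteq> ?H" by blast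
  qed
  then have \<pi>S: "?\<pi> \<in> ring_hom (?Q\<lparr>carrier := SS\<rparr>) (?D\<lparr>carrier := adjoins ?D ?B' zs'\<rparr>)"
    using SSQ by (intro ring_hom_memI) (auto simp: subset_iff)
  define g where "g = (\<lambda>x. h' (?\<pi> x))"
  have g: "g \<in> ring_hom (?Q\<lparr>carrier := SS\<rparr>) K"
    unfolding g_def using ring_hom_comp[OF \<pi>S h'(1)] .
  show ?thesis
  proof (rule that[of "?Q\<lparr>carrier := SS\<rparr>" p z \<beta> g])
    show "cring (?Q\<lparr>carrier := SS\<rparr>)" using cring_subring[OF Q.is_cring SS] .
    show "p n \<in> ring_hom (?Q\<lparr>carrier := SS\<rparr>) (R n)" for n
      using SSQ by (intro ring_hom_memI) (auto simp: p_def prod_ring_def)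
    show "x = y" if "x \<in> carrier (?Q\<lparr>carrier := SS\<rparr>)" "y \<in> carrier (?Q\<lparr>carrier := SS\<rparr>)"
      "\<And>n. p n x = p n y" for x y using that(3) by (auto simp: p_def)
    show "z i \<in> carrier (?Q\<lparr>carrier := SS\<rparr>)" if "i \<in> I" for i
      using SSi(2) "is" that by (auto simp: zs_def)
    show "p n (z i) = a n i" for n i by (simp add: p_def z_def)
    show "\<beta> \<in> ring_hom ?KB (?Q\<lparr>carrier := SS\<rparr>)"
      using SSi(1) by (intro ring_hom_memI) (auto simp: \<beta>1 ring_hom_mult[OF \<beta>, simplified] ring_hom_add[OF \<beta>, simplified])
    show "p n (\<beta> b) = \<rho> n b" for n b by (simp add: p_def \<beta>_def)
    show "g \<in> ring_hom (?Q\<lparr>carrier := SS\<rparr>) K" by (rule g)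
    show "g (\<beta> b) = b" if "b \<in> B" for b
      using h'(2)[of "f b"] h(2)[OF that] that by (simp add: g_def f_def)
  qed
qed

section \<open>Algebras with a basis\<close>

text \<open>
  A nonassociative algebra \<open>V\<close> over a commutative ring \<open>R\<close>, free of rank \<open>n\<close> as a module: \<open>b\<close> is a basis,
  \<open>\<kappa> v i\<close> is the coordinate of \<open>v\<close> at \<open>b i\<close>, and \<open>c i j k\<close> is the coordinate of \<open>b i b j\<close> at \<open>b k\<close>. All three
  families matter only for indices below \<open>n\<close>.
\<close>

locale based_alg = nonassoc_algebra R V for R (structure) and V (structure) +
  fixes n :: nat and b :: "nat \<Rightarrow> 'c" and c :: "nat \<Rightarrow> nat \<Rightarrow> nat \<Rightarrow> 'a" and \<kappa> :: "'c \<Rightarrow> nat \<Rightarrow> 'a"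
  assumes b_closed: "i < n \<Longrightarrow> b i \<in> carrier V"
    and c_closed: "i < n \<Longrightarrow> j < n \<Longrightarrow> k < n \<Longrightarrow> c i j k \<in> carrier R"
    and coord_closed: "v \<in> carrier V \<Longrightarrow> i < n \<Longrightarrow> \<kappa> v i \<in> carrier R"
    and coord_add: "v \<in> carrier V \<Longrightarrow> w \<in> carrier V \<Longrightarrow> i < n \<Longrightarrow> \<kappa> (v \<oplus>\<^bsub>V\<^esub> w) i = \<kappa> v i \<oplus> \<kappa> w i"
    and coord_smult: "r \<in> carrier R \<Longrightarrow> v \<in> carrier V \<Longrightarrow> i < n \<Longrightarrow> \<kappa> (r \<odot>\<^bsub>V\<^esub> v) i = r \<otimes> \<kappa> v i"
    and coord_basis: "i < n \<Longrightarrow> j < n \<Longrightarrow> \<kappa> (b j) i = (if i = j then \<one> else \<zero>)"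
    and coord_inj: "v \<in> carrier V \<Longrightarrow> w \<in> carrier V \<Longrightarrow> (\<And>i. i < n \<Longrightarrow> \<kappa> v i = \<kappa> w i) \<Longrightarrow> v = w"
    and coord_mult: "v \<in> carrier V \<Longrightarrow> w \<in> carrier V \<Longrightarrow> k < n \<Longrightarrow>
      \<kappa> (v \<otimes>\<^bsub>V\<^esub> w) k = (\<Oplus>i\<in>{..<n}. \<Oplus>j\<in>{..<n}. \<kappa> v i \<otimes> \<kappa> w j \<otimes> c i j k)"

text \<open>
  The algebra axioms follow from the rules for coordinates, because elements with equal coordinates are equal.
\<close>

lemma based_algI:
  fixes R (structure) and V (structure)
  assumes R: "cring R"
    and clo: "\<zero>\<^bsub>V\<^esub> \<in> carrier V" "\<And>v w. v \<in> carrier V \<Longrightarrow> w \<in> carrier V \<Longrightarrow> v \<oplus>\<^bsub>V\<^esub> w \<in> carrier V"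
      "\<And>v w. v \<in> carrier V \<Longrightarrow> w \<in> carrier V \<Longrightarrow> v \<otimes>\<^bsub>V\<^esub> w \<in> carrier V"
      "\<And>r v. r \<in> carrier R \<Longrightarrow> v \<in> carrier V \<Longrightarrow> r \<odot>\<^bsub>V\<^esub> v \<in> carrier V"
    and b_closed: "\<And>i. i < n \<Longrightarrow> b i \<in> carrier V"
    and c_closed: "\<And>i j k. i < n \<Longrightarrow> j < n \<Longrightarrow> k < n \<Longrightarrow> c i j k \<in> carrier R"
    and coord_closed: "\<And>v i. v \<in> carrier V \<Longrightarrow> i < n \<Longrightarrow> \<kappa> v i \<in> carrier R"
    and coord_zero: "\<And>i. i < n \<Longrightarrow> \<kappa> \<zero>\<^bsub>V\<^esub> i = \<zero>"
    and coord_add: "\<And>v w i. v \<in> carrier V \<Longrightarrow> w \<in> carrier V \<Longrightarrow> i < n \<Longrightarrow> \<kappa> (v \<oplus>\<^bsub>V\<^esub> w) i = \<kappa> v i \<oplus> \<kappa> w i"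
    and coord_smult: "\<And>r v i. r \<in> carrier R \<Longrightarrow> v \<in> carrier V \<Longrightarrow> i < n \<Longrightarrow> \<kappa> (r \<odot>\<^bsub>V\<^esub> v) i = r \<otimes> \<kappa> v i"
    and coord_basis: "\<And>i j. i < n \<Longrightarrow> j < n \<Longrightarrow> \<kappa> (b j) i = (if i = j then \<one> else \<zero>)"
    and coord_inj: "\<And>v w. v \<in> carrier V \<Longrightarrow> w \<in> carrier V \<Longrightarrow> (\<And>i. i < n \<Longrightarrow> \<kappa> v i = \<kappa> w i) \<Longrightarrow> v = w"
    and coord_mult: "\<And>v w k. v \<in> carrier V \<Longrightarrow> w \<in> carrier V \<Longrightarrow> k < n \<Longrightarrow>
      \<kappa> (v \<otimes>\<^bsub>V\<^esub> w) k = (\<Oplus>i\<in>{..<n}. \<Oplus>j\<in>{..<n}. \<kappa> v i \<otimes> \<kappa> w j \<otimes> c i j k)"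
  shows "based_alg R V n b c \<kappa>"
proof -
  interpret cring R by fact
  have ab: "abelian_group V"
  proof (rule abelian_groupI)
    fix x assume x: "x \<in> carrier V"
    have "\<ominus> \<one> \<odot>\<^bsub>V\<^esub> x \<oplus>\<^bsub>V\<^esub> x = \<zero>\<^bsub>V\<^esub>"
      by (rule coord_inj) (use x in \<open>simp_all add: clo coord_add coord_smult coord_zero coord_closed l_minus l_neg\<close>)
    then show "\<exists>y\<in>carrier V. y \<oplus>\<^bsub>V\<^esub> x = \<zero>\<^bsub>V\<^esub>" using clo(4)[OF _ x, of "\<ominus> \<one>"] by auto
  next
    fix x y z assume x: "x \<in> carrier V" "y \<in> carrier V" "z \<in> carrier V"
    show "x \<oplus>\<^bsub>V\<^esub> y \<oplus>\<^bsub>V\<^esub> z = x \<oplus>\<^bsub>V\<^esub> (y \<oplus>\<^bsub>V\<^esub> z)"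
      by (rule coord_inj) (use x in \<open>simp_all add: clo coord_add coord_closed a_assoc\<close>)
  next
    fix x y assume x: "x \<in> carrier V" "y \<in> carrier V"
    show "x \<oplus>\<^bsub>V\<^esub> y = y \<oplus>\<^bsub>V\<^esub> x"
      by (rule coord_inj) (use x in \<open>simp_all add: clo coord_add coord_closed a_comm\<close>)
  next
    fix x assume x: "x \<in> carrier V"
    show "\<zero>\<^bsub>V\<^esub> \<oplus>\<^bsub>V\<^esub> x = x"
      by (rule coord_inj) (use x in \<open>simp_all add: clo coord_add coord_zero coord_closed\<close>)
  qed (use clo in auto)
  have "module R V"
  proof (rule moduleI[OF R ab])
    fix x y v assume x: "x \<in> carrier R" "y \<in> carrier R" "v \<in> carrier V"
    show "(x \<oplus> y) \<odot>\<^bsub>V\<^esub> v = x \<odot>\<^bsub>V\<^esub> v \<oplus>\<^bsub>V\<^esub> y \<odot>\<^bsub>V\<^esub> v"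
      by (rule coord_inj) (use x in \<open>simp_all add: clo coord_add coord_smult coord_closed l_distr\<close>)
    show "(x \<otimes> y) \<odot>\<^bsub>V\<^esub> v = x \<odot>\<^bsub>V\<^esub> (y \<odot>\<^bsub>V\<^esub> v)"
      by (rule coord_inj) (use x in \<open>simp_all add: clo coord_add coord_smult coord_closed m_assoc\<close>)
  next
    fix x v w assume x: "x \<in> carrier R" "v \<in> carrier V" "w \<in> carrier V"
    show "x \<odot>\<^bsub>V\<^esub> (v \<oplus>\<^bsub>V\<^esub> w) = x \<odot>\<^bsub>V\<^esub> v \<oplus>\<^bsub>V\<^esub> x \<odot>\<^bsub>V\<^esub> w"
      by (rule coord_inj) (use x in \<open>simp_all add: clo coord_add coord_smult coord_closed r_distr\<close>)
  next
    fix v assume x: "v \<in> carrier V"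
    show "\<one> \<odot>\<^bsub>V\<^esub> v = v"
      by (rule coord_inj) (use x in \<open>simp_all add: clo coord_add coord_smult coord_closed\<close>)
  qed (use clo in auto)
  moreover have "nonassoc_algebra_axioms R V"
  proof
    fix x y z assume x: "x \<in> carrier V" "y \<in> carrier V" "z \<in> carrier V"
    show "(x \<oplus>\<^bsub>V\<^esub> y) \<otimes>\<^bsub>V\<^esub> z = x \<otimes>\<^bsub>V\<^esub> z \<oplus>\<^bsub>V\<^esub> y \<otimes>\<^bsub>V\<^esub> z"
    proof (rule coord_inj)
      fix k assume k: "k < n"
      have "\<kappa> ((x \<oplus>\<^bsub>V\<^esub> y) \<otimes>\<^bsub>V\<^esub> z) k = (\<Oplus>i\<in>{..<n}. \<Oplus>j\<in>{..<n}. \<kappa> x i \<otimes> \<kappa> z j \<otimes> c i j k \<oplus> \<kappa> y i \<otimes> \<kappa> z j \<otimes> c i j k)"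
        using x k by (simp add: coord_mult clo coord_add coord_closed c_closed l_distr Pi_def cong: finsum_cong)
      also have "\<dots> = (\<Oplus>i\<in>{..<n}. (\<Oplus>j\<in>{..<n}. \<kappa> x i \<otimes> \<kappa> z j \<otimes> c i j k) \<oplus> (\<Oplus>j\<in>{..<n}. \<kappa> y i \<otimes> \<kappa> z j \<otimes> c i j k))"
        using x k by (intro finsum_cong' finsum_addf) (simp_all add: coord_closed c_closed Pi_def)
      also have "\<dots> = \<kappa> (x \<otimes>\<^bsub>V\<^esub> z \<oplus>\<^bsub>V\<^esub> y \<otimes>\<^bsub>V\<^esub> z) k"
        using x k by (simp add: coord_mult clo coord_add coord_closed c_closed finsum_addf Pi_def)
      finally show "\<kappa> ((x \<oplus>\<^bsub>V\<^esub> y) \<otimes>\<^bsub>V\<^esub> z) k = \<kappa> (x \<otimes>\<^bsub>V\<^esub> z \<oplus>\<^bsub>V\<^esub> y \<otimes>\<^bsub>V\<^esub> z) k" .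
    qed (use x clo in auto)
    show "z \<otimes>\<^bsub>V\<^esub> (x \<oplus>\<^bsub>V\<^esub> y) = z \<otimes>\<^bsub>V\<^esub> x \<oplus>\<^bsub>V\<^esub> z \<otimes>\<^bsub>V\<^esub> y"
    proof (rule coord_inj)
      fix k assume k: "k < n"
      have "\<kappa> (z \<otimes>\<^bsub>V\<^esub> (x \<oplus>\<^bsub>V\<^esub> y)) k = (\<Oplus>i\<in>{..<n}. \<Oplus>j\<in>{..<n}. \<kappa> z i \<otimes> \<kappa> x j \<otimes> c i j k \<oplus> \<kappa> z i \<otimes> \<kappa> y j \<otimes> c i j k)"
        using x k by (simp add: coord_mult clo coord_add coord_closed c_closed l_distr r_distr Pi_def cong: finsum_cong)
      also have "\<dots> = (\<Oplus>i\<in>{..<n}. (\<Oplus>j\<in>{..<n}. \<kappa> z i \<otimes> \<kappa> x j \<otimes> c i j k) \<oplus> (\<Oplus>j\<in>{..<n}. \<kappa> z i \<otimes> \<kappa> y j \<otimes> c i j k))"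
        using x k by (intro finsum_cong' finsum_addf) (simp_all add: coord_closed c_closed Pi_def)
      also have "\<dots> = \<kappa> (z \<otimes>\<^bsub>V\<^esub> x \<oplus>\<^bsub>V\<^esub> z \<otimes>\<^bsub>V\<^esub> y) k"
        using x k by (simp add: coord_mult clo coord_add coord_closed c_closed finsum_addf Pi_def)
      finally show "\<kappa> (z \<otimes>\<^bsub>V\<^esub> (x \<oplus>\<^bsub>V\<^esub> y)) k = \<kappa> (z \<otimes>\<^bsub>V\<^esub> x \<oplus>\<^bsub>V\<^esub> z \<otimes>\<^bsub>V\<^esub> y) k" .
    qed (use x clo in auto)
  next
    fix r x y assume x: "r \<in> carrier R" "x \<in> carrier V" "y \<in> carrier V"
    show "(r \<odot>\<^bsub>V\<^esub> x) \<otimes>\<^bsub>V\<^esub> y = r \<odot>\<^bsub>V\<^esub> (x \<otimes>\<^bsub>V\<^esub> y)"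
      by (rule coord_inj)
        (use x in \<open>simp_all add: coord_mult clo coord_smult coord_closed c_closed finsum_rdistr m_assoc Pi_def cong: finsum_cong\<close>)
    show "x \<otimes>\<^bsub>V\<^esub> (r \<odot>\<^bsub>V\<^esub> y) = r \<odot>\<^bsub>V\<^esub> (x \<otimes>\<^bsub>V\<^esub> y)"
      by (rule coord_inj)
        (use x in \<open>simp_all add: coord_mult clo coord_smult coord_closed c_closed finsum_rdistr m_ac Pi_def cong: finsum_cong\<close>)
  qed (use clo in auto)
  ultimately show ?thesis
    unfolding based_alg_def nonassoc_algebra_def based_alg_axioms_def
    using assms by blast
qed

context based_alg
begin

lemma finsum_basis_closed:
  "(\<And>i. i < m \<Longrightarrow> f i \<in> carrier R) \<Longrightarrow> m \<le> n \<Longrightarrow> (\<Oplus>\<^bsub>V\<^esub>i\<in>{..<m}. f i \<odot>\<^bsub>V\<^esub> b i) \<in> carrier V"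
  using b_closed by (intro M.finsum_closed) auto

lemma coord_zero: "i < n \<Longrightarrow> \<kappa> \<zero>\<^bsub>V\<^esub> i = \<zero>"
  using coord_smult[of "\<zero>" "\<zero>\<^bsub>V\<^esub>" i] coord_closed[of "\<zero>\<^bsub>V\<^esub>" i] by (simp add: smult_l_null)

lemma coord_finsum:
  assumes "f \<in> J \<rightarrow> carrier V" "i < n"
  shows "\<kappa> (\<Oplus>\<^bsub>V\<^esub>j\<in>J. f j) i = (\<Oplus>j\<in>J. \<kappa> (f j) i)"
  using assms(1)
proof (induction J rule: infinite_finite_induct)
  case (insert x F)
  then have "f x \<in> carrier V" "f \<in> F \<rightarrow> carrier V" "(\<lambda>j. \<kappa> (f j) i) \<in> F \<rightarrow> carrier R"
    using coord_closed[OF _ assms(2)] by auto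
  with insert show ?case using coord_closed[OF _ assms(2)] assms(2) by (simp add: coord_add)
qed (use assms coord_zero in auto)

lemma coord_basis_sum:
  assumes "\<And>j. j < n \<Longrightarrow> f j \<in> carrier R" "i < n"
  shows "\<kappa> (\<Oplus>\<^bsub>V\<^esub>j\<in>{..<n}. f j \<odot>\<^bsub>V\<^esub> b j) i = f i"
proof -
  have "\<kappa> (\<Oplus>\<^bsub>V\<^esub>j\<in>{..<n}. f j \<odot>\<^bsub>V\<^esub> b j) i = (\<Oplus>j\<in>{..<n}. if i = j then f j else \<zero>)"
    using assms b_closed
    by (simp add: coord_finsum Pi_def) (rule R.finsum_cong', auto simp: coord_smult coord_basis)
  also have "\<dots> = f i" using assms by (intro R.finsum_singleton) auto
  finally show ?thesis .
qed

lemma expand: "v \<in> carrier V \<Longrightarrow> v = (\<Oplus>\<^bsub>V\<^esub>j\<in>{..<n}. \<kappa> v j \<odot>\<^bsub>V\<^esub> b j)"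
  by (rule coord_inj) (use coord_closed coord_basis_sum finsum_basis_closed in auto)

end

section \<open>Extension of scalars in coordinates\<close>

text \<open>
  \<open>A\<close> is a free algebra over \<open>F\<close> and \<open>R\<close> is a commutative \<open>F\<close>-algebra. The aim is a basis of \<open>A \<otimes> R\<close> over \<open>R\<close>.
\<close>

locale scalar_ext = based_alg F A n b c \<kappa> + RR: algebra F R
  for F :: "('f, 'm) ring_scheme" (structure) and A :: "('f, 'a, 'n) module_scheme" (structure)
    and n b c \<kappa> and R :: "('f, 'r, 'p) module_scheme"
begin

definition emb :: "'f \<Rightarrow> 'r" where "emb x = x \<odot>\<^bsub>R\<^esub> \<one>\<^bsub>R\<^esub>"

lemma emb_closed: "x \<in> carrier F \<Longrightarrow> emb x \<in> carrier R"
  by (simp add: emb_def)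

lemma smult_emb: "x \<in> carrier F \<Longrightarrow> r \<in> carrier R \<Longrightarrow> x \<odot>\<^bsub>R\<^esub> r = emb x \<otimes>\<^bsub>R\<^esub> r"
  using RR.smult_assoc2[of x "\<one>\<^bsub>R\<^esub>" r] by (simp add: emb_def)

lemma emb_hom: "emb \<in> ring_hom F R"
proof (rule ring_hom_memI)
  fix x y assume "x \<in> carrier F" "y \<in> carrier F"
  then show "emb (x \<otimes> y) = emb x \<otimes>\<^bsub>R\<^esub> emb y"
    using smult_emb[of x "emb y"] by (simp add: emb_def RR.smult_assoc1)
qed (simp_all add: emb_def RR.smult_l_distr)

abbreviation "S \<equiv> carrier A \<times> carrier R"
abbreviation "Fr \<equiv> tensor_free A R"
abbreviation "Nul \<equiv> tensor_null F A R"
abbreviation "T \<equiv> extend_scalars F A R"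

lemma Fr_carrier: "u \<in> carrier Fr \<longleftrightarrow> Poly_Mapping.keys u \<subseteq> S"
  by (simp add: tensor_free_def)

text \<open>
  The \<open>i\<close>th coordinate on the free abelian group on \<open>A \<times> R\<close>: the additive map with value \<open>\<kappa> a i r\<close> at \<open>(a, r)\<close>.
\<close>

definition kf :: "nat \<Rightarrow> ('a \<times> 'r \<Rightarrow>\<^sub>0 int) \<Rightarrow> 'r" where
  "kf i = (SOME h. h \<in> hom Fr (add_monoid R) \<and> (\<forall>a \<in> carrier A. \<forall>r \<in> carrier R. h (frag_of (a, r)) = \<kappa> a i \<odot>\<^bsub>R\<^esub> r))"

lemma kf:
  assumes "i < n"
  shows "kf i \<in> hom Fr (add_monoid R)"
    "a \<in> carrier A \<Longrightarrow> r \<in> carrier R \<Longrightarrow> kf i (frag_of (a, r)) = \<kappa> a i \<odot>\<^bsub>R\<^esub> r"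
proof -
  have "(\<lambda>(a, r). \<kappa> a i \<odot>\<^bsub>R\<^esub> r) ` S \<subseteq> carrier (add_monoid R)"
    using coord_closed[OF _ assms] by auto
  then obtain h where "h \<in> hom (free_Abelian_group S) (add_monoid R)"
    "\<And>x. x \<in> S \<Longrightarrow> h (frag_of x) = (\<lambda>(a, r). \<kappa> a i \<odot>\<^bsub>R\<^esub> r) x"
    using comm_group.free_Abelian_group_universal[OF RR.a_comm_group] by metis
  then have "\<exists>h. h \<in> hom Fr (add_monoid R) \<and> (\<forall>a \<in> carrier A. \<forall>r \<in> carrier R. h (frag_of (a, r)) = \<kappa> a i \<odot>\<^bsub>R\<^esub> r)"
    by (intro exI[of _ h]) (auto simp: tensor_free_def)
  from someI_ex[OF this]
  show "kf i \<in> hom Fr (add_monoid R)"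
    "a \<in> carrier A \<Longrightarrow> r \<in> carrier R \<Longrightarrow> kf i (frag_of (a, r)) = \<kappa> a i \<odot>\<^bsub>R\<^esub> r"
    unfolding kf_def by blast+
qed

lemma Fr_group: "comm_group Fr"
  by (simp add: tensor_free_def abelian_free_Abelian_group)

lemma Fr_ops [simp]: "x \<otimes>\<^bsub>Fr\<^esub> y = x + y" "\<one>\<^bsub>Fr\<^esub> = 0"
  by (simp_all add: tensor_free_def)

lemma Fr_inv: "x \<in> carrier Fr \<Longrightarrow> inv\<^bsub>Fr\<^esub> x = - x"
  by (simp add: tensor_free_def)

lemma Fr_closed:
  "u \<in> carrier Fr \<Longrightarrow> v \<in> carrier Fr \<Longrightarrow> u + v \<in> carrier Fr"
  "u \<in> carrier Fr \<Longrightarrow> v \<in> carrier Fr \<Longrightarrow> u - v \<in> carrier Fr"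
  "0 \<in> carrier Fr"
  "a \<in> carrier A \<Longrightarrow> r \<in> carrier R \<Longrightarrow> frag_of (a, r) \<in> carrier Fr"
  unfolding Fr_carrier using keys_add[of u v] keys_diff[of u v] by (auto simp: keys_frag_of)

lemma Fr_induct [consumes 1, case_names zero diff one]:
  assumes "u \<in> carrier Fr" "P 0"
    "\<And>x y. x \<in> carrier Fr \<Longrightarrow> y \<in> carrier Fr \<Longrightarrow> P x \<Longrightarrow> P y \<Longrightarrow> P (x - y)"
    "\<And>a r. a \<in> carrier A \<Longrightarrow> r \<in> carrier R \<Longrightarrow> P (frag_of (a, r))"
  shows "P u"
  by (rule free_Abelian_group_induct[of u S]) (use assms in \<open>auto simp: Fr_carrier\<close>)

lemma kf_simps:
  assumes "i < n"
  shows "u \<in> carrier Fr \<Longrightarrow> kf i u \<in> carrier R"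
    "kf i 0 = \<zero>\<^bsub>R\<^esub>"
    "u \<in> carrier Fr \<Longrightarrow> v \<in> carrier Fr \<Longrightarrow> kf i (u + v) = kf i u \<oplus>\<^bsub>R\<^esub> kf i v"
    "u \<in> carrier Fr \<Longrightarrow> v \<in> carrier Fr \<Longrightarrow> kf i (u - v) = kf i u \<ominus>\<^bsub>R\<^esub> kf i v"
proof -
  interpret Fr: comm_group Fr by (rule Fr_group)
  interpret G: comm_group "add_monoid R" by (rule RR.a_comm_group)
  interpret h: group_hom Fr "add_monoid R" "kf i"
    using kf(1)[OF assms] by unfold_locales
  show c: "u \<in> carrier Fr \<Longrightarrow> kf i u \<in> carrier R" for u using h.hom_closed by simp
  show "kf i 0 = \<zero>\<^bsub>R\<^esub>" using h.hom_one by simp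
  show add: "u \<in> carrier Fr \<Longrightarrow> v \<in> carrier Fr \<Longrightarrow> kf i (u + v) = kf i u \<oplus>\<^bsub>R\<^esub> kf i v" for u v
    using h.hom_mult[of u v] by simp
  assume uv: "u \<in> carrier Fr" "v \<in> carrier Fr"
  have "kf i (u - v + v) = kf i (u - v) \<oplus>\<^bsub>R\<^esub> kf i v" using uv Fr_closed by (intro add) auto
  then have "kf i u \<ominus>\<^bsub>R\<^esub> kf i v = kf i (u - v) \<oplus>\<^bsub>R\<^esub> kf i v \<ominus>\<^bsub>R\<^esub> kf i v" by simp
  then show "kf i (u - v) = kf i u \<ominus>\<^bsub>R\<^esub> kf i v"
    using c[OF uv(1)] c[OF uv(2)] c[OF Fr_closed(2)[OF uv]] by (simp add: RR.minus_eq RR.a_assoc RR.r_neg)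
qed

lemma rels_closed: "tensor_rels F A R \<subseteq> carrier Fr"
  unfolding tensor_rels_def by (auto intro!: Fr_closed)

lemma Nul_subgroup: "subgroup Nul Fr"
  unfolding tensor_null_def using group.generate_is_subgroup[OF comm_group.axioms(2)[OF Fr_group] rels_closed] .

lemma Nul_simps:
  "Nul \<subseteq> carrier Fr" "0 \<in> Nul" "u \<in> Nul \<Longrightarrow> v \<in> Nul \<Longrightarrow> u + v \<in> Nul" "u \<in> Nul \<Longrightarrow> v \<in> Nul \<Longrightarrow> u - v \<in> Nul"
proof -
  show c: "Nul \<subseteq> carrier Fr" using subgroup.subset[OF Nul_subgroup] .
  show "0 \<in> Nul" using subgroup.one_closed[OF Nul_subgroup] by simp
  show add: "u \<in> Nul \<Longrightarrow> v \<in> Nul \<Longrightarrow> u + v \<in> Nul" for u v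
    using subgroup.m_closed[OF Nul_subgroup, of u v] by simp
  show "u \<in> Nul \<Longrightarrow> v \<in> Nul \<Longrightarrow> u - v \<in> Nul" for u v
    using add[of u "- v"] subgroup.m_inv_closed[OF Nul_subgroup, of v] c Fr_inv[of v] by auto
qed

lemma kf_rel:
  assumes "u \<in> tensor_rels F A R" "i < n"
  shows "kf i u = \<zero>\<^bsub>R\<^esub>"
proof -
  interpret emb: ring_hom_cring F R emb by unfold_locales (rule emb_hom)
  have canc: "x \<oplus>\<^bsub>R\<^esub> y \<ominus>\<^bsub>R\<^esub> x \<ominus>\<^bsub>R\<^esub> y = \<zero>\<^bsub>R\<^esub>" if "x \<in> carrier R" "y \<in> carrier R" for x y
    using that by (simp add: RR.a_comm[of x y] RR.minus_eq RR.a_assoc RR.r_neg)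
  consider (1) a a' r where "a \<in> carrier A" "a' \<in> carrier A" "r \<in> carrier R"
      "u = frag_of (a \<oplus>\<^bsub>A\<^esub> a', r) - frag_of (a, r) - frag_of (a', r)"
    | (2) a r s where "a \<in> carrier A" "r \<in> carrier R" "s \<in> carrier R"
      "u = frag_of (a, r \<oplus>\<^bsub>R\<^esub> s) - frag_of (a, r) - frag_of (a, s)"
    | (3) a x r where "a \<in> carrier A" "x \<in> carrier F" "r \<in> carrier R"
      "u = frag_of (x \<odot>\<^bsub>A\<^esub> a, r) - frag_of (a, x \<odot>\<^bsub>R\<^esub> r)"
    using assms(1) unfolding tensor_rels_def by auto
  then show ?thesis
  proof cases
    case 1
    then show ?thesis using assms(2) canc
      by (simp add: kf_simps kf Fr_closed coord_add coord_closed RR.smult_l_distr)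
  next
    case 2
    then show ?thesis using assms(2) canc
      by (simp add: kf_simps kf Fr_closed coord_closed RR.smult_r_distr)
  next
    case 3
    then show ?thesis using assms(2)
      by (simp add: kf_simps kf Fr_closed coord_smult coord_closed smult_emb RR.m_assoc RR.m_lcomm emb_closed)
  qed
qed

lemma kf_Nul:
  assumes "u \<in> Nul" "i < n" shows "kf i u = \<zero>\<^bsub>R\<^esub>"
  using assms(1) unfolding tensor_null_def
proof (induction u rule: generate.induct)
  case one
  then show ?case using kf_simps assms by simp
next
  case (incl h)
  then show ?case using kf_rel assms by simp
next
  case (inv h)
  then have "h \<in> carrier Fr" using rels_closed by auto
  then show ?case using kf_simps(4)[of i 0 h] kf_simps(2) Fr_closed(3) Fr_inv[of h] kf_rel[OF inv] assms
    by (simp add: RR.minus_eq)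
next
  case (eng h1 h2)
  then have "h1 \<in> carrier Fr" "h2 \<in> carrier Fr"
    using Nul_simps(1) unfolding tensor_null_def by auto
  then show ?case using eng kf_simps assms by simp
qed

lemma rel_add: "a \<in> carrier A \<Longrightarrow> a' \<in> carrier A \<Longrightarrow> r \<in> carrier R \<Longrightarrow>
    frag_of (a \<oplus>\<^bsub>A\<^esub> a', r) - frag_of (a, r) - frag_of (a', r) \<in> Nul"
  unfolding tensor_null_def by (rule generate.incl) (auto simp: tensor_rels_def)

lemma rel_add2: "a \<in> carrier A \<Longrightarrow> r \<in> carrier R \<Longrightarrow> s \<in> carrier R \<Longrightarrow>
    frag_of (a, r \<oplus>\<^bsub>R\<^esub> s) - frag_of (a, r) - frag_of (a, s) \<in> Nul"
  unfolding tensor_null_def by (rule generate.incl) (auto simp: tensor_rels_def)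

lemma rel_smult: "a \<in> carrier A \<Longrightarrow> x \<in> carrier F \<Longrightarrow> r \<in> carrier R \<Longrightarrow>
    frag_of (x \<odot>\<^bsub>A\<^esub> a, r) - frag_of (a, x \<odot>\<^bsub>R\<^esub> r) \<in> Nul"
  unfolding tensor_null_def by (rule generate.incl) (auto simp: tensor_rels_def)

lemma rel_zero: "a \<in> carrier A \<Longrightarrow> frag_of (a, \<zero>\<^bsub>R\<^esub>) \<in> Nul"
proof -
  assume a: "a \<in> carrier A"
  have "0 - (frag_of (a, \<zero>\<^bsub>R\<^esub> \<oplus>\<^bsub>R\<^esub> \<zero>\<^bsub>R\<^esub>) - frag_of (a, \<zero>\<^bsub>R\<^esub>) - frag_of (a, \<zero>\<^bsub>R\<^esub>)) \<in> Nul"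
    by (rule Nul_simps(4)[OF Nul_simps(2) rel_add2]) (use a in auto)
  then show ?thesis by simp
qed

lemma rel_zero2: "r \<in> carrier R \<Longrightarrow> frag_of (\<zero>\<^bsub>A\<^esub>, r) \<in> Nul"
proof -
  assume a: "r \<in> carrier R"
  have "0 - (frag_of (\<zero>\<^bsub>A\<^esub> \<oplus>\<^bsub>A\<^esub> \<zero>\<^bsub>A\<^esub>, r) - frag_of (\<zero>\<^bsub>A\<^esub>, r) - frag_of (\<zero>\<^bsub>A\<^esub>, r)) \<in> Nul"
    by (rule Nul_simps(4)[OF Nul_simps(2) rel_add]) (use a in auto)
  then show ?thesis by simp
qed

lemma rel_diff: "a \<in> carrier A \<Longrightarrow> r \<in> carrier R \<Longrightarrow> s \<in> carrier R \<Longrightarrow>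
    frag_of (a, r) - frag_of (a, s) - frag_of (a, r \<ominus>\<^bsub>R\<^esub> s) \<in> Nul"
proof -
  assume a: "a \<in> carrier A" "r \<in> carrier R" "s \<in> carrier R"
  have "(r \<ominus>\<^bsub>R\<^esub> s) \<oplus>\<^bsub>R\<^esub> s = r" using a by (simp add: RR.minus_eq RR.a_assoc RR.l_neg)
  then have "frag_of (a, r) - frag_of (a, r \<ominus>\<^bsub>R\<^esub> s) - frag_of (a, s) \<in> Nul"
    using rel_add2[of a "r \<ominus>\<^bsub>R\<^esub> s" s] a by simp
  then show ?thesis by (simp add: algebra_simps)
qed

lemma rel_sum:
  assumes "r \<in> carrier R" "\<And>i. i < m \<Longrightarrow> f i \<in> carrier F" "m \<le> n"
  shows "frag_of (\<Oplus>\<^bsub>A\<^esub>i\<in>{..<m}. f i \<odot>\<^bsub>A\<^esub> b i, r) - (\<Sum>i<m. frag_of (b i, f i \<odot>\<^bsub>R\<^esub> r)) \<in> Nul"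
  using assms(2,3)
proof (induction m)
  case 0
  then show ?case using rel_zero2 assms(1) by simp
next
  case (Suc m)
  let ?s = "\<Oplus>\<^bsub>A\<^esub>i\<in>{..<m}. f i \<odot>\<^bsub>A\<^esub> b i"
  have s: "?s \<in> carrier A" "b m \<in> carrier A" using Suc.prems finsum_basis_closed[of m f] b_closed by auto
  have e: "(\<Oplus>\<^bsub>A\<^esub>i\<in>{..<Suc m}. f i \<odot>\<^bsub>A\<^esub> b i) = ?s \<oplus>\<^bsub>A\<^esub> f m \<odot>\<^bsub>A\<^esub> b m"
    using Suc.prems s b_closed unfolding lessThan_Suc by (subst M.finsum_insert) (auto simp: Pi_def M.a_comm)
  have "frag_of (?s \<oplus>\<^bsub>A\<^esub> f m \<odot>\<^bsub>A\<^esub> b m, r) - frag_of (?s, r) - frag_of (f m \<odot>\<^bsub>A\<^esub> b m, r) \<in> Nul"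
    using s Suc.prems assms(1) by (intro rel_add) auto
  moreover have "frag_of (f m \<odot>\<^bsub>A\<^esub> b m, r) - frag_of (b m, f m \<odot>\<^bsub>R\<^esub> r) \<in> Nul"
    using s Suc.prems assms(1) by (intro rel_smult) auto
  moreover have "frag_of (?s, r) - (\<Sum>i<m. frag_of (b i, f i \<odot>\<^bsub>R\<^esub> r)) \<in> Nul"
    using Suc.prems by (intro Suc.IH) auto
  ultimately have "(frag_of (?s \<oplus>\<^bsub>A\<^esub> f m \<odot>\<^bsub>A\<^esub> b m, r) - frag_of (?s, r) - frag_of (f m \<odot>\<^bsub>A\<^esub> b m, r)) +
     (frag_of (f m \<odot>\<^bsub>A\<^esub> b m, r) - frag_of (b m, f m \<odot>\<^bsub>R\<^esub> r)) +
     (frag_of (?s, r) - (\<Sum>i<m. frag_of (b i, f i \<odot>\<^bsub>R\<^esub> r))) \<in> Nul"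
    using Nul_simps(3) by blast
  then show ?case unfolding e by (simp add: algebra_simps)
qed

lemma Nul_sum: "(\<And>i. i < m \<Longrightarrow> f i \<in> Nul) \<Longrightarrow> (\<Sum>i<(m::nat). f i) \<in> Nul"
  by (induction m) (auto simp: Nul_simps)

text \<open>Every element of the free group is congruent to a combination of the \<open>b i\<close>.\<close>

lemma reduce: "u \<in> carrier Fr \<Longrightarrow> u - (\<Sum>i<n. frag_of (b i, kf i u)) \<in> Nul"
proof (induction u rule: Fr_induct)
  case zero
  have "0 - (\<Sum>i<n. frag_of (b i, kf i 0)) \<in> Nul"
    by (rule Nul_simps(4)[OF Nul_simps(2) Nul_sum]) (simp add: kf_simps rel_zero b_closed)
  then show ?case .
next
  case (diff x y)
  have "(\<Sum>i<n. frag_of (b i, kf i x) - frag_of (b i, kf i y) - frag_of (b i, kf i (x - y))) \<in> Nul"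
    by (rule Nul_sum) (use diff in \<open>simp add: kf_simps rel_diff b_closed\<close>)
  then have "(x - (\<Sum>i<n. frag_of (b i, kf i x))) - (y - (\<Sum>i<n. frag_of (b i, kf i y))) +
    (\<Sum>i<n. frag_of (b i, kf i x) - frag_of (b i, kf i y) - frag_of (b i, kf i (x - y))) \<in> Nul"
    using Nul_simps(3,4) diff by blast
  then show ?case by (simp add: sum_subtractf)
next
  case (one a r)
  then have "a = (\<Oplus>\<^bsub>A\<^esub>i\<in>{..<n}. \<kappa> a i \<odot>\<^bsub>A\<^esub> b i)" by (intro expand) auto
  then have "frag_of (a, r) - (\<Sum>i<n. frag_of (b i, \<kappa> a i \<odot>\<^bsub>R\<^esub> r)) \<in> Nul"
    using rel_sum[of r n "\<kappa> a"] one coord_closed by simp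
  moreover have "(\<Sum>i<n. frag_of (b i, kf i (frag_of (a, r)))) = (\<Sum>i<n. frag_of (b i, \<kappa> a i \<odot>\<^bsub>R\<^esub> r))"
    using one by (intro sum.cong) (auto simp: kf)
  ultimately show ?case by simp
qed

abbreviation "cls \<equiv> tensor_class F A R"

lemma cls_eq_iff:
  assumes "u \<in> carrier Fr" "v \<in> carrier Fr"
  shows "cls u = cls v \<longleftrightarrow> (\<forall>i<n. kf i u = kf i v)"
proof -
  interpret Fr: comm_group Fr by (rule Fr_group)
  have cls: "cls u = cls v \<longleftrightarrow> u - v \<in> Nul"
  proof
    assume "cls u = cls v"
    then have "u \<in> cls v" using Fr.rcos_self[OF assms(1) Nul_subgroup] by (simp add: tensor_class_def)
    then show "u - v \<in> Nul" by (auto simp: tensor_class_def r_coset_def)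
  next
    assume "u - v \<in> Nul"
    then have "(u - v) \<otimes>\<^bsub>Fr\<^esub> v \<in> cls v" unfolding tensor_class_def r_coset_def by blast
    then have "u \<in> Nul #>\<^bsub>Fr\<^esub> v" by (simp add: tensor_class_def)
    then show "cls u = cls v" unfolding tensor_class_def
      using Fr.repr_independence[OF _ assms(2) Nul_subgroup] by simp
  qed
  show ?thesis unfolding cls
  proof
    assume uv: "u - v \<in> Nul"
    show "\<forall>i<n. kf i u = kf i v"
    proof (intro allI impI)
      fix i assume i: "i < n"
      have "kf i u \<ominus>\<^bsub>R\<^esub> kf i v = \<zero>\<^bsub>R\<^esub>" using kf_Nul[OF uv i] kf_simps(4)[OF i assms] by simp
      then show "kf i u = kf i v" using kf_simps(1)[OF i] assms by simp
    qed
  next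
    assume eq: "\<forall>i<n. kf i u = kf i v"
    have "(u - (\<Sum>i<n. frag_of (b i, kf i u))) - (v - (\<Sum>i<n. frag_of (b i, kf i v))) \<in> Nul"
      using Nul_simps(4) reduce assms by blast
    moreover have "(\<Sum>i<n. frag_of (b i, kf i u)) = (\<Sum>i<n. frag_of (b i, kf i v))"
      using eq by (intro sum.cong) auto
    ultimately show "u - v \<in> Nul" by simp
  qed
qed

lemma T_carrier: "carrier T = cls ` carrier Fr"
  unfolding extend_scalars_def by (auto simp: FactGroup_def RCOSETS_def tensor_class_def)

lemma cls_mem: "u \<in> carrier Fr \<Longrightarrow> u \<in> cls u"
  unfolding tensor_class_def using group.rcos_self[OF comm_group.axioms(2)[OF Fr_group] _ Nul_subgroup] .

lemma mem_cls:
  assumes "u' \<in> cls u" "u \<in> carrier Fr" shows "u' \<in> carrier Fr" "cls u' = cls u"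
proof -
  interpret Fr: comm_group Fr by (rule Fr_group)
  show "u' \<in> carrier Fr" using assms Nul_simps(1) Fr_closed(1) by (auto simp: tensor_class_def r_coset_def)
  show "cls u' = cls u" using Fr.repr_independence[OF _ assms(2) Nul_subgroup] assms(1)
    by (simp add: tensor_class_def)
qed

lemma cls_Union:
  assumes "u \<in> carrier Fr" "\<And>u'. u' \<in> carrier Fr \<Longrightarrow> cls u' = cls u \<Longrightarrow> P u' = P u"
  shows "(\<Union>u'\<in>cls u. P u') = P u"
  using cls_mem[OF assms(1)] mem_cls[OF _ assms(1)] assms(2) by blast

text \<open>
  A coordinate of a coset is the coordinate of any representative.
\<close>

definition coordT :: "('a \<times> 'r \<Rightarrow>\<^sub>0 int) set \<Rightarrow> nat \<Rightarrow> 'r" where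
  "coordT U i = kf i (SOME u. u \<in> U)"

lemma coordT_cls: "u \<in> carrier Fr \<Longrightarrow> i < n \<Longrightarrow> coordT (cls u) i = kf i u"
proof -
  assume u: "u \<in> carrier Fr" "i < n"
  let ?u = "SOME u'. u' \<in> cls u"
  have "?u \<in> cls u" using cls_mem[OF u(1)] by (rule someI)
  then show ?thesis using cls_eq_iff[of ?u u] mem_cls[of ?u u] u by (simp add: coordT_def)
qed

lemma T_add: "u \<in> carrier Fr \<Longrightarrow> v \<in> carrier Fr \<Longrightarrow> cls u \<oplus>\<^bsub>T\<^esub> cls v = cls (u + v)"
proof -
  assume uv: "u \<in> carrier Fr" "v \<in> carrier Fr"
  interpret Fr: comm_group Fr by (rule Fr_group)
  interpret N: normal Nul Fr using Fr.normal_iff_subgroup Nul_subgroup by blast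
  show ?thesis using N.rcos_sum[OF uv] by (simp add: extend_scalars_def FactGroup_def tensor_class_def)
qed

lemma T_zero: "\<zero>\<^bsub>T\<^esub> = cls 0"
proof -
  interpret Fr: comm_group Fr by (rule Fr_group)
  show ?thesis using Fr.coset_mult_one[OF Nul_simps(1)]
    by (simp add: extend_scalars_def FactGroup_def tensor_class_def)
qed

lemma frag_map2_simps:
  "frag_map2 h 0 = 0" "frag_map2 h (u - v) = frag_map2 h u - frag_map2 h v"
  "frag_map2 h (frag_of (a, r)) = frag_of (a, h r)"
  by (simp_all add: frag_map2_def frag_extend_diff)

lemma frag_map2_smult:
  assumes "u \<in> carrier Fr" "s \<in> carrier R"
  shows "frag_map2 (\<lambda>r. s \<otimes>\<^bsub>R\<^esub> r) u \<in> carrier Fr \<and>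
    (\<forall>i<n. kf i (frag_map2 (\<lambda>r. s \<otimes>\<^bsub>R\<^esub> r) u) = s \<otimes>\<^bsub>R\<^esub> kf i u)"
  using assms(1)
proof (induction u rule: Fr_induct)
  case zero
  then show ?case using assms(2) by (simp add: frag_map2_simps Fr_closed kf_simps)
next
  case (diff x y)
  then show ?case using assms(2)
    by (simp add: frag_map2_simps Fr_closed kf_simps RR.minus_eq RR.r_distr RR.r_minus)
next
  case (one a r)
  then show ?case using assms(2) coord_closed
    by (simp add: frag_map2_simps Fr_closed kf smult_emb emb_closed RR.m_lcomm)
qed

lemma T_smult:
  assumes "u \<in> carrier Fr" "s \<in> carrier R"
  shows "s \<odot>\<^bsub>T\<^esub> cls u = cls (frag_map2 (\<lambda>r. s \<otimes>\<^bsub>R\<^esub> r) u)"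
proof -
  have "(\<Union>u'\<in>cls u. cls (frag_map2 (\<lambda>r. s \<otimes>\<^bsub>R\<^esub> r) u')) = cls (frag_map2 (\<lambda>r. s \<otimes>\<^bsub>R\<^esub> r) u)"
  proof (rule cls_Union[OF assms(1)])
    fix u' assume "u' \<in> carrier Fr" "cls u' = cls u"
    then show "cls (frag_map2 (\<lambda>r. s \<otimes>\<^bsub>R\<^esub> r) u') = cls (frag_map2 (\<lambda>r. s \<otimes>\<^bsub>R\<^esub> r) u)"
      using frag_map2_smult[OF _ assms(2)] assms(1) by (simp add: cls_eq_iff)
  qed
  then show ?thesis by (simp add: extend_scalars_def)
qed

abbreviation "c' \<equiv> \<lambda>i j k. emb (c i j k)"

lemma c'_closed: "i < n \<Longrightarrow> j < n \<Longrightarrow> k < n \<Longrightarrow> c' i j k \<in> carrier R"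
  using c_closed emb_closed by blast

lemma frag_prod_simps:
  "frag_prod A R 0 v = 0" "frag_prod A R (u - u') v = frag_prod A R u v - frag_prod A R u' v"
  "frag_prod A R (frag_of (a, r)) 0 = 0"
  "frag_prod A R (frag_of (a, r)) (v - v') = frag_prod A R (frag_of (a, r)) v - frag_prod A R (frag_of (a, r)) v'"
  "frag_prod A R (frag_of (a, r)) (frag_of (a', s)) = frag_of (a \<otimes>\<^bsub>A\<^esub> a', r \<otimes>\<^bsub>R\<^esub> s)"
  by (simp_all add: frag_prod_def frag_extend_diff)

text \<open>
  The \<open>k\<close>th coordinate of the product of the elements with coordinates \<open>x\<close> and \<open>y\<close>.
\<close>

definition bil :: "nat \<Rightarrow> (nat \<Rightarrow> 'r) \<Rightarrow> (nat \<Rightarrow> 'r) \<Rightarrow> 'r" where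
  "bil k x y = (\<Oplus>\<^bsub>R\<^esub>i\<in>{..<n}. \<Oplus>\<^bsub>R\<^esub>j\<in>{..<n}. x i \<otimes>\<^bsub>R\<^esub> y j \<otimes>\<^bsub>R\<^esub> c' i j k)"

lemma bil_cong: "(\<And>i. i < n \<Longrightarrow> x i = x' i \<and> x' i \<in> carrier R) \<Longrightarrow> (\<And>i. i < n \<Longrightarrow> y i = y' i \<and> y' i \<in> carrier R) \<Longrightarrow> k < n \<Longrightarrow>
    bil k x y = bil k x' y'"
  unfolding bil_def by (intro RR.finsum_cong' ) (auto simp: c'_closed)

lemma bil_closed: "(\<And>i. i < n \<Longrightarrow> x i \<in> carrier R) \<Longrightarrow> (\<And>i. i < n \<Longrightarrow> y i \<in> carrier R) \<Longrightarrow> k < n \<Longrightarrow> bil k x y \<in> carrier R"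
  unfolding bil_def by (intro RR.finsum_closed) (auto simp: c'_closed)

lemma finsum_minus:
  assumes "f \<in> J \<rightarrow> carrier R" "g \<in> J \<rightarrow> carrier R"
  shows "(\<Oplus>\<^bsub>R\<^esub>i\<in>J. f i \<ominus>\<^bsub>R\<^esub> g i) = (\<Oplus>\<^bsub>R\<^esub>i\<in>J. f i) \<ominus>\<^bsub>R\<^esub> (\<Oplus>\<^bsub>R\<^esub>i\<in>J. g i)"
  using assms
proof (induction J rule: infinite_finite_induct)
  case (insert x H)
  then have *: "f x \<in> carrier R" "g x \<in> carrier R" "f \<in> H \<rightarrow> carrier R" "g \<in> H \<rightarrow> carrier R" by auto
  then have "(\<Oplus>\<^bsub>R\<^esub>i\<in>H. f i) \<in> carrier R" "(\<Oplus>\<^bsub>R\<^esub>i\<in>H. g i) \<in> carrier R" by auto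
  then show ?case using insert * by (simp add: Pi_def RR.minus_eq RR.minus_add RR.a_ac)
qed (auto simp: RR.minus_eq)

lemma bil_diff_left:
  assumes "\<And>i. i < n \<Longrightarrow> x i \<in> carrier R" "\<And>i. i < n \<Longrightarrow> x' i \<in> carrier R" "\<And>i. i < n \<Longrightarrow> y i \<in> carrier R" "k < n"
  shows "bil k (\<lambda>i. x i \<ominus>\<^bsub>R\<^esub> x' i) y = bil k x y \<ominus>\<^bsub>R\<^esub> bil k x' y"
proof -
  have "bil k (\<lambda>i. x i \<ominus>\<^bsub>R\<^esub> x' i) y =
    (\<Oplus>\<^bsub>R\<^esub>i\<in>{..<n}. \<Oplus>\<^bsub>R\<^esub>j\<in>{..<n}. x i \<otimes>\<^bsub>R\<^esub> y j \<otimes>\<^bsub>R\<^esub> c' i j k \<ominus>\<^bsub>R\<^esub> x' i \<otimes>\<^bsub>R\<^esub> y j \<otimes>\<^bsub>R\<^esub> c' i j k)"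
    unfolding bil_def using assms c'_closed
    by (intro RR.finsum_cong') (auto simp: RR.minus_eq RR.l_distr RR.l_minus)
  also have "\<dots> = (\<Oplus>\<^bsub>R\<^esub>i\<in>{..<n}. (\<Oplus>\<^bsub>R\<^esub>j\<in>{..<n}. x i \<otimes>\<^bsub>R\<^esub> y j \<otimes>\<^bsub>R\<^esub> c' i j k) \<ominus>\<^bsub>R\<^esub> (\<Oplus>\<^bsub>R\<^esub>j\<in>{..<n}. x' i \<otimes>\<^bsub>R\<^esub> y j \<otimes>\<^bsub>R\<^esub> c' i j k))"
    using assms c'_closed by (intro RR.finsum_cong' finsum_minus) auto
  also have "\<dots> = bil k x y \<ominus>\<^bsub>R\<^esub> bil k x' y"
    unfolding bil_def using assms c'_closed by (intro finsum_minus) auto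
  finally show ?thesis .
qed

lemma bil_diff_right:
  assumes "\<And>i. i < n \<Longrightarrow> x i \<in> carrier R" "\<And>i. i < n \<Longrightarrow> y i \<in> carrier R" "\<And>i. i < n \<Longrightarrow> y' i \<in> carrier R" "k < n"
  shows "bil k x (\<lambda>i. y i \<ominus>\<^bsub>R\<^esub> y' i) = bil k x y \<ominus>\<^bsub>R\<^esub> bil k x y'"
proof -
  have "bil k x (\<lambda>i. y i \<ominus>\<^bsub>R\<^esub> y' i) =
    (\<Oplus>\<^bsub>R\<^esub>i\<in>{..<n}. \<Oplus>\<^bsub>R\<^esub>j\<in>{..<n}. x i \<otimes>\<^bsub>R\<^esub> y j \<otimes>\<^bsub>R\<^esub> c' i j k \<ominus>\<^bsub>R\<^esub> x i \<otimes>\<^bsub>R\<^esub> y' j \<otimes>\<^bsub>R\<^esub> c' i j k)"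
    unfolding bil_def using assms c'_closed
    by (intro RR.finsum_cong') (auto simp: RR.minus_eq RR.l_distr RR.r_distr RR.l_minus RR.r_minus)
  also have "\<dots> = (\<Oplus>\<^bsub>R\<^esub>i\<in>{..<n}. (\<Oplus>\<^bsub>R\<^esub>j\<in>{..<n}. x i \<otimes>\<^bsub>R\<^esub> y j \<otimes>\<^bsub>R\<^esub> c' i j k) \<ominus>\<^bsub>R\<^esub> (\<Oplus>\<^bsub>R\<^esub>j\<in>{..<n}. x i \<otimes>\<^bsub>R\<^esub> y' j \<otimes>\<^bsub>R\<^esub> c' i j k))"
    using assms c'_closed by (intro RR.finsum_cong' finsum_minus) auto
  also have "\<dots> = bil k x y \<ominus>\<^bsub>R\<^esub> bil k x y'"
    unfolding bil_def using assms c'_closed by (intro finsum_minus) auto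
  finally show ?thesis .
qed

lemma bil_pure:
  assumes "a \<in> carrier A" "a' \<in> carrier A" "r \<in> carrier R" "s \<in> carrier R" "k < n"
  shows "emb (\<kappa> (a \<otimes>\<^bsub>A\<^esub> a') k) \<otimes>\<^bsub>R\<^esub> (r \<otimes>\<^bsub>R\<^esub> s) = bil k (\<lambda>i. emb (\<kappa> a i) \<otimes>\<^bsub>R\<^esub> r) (\<lambda>j. emb (\<kappa> a' j) \<otimes>\<^bsub>R\<^esub> s)"
proof -
  interpret emb: ring_hom_cring F R emb by unfold_locales (rule emb_hom)
  have cl: "\<And>i. i < n \<Longrightarrow> \<kappa> a i \<in> carrier F" "\<And>i. i < n \<Longrightarrow> \<kappa> a' i \<in> carrier F"
    using coord_closed assms by auto
  have ec: "\<And>i. i < n \<Longrightarrow> emb (\<kappa> a i) \<in> carrier R" "\<And>i. i < n \<Longrightarrow> emb (\<kappa> a' i) \<in> carrier R"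
    "\<And>i j. i < n \<Longrightarrow> j < n \<Longrightarrow> c' i j k \<in> carrier R"
    using cl emb_closed c'_closed assms(5) by auto
  have tm: "emb (\<kappa> a i \<otimes> \<kappa> a' j \<otimes> c i j k) \<otimes>\<^bsub>R\<^esub> (r \<otimes>\<^bsub>R\<^esub> s) =
      emb (\<kappa> a i) \<otimes>\<^bsub>R\<^esub> r \<otimes>\<^bsub>R\<^esub> (emb (\<kappa> a' j) \<otimes>\<^bsub>R\<^esub> s) \<otimes>\<^bsub>R\<^esub> c' i j k" if ij: "i < n" "j < n" for i j
  proof -
    have "emb (\<kappa> a i \<otimes> \<kappa> a' j \<otimes> c i j k) = emb (\<kappa> a i) \<otimes>\<^bsub>R\<^esub> emb (\<kappa> a' j) \<otimes>\<^bsub>R\<^esub> c' i j k"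
      using cl ij c_closed assms(5) by simp
    then show ?thesis using ec ij assms(3,4) by (simp add: RR.m_ac)
  qed
  have "emb (\<kappa> (a \<otimes>\<^bsub>A\<^esub> a') k) = emb (\<Oplus>i\<in>{..<n}. \<Oplus>j\<in>{..<n}. \<kappa> a i \<otimes> \<kappa> a' j \<otimes> c i j k)"
    using assms by (simp add: coord_mult)
  also have "\<dots> = (\<Oplus>\<^bsub>R\<^esub>i\<in>{..<n}. emb (\<Oplus>j\<in>{..<n}. \<kappa> a i \<otimes> \<kappa> a' j \<otimes> c i j k))"
    by (subst emb.hom_finsum) (use cl c_closed assms(5) in \<open>auto simp: comp_def\<close>)
  also have "\<dots> = (\<Oplus>\<^bsub>R\<^esub>i\<in>{..<n}. \<Oplus>\<^bsub>R\<^esub>j\<in>{..<n}. emb (\<kappa> a i \<otimes> \<kappa> a' j \<otimes> c i j k))"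
  proof (rule RR.finsum_cong'[OF refl])
    fix i assume i: "i \<in> {..<n}"
    show "emb (\<Oplus>j\<in>{..<n}. \<kappa> a i \<otimes> \<kappa> a' j \<otimes> c i j k) = (\<Oplus>\<^bsub>R\<^esub>j\<in>{..<n}. emb (\<kappa> a i \<otimes> \<kappa> a' j \<otimes> c i j k))"
      by (subst emb.hom_finsum) (use i cl c_closed assms(5) in \<open>auto simp: comp_def\<close>)
  qed (use cl c_closed assms(5) emb_closed in \<open>auto intro!: RR.finsum_closed\<close>)
  finally have "emb (\<kappa> (a \<otimes>\<^bsub>A\<^esub> a') k) \<otimes>\<^bsub>R\<^esub> (r \<otimes>\<^bsub>R\<^esub> s) =
      (\<Oplus>\<^bsub>R\<^esub>i\<in>{..<n}. \<Oplus>\<^bsub>R\<^esub>j\<in>{..<n}. emb (\<kappa> a i \<otimes> \<kappa> a' j \<otimes> c i j k)) \<otimes>\<^bsub>R\<^esub> (r \<otimes>\<^bsub>R\<^esub> s)" by simp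
  also have "\<dots> = (\<Oplus>\<^bsub>R\<^esub>i\<in>{..<n}. (\<Oplus>\<^bsub>R\<^esub>j\<in>{..<n}. emb (\<kappa> a i \<otimes> \<kappa> a' j \<otimes> c i j k)) \<otimes>\<^bsub>R\<^esub> (r \<otimes>\<^bsub>R\<^esub> s))"
    by (rule RR.finsum_ldistr) (use cl c_closed assms(3-5) emb_closed in \<open>auto intro!: RR.finsum_closed\<close>)
  also have "\<dots> = bil k (\<lambda>i. emb (\<kappa> a i) \<otimes>\<^bsub>R\<^esub> r) (\<lambda>j. emb (\<kappa> a' j) \<otimes>\<^bsub>R\<^esub> s)"
    unfolding bil_def
  proof (rule RR.finsum_cong'[OF refl])
    fix i assume i: "i \<in> {..<n}"
    have "(\<Oplus>\<^bsub>R\<^esub>j\<in>{..<n}. emb (\<kappa> a i \<otimes> \<kappa> a' j \<otimes> c i j k)) \<otimes>\<^bsub>R\<^esub> (r \<otimes>\<^bsub>R\<^esub> s)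
      = (\<Oplus>\<^bsub>R\<^esub>j\<in>{..<n}. emb (\<kappa> a i \<otimes> \<kappa> a' j \<otimes> c i j k) \<otimes>\<^bsub>R\<^esub> (r \<otimes>\<^bsub>R\<^esub> s))"
      by (rule RR.finsum_ldistr) (use i cl c_closed assms(3-5) emb_closed in auto)
    also have "\<dots> = (\<Oplus>\<^bsub>R\<^esub>j\<in>{..<n}. emb (\<kappa> a i) \<otimes>\<^bsub>R\<^esub> r \<otimes>\<^bsub>R\<^esub> (emb (\<kappa> a' j) \<otimes>\<^bsub>R\<^esub> s) \<otimes>\<^bsub>R\<^esub> c' i j k)"
      by (rule RR.finsum_cong'[OF refl]) (use i ec assms(3,4) tm in auto)
    finally show "(\<Oplus>\<^bsub>R\<^esub>j\<in>{..<n}. emb (\<kappa> a i \<otimes> \<kappa> a' j \<otimes> c i j k)) \<otimes>\<^bsub>R\<^esub> (r \<otimes>\<^bsub>R\<^esub> s) =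
      (\<Oplus>\<^bsub>R\<^esub>j\<in>{..<n}. emb (\<kappa> a i) \<otimes>\<^bsub>R\<^esub> r \<otimes>\<^bsub>R\<^esub> (emb (\<kappa> a' j) \<otimes>\<^bsub>R\<^esub> s) \<otimes>\<^bsub>R\<^esub> c' i j k)" .
  next
    show "(\<lambda>i. \<Oplus>\<^bsub>R\<^esub>j\<in>{..<n}. emb (\<kappa> a i) \<otimes>\<^bsub>R\<^esub> r \<otimes>\<^bsub>R\<^esub> (emb (\<kappa> a' j) \<otimes>\<^bsub>R\<^esub> s) \<otimes>\<^bsub>R\<^esub> c' i j k)
        \<in> {..<n} \<rightarrow> carrier R"
    proof
      fix i assume "i \<in> {..<n}"
      then show "(\<Oplus>\<^bsub>R\<^esub>j\<in>{..<n}. emb (\<kappa> a i) \<otimes>\<^bsub>R\<^esub> r \<otimes>\<^bsub>R\<^esub> (emb (\<kappa> a' j) \<otimes>\<^bsub>R\<^esub> s) \<otimes>\<^bsub>R\<^esub> c' i j k) \<in> carrier R"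
        using ec assms(3,4) by (intro RR.finsum_closed) simp
    qed
  qed
  finally show ?thesis .
qed

lemma frag_prod_coord1:
  assumes "v \<in> carrier Fr" "a \<in> carrier A" "r \<in> carrier R"
  shows "frag_prod A R (frag_of (a, r)) v \<in> carrier Fr \<and>
    (\<forall>k<n. kf k (frag_prod A R (frag_of (a, r)) v) = bil k (\<lambda>i. kf i (frag_of (a, r))) (\<lambda>j. kf j v))"
  using assms(1)
proof (induction v rule: Fr_induct)
  case zero
  have "bil k (\<lambda>i. kf i (frag_of (a, r))) (\<lambda>j. kf j 0 \<ominus>\<^bsub>R\<^esub> kf j 0) = \<zero>\<^bsub>R\<^esub>" if "k < n" for k
    using that assms bil_closed[of "\<lambda>i. kf i (frag_of (a, r))" "\<lambda>j. kf j 0" k]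
    by (subst bil_diff_right) (auto simp: kf_simps Fr_closed RR.r_neg RR.minus_eq)
  moreover have "bil k (\<lambda>i. kf i (frag_of (a, r))) (\<lambda>j. kf j 0 \<ominus>\<^bsub>R\<^esub> kf j 0) = bil k (\<lambda>i. kf i (frag_of (a, r))) (\<lambda>j. kf j 0)" if "k < n" for k
    using assms that by (intro bil_cong) (auto simp: kf_simps Fr_closed RR.minus_eq)
  ultimately show ?case by (simp add: frag_prod_simps Fr_closed kf_simps)
next
  case (diff x y)
  have "bil k (\<lambda>i. kf i (frag_of (a, r))) (\<lambda>j. kf j (x - y)) =
      bil k (\<lambda>i. kf i (frag_of (a, r))) (\<lambda>j. kf j x) \<ominus>\<^bsub>R\<^esub> bil k (\<lambda>i. kf i (frag_of (a, r))) (\<lambda>j. kf j y)"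
    if "k < n" for k
    using that diff assms by (subst bil_diff_right[symmetric]) (auto simp: kf_simps Fr_closed intro!: bil_cong)
  then show ?case using diff by (simp add: frag_prod_simps Fr_closed kf_simps)
next
  case (one a' s)
  have "kf k (frag_of (a \<otimes>\<^bsub>A\<^esub> a', r \<otimes>\<^bsub>R\<^esub> s)) = bil k (\<lambda>i. kf i (frag_of (a, r))) (\<lambda>j. kf j (frag_of (a', s)))"
    if k: "k < n" for k
  proof -
    have "kf k (frag_of (a \<otimes>\<^bsub>A\<^esub> a', r \<otimes>\<^bsub>R\<^esub> s)) = emb (\<kappa> (a \<otimes>\<^bsub>A\<^esub> a') k) \<otimes>\<^bsub>R\<^esub> (r \<otimes>\<^bsub>R\<^esub> s)"
      using one assms k by (simp add: kf prod_closed smult_emb coord_closed)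
    also have "\<dots> = bil k (\<lambda>i. emb (\<kappa> a i) \<otimes>\<^bsub>R\<^esub> r) (\<lambda>j. emb (\<kappa> a' j) \<otimes>\<^bsub>R\<^esub> s)"
      using one assms k by (intro bil_pure) auto
    also have "\<dots> = bil k (\<lambda>i. kf i (frag_of (a, r))) (\<lambda>j. kf j (frag_of (a', s)))"
      using one assms k by (intro bil_cong) (auto simp: kf smult_emb coord_closed emb_closed)
    finally show ?thesis .
  qed
  then show ?case using one assms by (simp add: frag_prod_simps Fr_closed prod_closed)
qed

lemma frag_prod_coord:
  assumes "v \<in> carrier Fr" "u \<in> carrier Fr"
  shows "frag_prod A R u v \<in> carrier Fr \<and>
    (\<forall>k<n. kf k (frag_prod A R u v) = bil k (\<lambda>i. kf i u) (\<lambda>j. kf j v))"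
  using assms(2)
proof (induction u rule: Fr_induct)
  case zero
  have "bil k (\<lambda>i. kf i 0 \<ominus>\<^bsub>R\<^esub> kf i 0) (\<lambda>j. kf j v) = \<zero>\<^bsub>R\<^esub>" if "k < n" for k
    using that assms(1) bil_closed[of "\<lambda>i. kf i 0" "\<lambda>j. kf j v" k]
    by (subst bil_diff_left) (auto simp: kf_simps Fr_closed RR.r_neg RR.minus_eq)
  moreover have "bil k (\<lambda>i. kf i 0 \<ominus>\<^bsub>R\<^esub> kf i 0) (\<lambda>j. kf j v) = bil k (\<lambda>i. kf i 0) (\<lambda>j. kf j v)" if "k < n" for k
    using assms(1) that by (intro bil_cong) (auto simp: kf_simps Fr_closed RR.minus_eq)
  ultimately show ?case by (simp add: frag_prod_simps Fr_closed kf_simps)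
next
  case (diff x y)
  have "bil k (\<lambda>i. kf i (x - y)) (\<lambda>j. kf j v) =
      bil k (\<lambda>i. kf i x) (\<lambda>j. kf j v) \<ominus>\<^bsub>R\<^esub> bil k (\<lambda>i. kf i y) (\<lambda>j. kf j v)"
    if "k < n" for k
    using that diff assms(1) by (subst bil_diff_left[symmetric]) (auto simp: kf_simps Fr_closed intro!: bil_cong)
  then show ?case using diff by (simp add: frag_prod_simps Fr_closed kf_simps)
next
  case (one a r)
  then show ?case using frag_prod_coord1[OF assms(1)] by blast
qed

lemma T_mult:
  assumes "u \<in> carrier Fr" "v \<in> carrier Fr"
  shows "cls u \<otimes>\<^bsub>T\<^esub> cls v = cls (frag_prod A R u v)"
proof -
  have *: "cls (frag_prod A R u' v') = cls (frag_prod A R u v)"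
    if "u' \<in> carrier Fr" "cls u' = cls u" "v' \<in> carrier Fr" "cls v' = cls v" for u' v'
    using that frag_prod_coord assms
    by (auto simp: cls_eq_iff kf_simps intro!: bil_cong)
  have inner: "(\<Union>v'\<in>cls v. cls (frag_prod A R u' v')) = cls (frag_prod A R u' v)"
    if u': "u' \<in> carrier Fr" "cls u' = cls u" for u'
  proof (rule cls_Union[OF assms(2)])
    fix v' assume v': "v' \<in> carrier Fr" "cls v' = cls v"
    show "cls (frag_prod A R u' v') = cls (frag_prod A R u' v)"
      using *[OF u' v'] *[OF u' assms(2) refl] by (rule trans[OF _ sym])
  qed
  have "(\<Union>u'\<in>cls u. \<Union>v'\<in>cls v. cls (frag_prod A R u' v')) = (\<Union>v'\<in>cls v. cls (frag_prod A R u v'))"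
  proof (rule cls_Union[OF assms(1)])
    fix u' assume u': "u' \<in> carrier Fr" "cls u' = cls u"
    show "(\<Union>v'\<in>cls v. cls (frag_prod A R u' v')) = (\<Union>v'\<in>cls v. cls (frag_prod A R u v'))"
      unfolding inner[OF u'] inner[OF assms(1) refl] by (rule *[OF u' assms(2) refl])
  qed
  then show ?thesis unfolding inner[OF assms(1) refl] by (simp add: extend_scalars_def)
qed

theorem T_based: "based_alg R T n (\<lambda>i. pure_tensor F A R (b i) \<one>\<^bsub>R\<^esub>) c' coordT"
proof (rule based_algI)
  show "cring R" by (rule RR.is_cring)
  show "\<zero>\<^bsub>T\<^esub> \<in> carrier T" by (simp add: T_carrier T_zero Fr_closed)
  show "v \<oplus>\<^bsub>T\<^esub> w \<in> carrier T" if "v \<in> carrier T" "w \<in> carrier T" for v w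
    using that by (auto simp: T_carrier T_add Fr_closed)
  show "v \<otimes>\<^bsub>T\<^esub> w \<in> carrier T" if "v \<in> carrier T" "w \<in> carrier T" for v w
    using that by (auto simp: T_carrier T_mult frag_prod_coord)
  show "r \<odot>\<^bsub>T\<^esub> v \<in> carrier T" if "r \<in> carrier R" "v \<in> carrier T" for r v
    using that by (auto simp: T_carrier T_smult frag_map2_smult)
  show "pure_tensor F A R (b i) \<one>\<^bsub>R\<^esub> \<in> carrier T" if "i < n" for i
    using that b_closed by (simp add: pure_tensor_def T_carrier Fr_closed)
  show "c' i j k \<in> carrier R" if "i < n" "j < n" "k < n" for i j k using that c'_closed by simp
  show "coordT v i \<in> carrier R" if "v \<in> carrier T" "i < n" for v i
    using that by (auto simp: T_carrier coordT_cls kf_simps)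
  show "coordT \<zero>\<^bsub>T\<^esub> i = \<zero>\<^bsub>R\<^esub>" if "i < n" for i using that by (simp add: T_zero coordT_cls Fr_closed kf_simps)
  show "coordT (v \<oplus>\<^bsub>T\<^esub> w) i = coordT v i \<oplus>\<^bsub>R\<^esub> coordT w i" if "v \<in> carrier T" "w \<in> carrier T" "i < n" for v w i
    using that by (auto simp: T_carrier T_add coordT_cls Fr_closed kf_simps)
  show "coordT (r \<odot>\<^bsub>T\<^esub> v) i = r \<otimes>\<^bsub>R\<^esub> coordT v i" if "r \<in> carrier R" "v \<in> carrier T" "i < n" for r v i
    using that by (auto simp: T_carrier T_smult coordT_cls frag_map2_smult)
  show "coordT (pure_tensor F A R (b j) \<one>\<^bsub>R\<^esub>) i = (if i = j then \<one>\<^bsub>R\<^esub> else \<zero>\<^bsub>R\<^esub>)" if "i < n" "j < n" for i j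
    using that b_closed by (simp add: pure_tensor_def coordT_cls Fr_closed kf coord_basis RR.smult_l_null)
  show "v = w" if "v \<in> carrier T" "w \<in> carrier T" "\<And>i. i < n \<Longrightarrow> coordT v i = coordT w i" for v w
  proof -
    obtain u u' where u: "u \<in> carrier Fr" "v = cls u" "u' \<in> carrier Fr" "w = cls u'"
      using \<open>v \<in> carrier T\<close> \<open>w \<in> carrier T\<close>
      unfolding T_carrier by (elim imageE) (rule that)
    then show ?thesis using that(3) cls_eq_iff[OF u(1,3)] by (simp add: coordT_cls)
  qed
  show "coordT (v \<otimes>\<^bsub>T\<^esub> w) k = (\<Oplus>\<^bsub>R\<^esub>i\<in>{..<n}. \<Oplus>\<^bsub>R\<^esub>j\<in>{..<n}. coordT v i \<otimes>\<^bsub>R\<^esub> coordT w j \<otimes>\<^bsub>R\<^esub> c' i j k)"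
    if vw: "v \<in> carrier T" "w \<in> carrier T" and k: "k < n" for v w k
  proof -
    obtain u u' where u: "u \<in> carrier Fr" "v = cls u" "u' \<in> carrier Fr" "w = cls u'"
      using vw unfolding T_carrier by (elim imageE) (rule that)
    have "coordT (v \<otimes>\<^bsub>T\<^esub> w) k = bil k (\<lambda>i. kf i u) (\<lambda>j. kf j u')"
      using u k frag_prod_coord by (simp add: T_mult coordT_cls)
    also have "\<dots> = bil k (coordT v) (coordT w)" using u k by (intro bil_cong) (auto simp: coordT_cls kf_simps)
    finally show ?thesis unfolding bil_def .
  qed
qed

lemma coord_pure: "a \<in> carrier A \<Longrightarrow> r \<in> carrier R \<Longrightarrow> i < n \<Longrightarrow> coordT (pure_tensor F A R a r) i = emb (\<kappa> a i) \<otimes>\<^bsub>R\<^esub> r"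
  by (simp add: pure_tensor_def coordT_cls Fr_closed kf smult_emb coord_closed)

lemma pure_closed: "a \<in> carrier A \<Longrightarrow> r \<in> carrier R \<Longrightarrow> pure_tensor F A R a r \<in> carrier T"
  by (simp add: pure_tensor_def T_carrier Fr_closed)

end

section \<open>Automorphisms and gradings as matrices\<close>

text \<open>
  In these three definitions matrices over \<open>R\<close> are functions of two indices below \<open>n\<close>, and \<open>c\<close> are the structure
  constants. \<open>M\<close> is the matrix of an automorphism, with inverse \<open>N\<close>: it is invertible and respects the multiplication table.
\<close>

definition aut_mat :: "('r, 'm) ring_scheme \<Rightarrow> nat \<Rightarrow> (nat \<Rightarrow> nat \<Rightarrow> nat \<Rightarrow> 'r) \<Rightarrow>
    (nat \<Rightarrow> nat \<Rightarrow> 'r) \<Rightarrow> (nat \<Rightarrow> nat \<Rightarrow> 'r) \<Rightarrow> bool" where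
  "aut_mat R n c M N \<longleftrightarrow>
     (\<forall>i<n. \<forall>j<n. M i j \<in> carrier R \<and> N i j \<in> carrier R) \<and>
     (\<forall>i<n. \<forall>j<n. (\<Oplus>\<^bsub>R\<^esub>k\<in>{..<n}. M i k \<otimes>\<^bsub>R\<^esub> N k j) = (if i = j then \<one>\<^bsub>R\<^esub> else \<zero>\<^bsub>R\<^esub>)) \<and>
     (\<forall>i<n. \<forall>j<n. (\<Oplus>\<^bsub>R\<^esub>k\<in>{..<n}. N i k \<otimes>\<^bsub>R\<^esub> M k j) = (if i = j then \<one>\<^bsub>R\<^esub> else \<zero>\<^bsub>R\<^esub>)) \<and>
     (\<forall>i<n. \<forall>j<n. \<forall>l<n. (\<Oplus>\<^bsub>R\<^esub>k\<in>{..<n}. M l k \<otimes>\<^bsub>R\<^esub> c i j k) =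
       (\<Oplus>\<^bsub>R\<^esub>p\<in>{..<n}. \<Oplus>\<^bsub>R\<^esub>q\<in>{..<n}. M p i \<otimes>\<^bsub>R\<^esub> M q j \<otimes>\<^bsub>R\<^esub> c p q l))"

text \<open>
  \<open>M E = E' M\<close>.
\<close>

definition intertwines :: "('r, 'm) ring_scheme \<Rightarrow> nat \<Rightarrow> (nat \<Rightarrow> nat \<Rightarrow> 'r) \<Rightarrow>
    (nat \<Rightarrow> nat \<Rightarrow> 'r) \<Rightarrow> (nat \<Rightarrow> nat \<Rightarrow> 'r) \<Rightarrow> bool" where
  "intertwines R n M E E' \<longleftrightarrow> (\<forall>i<n. \<forall>j<n.
     (\<Oplus>\<^bsub>R\<^esub>k\<in>{..<n}. M i k \<otimes>\<^bsub>R\<^esub> E k j) = (\<Oplus>\<^bsub>R\<^esub>k\<in>{..<n}. E' i k \<otimes>\<^bsub>R\<^esub> M k j))"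

text \<open>
  The matrices \<open>E g\<close> are the projections to the homogeneous components of a grading: they are
  orthogonal idempotents with sum \<open>1\<close>, zero outside the finite set \<open>T\<close>, and the product of elements of
  degrees \<open>g\<close> and \<open>h\<close> has no component in any degree \<open>k \<noteq> g h\<close>. All these are polynomial equations over the ring
  generated by the structure constants.
\<close>

definition grad_mat :: "('r, 'm) ring_scheme \<Rightarrow> nat \<Rightarrow> (nat \<Rightarrow> nat \<Rightarrow> nat \<Rightarrow> 'r) \<Rightarrow>
    ('g, 'l) monoid_scheme \<Rightarrow> 'g set \<Rightarrow> ('g \<Rightarrow> nat \<Rightarrow> nat \<Rightarrow> 'r) \<Rightarrow> bool" where
  "grad_mat R n c G T E \<longleftrightarrow> finite T \<and> T \<subseteq> carrier G \<and>
     (\<forall>g \<in> carrier G. \<forall>i<n. \<forall>j<n. E g i j \<in> carrier R \<and> (g \<notin> T \<longrightarrow> E g i j = \<zero>\<^bsub>R\<^esub>)) \<and>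
     (\<forall>g \<in> carrier G. \<forall>h \<in> carrier G. \<forall>i<n. \<forall>j<n.
       (\<Oplus>\<^bsub>R\<^esub>k\<in>{..<n}. E g i k \<otimes>\<^bsub>R\<^esub> E h k j) = (if g = h then E g i j else \<zero>\<^bsub>R\<^esub>)) \<and>
     (\<forall>i<n. \<forall>j<n. (\<Oplus>\<^bsub>R\<^esub>g\<in>T. E g i j) = (if i = j then \<one>\<^bsub>R\<^esub> else \<zero>\<^bsub>R\<^esub>)) \<and>
     (\<forall>g \<in> carrier G. \<forall>h \<in> carrier G. \<forall>k \<in> carrier G. k \<noteq> g \<otimes>\<^bsub>G\<^esub> h \<longrightarrow>
       (\<forall>i<n. \<forall>j<n. \<forall>l<n. (\<Oplus>\<^bsub>R\<^esub>r\<in>{..<n}. E k l r \<otimes>\<^bsub>R\<^esub>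
         (\<Oplus>\<^bsub>R\<^esub>p\<in>{..<n}. \<Oplus>\<^bsub>R\<^esub>q\<in>{..<n}. E g p i \<otimes>\<^bsub>R\<^esub> E h q j \<otimes>\<^bsub>R\<^esub> c p q r)) = \<zero>\<^bsub>R\<^esub>))"

context based_alg
begin

text \<open>
  The linear map with matrix \<open>M\<close>; \<open>mat\<close> is the matrix of a linear map.
\<close>

definition lin :: "(nat \<Rightarrow> nat \<Rightarrow> 'a) \<Rightarrow> 'c \<Rightarrow> 'c" where
  "lin M v = (\<Oplus>\<^bsub>V\<^esub>i\<in>{..<n}. (\<Oplus>j\<in>{..<n}. M i j \<otimes> \<kappa> v j) \<odot>\<^bsub>V\<^esub> b i)"

definition mat :: "('c \<Rightarrow> 'c) \<Rightarrow> nat \<Rightarrow> nat \<Rightarrow> 'a" where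
  "mat \<phi> i j = \<kappa> (\<phi> (b j)) i"

definition mclosed :: "(nat \<Rightarrow> nat \<Rightarrow> 'a) \<Rightarrow> bool" where
  "mclosed M \<longleftrightarrow> (\<forall>i<n. \<forall>j<n. M i j \<in> carrier R)"

definition linear_map :: "('c \<Rightarrow> 'c) \<Rightarrow> bool" where
  "linear_map \<phi> \<longleftrightarrow> (\<forall>v \<in> carrier V. \<phi> v \<in> carrier V) \<and>
     (\<forall>v \<in> carrier V. \<forall>w \<in> carrier V. \<phi> (v \<oplus>\<^bsub>V\<^esub> w) = \<phi> v \<oplus>\<^bsub>V\<^esub> \<phi> w) \<and>
     (\<forall>r \<in> carrier R. \<forall>v \<in> carrier V. \<phi> (r \<odot>\<^bsub>V\<^esub> v) = r \<odot>\<^bsub>V\<^esub> \<phi> v)"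

lemma linear_mapD:
  assumes "linear_map \<phi>"
  shows "v \<in> carrier V \<Longrightarrow> \<phi> v \<in> carrier V"
    "v \<in> carrier V \<Longrightarrow> w \<in> carrier V \<Longrightarrow> \<phi> (v \<oplus>\<^bsub>V\<^esub> w) = \<phi> v \<oplus>\<^bsub>V\<^esub> \<phi> w"
    "r \<in> carrier R \<Longrightarrow> v \<in> carrier V \<Longrightarrow> \<phi> (r \<odot>\<^bsub>V\<^esub> v) = r \<odot>\<^bsub>V\<^esub> \<phi> v"
  using assms by (auto simp: linear_map_def)

lemma linear_mapI:
  assumes "\<And>v. v \<in> carrier V \<Longrightarrow> \<phi> v \<in> carrier V"
    "\<And>v w. v \<in> carrier V \<Longrightarrow> w \<in> carrier V \<Longrightarrow> \<phi> (v \<oplus>\<^bsub>V\<^esub> w) = \<phi> v \<oplus>\<^bsub>V\<^esub> \<phi> w"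
    "\<And>r v. r \<in> carrier R \<Longrightarrow> v \<in> carrier V \<Longrightarrow> \<phi> (r \<odot>\<^bsub>V\<^esub> v) = r \<odot>\<^bsub>V\<^esub> \<phi> v"
  shows "linear_map \<phi>"
  using assms by (auto simp: linear_map_def)

lemma linear_map_zero: "linear_map \<phi> \<Longrightarrow> \<phi> \<zero>\<^bsub>V\<^esub> = \<zero>\<^bsub>V\<^esub>"
  using linear_mapD(3)[of \<phi> "\<zero>" "\<zero>\<^bsub>V\<^esub>"] linear_mapD(1)[of \<phi> "\<zero>\<^bsub>V\<^esub>"] by (simp add: smult_l_null)

lemma linear_map_finsum:
  assumes "linear_map \<phi>" "f \<in> J \<rightarrow> carrier V"
  shows "\<phi> (\<Oplus>\<^bsub>V\<^esub>j\<in>J. f j) = (\<Oplus>\<^bsub>V\<^esub>j\<in>J. \<phi> (f j))"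
  using assms(2)
proof (induction J rule: infinite_finite_induct)
  case (insert x F)
  then have "f x \<in> carrier V" "f \<in> F \<rightarrow> carrier V" "(\<lambda>j. \<phi> (f j)) \<in> F \<rightarrow> carrier V"
    using linear_mapD(1)[OF assms(1)] by auto
  with insert show ?case using linear_mapD[OF assms(1)] by simp
qed (simp_all add: linear_map_zero[OF assms(1)])

lemma linear_ext:
  assumes "linear_map \<phi>" "linear_map \<psi>" "\<And>j. j < n \<Longrightarrow> \<phi> (b j) = \<psi> (b j)" "v \<in> carrier V"
  shows "\<phi> v = \<psi> v"
proof -
  have c: "(\<lambda>j. \<kappa> v j \<odot>\<^bsub>V\<^esub> b j) \<in> {..<n} \<rightarrow> carrier V"
    using coord_closed[OF assms(4)] b_closed by auto
  have "\<phi> v = (\<Oplus>\<^bsub>V\<^esub>j\<in>{..<n}. \<phi> (\<kappa> v j \<odot>\<^bsub>V\<^esub> b j))"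
    by (subst expand[OF assms(4)]) (rule linear_map_finsum[OF assms(1) c])
  also have "\<dots> = (\<Oplus>\<^bsub>V\<^esub>j\<in>{..<n}. \<psi> (\<kappa> v j \<odot>\<^bsub>V\<^esub> b j))"
    by (rule M.finsum_cong'[OF refl])
       (use assms coord_closed[OF assms(4)] b_closed linear_mapD(1,3)[OF assms(1)] linear_mapD(1,3)[OF assms(2)] in auto)
  also have "\<dots> = \<psi> v"
    by (subst (2) expand[OF assms(4)]) (rule linear_map_finsum[OF assms(2) c, symmetric])
  finally show ?thesis .
qed

lemma bilinear_ext:
  assumes "\<And>w. w \<in> carrier V \<Longrightarrow> linear_map (\<lambda>v. f v w)" "\<And>v. v \<in> carrier V \<Longrightarrow> linear_map (\<lambda>w. f v w)"
    "\<And>w. w \<in> carrier V \<Longrightarrow> linear_map (\<lambda>v. g v w)" "\<And>v. v \<in> carrier V \<Longrightarrow> linear_map (\<lambda>w. g v w)"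
    "\<And>i j. i < n \<Longrightarrow> j < n \<Longrightarrow> f (b i) (b j) = g (b i) (b j)" "v \<in> carrier V" "w \<in> carrier V"
  shows "f v w = g v w"
proof (rule linear_ext[OF assms(1)[OF assms(7)] assms(3)[OF assms(7)] _ assms(6)])
  fix i assume "i < n"
  then show "f (b i) w = g (b i) w"
    by (intro linear_ext[OF assms(2)[of "b i"] assms(4)[of "b i"] assms(5) assms(7)]) (use b_closed in auto)
qed

lemma linear_map_comp: "linear_map \<phi> \<Longrightarrow> linear_map \<psi> \<Longrightarrow> linear_map (\<lambda>v. \<phi> (\<psi> v))"
  by (simp add: linear_map_def)

lemma linear_map_id: "linear_map (\<lambda>v. v)" by (simp add: linear_map_def)

lemma linear_map_const0: "linear_map (\<lambda>v. \<zero>\<^bsub>V\<^esub>)" by (simp add: linear_map_def)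

lemma linear_map_mult:
  "w \<in> carrier V \<Longrightarrow> linear_map (\<lambda>v. v \<otimes>\<^bsub>V\<^esub> w)" "w \<in> carrier V \<Longrightarrow> linear_map (\<lambda>v. w \<otimes>\<^bsub>V\<^esub> v)"
  by (simp_all add: linear_map_def prod_closed prod_l_distr prod_r_distr prod_smult_l prod_smult_r)

lemma linear_map_sum:
  assumes "\<And>g. g \<in> T \<Longrightarrow> linear_map (\<phi> g)"
  shows "linear_map (\<lambda>v. \<Oplus>\<^bsub>V\<^esub>g\<in>T. \<phi> g v)"
proof (rule linear_mapI)
  show "(\<Oplus>\<^bsub>V\<^esub>g\<in>T. \<phi> g v) \<in> carrier V" if "v \<in> carrier V" for v
    using linear_mapD(1)[OF assms] that by (intro M.finsum_closed) auto
  show "(\<Oplus>\<^bsub>V\<^esub>g\<in>T. \<phi> g (v \<oplus>\<^bsub>V\<^esub> w)) = (\<Oplus>\<^bsub>V\<^esub>g\<in>T. \<phi> g v) \<oplus>\<^bsub>V\<^esub> (\<Oplus>\<^bsub>V\<^esub>g\<in>T. \<phi> g w)"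
    if "v \<in> carrier V" "w \<in> carrier V" for v w
  proof -
    have "(\<Oplus>\<^bsub>V\<^esub>g\<in>T. \<phi> g (v \<oplus>\<^bsub>V\<^esub> w)) = (\<Oplus>\<^bsub>V\<^esub>g\<in>T. \<phi> g v \<oplus>\<^bsub>V\<^esub> \<phi> g w)"
      by (rule M.finsum_cong'[OF refl]) (use linear_mapD(1,2)[OF assms] that in auto)
    also have "\<dots> = (\<Oplus>\<^bsub>V\<^esub>g\<in>T. \<phi> g v) \<oplus>\<^bsub>V\<^esub> (\<Oplus>\<^bsub>V\<^esub>g\<in>T. \<phi> g w)"
      by (rule M.finsum_addf) (use linear_mapD(1)[OF assms] that in auto)
    finally show ?thesis .
  qed
  show "(\<Oplus>\<^bsub>V\<^esub>g\<in>T. \<phi> g (r \<odot>\<^bsub>V\<^esub> v)) = r \<odot>\<^bsub>V\<^esub> (\<Oplus>\<^bsub>V\<^esub>g\<in>T. \<phi> g v)"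
    if "r \<in> carrier R" "v \<in> carrier V" for r v
  proof -
    have l: "linear_map (\<lambda>w. r \<odot>\<^bsub>V\<^esub> w)"
      using that(1) by (intro linear_mapI) (auto simp: smult_r_distr m_comm simp flip: smult_assoc1)
    have "(\<Oplus>\<^bsub>V\<^esub>g\<in>T. \<phi> g (r \<odot>\<^bsub>V\<^esub> v)) = (\<Oplus>\<^bsub>V\<^esub>g\<in>T. r \<odot>\<^bsub>V\<^esub> \<phi> g v)"
      by (rule M.finsum_cong'[OF refl]) (use linear_mapD(1,3)[OF assms] that in auto)
    also have "\<dots> = r \<odot>\<^bsub>V\<^esub> (\<Oplus>\<^bsub>V\<^esub>g\<in>T. \<phi> g v)"
      by (rule linear_map_finsum[OF l, symmetric]) (use linear_mapD(1)[OF assms] that in auto)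
    finally show ?thesis .
  qed
qed

lemma lin_coord:
  assumes "mclosed M" "v \<in> carrier V" "i < n"
  shows "\<kappa> (lin M v) i = (\<Oplus>j\<in>{..<n}. M i j \<otimes> \<kappa> v j)"
  unfolding lin_def
  by (rule coord_basis_sum) (use assms coord_closed in \<open>auto simp: mclosed_def intro!: R.finsum_closed\<close>)

lemma lin_closed: "mclosed M \<Longrightarrow> v \<in> carrier V \<Longrightarrow> lin M v \<in> carrier V"
  unfolding lin_def
  by (rule finsum_basis_closed) (use coord_closed in \<open>auto simp: mclosed_def intro!: R.finsum_closed\<close>)

lemma lin_linear:
  assumes "mclosed M" shows "linear_map (lin M)"
proof (rule linear_mapI)
  show "lin M v \<in> carrier V" if "v \<in> carrier V" for v using lin_closed[OF assms that] .
  have mc: "\<And>i j. i < n \<Longrightarrow> j < n \<Longrightarrow> M i j \<in> carrier R" using assms by (simp add: mclosed_def)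
  show "lin M (v \<oplus>\<^bsub>V\<^esub> w) = lin M v \<oplus>\<^bsub>V\<^esub> lin M w" if vw: "v \<in> carrier V" "w \<in> carrier V" for v w
  proof (rule coord_inj)
    fix i assume i: "i < n"
    have "(\<Oplus>j\<in>{..<n}. M i j \<otimes> \<kappa> (v \<oplus>\<^bsub>V\<^esub> w) j) = (\<Oplus>j\<in>{..<n}. M i j \<otimes> \<kappa> v j \<oplus> M i j \<otimes> \<kappa> w j)"
      by (rule R.finsum_cong'[OF refl]) (use i vw mc coord_closed coord_add in \<open>auto simp: r_distr\<close>)
    also have "\<dots> = (\<Oplus>j\<in>{..<n}. M i j \<otimes> \<kappa> v j) \<oplus> (\<Oplus>j\<in>{..<n}. M i j \<otimes> \<kappa> w j)"
      by (rule R.finsum_addf) (use i vw mc coord_closed in auto)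
    finally show "\<kappa> (lin M (v \<oplus>\<^bsub>V\<^esub> w)) i = \<kappa> (lin M v \<oplus>\<^bsub>V\<^esub> lin M w) i"
      using i vw by (simp add: lin_coord[OF assms] coord_add lin_closed[OF assms])
  qed (use vw lin_closed[OF assms] in auto)
  show "lin M (r \<odot>\<^bsub>V\<^esub> v) = r \<odot>\<^bsub>V\<^esub> lin M v" if vw: "r \<in> carrier R" "v \<in> carrier V" for r v
  proof (rule coord_inj)
    fix i assume i: "i < n"
    have "(\<Oplus>j\<in>{..<n}. M i j \<otimes> \<kappa> (r \<odot>\<^bsub>V\<^esub> v) j) = (\<Oplus>j\<in>{..<n}. r \<otimes> (M i j \<otimes> \<kappa> v j))"
      by (rule R.finsum_cong'[OF refl]) (use i vw mc coord_closed coord_smult in \<open>auto simp: m_lcomm\<close>)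
    also have "\<dots> = r \<otimes> (\<Oplus>j\<in>{..<n}. M i j \<otimes> \<kappa> v j)"
      by (rule R.finsum_rdistr[symmetric]) (use i vw mc coord_closed in auto)
    finally show "\<kappa> (lin M (r \<odot>\<^bsub>V\<^esub> v)) i = \<kappa> (r \<odot>\<^bsub>V\<^esub> lin M v) i"
      using i vw by (simp add: lin_coord[OF assms] coord_smult lin_closed[OF assms])
  qed (use vw lin_closed[OF assms] in auto)
qed

lemma finsum_delta:
  assumes "j < n" and that: "\<And>k. k < n \<Longrightarrow> f k \<in> carrier R"
  shows "(\<Oplus>k\<in>{..<n}. f k \<otimes> (if k = j then \<one> else \<zero>)) = f j"
proof -
  have "(\<Oplus>k\<in>{..<n}. f k \<otimes> (if k = j then \<one> else \<zero>)) = (\<Oplus>k\<in>{..<n}. if j = k then f k else \<zero>)"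
    by (rule R.finsum_cong'[OF refl]) (use that in auto)
  also have "\<dots> = f j" by (rule R.finsum_singleton) (use assms that in auto)
  finally show ?thesis .
qed

lemma lin_basis:
  assumes "mclosed M" "i < n" "j < n" shows "\<kappa> (lin M (b j)) i = M i j"
proof -
  have "\<kappa> (lin M (b j)) i = (\<Oplus>k\<in>{..<n}. M i k \<otimes> (if k = j then \<one> else \<zero>))"
    unfolding lin_coord[OF assms(1) b_closed[OF assms(3)] assms(2)]
    by (rule R.finsum_cong'[OF refl]) (use assms coord_basis in \<open>auto simp: mclosed_def\<close>)
  then show ?thesis using finsum_delta[of j "M i"] assms by (simp add: mclosed_def)
qed

lemma mat_closed: "linear_map \<phi> \<Longrightarrow> mclosed (mat \<phi>)"
  using linear_mapD(1) b_closed coord_closed by (simp add: mclosed_def mat_def)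

lemma lin_mat:
  assumes "linear_map \<phi>" "v \<in> carrier V" shows "lin (mat \<phi>) v = \<phi> v"
proof (rule linear_ext[OF lin_linear[OF mat_closed[OF assms(1)]] assms(1) _ assms(2)])
  fix j assume j: "j < n"
  show "lin (mat \<phi>) (b j) = \<phi> (b j)"
    by (rule coord_inj)
       (use j b_closed linear_mapD(1)[OF assms(1)] lin_closed[OF mat_closed[OF assms(1)]] lin_basis[OF mat_closed[OF assms(1)]]
        in \<open>auto simp: mat_def\<close>)
qed

lemma coord_basis_mult:
  assumes "i < n" "j < n" "k < n" shows "\<kappa> (b i \<otimes>\<^bsub>V\<^esub> b j) k = c i j k"
proof -
  have inner: "(\<Oplus>q\<in>{..<n}. \<kappa> (b i) p \<otimes> \<kappa> (b j) q \<otimes> c p q k) = c p j k \<otimes> (if p = i then \<one> else \<zero>)" if p: "p < n" for p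
  proof -
    have "(\<Oplus>q\<in>{..<n}. \<kappa> (b i) p \<otimes> \<kappa> (b j) q \<otimes> c p q k) = (\<Oplus>q\<in>{..<n}. (if p = i then c p q k else \<zero>) \<otimes> (if q = j then \<one> else \<zero>))"
      by (rule R.finsum_cong'[OF refl]) (use assms p c_closed coord_basis in auto)
    also have "\<dots> = (if p = i then c p j k else \<zero>)"
      by (rule finsum_delta) (use assms p c_closed in auto)
    finally show ?thesis using assms p c_closed by auto
  qed
  have "\<kappa> (b i \<otimes>\<^bsub>V\<^esub> b j) k = (\<Oplus>p\<in>{..<n}. c p j k \<otimes> (if p = i then \<one> else \<zero>))"
    unfolding coord_mult[OF b_closed[OF assms(1)] b_closed[OF assms(2)] assms(3)]
    by (rule R.finsum_cong'[OF refl]) (use assms c_closed inner in auto)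
  also have "\<dots> = c i j k" by (rule finsum_delta) (use assms c_closed in auto)
  finally show ?thesis .
qed

lemma lin_lin_coord:
  assumes "mclosed M" "mclosed N" "i < n" "j < n"
  shows "(\<Oplus>k\<in>{..<n}. M i k \<otimes> N k j) = \<kappa> (lin M (lin N (b j))) i"
proof -
  have "\<kappa> (lin M (lin N (b j))) i = (\<Oplus>k\<in>{..<n}. M i k \<otimes> \<kappa> (lin N (b j)) k)"
    using lin_coord[OF assms(1)] lin_closed[OF assms(2)] b_closed assms by simp
  also have "\<dots> = (\<Oplus>k\<in>{..<n}. M i k \<otimes> N k j)"
    by (rule R.finsum_cong'[OF refl]) (use assms lin_basis[OF assms(2)] in \<open>auto simp: mclosed_def\<close>)
  finally show ?thesis by simp
qed

lemma lin_prod_coord: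
  assumes "mclosed M" "mclosed N" "i < n" "j < n" "l < n"
  shows "(\<Oplus>p\<in>{..<n}. \<Oplus>q\<in>{..<n}. M p i \<otimes> N q j \<otimes> c p q l) = \<kappa> (lin M (b i) \<otimes>\<^bsub>V\<^esub> lin N (b j)) l"
proof -
  have "\<kappa> (lin M (b i) \<otimes>\<^bsub>V\<^esub> lin N (b j)) l = (\<Oplus>p\<in>{..<n}. \<Oplus>q\<in>{..<n}. \<kappa> (lin M (b i)) p \<otimes> \<kappa> (lin N (b j)) q \<otimes> c p q l)"
    using lin_closed b_closed assms by (intro coord_mult) auto
  also have "\<dots> = (\<Oplus>p\<in>{..<n}. \<Oplus>q\<in>{..<n}. M p i \<otimes> N q j \<otimes> c p q l)"
    using assms(1,2) unfolding mclosed_def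
    by (intro R.finsum_cong' refl) (auto simp: lin_basis assms c_closed intro!: R.finsum_closed)
  finally show ?thesis by simp
qed

lemma ext_coord_iff:
  assumes "linear_map \<phi>" "linear_map \<psi>"
  shows "(\<forall>i<n. \<forall>j<n. \<kappa> (\<phi> (b j)) i = \<kappa> (\<psi> (b j)) i) \<longleftrightarrow> (\<forall>v \<in> carrier V. \<phi> v = \<psi> v)"
proof
  assume *: "\<forall>i<n. \<forall>j<n. \<kappa> (\<phi> (b j)) i = \<kappa> (\<psi> (b j)) i"
  have "\<phi> (b j) = \<psi> (b j)" if "j < n" for j
    by (rule coord_inj) (use * that b_closed linear_mapD(1) assms in auto)
  then show "\<forall>v \<in> carrier V. \<phi> v = \<psi> v" using linear_ext[OF assms] by blast
next
  assume "\<forall>v \<in> carrier V. \<phi> v = \<psi> v"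
  then show "\<forall>i<n. \<forall>j<n. \<kappa> (\<phi> (b j)) i = \<kappa> (\<psi> (b j)) i" using b_closed by simp
qed

lemma ext_coord_iff2:
  assumes "\<And>w. w \<in> carrier V \<Longrightarrow> linear_map (\<lambda>v. f v w)" "\<And>v. v \<in> carrier V \<Longrightarrow> linear_map (\<lambda>w. f v w)"
    "\<And>w. w \<in> carrier V \<Longrightarrow> linear_map (\<lambda>v. g v w)" "\<And>v. v \<in> carrier V \<Longrightarrow> linear_map (\<lambda>w. g v w)"
  shows "(\<forall>i<n. \<forall>j<n. \<forall>l<n. \<kappa> (f (b i) (b j)) l = \<kappa> (g (b i) (b j)) l) \<longleftrightarrow>
    (\<forall>v \<in> carrier V. \<forall>w \<in> carrier V. f v w = g v w)"
proof
  assume *: "\<forall>i<n. \<forall>j<n. \<forall>l<n. \<kappa> (f (b i) (b j)) l = \<kappa> (g (b i) (b j)) l"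
  have "f (b i) (b j) = g (b i) (b j)" if "i < n" "j < n" for i j
    by (rule coord_inj) (use * that b_closed linear_mapD(1)[OF assms(1)] linear_mapD(1)[OF assms(3)] in auto)
  then show "\<forall>v \<in> carrier V. \<forall>w \<in> carrier V. f v w = g v w" using bilinear_ext[OF assms] by blast
next
  assume "\<forall>v \<in> carrier V. \<forall>w \<in> carrier V. f v w = g v w"
  then show "\<forall>i<n. \<forall>j<n. \<forall>l<n. \<kappa> (f (b i) (b j)) l = \<kappa> (g (b i) (b j)) l" using b_closed by simp
qed

lemma aut_mat_iff:
  "aut_mat R n c M N \<longleftrightarrow> mclosed M \<and> mclosed N \<and>
    (\<forall>v \<in> carrier V. lin M (lin N v) = v) \<and> (\<forall>v \<in> carrier V. lin N (lin M v) = v) \<and>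
    (\<forall>v \<in> carrier V. \<forall>w \<in> carrier V. lin M (v \<otimes>\<^bsub>V\<^esub> w) = lin M v \<otimes>\<^bsub>V\<^esub> lin M w)"
proof (cases "mclosed M \<and> mclosed N")
  case True
  then have M: "mclosed M" and N: "mclosed N" by auto
  note lM = lin_linear[OF M] and lN = lin_linear[OF N]
  have 1: "(\<forall>i<n. \<forall>j<n. (\<Oplus>k\<in>{..<n}. M i k \<otimes> N k j) = (if i = j then \<one> else \<zero>)) \<longleftrightarrow>
      (\<forall>v \<in> carrier V. lin M (lin N v) = v)"
    using ext_coord_iff[OF linear_map_comp[OF lM lN] linear_map_id] by (simp add: lin_lin_coord M N coord_basis)
  have 2: "(\<forall>i<n. \<forall>j<n. (\<Oplus>k\<in>{..<n}. N i k \<otimes> M k j) = (if i = j then \<one> else \<zero>)) \<longleftrightarrow>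
      (\<forall>v \<in> carrier V. lin N (lin M v) = v)"
    using ext_coord_iff[OF linear_map_comp[OF lN lM] linear_map_id] by (simp add: lin_lin_coord M N coord_basis)
  have 3: "(\<Oplus>k\<in>{..<n}. M l k \<otimes> c i j k) = \<kappa> (lin M (b i \<otimes>\<^bsub>V\<^esub> b j)) l" if "i < n" "j < n" "l < n" for i j l
  proof -
    have "\<kappa> (lin M (b i \<otimes>\<^bsub>V\<^esub> b j)) l = (\<Oplus>k\<in>{..<n}. M l k \<otimes> \<kappa> (b i \<otimes>\<^bsub>V\<^esub> b j) k)"
      using that b_closed prod_closed by (intro lin_coord[OF M]) auto
    also have "\<dots> = (\<Oplus>k\<in>{..<n}. M l k \<otimes> c i j k)"
      by (rule R.finsum_cong'[OF refl]) (use that M coord_basis_mult c_closed in \<open>auto simp: mclosed_def\<close>)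
    finally show ?thesis by simp
  qed
  have 4: "(\<forall>i<n. \<forall>j<n. \<forall>l<n. \<kappa> (lin M (b i \<otimes>\<^bsub>V\<^esub> b j)) l = \<kappa> (lin M (b i) \<otimes>\<^bsub>V\<^esub> lin M (b j)) l) \<longleftrightarrow>
     (\<forall>v \<in> carrier V. \<forall>w \<in> carrier V. lin M (v \<otimes>\<^bsub>V\<^esub> w) = lin M v \<otimes>\<^bsub>V\<^esub> lin M w)"
    by (rule ext_coord_iff2)
       (auto intro!: linear_map_comp[OF lM] linear_map_comp[OF _ lM] linear_map_mult lin_closed[OF M])
  show ?thesis unfolding aut_mat_def 1 2 4[symmetric] using M N
    by (simp add: 3 lin_prod_coord mclosed_def)
next
  case False
  then show ?thesis by (auto simp: aut_mat_def mclosed_def)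
qed

lemma intertwines_iff:
  assumes "mclosed M" "mclosed E" "mclosed E'"
  shows "intertwines R n M E E' \<longleftrightarrow> (\<forall>v \<in> carrier V. lin M (lin E v) = lin E' (lin M v))"
  unfolding intertwines_def
  using ext_coord_iff[OF linear_map_comp[OF lin_linear lin_linear] linear_map_comp[OF lin_linear lin_linear], OF assms(1,2,3,1)]
  by (simp add: lin_lin_coord assms)

text \<open>
  The same as \<open>grad_mat\<close>, for linear maps in place of matrices.
\<close>

definition grad_ops :: "('g, 'l) monoid_scheme \<Rightarrow> 'g set \<Rightarrow> ('g \<Rightarrow> 'c \<Rightarrow> 'c) \<Rightarrow> bool" where
  "grad_ops G T e \<longleftrightarrow> finite T \<and> T \<subseteq> carrier G \<and> (\<forall>g \<in> carrier G. linear_map (e g)) \<and>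
     (\<forall>g \<in> carrier G - T. \<forall>v \<in> carrier V. e g v = \<zero>\<^bsub>V\<^esub>) \<and>
     (\<forall>g \<in> carrier G. \<forall>h \<in> carrier G. \<forall>v \<in> carrier V. e g (e h v) = (if g = h then e g v else \<zero>\<^bsub>V\<^esub>)) \<and>
     (\<forall>v \<in> carrier V. (\<Oplus>\<^bsub>V\<^esub>g\<in>T. e g v) = v) \<and>
     (\<forall>g \<in> carrier G. \<forall>h \<in> carrier G. \<forall>k \<in> carrier G. k \<noteq> g \<otimes>\<^bsub>G\<^esub> h \<longrightarrow>
       (\<forall>v \<in> carrier V. \<forall>w \<in> carrier V. e k (e g v \<otimes>\<^bsub>V\<^esub> e h w) = \<zero>\<^bsub>V\<^esub>))"

lemma grad_mat_iff:
  assumes cl: "\<And>g. g \<in> carrier G \<Longrightarrow> mclosed (E g)"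
  shows "grad_mat R n c G T E \<longleftrightarrow> grad_ops G T (\<lambda>g. lin (E g))"
proof -
  note l = lin_linear[OF cl]
  have 1: "(\<forall>i<n. \<forall>j<n. g \<notin> T \<longrightarrow> E g i j = \<zero>) \<longleftrightarrow> (g \<in> carrier G - T \<longrightarrow> (\<forall>v \<in> carrier V. lin (E g) v = \<zero>\<^bsub>V\<^esub>))"
    if "g \<in> carrier G" for g
    using ext_coord_iff[OF l[OF that] linear_map_const0] that by (simp add: lin_basis cl coord_zero) blast
  have 2: "(\<forall>i<n. \<forall>j<n. (\<Oplus>k\<in>{..<n}. E g i k \<otimes> E h k j) = (if g = h then E g i j else \<zero>)) \<longleftrightarrow>
      (\<forall>v \<in> carrier V. lin (E g) (lin (E h) v) = (if g = h then lin (E g) v else \<zero>\<^bsub>V\<^esub>))"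
    if gh: "g \<in> carrier G" "h \<in> carrier G" for g h
  proof -
    have "linear_map (\<lambda>v. if g = h then lin (E g) v else \<zero>\<^bsub>V\<^esub>)"
      using l[OF gh(1)] linear_map_const0 by (cases "g = h") auto
    from ext_coord_iff[OF linear_map_comp[OF l[OF gh(1)] l[OF gh(2)]] this]
    show ?thesis using gh by (auto simp: lin_lin_coord lin_basis cl coord_zero)
  qed
  have 3: "(\<forall>i<n. \<forall>j<n. (\<Oplus>g\<in>T. E g i j) = (if i = j then \<one> else \<zero>)) \<longleftrightarrow>
      (\<forall>v \<in> carrier V. (\<Oplus>\<^bsub>V\<^esub>g\<in>T. lin (E g) v) = v)" if T: "T \<subseteq> carrier G"
  proof -
    have "\<kappa> (\<Oplus>\<^bsub>V\<^esub>g\<in>T. lin (E g) (b j)) i = (\<Oplus>g\<in>T. E g i j)" if ij: "i < n" "j < n" for i j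
    proof -
      have "\<kappa> (\<Oplus>\<^bsub>V\<^esub>g\<in>T. lin (E g) (b j)) i = (\<Oplus>g\<in>T. \<kappa> (lin (E g) (b j)) i)"
        using T ij b_closed lin_closed cl by (intro coord_finsum) auto
      also have "\<dots> = (\<Oplus>g\<in>T. E g i j)"
        by (rule R.finsum_cong'[OF refl]) (use T ij cl lin_basis in \<open>auto simp: mclosed_def\<close>)
      finally show ?thesis .
    qed
    moreover have "linear_map (\<lambda>v. \<Oplus>\<^bsub>V\<^esub>g\<in>T. lin (E g) v)" using T l by (intro linear_map_sum) auto
    from ext_coord_iff[OF this linear_map_id]
    have "(\<forall>i<n. \<forall>j<n. \<kappa> (\<Oplus>\<^bsub>V\<^esub>g\<in>T. lin (E g) (b j)) i = \<kappa> (b j) i) \<longleftrightarrow> (\<forall>v \<in> carrier V. (\<Oplus>\<^bsub>V\<^esub>g\<in>T. lin (E g) v) = v)" .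
    ultimately show ?thesis by (simp add: coord_basis)
  qed
  have 4: "(\<forall>i<n. \<forall>j<n. \<forall>l<n. (\<Oplus>r\<in>{..<n}. E k l r \<otimes>
         (\<Oplus>p\<in>{..<n}. \<Oplus>q\<in>{..<n}. E g p i \<otimes> E h q j \<otimes> c p q r)) = \<zero>) \<longleftrightarrow>
      (\<forall>v \<in> carrier V. \<forall>w \<in> carrier V. lin (E k) (lin (E g) v \<otimes>\<^bsub>V\<^esub> lin (E h) w) = \<zero>\<^bsub>V\<^esub>)"
    if gh: "g \<in> carrier G" "h \<in> carrier G" "k \<in> carrier G" for g h k
  proof -
    have "(\<Oplus>r\<in>{..<n}. E k l r \<otimes> (\<Oplus>p\<in>{..<n}. \<Oplus>q\<in>{..<n}. E g p i \<otimes> E h q j \<otimes> c p q r))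
        = \<kappa> (lin (E k) (lin (E g) (b i) \<otimes>\<^bsub>V\<^esub> lin (E h) (b j))) l" if ij: "i < n" "j < n" "l < n" for i j l
    proof -
      have m: "lin (E g) (b i) \<otimes>\<^bsub>V\<^esub> lin (E h) (b j) \<in> carrier V"
        using ij gh b_closed lin_closed cl prod_closed by simp
      have "\<kappa> (lin (E k) (lin (E g) (b i) \<otimes>\<^bsub>V\<^esub> lin (E h) (b j))) l =
          (\<Oplus>r\<in>{..<n}. E k l r \<otimes> \<kappa> (lin (E g) (b i) \<otimes>\<^bsub>V\<^esub> lin (E h) (b j)) r)"
        by (rule lin_coord[OF cl[OF gh(3)] m ij(3)])
      also have "\<dots> = (\<Oplus>r\<in>{..<n}. E k l r \<otimes> (\<Oplus>p\<in>{..<n}. \<Oplus>q\<in>{..<n}. E g p i \<otimes> E h q j \<otimes> c p q r))"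
        by (rule R.finsum_cong'[OF refl])
           (use gh ij cl coord_closed[OF m] in \<open>auto simp: lin_prod_coord mclosed_def\<close>)
      finally show ?thesis by simp
    qed
    moreover have "(\<forall>i<n. \<forall>j<n. \<forall>l<n. \<kappa> (lin (E k) (lin (E g) (b i) \<otimes>\<^bsub>V\<^esub> lin (E h) (b j))) l = \<kappa> \<zero>\<^bsub>V\<^esub> l) \<longleftrightarrow>
      (\<forall>v \<in> carrier V. \<forall>w \<in> carrier V. lin (E k) (lin (E g) v \<otimes>\<^bsub>V\<^esub> lin (E h) w) = \<zero>\<^bsub>V\<^esub>)"
      by (rule ext_coord_iff2)
         (use gh in \<open>auto intro!: linear_map_comp[OF l] linear_map_comp[OF _ l] linear_map_mult lin_closed[OF cl] linear_map_const0\<close>)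
    ultimately show ?thesis by (simp add: coord_zero)
  qed
  show ?thesis
  proof (cases "T \<subseteq> carrier G")
    case True
    have c0: "(\<forall>g\<in>carrier G. \<forall>i<n. \<forall>j<n. E g i j \<in> carrier R \<and> (g \<notin> T \<longrightarrow> E g i j = \<zero>)) \<longleftrightarrow>
        (\<forall>g\<in>carrier G - T. \<forall>v\<in>carrier V. lin (E g) v = \<zero>\<^bsub>V\<^esub>)"
      using 1 cl unfolding mclosed_def by (metis DiffE DiffI)
    show ?thesis unfolding grad_mat_def grad_ops_def c0 3[OF True] using 2 4 l by (simp cong: conj_cong)
  qed (simp add: grad_mat_def grad_ops_def)
qed

end

section \<open>Comparing two gradings\<close>

context based_alg
begin

lemma grad_opsD:
  assumes "grad_ops G T e"
  shows "finite T" "T \<subseteq> carrier G" "\<And>g. g \<in> carrier G \<Longrightarrow> linear_map (e g)"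
    "\<And>g v. g \<in> carrier G \<Longrightarrow> v \<in> carrier V \<Longrightarrow> e g v \<in> carrier V"
    "\<And>g v. g \<in> carrier G \<Longrightarrow> g \<notin> T \<Longrightarrow> v \<in> carrier V \<Longrightarrow> e g v = \<zero>\<^bsub>V\<^esub>"
    "\<And>g h v. g \<in> carrier G \<Longrightarrow> h \<in> carrier G \<Longrightarrow> v \<in> carrier V \<Longrightarrow> e g (e h v) = (if g = h then e g v else \<zero>\<^bsub>V\<^esub>)"
    "\<And>v. v \<in> carrier V \<Longrightarrow> (\<Oplus>\<^bsub>V\<^esub>g\<in>T. e g v) = v"
    "\<And>g h k v w. g \<in> carrier G \<Longrightarrow> h \<in> carrier G \<Longrightarrow> k \<in> carrier G \<Longrightarrow> k \<noteq> g \<otimes>\<^bsub>G\<^esub> h \<Longrightarrow>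
      v \<in> carrier V \<Longrightarrow> w \<in> carrier V \<Longrightarrow> e k (e g v \<otimes>\<^bsub>V\<^esub> e h w) = \<zero>\<^bsub>V\<^esub>"
  using assms linear_mapD(1) unfolding grad_ops_def by blast+

lemma linear_map_minus:
  assumes "linear_map \<phi>" "v \<in> carrier V" "w \<in> carrier V"
  shows "\<phi> (v \<ominus>\<^bsub>V\<^esub> w) = \<phi> v \<ominus>\<^bsub>V\<^esub> \<phi> w"
proof -
  have m: "\<phi> v \<in> carrier V" "\<phi> w \<in> carrier V" "\<phi> (v \<ominus>\<^bsub>V\<^esub> w) \<in> carrier V"
    using linear_mapD(1)[OF assms(1)] assms by auto
  have "\<phi> (v \<ominus>\<^bsub>V\<^esub> w) \<oplus>\<^bsub>V\<^esub> \<phi> w = \<phi> (v \<ominus>\<^bsub>V\<^esub> w \<oplus>\<^bsub>V\<^esub> w)"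
    using linear_mapD(2)[OF assms(1), of "v \<ominus>\<^bsub>V\<^esub> w" w] assms by simp
  also have "v \<ominus>\<^bsub>V\<^esub> w \<oplus>\<^bsub>V\<^esub> w = v" using assms by (simp add: M.minus_eq M.a_assoc M.l_neg)
  finally have "\<phi> (v \<ominus>\<^bsub>V\<^esub> w) \<oplus>\<^bsub>V\<^esub> \<phi> w = \<phi> v" .
  then have "\<phi> v \<ominus>\<^bsub>V\<^esub> \<phi> w = \<phi> (v \<ominus>\<^bsub>V\<^esub> w) \<oplus>\<^bsub>V\<^esub> \<phi> w \<ominus>\<^bsub>V\<^esub> \<phi> w" by simp
  then show ?thesis using m by (simp add: M.minus_eq M.a_assoc M.r_neg)
qed

lemma minus_zeroD:
  assumes "v \<in> carrier V" "w \<in> carrier V" "v \<ominus>\<^bsub>V\<^esub> w = \<zero>\<^bsub>V\<^esub>"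
  shows "v = w"
proof -
  have "v = v \<ominus>\<^bsub>V\<^esub> w \<oplus>\<^bsub>V\<^esub> w" using assms(1,2) by (simp add: M.minus_eq M.a_assoc M.l_neg)
  then show ?thesis using assms by simp
qed

lemma grad_ops_single:
  assumes "grad_ops G T e" "k \<in> carrier G" "v \<in> carrier V"
    "\<And>g. g \<in> carrier G \<Longrightarrow> g \<noteq> k \<Longrightarrow> e g v = \<zero>\<^bsub>V\<^esub>"
  shows "e k v = v"
proof -
  note e = grad_opsD[OF assms(1)]
  have eq: "v = (\<Oplus>\<^bsub>V\<^esub>g\<in>T. if k = g then e g v else \<zero>\<^bsub>V\<^esub>)"
    by (subst e(7)[OF assms(3), symmetric], rule M.finsum_cong'[OF refl])
       (use assms e(2,4) in auto)
  show ?thesis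
  proof (cases "k \<in> T")
    case True
    have "(\<Oplus>\<^bsub>V\<^esub>g\<in>T. if k = g then e g v else \<zero>\<^bsub>V\<^esub>) = e k v"
      by (rule M.finsum_singleton[OF True e(1)]) (use assms e(2,4) in auto)
    then show ?thesis using eq by simp
  next
    case False
    have "(\<Oplus>\<^bsub>V\<^esub>g\<in>T. if k = g then e g v else \<zero>\<^bsub>V\<^esub>) = (\<Oplus>\<^bsub>V\<^esub>g\<in>T. \<zero>\<^bsub>V\<^esub>)"
      by (rule M.finsum_cong'[OF refl]) (use False in auto)
    then have "v = \<zero>\<^bsub>V\<^esub>" using eq by simp
    then show ?thesis using linear_map_zero[OF e(3)[OF assms(2)]] by simp
  qed
qed

lemma grad_ops_prod:
  assumes "monoid G" "grad_ops G T e" "g \<in> carrier G" "h \<in> carrier G" "v \<in> carrier V" "w \<in> carrier V"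
  shows "e (g \<otimes>\<^bsub>G\<^esub> h) (e g v \<otimes>\<^bsub>V\<^esub> e h w) = e g v \<otimes>\<^bsub>V\<^esub> e h w"
proof -
  note e = grad_opsD[OF assms(2)]
  show ?thesis
    by (rule grad_ops_single[OF assms(2)])
       (use assms e(4,8) prod_closed monoid.m_closed[OF assms(1)] in auto)
qed

lemma grad_ops_ext:
  assumes "grad_ops G T e" "linear_map \<phi>" "linear_map \<psi>"
    "\<And>g v. g \<in> T \<Longrightarrow> v \<in> carrier V \<Longrightarrow> \<phi> (e g v) = \<psi> (e g v)" "v \<in> carrier V"
  shows "\<phi> v = \<psi> v"
proof -
  note e = grad_opsD[OF assms(1)]
  have c: "(\<lambda>g. e g v) \<in> T \<rightarrow> carrier V" using e(2,4) assms(5) by auto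
  have "\<phi> v = (\<Oplus>\<^bsub>V\<^esub>g\<in>T. \<phi> (e g v))"
    using linear_map_finsum[OF assms(2) c] e(7)[OF assms(5)] by simp
  also have "\<dots> = (\<Oplus>\<^bsub>V\<^esub>g\<in>T. \<psi> (e g v))"
    by (rule M.finsum_cong'[OF refl]) (use assms c linear_mapD(1)[OF assms(3)] in auto)
  also have "\<dots> = \<psi> v"
    using linear_map_finsum[OF assms(3) c] e(7)[OF assms(5)] by simp
  finally show ?thesis .
qed

text \<open>
  For two gradings with projections \<open>e g\<close> and \<open>e' g\<close>, the map \<open>\<Sum> e g e' g\<close> carries components of
  the second to components of the first, so it intertwines the projections. If the two families agree modulo a square-zero
  ideal of scalars, then it is an automorphism: it is then invertible, and it respects products.
\<close>

definition gtrans :: "'g set \<Rightarrow> ('g \<Rightarrow> 'c \<Rightarrow> 'c) \<Rightarrow> ('g \<Rightarrow> 'c \<Rightarrow> 'c) \<Rightarrow> 'c \<Rightarrow> 'c" where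
  "gtrans T e e' v = (\<Oplus>\<^bsub>V\<^esub>g\<in>T. e g (e' g v))"

lemma gtrans_linear:
  assumes "grad_ops G T e" "grad_ops G T e'"
  shows "linear_map (gtrans T e e')"
proof -
  have "linear_map (\<lambda>v. \<Oplus>\<^bsub>V\<^esub>g\<in>T. e g (e' g v))"
  proof (rule linear_map_sum)
    fix g assume "g \<in> T"
    then have "g \<in> carrier G" using grad_opsD(2)[OF assms(1)] by blast
    then show "linear_map (\<lambda>v. e g (e' g v))"
      by (intro linear_map_comp[OF grad_opsD(3)[OF assms(1)] grad_opsD(3)[OF assms(2)]])
  qed
  moreover have "gtrans T e e' = (\<lambda>v. \<Oplus>\<^bsub>V\<^esub>g\<in>T. e g (e' g v))" by (simp add: gtrans_def fun_eq_iff)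
  ultimately show ?thesis by simp
qed

lemma gtrans_hom:
  assumes "grad_ops G T e" "grad_ops G T e'" "h \<in> carrier G" "v \<in> carrier V"
  shows "gtrans T e e' (e' h v) = e h (e' h v)"
proof (cases "h \<in> T")
  note e = grad_opsD[OF assms(1)] and e' = grad_opsD[OF assms(2)]
  case True
  have "gtrans T e e' (e' h v) = (\<Oplus>\<^bsub>V\<^esub>g\<in>T. if h = g then e g (e' h v) else \<zero>\<^bsub>V\<^esub>)"
    unfolding gtrans_def
  proof (rule M.finsum_cong'[OF refl])
    fix g assume "g \<in> T"
    then have g: "g \<in> carrier G" using e(2) by blast
    show "e g (e' g (e' h v)) = (if h = g then e g (e' h v) else \<zero>\<^bsub>V\<^esub>)"
      unfolding e'(6)[OF g assms(3,4)] using linear_map_zero[OF e(3)[OF g]] by simp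
  qed (use assms e(2,4) e'(4) in auto)
  also have "\<dots> = e h (e' h v)"
    by (rule M.finsum_singleton[OF True e(1)]) (use assms e(2,4) e'(4) in auto)
  finally show ?thesis .
next
  note e = grad_opsD[OF assms(1)] and e' = grad_opsD[OF assms(2)]
  case False
  show ?thesis
    unfolding e'(5)[OF assms(3) False assms(4)] linear_map_zero[OF e(3)[OF assms(3)]]
    by (rule linear_map_zero[OF gtrans_linear[OF assms(1,2)]])
qed

lemma gtrans_intertwines:
  assumes "grad_ops G T e" "grad_ops G T e'" "h \<in> carrier G" "v \<in> carrier V"
  shows "gtrans T e e' (e' h v) = e h (gtrans T e e' v)"
proof (rule grad_ops_ext[OF assms(2) _ _ _ assms(4)])
  note e = grad_opsD[OF assms(1)] and e' = grad_opsD[OF assms(2)]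
  note l = gtrans_linear[OF assms(1,2)]
  show "linear_map (\<lambda>v. gtrans T e e' (e' h v))" by (rule linear_map_comp[OF l e'(3)[OF assms(3)]])
  show "linear_map (\<lambda>v. e h (gtrans T e e' v))" by (rule linear_map_comp[OF e(3)[OF assms(3)] l])
  fix g v assume g: "g \<in> T" and v: "v \<in> carrier V"
  have gG: "g \<in> carrier G" using g e(2) by blast
  show "gtrans T e e' (e' h (e' g v)) = e h (gtrans T e e' (e' g v))"
    unfolding gtrans_hom[OF assms(1,2) gG v] gtrans_hom[OF assms(1-3) e'(4)[OF gG v]]
    using e'(6)[OF assms(3) gG v] e(6)[OF assms(3) gG e'(4)[OF gG v]] linear_map_zero[OF e(3)[OF assms(3)]] by auto
qed

text \<open>
  \<open>W\<close> stands for the elements with coordinates in the square-zero ideal. On \<open>W\<close> the two families of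
  projections agree, because their difference has coefficients in the ideal.
\<close>

lemma gtrans_inverse:
  assumes "grad_ops G T e" "grad_ops G T e'"
    and close: "\<And>g v. g \<in> carrier G \<Longrightarrow> v \<in> carrier V \<Longrightarrow> e g v \<ominus>\<^bsub>V\<^esub> e' g v \<in> W"
    and W: "W \<subseteq> carrier V" and sq: "\<And>g w. g \<in> carrier G \<Longrightarrow> w \<in> W \<Longrightarrow> e g w = e' g w"
    and v: "v \<in> carrier V"
  shows "gtrans T e e' (gtrans T e' e v) = v"
proof (rule grad_ops_ext[OF assms(1) _ linear_map_id _ v])
  note e = grad_opsD[OF assms(1)] and e' = grad_opsD[OF assms(2)]
  show "linear_map (\<lambda>v. gtrans T e e' (gtrans T e' e v))"
    by (rule linear_map_comp[OF gtrans_linear[OF assms(1,2)] gtrans_linear[OF assms(2,1)]])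
  fix h v assume h: "h \<in> T" and v: "v \<in> carrier V"
  have hG: "h \<in> carrier G" using h e(2) by blast
  let ?x = "e h v"
  have x: "?x \<in> carrier V" "e' h ?x \<in> carrier V" using e(4) e'(4) hG v by auto
  have "e h ?x = ?x" using e(6)[OF hG hG v] by simp
  then have w: "?x \<ominus>\<^bsub>V\<^esub> e' h ?x \<in> W" using close[OF hG x(1)] by simp
  have "e h (?x \<ominus>\<^bsub>V\<^esub> e' h ?x) = e' h (?x \<ominus>\<^bsub>V\<^esub> e' h ?x)" using sq[OF hG w] .
  also have "\<dots> = e' h ?x \<ominus>\<^bsub>V\<^esub> e' h (e' h ?x)" by (rule linear_map_minus[OF e'(3)[OF hG] x])
  also have "\<dots> = \<zero>\<^bsub>V\<^esub>" using e'(6)[OF hG hG x(1)] x by (simp add: M.minus_eq M.r_neg)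
  finally have "e h ?x \<ominus>\<^bsub>V\<^esub> e h (e' h ?x) = \<zero>\<^bsub>V\<^esub>" using linear_map_minus[OF e(3)[OF hG] x] by simp
  then have "e h (e' h ?x) = ?x"
    using minus_zeroD[OF e(4)[OF hG x(1)] e(4)[OF hG x(2)]] \<open>e h ?x = ?x\<close> by simp
  then show "gtrans T e e' (gtrans T e' e (e h v)) = e h v"
    using gtrans_hom[OF assms(2,1) hG v] gtrans_hom[OF assms(1,2) hG x(1)] by simp
qed

text \<open>
  For \<open>v\<close> of degree \<open>g\<close> and \<open>w\<close> of degree \<open>h\<close> in the second grading, write \<open>v = e g v + v'\<close> and \<open>w = e h w + w'\<close>.
  The errors \<open>v'\<close> and \<open>w'\<close> lie in \<open>W\<close>, so \<open>v' w' = 0\<close>; and \<open>e (g h)\<close> kills \<open>v' (e h w)\<close> and \<open>(e g v) w'\<close>, as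
  \<open>v'\<close> has no component of degree \<open>g\<close> and \<open>w'\<close> none of degree \<open>h\<close>.
\<close>

lemma gtrans_mult:
  assumes G: "group G" and "grad_ops G T e" "grad_ops G T e'"
    and close: "\<And>g v. g \<in> carrier G \<Longrightarrow> v \<in> carrier V \<Longrightarrow> e' g v \<ominus>\<^bsub>V\<^esub> e g v \<in> W"
    and W: "W \<subseteq> carrier V"
    and WW: "\<And>w w'. w \<in> W \<Longrightarrow> w' \<in> W \<Longrightarrow> w \<otimes>\<^bsub>V\<^esub> w' = \<zero>\<^bsub>V\<^esub>"
    and vw: "v \<in> carrier V" "w \<in> carrier V"
  shows "gtrans T e e' (v \<otimes>\<^bsub>V\<^esub> w) = gtrans T e e' v \<otimes>\<^bsub>V\<^esub> gtrans T e e' w"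
proof -
  interpret G: group G by fact
  note e = grad_opsD[OF assms(2)] and e' = grad_opsD[OF assms(3)]
  let ?\<phi> = "gtrans T e e'"
  have lin\<phi>: "linear_map ?\<phi>" using gtrans_linear[OF assms(2,3)] .
  note \<phi>c = linear_mapD(1)[OF lin\<phi>]
  have kill_l: "e (g \<otimes>\<^bsub>G\<^esub> h) (u \<otimes>\<^bsub>V\<^esub> e h y) = \<zero>\<^bsub>V\<^esub>"
    if gh: "g \<in> carrier G" "h \<in> carrier G" and u: "u \<in> carrier V" "e g u = \<zero>\<^bsub>V\<^esub>" and y: "y \<in> carrier V" for g h u y
  proof -
    have k: "g \<otimes>\<^bsub>G\<^esub> h \<in> carrier G" using gh by simp
    have uc: "(\<lambda>g'. e g' u) \<in> T \<rightarrow> carrier V" using e(2,4) u(1) by auto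
    have l: "linear_map (\<lambda>u. e (g \<otimes>\<^bsub>G\<^esub> h) (u \<otimes>\<^bsub>V\<^esub> e h y))"
      by (rule linear_map_comp[OF e(3)[OF k] linear_map_mult(1)[OF e(4)[OF gh(2) y]]])
    have "e (g \<otimes>\<^bsub>G\<^esub> h) (u \<otimes>\<^bsub>V\<^esub> e h y) = (\<Oplus>\<^bsub>V\<^esub>g'\<in>T. e (g \<otimes>\<^bsub>G\<^esub> h) (e g' u \<otimes>\<^bsub>V\<^esub> e h y))"
      using linear_map_finsum[OF l uc] unfolding e(7)[OF u(1)] .
    also have "\<dots> = (\<Oplus>\<^bsub>V\<^esub>g'\<in>T. \<zero>\<^bsub>V\<^esub>)"
    proof (rule M.finsum_cong'[OF refl])
      fix g' assume "g' \<in> T"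
      then have g': "g' \<in> carrier G" using e(2) by blast
      show "e (g \<otimes>\<^bsub>G\<^esub> h) (e g' u \<otimes>\<^bsub>V\<^esub> e h y) = \<zero>\<^bsub>V\<^esub>"
      proof (cases "g' = g")
        case True
        then show ?thesis using u(2) linear_map_zero[OF l] by simp
      next
        case False
        then have "g \<otimes>\<^bsub>G\<^esub> h \<noteq> g' \<otimes>\<^bsub>G\<^esub> h" using gh g' by simp
        then show ?thesis using e(8)[OF g' gh(2) k _ u(1) y] by simp
      qed
    qed auto
    finally show ?thesis by simp
  qed
  have kill_r: "e (g \<otimes>\<^bsub>G\<^esub> h) (e g y \<otimes>\<^bsub>V\<^esub> u) = \<zero>\<^bsub>V\<^esub>"
    if gh: "g \<in> carrier G" "h \<in> carrier G" and u: "u \<in> carrier V" "e h u = \<zero>\<^bsub>V\<^esub>" and y: "y \<in> carrier V" for g h u y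
  proof -
    have k: "g \<otimes>\<^bsub>G\<^esub> h \<in> carrier G" using gh by simp
    have uc: "(\<lambda>g'. e g' u) \<in> T \<rightarrow> carrier V" using e(2,4) u(1) by auto
    have l: "linear_map (\<lambda>u. e (g \<otimes>\<^bsub>G\<^esub> h) (e g y \<otimes>\<^bsub>V\<^esub> u))"
      by (rule linear_map_comp[OF e(3)[OF k] linear_map_mult(2)[OF e(4)[OF gh(1) y]]])
    have "e (g \<otimes>\<^bsub>G\<^esub> h) (e g y \<otimes>\<^bsub>V\<^esub> u) = (\<Oplus>\<^bsub>V\<^esub>h'\<in>T. e (g \<otimes>\<^bsub>G\<^esub> h) (e g y \<otimes>\<^bsub>V\<^esub> e h' u))"
      using linear_map_finsum[OF l uc] unfolding e(7)[OF u(1)] .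
    also have "\<dots> = (\<Oplus>\<^bsub>V\<^esub>h'\<in>T. \<zero>\<^bsub>V\<^esub>)"
    proof (rule M.finsum_cong'[OF refl])
      fix h' assume "h' \<in> T"
      then have h': "h' \<in> carrier G" using e(2) by blast
      show "e (g \<otimes>\<^bsub>G\<^esub> h) (e g y \<otimes>\<^bsub>V\<^esub> e h' u) = \<zero>\<^bsub>V\<^esub>"
      proof (cases "h' = h")
        case True
        then show ?thesis using u(2) linear_map_zero[OF l] by simp
      next
        case False
        then have "g \<otimes>\<^bsub>G\<^esub> h \<noteq> g \<otimes>\<^bsub>G\<^esub> h'" using gh h' by simp
        then show ?thesis using e(8)[OF gh(1) h' k _ y u(1)] by simp
      qed
    qed auto
    finally show ?thesis by simp
  qed
  have hom: "?\<phi> (x \<otimes>\<^bsub>V\<^esub> y) = ?\<phi> x \<otimes>\<^bsub>V\<^esub> ?\<phi> y"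
    if gh: "g \<in> carrier G" "h \<in> carrier G" and x: "x \<in> carrier V" "e' g x = x" and y: "y \<in> carrier V" "e' h y = y" for g h x y
  proof -
    let ?k = "g \<otimes>\<^bsub>G\<^esub> h"
    have k: "?k \<in> carrier G" using gh by simp
    let ?p = "e g x" and ?q = "e h y"
    let ?u = "x \<ominus>\<^bsub>V\<^esub> ?p" and ?v = "y \<ominus>\<^bsub>V\<^esub> ?q"
    have c: "?p \<in> carrier V" "?q \<in> carrier V" "x \<otimes>\<^bsub>V\<^esub> y \<in> carrier V" "?u \<in> carrier V" "?v \<in> carrier V"
      using e(4) gh x y prod_closed by auto
    have u: "?u \<in> W" "?v \<in> W" using close[OF gh(1) x(1)] close[OF gh(2) y(1)] x(2) y(2) by auto
    have eu: "e g ?u = \<zero>\<^bsub>V\<^esub>" "e h ?v = \<zero>\<^bsub>V\<^esub>"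
      using linear_map_minus[OF e(3)[OF gh(1)] x(1) c(1)] linear_map_minus[OF e(3)[OF gh(2)] y(1) c(2)]
        e(6)[OF gh(1) gh(1) x(1)] e(6)[OF gh(2) gh(2) y(1)] c by (simp_all add: M.minus_eq M.r_neg)
    have "e' ?k (x \<otimes>\<^bsub>V\<^esub> y) = x \<otimes>\<^bsub>V\<^esub> y"
      using grad_ops_prod[OF G.is_monoid assms(3) gh x(1) y(1)] x(2) y(2) by simp
    then have L: "?\<phi> (x \<otimes>\<^bsub>V\<^esub> y) = e ?k (x \<otimes>\<^bsub>V\<^esub> y)"
      using gtrans_hom[OF assms(2,3) k c(3)] by simp
    have xs: "x = ?p \<oplus>\<^bsub>V\<^esub> ?u" "y = ?q \<oplus>\<^bsub>V\<^esub> ?v"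
      using c x y by (simp_all add: M.minus_eq M.a_lcomm M.r_neg)
    have "x \<otimes>\<^bsub>V\<^esub> y = (?p \<oplus>\<^bsub>V\<^esub> ?u) \<otimes>\<^bsub>V\<^esub> (?q \<oplus>\<^bsub>V\<^esub> ?v)" using xs by simp
    also have "\<dots> = (?p \<otimes>\<^bsub>V\<^esub> ?q \<oplus>\<^bsub>V\<^esub> ?u \<otimes>\<^bsub>V\<^esub> ?q) \<oplus>\<^bsub>V\<^esub> ?p \<otimes>\<^bsub>V\<^esub> ?v"
      using c WW[OF u] prod_closed by (simp add: prod_l_distr prod_r_distr)
    finally have "e ?k (x \<otimes>\<^bsub>V\<^esub> y) = e ?k (?p \<otimes>\<^bsub>V\<^esub> ?q) \<oplus>\<^bsub>V\<^esub> e ?k (?u \<otimes>\<^bsub>V\<^esub> ?q) \<oplus>\<^bsub>V\<^esub> e ?k (?p \<otimes>\<^bsub>V\<^esub> ?v)"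
      using linear_mapD(2)[OF e(3)[OF k]] c prod_closed by simp
    also have "\<dots> = ?p \<otimes>\<^bsub>V\<^esub> ?q"
      using kill_l[OF gh c(4) eu(1) y(1)] kill_r[OF gh c(5) eu(2) x(1)] grad_ops_prod[OF G.is_monoid assms(2) gh x(1) y(1)]
        c prod_closed by simp
    also have "?p = ?\<phi> x" using gtrans_hom[OF assms(2,3) gh(1) x(1)] x(2) by simp
    also have "?q = ?\<phi> y" using gtrans_hom[OF assms(2,3) gh(2) y(1)] y(2) by simp
    finally show ?thesis using L by simp
  qed
  have step: "?\<phi> (x \<otimes>\<^bsub>V\<^esub> w) = ?\<phi> x \<otimes>\<^bsub>V\<^esub> ?\<phi> w"
    if g: "g \<in> carrier G" and x: "x \<in> carrier V" "e' g x = x" for g x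
  proof (rule grad_ops_ext[OF assms(3) _ _ _ vw(2)])
    show "linear_map (\<lambda>w. ?\<phi> (x \<otimes>\<^bsub>V\<^esub> w))" using linear_map_comp[OF lin\<phi> linear_map_mult(2)[OF x(1)]] .
    show "linear_map (\<lambda>w. ?\<phi> x \<otimes>\<^bsub>V\<^esub> ?\<phi> w)" using linear_map_comp[OF linear_map_mult(2)[OF \<phi>c[OF x(1)]] lin\<phi>] .
    fix h y assume h: "h \<in> T" and y: "y \<in> carrier V"
    have "h \<in> carrier G" using h e(2) by blast
    then show "?\<phi> (x \<otimes>\<^bsub>V\<^esub> e' h y) = ?\<phi> x \<otimes>\<^bsub>V\<^esub> ?\<phi> (e' h y)"
      using hom[OF g _ x, of h "e' h y"] e'(4) e'(6)[of h h y] y by simp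
  qed
  show ?thesis
  proof (rule grad_ops_ext[OF assms(3) _ _ _ vw(1)])
    show "linear_map (\<lambda>v. ?\<phi> (v \<otimes>\<^bsub>V\<^esub> w))" using linear_map_comp[OF lin\<phi> linear_map_mult(1)[OF vw(2)]] .
    show "linear_map (\<lambda>v. ?\<phi> v \<otimes>\<^bsub>V\<^esub> ?\<phi> w)" using linear_map_comp[OF linear_map_mult(1)[OF \<phi>c[OF vw(2)]] lin\<phi>] .
    fix g x assume g: "g \<in> T" and x: "x \<in> carrier V"
    have "g \<in> carrier G" using g e(2) by blast
    then show "?\<phi> (e' g x \<otimes>\<^bsub>V\<^esub> w) = ?\<phi> (e' g x) \<otimes>\<^bsub>V\<^esub> ?\<phi> w"
      using step[of g "e' g x"] e'(4) e'(6)[of g g x] x by simp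
  qed
qed

end

section \<open>Gradings and their projections\<close>

context based_alg
begin

text \<open>
  The grading whose components are the images of the idempotents \<open>e g\<close>; \<open>mgrading\<close> below does the same
  for matrices.
\<close>

definition fixg :: "('g, 'l) monoid_scheme \<Rightarrow> ('g \<Rightarrow> 'c \<Rightarrow> 'c) \<Rightarrow> 'g \<Rightarrow> 'c set" where
  "fixg G e = (\<lambda>g \<in> carrier G. {v \<in> carrier V. e g v = v})"

lemma finsum_neutral:
  assumes "finite T" "S \<subseteq> T" "\<And>g. g \<in> T \<Longrightarrow> x g \<in> carrier V" "\<And>g. g \<in> T \<Longrightarrow> g \<notin> S \<Longrightarrow> x g = \<zero>\<^bsub>V\<^esub>"
  shows "(\<Oplus>\<^bsub>V\<^esub>g\<in>S. x g) = (\<Oplus>\<^bsub>V\<^esub>g\<in>T. x g)"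
  by (rule M.add.finprod_mono_neutral_cong_left) (use assms in auto)

lemma linear_map_uminus:
  assumes "linear_map \<phi>" "v \<in> carrier V" shows "\<phi> (\<ominus>\<^bsub>V\<^esub> v) = \<ominus>\<^bsub>V\<^esub> \<phi> v"
  using linear_map_minus[OF assms(1), of "\<zero>\<^bsub>V\<^esub>" v] assms linear_mapD(1)[OF assms(1)]
  by (simp add: linear_map_zero M.minus_eq)

lemma fixg_submodule:
  assumes "linear_map \<phi>" shows "submodule {v \<in> carrier V. \<phi> v = v} R V"
  by (rule submoduleI)
     (use assms linear_mapD[OF assms] in \<open>auto simp: linear_map_zero linear_map_uminus\<close>)

lemma fixg_grading:
  assumes G: "group G" and "grad_ops G T e" shows "fixg G e \<in> gradings G R V"
proof -
  interpret G: group G by fact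
  note e = grad_opsD[OF assms(2)]
  have uniq: "\<exists>!x. x \<in> (\<Pi>\<^sub>E g \<in> carrier G. fixg G e g) \<and> finite {g \<in> carrier G. x g \<noteq> \<zero>\<^bsub>V\<^esub>} \<and>
        a = (\<Oplus>\<^bsub>V\<^esub>g \<in> {g \<in> carrier G. x g \<noteq> \<zero>\<^bsub>V\<^esub>}. x g)" if a: "a \<in> carrier V" for a
  proof (rule ex1I[of _ "\<lambda>g \<in> carrier G. e g a"], intro conjI)
    let ?x = "\<lambda>g \<in> carrier G. e g a"
    show "?x \<in> (\<Pi>\<^sub>E g \<in> carrier G. fixg G e g)"
      using a e(4,6) by (auto simp: fixg_def)
    have sub: "{g \<in> carrier G. ?x g \<noteq> \<zero>\<^bsub>V\<^esub>} \<subseteq> T" using e(5) a by auto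
    show "finite {g \<in> carrier G. ?x g \<noteq> \<zero>\<^bsub>V\<^esub>}" using finite_subset[OF sub e(1)] .
    have "(\<Oplus>\<^bsub>V\<^esub>g \<in> {g \<in> carrier G. ?x g \<noteq> \<zero>\<^bsub>V\<^esub>}. ?x g) = (\<Oplus>\<^bsub>V\<^esub>g\<in>T. ?x g)"
      by (rule finsum_neutral[OF e(1) sub]) (use e(2,4) a in auto)
    also have "\<dots> = (\<Oplus>\<^bsub>V\<^esub>g\<in>T. e g a)" by (rule M.finsum_cong'[OF refl]) (use e(2,4) a in auto)
    finally show "a = (\<Oplus>\<^bsub>V\<^esub>g \<in> {g \<in> carrier G. ?x g \<noteq> \<zero>\<^bsub>V\<^esub>}. ?x g)" using e(7)[OF a] by simp
  next
    fix x assume x: "x \<in> (\<Pi>\<^sub>E g \<in> carrier G. fixg G e g) \<and> finite {g \<in> carrier G. x g \<noteq> \<zero>\<^bsub>V\<^esub>} \<and>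
        a = (\<Oplus>\<^bsub>V\<^esub>g \<in> {g \<in> carrier G. x g \<noteq> \<zero>\<^bsub>V\<^esub>}. x g)"
    let ?S = "{g \<in> carrier G. x g \<noteq> \<zero>\<^bsub>V\<^esub>}"
    have xc: "x g \<in> carrier V" "e g (x g) = x g" if "g \<in> carrier G" for g
      using x that by (auto simp: fixg_def PiE_iff)
    have "x h = e h a" if h: "h \<in> carrier G" for h
    proof -
      have "e h a = (\<Oplus>\<^bsub>V\<^esub>g\<in>?S. e h (x g))"
        using linear_map_finsum[OF e(3)[OF h], of x ?S] xc x by auto
      also have "\<dots> = (\<Oplus>\<^bsub>V\<^esub>g\<in>?S. if h = g then x g else \<zero>\<^bsub>V\<^esub>)"
      proof (rule M.finsum_cong'[OF refl])
        fix g assume "g \<in> ?S"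
        then have g: "g \<in> carrier G" by simp
        show "e h (x g) = (if h = g then x g else \<zero>\<^bsub>V\<^esub>)"
          using e(6)[OF h g xc(1)[OF g]] xc[OF g] by auto
      qed (use xc in auto)
      also have "\<dots> = x h"
      proof (cases "h \<in> ?S")
        case True
        show ?thesis by (rule M.finsum_singleton[OF True]) (use x xc in auto)
      next
        case False
        have "(\<Oplus>\<^bsub>V\<^esub>g\<in>?S. if h = g then x g else \<zero>\<^bsub>V\<^esub>) = (\<Oplus>\<^bsub>V\<^esub>g\<in>?S. \<zero>\<^bsub>V\<^esub>)"
          by (rule M.finsum_cong'[OF refl]) (use False in auto)
        then show ?thesis using False h by simp
      qed
      finally show ?thesis by simp
    qed
    moreover have "x \<in> extensional (carrier G)" using x by (auto simp: PiE_def)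
    ultimately show "x = (\<lambda>g \<in> carrier G. e g a)" by (intro extensionalityI[of _ "carrier G"]) auto
  qed
  have prod: "x \<otimes>\<^bsub>V\<^esub> y \<in> fixg G e (g \<otimes>\<^bsub>G\<^esub> h)"
    if "g \<in> carrier G" "h \<in> carrier G" "x \<in> fixg G e g" "y \<in> fixg G e h" for g h x y
    using that grad_ops_prod[OF G.is_monoid assms(2) that(1,2), of x y] prod_closed by (simp add: fixg_def)
  have sm: "\<forall>g \<in> carrier G. submodule (fixg G e g) R V"
    using fixg_submodule[OF e(3)] by (simp add: fixg_def)
  have ext: "fixg G e \<in> extensional (carrier G)" by (simp add: fixg_def)
  show ?thesis unfolding gradings_def using uniq prod sm ext by blast
qed

text \<open>
  The projections of a grading are \<open>R\<close>-linear because decompositions are unique. Only finitely many are nonzero,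
  as each of the finitely many basis elements has finite support.
\<close>

lemma grading_grad_ops:
  assumes G: "group G" and \<Gamma>: "\<Gamma> \<in> gradings G R V"
  shows "\<exists>T e. grad_ops G T e \<and> \<Gamma> = fixg G e"
proof -
  interpret G: group G by fact
  define P where "P = (\<lambda>a x. x \<in> (\<Pi>\<^sub>E g \<in> carrier G. \<Gamma> g) \<and> finite {g \<in> carrier G. x g \<noteq> \<zero>\<^bsub>V\<^esub>} \<and>
        a = (\<Oplus>\<^bsub>V\<^esub>g \<in> {g \<in> carrier G. x g \<noteq> \<zero>\<^bsub>V\<^esub>}. x g))"
  have ex1: "\<exists>!x. P a x" if "a \<in> carrier V" for a using \<Gamma> that by (simp add: gradings_def P_def)
  have sm: "submodule (\<Gamma> g) R V" if "g \<in> carrier G" for g using \<Gamma> that by (simp add: gradings_def)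
  have ext: "\<Gamma> \<in> extensional (carrier G)" using \<Gamma> by (simp add: gradings_def)
  have prod: "x \<otimes>\<^bsub>V\<^esub> y \<in> \<Gamma> (g \<otimes>\<^bsub>G\<^esub> h)" if "g \<in> carrier G" "h \<in> carrier G" "x \<in> \<Gamma> g" "y \<in> \<Gamma> h" for g h x y
    using \<Gamma> that by (simp add: gradings_def)
  have sub: "\<Gamma> g \<subseteq> carrier V" if "g \<in> carrier G" for g using submoduleE(1)[OF sm[OF that]] .
  have z: "\<zero>\<^bsub>V\<^esub> \<in> \<Gamma> g" if "g \<in> carrier G" for g
    using submodule.axioms(1)[OF sm[OF that]] subgroup.one_closed by fastforce
  define dec where "dec = (\<lambda>a. THE x. P a x)"
  have decP: "P a (dec a)" if "a \<in> carrier V" for a unfolding dec_def using theI'[OF ex1[OF that]] .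
  define supp where "supp = (\<lambda>a. {g \<in> carrier G. dec a g \<noteq> \<zero>\<^bsub>V\<^esub>})"
  have dec: "dec a g \<in> \<Gamma> g" "dec a g \<in> carrier V" if "a \<in> carrier V" "g \<in> carrier G" for a g
    using decP[OF that(1)] that(2) sub by (auto simp: P_def PiE_iff)
  have fs: "finite (supp a)" "a = (\<Oplus>\<^bsub>V\<^esub>g\<in>supp a. dec a g)" "supp a \<subseteq> carrier G" if "a \<in> carrier V" for a
    using decP[OF that] by (auto simp: P_def supp_def)
  have char: "dec a g = x g"
    if a: "a \<in> carrier V" and x: "\<And>g. g \<in> carrier G \<Longrightarrow> x g \<in> \<Gamma> g" and S: "finite S" "S \<subseteq> carrier G"
      "\<And>g. g \<in> carrier G \<Longrightarrow> g \<notin> S \<Longrightarrow> x g = \<zero>\<^bsub>V\<^esub>" and s: "a = (\<Oplus>\<^bsub>V\<^esub>g\<in>S. x g)" and g: "g \<in> carrier G" for a x S g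
  proof -
    let ?y = "\<lambda>g \<in> carrier G. x g"
    have sub': "{g \<in> carrier G. ?y g \<noteq> \<zero>\<^bsub>V\<^esub>} \<subseteq> S" using S by auto
    have xc: "x g \<in> carrier V" if "g \<in> carrier G" for g using x sub that by blast
    have "(\<Oplus>\<^bsub>V\<^esub>g\<in>{g \<in> carrier G. ?y g \<noteq> \<zero>\<^bsub>V\<^esub>}. ?y g) = (\<Oplus>\<^bsub>V\<^esub>g\<in>S. ?y g)"
      by (rule finsum_neutral[OF S(1) sub']) (use S(2) xc in auto)
    also have "\<dots> = (\<Oplus>\<^bsub>V\<^esub>g\<in>S. x g)" by (rule M.finsum_cong'[OF refl]) (use S(2) xc in auto)
    also have "\<dots> = a" by (rule s[symmetric])
    finally have "a = (\<Oplus>\<^bsub>V\<^esub>g\<in>{g \<in> carrier G. ?y g \<noteq> \<zero>\<^bsub>V\<^esub>}. ?y g)" by (rule sym)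
    moreover have "?y \<in> (\<Pi>\<^sub>E g \<in> carrier G. \<Gamma> g)" using x by auto
    ultimately have "P a ?y" unfolding P_def using finite_subset[OF sub' S(1)] by (intro conjI)
    then have "dec a = ?y" using ex1[OF a] decP[OF a] by blast
    then show ?thesis using g by simp
  qed
  define e where "e = (\<lambda>g v. dec v g)"
  have lin_e: "linear_map (e g)" if g: "g \<in> carrier G" for g
  proof (rule linear_mapI)
    show "e g v \<in> carrier V" if "v \<in> carrier V" for v using dec g that by (simp add: e_def)
    show "e g (v \<oplus>\<^bsub>V\<^esub> w) = e g v \<oplus>\<^bsub>V\<^esub> e g w" if v: "v \<in> carrier V" and w: "w \<in> carrier V" for v w
      unfolding e_def
    proof (rule char[of _ _ "supp v \<union> supp w"])
      let ?S = "supp v \<union> supp w"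
      have c: "dec v g \<in> carrier V" "dec w g \<in> carrier V" if "g \<in> ?S" for g
        using dec(2) v w that fs(3) by auto
      have "v = (\<Oplus>\<^bsub>V\<^esub>g\<in>?S. dec v g)"
        by (subst fs(2)[OF v], rule finsum_neutral)
           (use fs v w c in \<open>auto simp: supp_def\<close>)
      moreover have "w = (\<Oplus>\<^bsub>V\<^esub>g\<in>?S. dec w g)"
        by (subst fs(2)[OF w], rule finsum_neutral)
           (use fs v w c in \<open>auto simp: supp_def\<close>)
      moreover have "(\<Oplus>\<^bsub>V\<^esub>g\<in>?S. dec v g \<oplus>\<^bsub>V\<^esub> dec w g) = (\<Oplus>\<^bsub>V\<^esub>g\<in>?S. dec v g) \<oplus>\<^bsub>V\<^esub> (\<Oplus>\<^bsub>V\<^esub>g\<in>?S. dec w g)"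
        by (rule M.finsum_addf) (use c in auto)
      ultimately show "v \<oplus>\<^bsub>V\<^esub> w = (\<Oplus>\<^bsub>V\<^esub>g\<in>?S. dec v g \<oplus>\<^bsub>V\<^esub> dec w g)" by simp
    qed (use v w g fs dec submoduleE(5)[OF sm] in \<open>auto simp: supp_def\<close>)
    show "e g (r \<odot>\<^bsub>V\<^esub> v) = r \<odot>\<^bsub>V\<^esub> e g v" if r: "r \<in> carrier R" and v: "v \<in> carrier V" for r v
      unfolding e_def
    proof (rule char[of _ _ "supp v"])
      have l: "linear_map (\<lambda>w. r \<odot>\<^bsub>V\<^esub> w)"
        using r by (intro linear_mapI) (auto simp: smult_r_distr m_comm simp flip: smult_assoc1)
      have "(\<lambda>g. dec v g) \<in> supp v \<rightarrow> carrier V" using dec(2) v fs(3) by auto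
      from linear_map_finsum[OF l this] show "r \<odot>\<^bsub>V\<^esub> v = (\<Oplus>\<^bsub>V\<^esub>g\<in>supp v. r \<odot>\<^bsub>V\<^esub> dec v g)"
        using fs(2)[OF v] by simp
    qed (use v r g fs dec submoduleE(4)[OF sm] in \<open>auto simp: supp_def smult_r_null\<close>)
  qed
  have ec: "e g v \<in> carrier V" "e g v \<in> \<Gamma> g" if "g \<in> carrier G" "v \<in> carrier V" for g v
    using dec that by (auto simp: e_def)
  have hom: "e g v = (if g = h then v else \<zero>\<^bsub>V\<^esub>)" if g: "g \<in> carrier G" and h: "h \<in> carrier G" and v: "v \<in> \<Gamma> h" for g h v
    unfolding e_def
  proof (rule char[of _ _ "{h}"])
    have vV: "v \<in> carrier V" using v sub h by blast
    show "v = (\<Oplus>\<^bsub>V\<^esub>g\<in>{h}. if g = h then v else \<zero>\<^bsub>V\<^esub>)" using vV by simp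
    show "v \<in> carrier V" by (rule vV)
  qed (use g h v z in auto)
  define T where "T = (\<Union>j\<in>{..<n}. supp (b j))"
  have T: "finite T" "T \<subseteq> carrier G" using fs b_closed by (auto simp: T_def)
  have off: "e g v = \<zero>\<^bsub>V\<^esub>" if g: "g \<in> carrier G" "g \<notin> T" and v: "v \<in> carrier V" for g v
  proof (rule linear_ext[OF lin_e[OF g(1)] linear_map_const0 _ v])
    fix j assume "j < n"
    then show "e g (b j) = \<zero>\<^bsub>V\<^esub>" using g by (auto simp: T_def supp_def e_def)
  qed
  have sum: "(\<Oplus>\<^bsub>V\<^esub>g\<in>T. e g v) = v" if v: "v \<in> carrier V" for v
  proof -
    have "supp v \<subseteq> T" using off v by (auto simp: supp_def e_def)
    then have "(\<Oplus>\<^bsub>V\<^esub>g\<in>supp v. e g v) = (\<Oplus>\<^bsub>V\<^esub>g\<in>T. e g v)"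
      using T ec v by (intro finsum_neutral) (auto simp: supp_def e_def)
    then show ?thesis using fs(2)[OF v] by (simp add: e_def)
  qed
  have "grad_ops G T e" unfolding grad_ops_def
  proof (intro conjI ballI impI T lin_e)
    fix g v assume "g \<in> carrier G - T" "v \<in> carrier V"
    then show "e g v = \<zero>\<^bsub>V\<^esub>" using off by simp
  next
    fix g h v assume "g \<in> carrier G" "h \<in> carrier G" "v \<in> carrier V"
    then show "e g (e h v) = (if g = h then e g v else \<zero>\<^bsub>V\<^esub>)" using hom[of g h "e h v"] ec by simp
  next
    fix v assume "v \<in> carrier V" then show "(\<Oplus>\<^bsub>V\<^esub>g\<in>T. e g v) = v" by (rule sum)
  next
    fix g h k v w assume *: "g \<in> carrier G" "h \<in> carrier G" "k \<in> carrier G" "k \<noteq> g \<otimes>\<^bsub>G\<^esub> h" "v \<in> carrier V" "w \<in> carrier V"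
    then show "e k (e g v \<otimes>\<^bsub>V\<^esub> e h w) = \<zero>\<^bsub>V\<^esub>"
      using hom[of k "g \<otimes>\<^bsub>G\<^esub> h" "e g v \<otimes>\<^bsub>V\<^esub> e h w"] prod ec by simp
  qed
  moreover have "\<Gamma> = fixg G e"
  proof (rule extensionalityI[OF ext])
    show "fixg G e \<in> extensional (carrier G)" by (simp add: fixg_def)
    fix g assume g: "g \<in> carrier G"
    show "\<Gamma> g = fixg G e g"
    proof
      show "\<Gamma> g \<subseteq> fixg G e g" using hom[OF g g] sub[OF g] g by (auto simp: fixg_def)
      show "fixg G e g \<subseteq> \<Gamma> g"
      proof
        fix v assume "v \<in> fixg G e g"
        then have "v \<in> carrier V" "e g v = v" using g by (auto simp: fixg_def)
        then show "v \<in> \<Gamma> g" using ec(2)[OF g, of v] by simp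
      qed
    qed
  qed
  ultimately show ?thesis by blast
qed

definition mgrading :: "('g, 'l) monoid_scheme \<Rightarrow> ('g \<Rightarrow> nat \<Rightarrow> nat \<Rightarrow> 'a) \<Rightarrow> 'g \<Rightarrow> 'c set" where
  "mgrading G E = fixg G (\<lambda>g. lin (E g))"

lemma grad_mat_closed: "grad_mat R n c G T E \<Longrightarrow> g \<in> carrier G \<Longrightarrow> mclosed (E g)"
  by (simp add: grad_mat_def mclosed_def)

lemma grad_mat_ops:
  assumes "grad_mat R n c G T E" shows "grad_ops G T (\<lambda>g. lin (E g))"
  using grad_mat_iff[of G E T] grad_mat_closed[OF assms] assms by blast

lemma mgrading_grading: "group G \<Longrightarrow> grad_mat R n c G T E \<Longrightarrow> mgrading G E \<in> gradings G R V"
  unfolding mgrading_def using fixg_grading[OF _ grad_mat_ops] .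

lemma grading_mgrading:
  assumes "group G" "\<Gamma> \<in> gradings G R V"
  shows "\<exists>T E. grad_mat R n c G T E \<and> \<Gamma> = mgrading G E"
proof -
  interpret G: group G by fact
  obtain T e where e: "grad_ops G T e" and \<Gamma>: "\<Gamma> = fixg G e" using grading_grad_ops[OF assms] by blast
  note eD = grad_opsD[OF e]
  define E where "E = (\<lambda>g. mat (e g))"
  have cl: "mclosed (E g)" if "g \<in> carrier G" for g using mat_closed[OF eD(3)[OF that]] by (simp add: E_def)
  have lin: "lin (E g) v = e g v" if "g \<in> carrier G" "v \<in> carrier V" for g v
    using lin_mat[OF eD(3)[OF that(1)] that(2)] by (simp add: E_def)
  have "grad_ops G T (\<lambda>g. lin (E g))" unfolding grad_ops_def
  proof (intro conjI ballI impI eD(1,2) lin_linear cl)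
    fix v assume v: "v \<in> carrier V"
    have "(\<Oplus>\<^bsub>V\<^esub>g\<in>T. lin (E g) v) = (\<Oplus>\<^bsub>V\<^esub>g\<in>T. e g v)"
      by (rule M.finsum_cong'[OF refl]) (use eD(2,4) v lin in auto)
    then show "(\<Oplus>\<^bsub>V\<^esub>g\<in>T. lin (E g) v) = v" using eD(7)[OF v] by simp
  next
    fix g v assume "g \<in> carrier G - T" "v \<in> carrier V"
    then show "lin (E g) v = \<zero>\<^bsub>V\<^esub>" using eD(5)[of g v] lin by simp
  next
    fix g h v assume "g \<in> carrier G" "h \<in> carrier G" "v \<in> carrier V"
    then show "lin (E g) (lin (E h) v) = (if g = h then lin (E g) v else \<zero>\<^bsub>V\<^esub>)"
      using eD(6)[of g h v] eD(4)[of h v] lin by simp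
  next
    fix g h k v w assume *: "g \<in> carrier G" "h \<in> carrier G" "k \<in> carrier G" "k \<noteq> g \<otimes>\<^bsub>G\<^esub> h" "v \<in> carrier V" "w \<in> carrier V"
    then show "lin (E k) (lin (E g) v \<otimes>\<^bsub>V\<^esub> lin (E h) w) = \<zero>\<^bsub>V\<^esub>"
      using eD(8)[OF *] eD(4)[OF *(1,5)] eD(4)[OF *(2,6)] lin prod_closed by simp
  qed
  then have "grad_mat R n c G T E" using grad_mat_iff[of G E T] cl by blast
  moreover have "\<Gamma> = mgrading G E"
    unfolding \<Gamma> mgrading_def fixg_def by (rule restrict_ext) (use lin in auto)
  ultimately show ?thesis by blast
qed

lemma linear_map_aut: "\<phi> \<in> algebra_auts R V \<Longrightarrow> linear_map \<phi>"
  unfolding algebra_auts_def linear_map_def Bij_def bij_betw_def by auto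

lemma aut_mat_exists:
  assumes "\<phi> \<in> algebra_auts R V"
  shows "\<exists>M N. aut_mat R n c M N \<and> (\<forall>v \<in> carrier V. lin M v = \<phi> v)"
proof -
  have \<phi>: "linear_map \<phi>" using linear_map_aut[OF assms] .
  have bij: "bij_betw \<phi> (carrier V) (carrier V)" using assms by (simp add: algebra_auts_def Bij_def)
  have mult: "\<phi> (v \<otimes>\<^bsub>V\<^esub> w) = \<phi> v \<otimes>\<^bsub>V\<^esub> \<phi> w" if "v \<in> carrier V" "w \<in> carrier V" for v w
    using assms that by (simp add: algebra_auts_def)
  define \<psi> where "\<psi> = inv_into (carrier V) \<phi>"
  have \<psi>: "\<psi> v \<in> carrier V" "\<phi> (\<psi> v) = v" "\<psi> (\<phi> v) = v" if "v \<in> carrier V" for v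
    using bij that unfolding \<psi>_def
    by (auto simp: bij_betw_def inv_into_into f_inv_into_f inv_into_f_f)
  have \<psi>l: "linear_map \<psi>"
  proof (rule linear_mapI)
    show "\<psi> v \<in> carrier V" if "v \<in> carrier V" for v using \<psi>(1)[OF that] .
    show "\<psi> (v \<oplus>\<^bsub>V\<^esub> w) = \<psi> v \<oplus>\<^bsub>V\<^esub> \<psi> w" if "v \<in> carrier V" "w \<in> carrier V" for v w
      using \<psi>(3)[of "\<psi> v \<oplus>\<^bsub>V\<^esub> \<psi> w"] linear_mapD(2)[OF \<phi>, of "\<psi> v" "\<psi> w"] \<psi>(1,2) that by simp
    show "\<psi> (r \<odot>\<^bsub>V\<^esub> v) = r \<odot>\<^bsub>V\<^esub> \<psi> v" if "r \<in> carrier R" "v \<in> carrier V" for r v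
      using \<psi>(3)[of "r \<odot>\<^bsub>V\<^esub> \<psi> v"] linear_mapD(3)[OF \<phi>, of r "\<psi> v"] \<psi>(1,2) that by simp
  qed
  have "aut_mat R n c (mat \<phi>) (mat \<psi>)"
    unfolding aut_mat_iff using mat_closed[OF \<phi>] mat_closed[OF \<psi>l] \<psi> mult lin_mat[OF \<phi>] lin_mat[OF \<psi>l]
      linear_mapD(1)[OF \<phi>] prod_closed by simp
  then show ?thesis using lin_mat[OF \<phi>] by blast
qed

lemma aut_mat_aut:
  assumes "aut_mat R n c M N"
  shows "restrict (lin M) (carrier V) \<in> algebra_auts R V"
proof -
  have M: "mclosed M" "mclosed N" "\<forall>v \<in> carrier V. lin M (lin N v) = v" "\<forall>v \<in> carrier V. lin N (lin M v) = v"
    "\<forall>v \<in> carrier V. \<forall>w \<in> carrier V. lin M (v \<otimes>\<^bsub>V\<^esub> w) = lin M v \<otimes>\<^bsub>V\<^esub> lin M w"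
    using assms unfolding aut_mat_iff by auto
  note lM = linear_mapD[OF lin_linear[OF M(1)]] and lN = linear_mapD[OF lin_linear[OF M(2)]]
  have "bij_betw (lin M) (carrier V) (carrier V)"
    by (rule bij_betw_byWitness[where f' = "lin N"]) (use M(3,4) lM(1) lN(1) in auto)
  then have "bij_betw (restrict (lin M) (carrier V)) (carrier V) (carrier V)"
    by (rule iffD1[OF bij_betw_cong, rotated]) simp
  then show ?thesis using M(5) lM prod_closed by (simp add: algebra_auts_def Bij_def)
qed

text \<open>
  An automorphism maps one grading to another if and only if it intertwines their projections.
\<close>

theorem grading_iso_iff:
  assumes G: "group G" and E: "grad_mat R n c G T E" and E': "grad_mat R n c G T' E'"
  shows "(mgrading G E, mgrading G E') \<in> grading_iso G R V \<longleftrightarrow>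
    (\<exists>M N. aut_mat R n c M N \<and> (\<forall>g \<in> carrier G. intertwines R n M (E g) (E' g)))"
proof
  note e = grad_opsD[OF grad_mat_ops[OF E]] and e' = grad_opsD[OF grad_mat_ops[OF E']]
  assume "(mgrading G E, mgrading G E') \<in> grading_iso G R V"
  then obtain \<phi> where \<phi>: "\<phi> \<in> algebra_auts R V" and img: "\<And>g. g \<in> carrier G \<Longrightarrow> \<phi> ` mgrading G E g = mgrading G E' g"
    unfolding grading_iso_def by auto
  note l\<phi> = linear_map_aut[OF \<phi>]
  obtain M N where MN: "aut_mat R n c M N" "\<forall>v \<in> carrier V. lin M v = \<phi> v" using aut_mat_exists[OF \<phi>] by blast
  have Mc: "mclosed M" using MN(1) by (simp add: aut_mat_iff)
  have "intertwines R n M (E g) (E' g)" if g: "g \<in> carrier G" for g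
    unfolding intertwines_iff[OF Mc grad_mat_closed[OF E g] grad_mat_closed[OF E' g]]
  proof
    fix v assume v: "v \<in> carrier V"
    have "\<phi> (lin (E g) v) = lin (E' g) (\<phi> v)"
    proof (rule grad_ops_ext[OF grad_mat_ops[OF E] _ _ _ v])
      show "linear_map (\<lambda>v. \<phi> (lin (E g) v))" by (rule linear_map_comp[OF l\<phi> e(3)[OF g]])
      show "linear_map (\<lambda>v. lin (E' g) (\<phi> v))" by (rule linear_map_comp[OF e'(3)[OF g] l\<phi>])
      fix h u assume h: "h \<in> T" and u: "u \<in> carrier V"
      have hG: "h \<in> carrier G" using h e(2) by blast
      let ?w = "lin (E h) u"
      have "?w \<in> mgrading G E h" using e(4)[OF hG u] e(6)[OF hG hG u] hG by (simp add: mgrading_def fixg_def)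
      then have "\<phi> ?w \<in> mgrading G E' h" using img[OF hG] by blast
      then have w: "\<phi> ?w \<in> carrier V" "lin (E' h) (\<phi> ?w) = \<phi> ?w" using hG by (auto simp: mgrading_def fixg_def)
      have "lin (E' g) (\<phi> ?w) = (if g = h then \<phi> ?w else \<zero>\<^bsub>V\<^esub>)"
        using e'(6)[OF g hG w(1)] w(2) by auto
      moreover have "\<phi> (lin (E g) ?w) = (if g = h then \<phi> ?w else \<zero>\<^bsub>V\<^esub>)"
        using e(6)[OF g hG u] linear_map_zero[OF l\<phi>] by auto
      ultimately show "\<phi> (lin (E g) ?w) = lin (E' g) (\<phi> ?w)" by simp
    qed
    then show "lin M (lin (E g) v) = lin (E' g) (lin M v)" using MN(2) v e(4)[OF g v] by simp
  qed
  with MN(1) show "\<exists>M N. aut_mat R n c M N \<and> (\<forall>g \<in> carrier G. intertwines R n M (E g) (E' g))" by blast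
next
  note e = grad_opsD[OF grad_mat_ops[OF E]] and e' = grad_opsD[OF grad_mat_ops[OF E']]
  assume "\<exists>M N. aut_mat R n c M N \<and> (\<forall>g \<in> carrier G. intertwines R n M (E g) (E' g))"
  then obtain M N where MN: "aut_mat R n c M N" and int: "\<And>g. g \<in> carrier G \<Longrightarrow> intertwines R n M (E g) (E' g)" by blast
  have M: "mclosed M" "mclosed N" "\<forall>v \<in> carrier V. lin M (lin N v) = v" "\<forall>v \<in> carrier V. lin N (lin M v) = v"
    using MN unfolding aut_mat_iff by auto
  note lM = linear_mapD(1)[OF lin_linear[OF M(1)]] and lN = linear_mapD(1)[OF lin_linear[OF M(2)]]
  have int': "lin M (lin (E g) v) = lin (E' g) (lin M v)" if "g \<in> carrier G" "v \<in> carrier V" for g v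
    using int[OF that(1)] that(2) unfolding intertwines_iff[OF M(1) grad_mat_closed[OF E that(1)] grad_mat_closed[OF E' that(1)]] by blast
  have "restrict (lin M) (carrier V) ` mgrading G E g = mgrading G E' g" if g: "g \<in> carrier G" for g
  proof
    show "restrict (lin M) (carrier V) ` mgrading G E g \<subseteq> mgrading G E' g"
    proof
      fix w assume "w \<in> restrict (lin M) (carrier V) ` mgrading G E g"
      then obtain v where v: "v \<in> carrier V" "lin (E g) v = v" "w = lin M v"
        using g by (auto simp: mgrading_def fixg_def)
      then show "w \<in> mgrading G E' g"
        using g int'[OF g v(1)] lM[OF v(1)] by (simp add: mgrading_def fixg_def)
    qed
    show "mgrading G E' g \<subseteq> restrict (lin M) (carrier V) ` mgrading G E g"
    proof
      fix w assume "w \<in> mgrading G E' g"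
      then have w: "w \<in> carrier V" "lin (E' g) w = w" using g by (auto simp: mgrading_def fixg_def)
      have "lin M (lin (E g) (lin N w)) = w" using int'[OF g lN[OF w(1)]] M(3) w by simp
      then have "lin (E g) (lin N w) = lin N w" using M(4) e(4)[OF g lN[OF w(1)]] by metis
      then have "lin N w \<in> mgrading G E g" using g lN[OF w(1)] by (simp add: mgrading_def fixg_def)
      moreover have "w = restrict (lin M) (carrier V) (lin N w)" using M(3) w(1) lN[OF w(1)] by simp
      ultimately show "w \<in> restrict (lin M) (carrier V) ` mgrading G E g" by blast
    qed
  qed
  then show "(mgrading G E, mgrading G E') \<in> grading_iso G R V"
    unfolding grading_iso_def using mgrading_grading[OF G E] mgrading_grading[OF G E'] aut_mat_aut[OF MN] by blast
qed

end

context scalar_ext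
begin

lemma emb_coord_sum:
  assumes "\<And>j. j < n \<Longrightarrow> x j \<in> carrier F" "\<And>j. j < n \<Longrightarrow> y j \<in> carrier F" "r \<in> carrier R"
  shows "(\<Oplus>\<^bsub>R\<^esub>j\<in>{..<n}. emb (x j) \<otimes>\<^bsub>R\<^esub> (emb (y j) \<otimes>\<^bsub>R\<^esub> r)) = emb (\<Oplus>j\<in>{..<n}. x j \<otimes> y j) \<otimes>\<^bsub>R\<^esub> r"
proof -
  interpret emb: ring_hom_cring F R emb by unfold_locales (rule emb_hom)
  have c: "\<And>j. j < n \<Longrightarrow> emb (x j) \<in> carrier R" "\<And>j. j < n \<Longrightarrow> emb (y j) \<in> carrier R"
    using assms emb_closed by auto
  have "emb (\<Oplus>j\<in>{..<n}. x j \<otimes> y j) \<otimes>\<^bsub>R\<^esub> r = (\<Oplus>\<^bsub>R\<^esub>j\<in>{..<n}. emb (x j \<otimes> y j)) \<otimes>\<^bsub>R\<^esub> r"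
    using assms by (subst emb.hom_finsum) (auto simp: comp_def)
  also have "\<dots> = (\<Oplus>\<^bsub>R\<^esub>j\<in>{..<n}. emb (x j \<otimes> y j) \<otimes>\<^bsub>R\<^esub> r)"
    by (rule RR.finsum_ldistr) (use assms emb_closed in auto)
  also have "\<dots> = (\<Oplus>\<^bsub>R\<^esub>j\<in>{..<n}. emb (x j) \<otimes>\<^bsub>R\<^esub> (emb (y j) \<otimes>\<^bsub>R\<^esub> r))"
    by (rule RR.finsum_cong'[OF refl]) (use assms c in \<open>auto simp: RR.m_assoc\<close>)
  finally show ?thesis by simp
qed

abbreviation "bT \<equiv> \<lambda>i. pure_tensor F A R (b i) \<one>\<^bsub>R\<^esub>"

theorem extend_mgrading:
  assumes G: "group G" and E: "grad_mat F n c G Q E"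
  shows "extend_grading G F A R (mgrading G E) = based_alg.mgrading R T n bT coordT G (\<lambda>g i j. emb (E g i j))"
proof -
  interpret TT: based_alg R T n bT c' coordT by (rule T_based)
  let ?E = "\<lambda>g i j. emb (E g i j)"
  have Ec: "mclosed (E g)" if "g \<in> carrier G" for g using grad_mat_closed[OF E that] .
  have Ec': "TT.mclosed (?E g)" if "g \<in> carrier G" for g
    using Ec[OF that] emb_closed by (simp add: TT.mclosed_def mclosed_def)
  have lin_pure: "TT.lin (?E g) (pure_tensor F A R a r) = pure_tensor F A R (lin (E g) a) r"
    if g: "g \<in> carrier G" and a: "a \<in> carrier A" and r: "r \<in> carrier R" for g a r
  proof (rule TT.coord_inj)
    fix i assume i: "i < n"
    have "coordT (TT.lin (?E g) (pure_tensor F A R a r)) i = (\<Oplus>\<^bsub>R\<^esub>j\<in>{..<n}. emb (E g i j) \<otimes>\<^bsub>R\<^esub> coordT (pure_tensor F A R a r) j)"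
      by (rule TT.lin_coord[OF Ec'[OF g] pure_closed[OF a r] i])
    also have "\<dots> = (\<Oplus>\<^bsub>R\<^esub>j\<in>{..<n}. emb (E g i j) \<otimes>\<^bsub>R\<^esub> (emb (\<kappa> a j) \<otimes>\<^bsub>R\<^esub> r))"
      by (rule RR.finsum_cong'[OF refl])
         (use Ec[OF g] i a r coord_pure coord_closed emb_closed in \<open>auto simp: mclosed_def\<close>)
    also have "\<dots> = emb (\<Oplus>j\<in>{..<n}. E g i j \<otimes> \<kappa> a j) \<otimes>\<^bsub>R\<^esub> r"
      by (rule emb_coord_sum) (use Ec[OF g] i a r coord_closed in \<open>auto simp: mclosed_def\<close>)
    also have "\<dots> = coordT (pure_tensor F A R (lin (E g) a) r) i"
      using coord_pure[OF lin_closed[OF Ec[OF g] a] r i] lin_coord[OF Ec[OF g] a i] by simp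
    finally show "coordT (TT.lin (?E g) (pure_tensor F A R a r)) i = coordT (pure_tensor F A R (lin (E g) a) r) i" .
  qed (use TT.lin_closed[OF Ec'[OF g] pure_closed[OF a r]] pure_closed[OF lin_closed[OF Ec[OF g] a] r] in auto)
  have smult_pure: "r \<odot>\<^bsub>T\<^esub> pure_tensor F A R a \<one>\<^bsub>R\<^esub> = pure_tensor F A R a r" if a: "a \<in> carrier A" and r: "r \<in> carrier R" for a r
  proof (rule TT.coord_inj)
    show "r \<odot>\<^bsub>T\<^esub> pure_tensor F A R a \<one>\<^bsub>R\<^esub> \<in> carrier T" "pure_tensor F A R a r \<in> carrier T"
      using TT.smult_closed[OF r] pure_closed a r by auto
    fix i assume "i < n"
    then show "coordT (r \<odot>\<^bsub>T\<^esub> pure_tensor F A R a \<one>\<^bsub>R\<^esub>) i = coordT (pure_tensor F A R a r) i"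
      using TT.coord_smult[OF r pure_closed[OF a]] coord_pure a r emb_closed coord_closed by (simp add: RR.m_comm)
  qed
  have "generate (add_monoid T) {pure_tensor F A R a k |a k. a \<in> mgrading G E g \<and> k \<in> carrier R} = TT.mgrading G ?E g"
    (is "generate _ ?P = _") if g: "g \<in> carrier G" for g
  proof
    have Tg: "group (add_monoid T)" using TT.M.add.is_group .
    have sg: "subgroup (TT.mgrading G ?E g) (add_monoid T)"
      using TT.fixg_submodule[OF TT.lin_linear[OF Ec'[OF g]]] g
      by (simp add: TT.mgrading_def TT.fixg_def submodule_def)
    have P: "?P \<subseteq> carrier T" using pure_closed g by (auto simp: mgrading_def fixg_def)
    show "generate (add_monoid T) ?P \<subseteq> TT.mgrading G ?E g"
    proof (rule group.generate_subgroup_incl[OF Tg _ sg])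
      show "?P \<subseteq> TT.mgrading G ?E g"
        using g pure_closed lin_pure[OF g] by (auto simp: mgrading_def fixg_def TT.mgrading_def TT.fixg_def)
    qed
    show "TT.mgrading G ?E g \<subseteq> generate (add_monoid T) ?P"
    proof
      fix v assume "v \<in> TT.mgrading G ?E g"
      then have v: "v \<in> carrier T" "TT.lin (?E g) v = v" using g by (auto simp: TT.mgrading_def TT.fixg_def)
      let ?H = "generate (add_monoid T) ?P"
      have H: "subgroup ?H (add_monoid T)" using group.generate_is_subgroup[OF Tg] P by simp
      have Hs: "\<zero>\<^bsub>T\<^esub> \<in> ?H" "\<And>x y. x \<in> ?H \<Longrightarrow> y \<in> ?H \<Longrightarrow> x \<oplus>\<^bsub>T\<^esub> y \<in> ?H" "?H \<subseteq> carrier T"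
        using subgroup.one_closed[OF H] subgroup.m_closed[OF H] subgroup.subset[OF H] by auto
      have Hsum: "(\<Oplus>\<^bsub>T\<^esub>j\<in>J. f j) \<in> ?H" if "f \<in> J \<rightarrow> ?H" for f and J :: "nat set"
        using that
      proof (induction J rule: infinite_finite_induct)
        case (insert x J)
        then have "f x \<in> carrier T" "f \<in> J \<rightarrow> carrier T" using Hs(3) by auto
        with insert Hs(2) show ?case by simp
      qed (simp_all add: Hs(1))
      have cj: "coordT v j \<odot>\<^bsub>T\<^esub> bT j \<in> carrier T" if "j < n" for j
        using TT.smult_closed TT.coord_closed[OF v(1) that] TT.b_closed[OF that] by simp
      have "v = TT.lin (?E g) (\<Oplus>\<^bsub>T\<^esub>j\<in>{..<n}. coordT v j \<odot>\<^bsub>T\<^esub> bT j)" using v TT.expand[OF v(1)] by simp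
      also have "\<dots> = (\<Oplus>\<^bsub>T\<^esub>j\<in>{..<n}. TT.lin (?E g) (coordT v j \<odot>\<^bsub>T\<^esub> bT j))"
        by (rule TT.linear_map_finsum[OF TT.lin_linear[OF Ec'[OF g]]]) (use cj in auto)
      also have "\<dots> \<in> ?H"
      proof (rule Hsum, rule)
        fix j assume "j \<in> {..<n}"
        then have j: "j < n" by simp
        have bj: "b j \<in> carrier A" using b_closed[OF j] .
        have r: "coordT v j \<in> carrier R" using TT.coord_closed[OF v(1) j] .
        have l: "lin (E g) (b j) \<in> carrier A" using lin_closed[OF Ec[OF g] bj] .
        have "TT.lin (?E g) (coordT v j \<odot>\<^bsub>T\<^esub> bT j) = pure_tensor F A R (lin (E g) (b j)) (coordT v j)"
          using smult_pure[OF bj r] lin_pure[OF g bj r] by simp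
        moreover have "lin (E g) (b j) \<in> mgrading G E g"
          using l grad_opsD(6)[OF grad_mat_ops[OF E] g g bj] g by (simp add: mgrading_def fixg_def)
        ultimately show "TT.lin (?E g) (coordT v j \<odot>\<^bsub>T\<^esub> bT j) \<in> ?H" using r by (auto intro!: generate.incl)
      qed
      finally show "v \<in> ?H" .
    qed
  qed
  note gen = this
  show ?thesis
  proof (rule extensionalityI[of _ "carrier G"])
    fix g assume g: "g \<in> carrier G"
    show "extend_grading G F A R (mgrading G E) g = TT.mgrading G ?E g"
      unfolding extend_grading_def restrict_apply'[OF g] by (rule gen[OF g])
  qed (simp_all only: extend_grading_def restrict_extensional TT.mgrading_def TT.fixg_def)
qed

end

section \<open>Matrix equations and ring homomorphisms\<close>

lemma hom_finsum_mult:
  assumes "cring R" "cring S" "h \<in> ring_hom R S"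
    "\<And>k. k < n \<Longrightarrow> x k \<in> carrier R" "\<And>k. k < n \<Longrightarrow> y k \<in> carrier R"
  shows "h (\<Oplus>\<^bsub>R\<^esub>k\<in>{..<n}. x k \<otimes>\<^bsub>R\<^esub> y k) = (\<Oplus>\<^bsub>S\<^esub>k\<in>{..<n}. h (x k) \<otimes>\<^bsub>S\<^esub> h (y k))"
proof -
  interpret R: cring R by fact
  interpret S: cring S by fact
  interpret h: ring_hom_cring R S h by unfold_locales fact
  have "h (\<Oplus>\<^bsub>R\<^esub>k\<in>{..<n}. x k \<otimes>\<^bsub>R\<^esub> y k) = (\<Oplus>\<^bsub>S\<^esub>k\<in>{..<n}. h (x k \<otimes>\<^bsub>R\<^esub> y k))"
    by (subst h.hom_finsum) (use assms in \<open>auto simp: comp_def\<close>)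
  also have "\<dots> = (\<Oplus>\<^bsub>S\<^esub>k\<in>{..<n}. h (x k) \<otimes>\<^bsub>S\<^esub> h (y k))"
    by (rule S.finsum_cong'[OF refl]) (use assms h.hom_closed in auto)
  finally show ?thesis .
qed

lemma bilinear_sum_closed:
  assumes "cring R" "\<And>p. p < n \<Longrightarrow> x p \<in> carrier R" "\<And>p. p < n \<Longrightarrow> y p \<in> carrier R"
    "\<And>p q. p < n \<Longrightarrow> q < n \<Longrightarrow> z p q \<in> carrier R"
  shows "(\<Oplus>\<^bsub>R\<^esub>p\<in>{..<n}. \<Oplus>\<^bsub>R\<^esub>q\<in>{..<n}. x p \<otimes>\<^bsub>R\<^esub> y q \<otimes>\<^bsub>R\<^esub> z p q) \<in> carrier R"
proof -
  interpret R: cring R by fact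
  show ?thesis using assms by (intro R.finsum_closed Pi_I) auto
qed

lemma hom_bilinear_sum:
  assumes "cring R" "cring S" "h \<in> ring_hom R S"
    "\<And>p. p < n \<Longrightarrow> x p \<in> carrier R" "\<And>p. p < n \<Longrightarrow> y p \<in> carrier R"
    "\<And>p q. p < n \<Longrightarrow> q < n \<Longrightarrow> z p q \<in> carrier R"
  shows "h (\<Oplus>\<^bsub>R\<^esub>p\<in>{..<n}. \<Oplus>\<^bsub>R\<^esub>q\<in>{..<n}. x p \<otimes>\<^bsub>R\<^esub> y q \<otimes>\<^bsub>R\<^esub> z p q) =
    (\<Oplus>\<^bsub>S\<^esub>p\<in>{..<n}. \<Oplus>\<^bsub>S\<^esub>q\<in>{..<n}. h (x p) \<otimes>\<^bsub>S\<^esub> h (y q) \<otimes>\<^bsub>S\<^esub> h (z p q))"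
proof -
  interpret R: cring R by fact
  interpret S: cring S by fact
  interpret h: ring_hom_cring R S h by unfold_locales fact
  have "h (\<Oplus>\<^bsub>R\<^esub>p\<in>{..<n}. \<Oplus>\<^bsub>R\<^esub>q\<in>{..<n}. x p \<otimes>\<^bsub>R\<^esub> y q \<otimes>\<^bsub>R\<^esub> z p q)
      = (\<Oplus>\<^bsub>S\<^esub>p\<in>{..<n}. h (\<Oplus>\<^bsub>R\<^esub>q\<in>{..<n}. x p \<otimes>\<^bsub>R\<^esub> y q \<otimes>\<^bsub>R\<^esub> z p q))"
    by (subst h.hom_finsum) (use assms in \<open>auto simp: comp_def\<close>)
  also have "\<dots> = (\<Oplus>\<^bsub>S\<^esub>p\<in>{..<n}. \<Oplus>\<^bsub>S\<^esub>q\<in>{..<n}. h (x p) \<otimes>\<^bsub>S\<^esub> h (y q) \<otimes>\<^bsub>S\<^esub> h (z p q))"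
  proof (rule S.finsum_cong'[OF refl])
    fix p assume p: "p \<in> {..<n}"
    have "h (\<Oplus>\<^bsub>R\<^esub>q\<in>{..<n}. x p \<otimes>\<^bsub>R\<^esub> y q \<otimes>\<^bsub>R\<^esub> z p q) = (\<Oplus>\<^bsub>S\<^esub>q\<in>{..<n}. h (x p \<otimes>\<^bsub>R\<^esub> y q \<otimes>\<^bsub>R\<^esub> z p q))"
      by (subst h.hom_finsum) (use assms p in \<open>auto simp: comp_def\<close>)
    also have "\<dots> = (\<Oplus>\<^bsub>S\<^esub>q\<in>{..<n}. h (x p) \<otimes>\<^bsub>S\<^esub> h (y q) \<otimes>\<^bsub>S\<^esub> h (z p q))"
      by (rule S.finsum_cong'[OF refl]) (use assms p h.hom_closed in auto)
    finally show "h (\<Oplus>\<^bsub>R\<^esub>q\<in>{..<n}. x p \<otimes>\<^bsub>R\<^esub> y q \<otimes>\<^bsub>R\<^esub> z p q) = (\<Oplus>\<^bsub>S\<^esub>q\<in>{..<n}. h (x p) \<otimes>\<^bsub>S\<^esub> h (y q) \<otimes>\<^bsub>S\<^esub> h (z p q))" .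
  next
    show "(\<lambda>p. \<Oplus>\<^bsub>S\<^esub>q\<in>{..<n}. h (x p) \<otimes>\<^bsub>S\<^esub> h (y q) \<otimes>\<^bsub>S\<^esub> h (z p q)) \<in> {..<n} \<rightarrow> carrier S"
      using assms h.hom_closed by (intro Pi_I S.finsum_closed) auto
  qed
  finally show ?thesis .
qed

lemma aut_mat_cong:
  assumes R: "cring R" and c: "\<And>i j k. i < n \<Longrightarrow> j < n \<Longrightarrow> k < n \<Longrightarrow> c i j k = c' i j k"
    "\<And>i j k. i < n \<Longrightarrow> j < n \<Longrightarrow> k < n \<Longrightarrow> c' i j k \<in> carrier R"
    and M: "aut_mat R n c M N"
  shows "aut_mat R n c' M N"
proof -
  interpret R: cring R by fact
  have cl: "\<And>i j. i < n \<Longrightarrow> j < n \<Longrightarrow> M i j \<in> carrier R" using M by (simp add: aut_mat_def)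
  have 1: "(\<Oplus>\<^bsub>R\<^esub>k\<in>{..<n}. M l k \<otimes>\<^bsub>R\<^esub> c i j k) = (\<Oplus>\<^bsub>R\<^esub>k\<in>{..<n}. M l k \<otimes>\<^bsub>R\<^esub> c' i j k)"
    if "i < n" "j < n" "l < n" for i j l
    by (rule R.finsum_cong'[OF refl]) (use cl c that in auto)
  have 2: "(\<Oplus>\<^bsub>R\<^esub>p\<in>{..<n}. \<Oplus>\<^bsub>R\<^esub>q\<in>{..<n}. M p i \<otimes>\<^bsub>R\<^esub> M q j \<otimes>\<^bsub>R\<^esub> c p q l) =
      (\<Oplus>\<^bsub>R\<^esub>p\<in>{..<n}. \<Oplus>\<^bsub>R\<^esub>q\<in>{..<n}. M p i \<otimes>\<^bsub>R\<^esub> M q j \<otimes>\<^bsub>R\<^esub> c' p q l)"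
    if "i < n" "j < n" "l < n" for i j l
    by (intro R.finsum_cong' refl) (use cl c that in \<open>auto intro!: R.finsum_closed\<close>)
  show ?thesis using M 1 2 unfolding aut_mat_def by simp
qed

lemma grad_mat_cong:
  assumes R: "cring R" and c: "\<And>i j k. i < n \<Longrightarrow> j < n \<Longrightarrow> k < n \<Longrightarrow> c i j k = c' i j k"
    "\<And>i j k. i < n \<Longrightarrow> j < n \<Longrightarrow> k < n \<Longrightarrow> c' i j k \<in> carrier R"
    and E: "grad_mat R n c G T E"
  shows "grad_mat R n c' G T E"
proof -
  interpret R: cring R by fact
  have cl: "\<And>g i j. g \<in> carrier G \<Longrightarrow> i < n \<Longrightarrow> j < n \<Longrightarrow> E g i j \<in> carrier R" using E by (simp add: grad_mat_def)
  have in2: "(\<Oplus>\<^bsub>R\<^esub>p\<in>{..<n}. \<Oplus>\<^bsub>R\<^esub>q\<in>{..<n}. E g p i \<otimes>\<^bsub>R\<^esub> E h q j \<otimes>\<^bsub>R\<^esub> c p q r) =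
      (\<Oplus>\<^bsub>R\<^esub>p\<in>{..<n}. \<Oplus>\<^bsub>R\<^esub>q\<in>{..<n}. E g p i \<otimes>\<^bsub>R\<^esub> E h q j \<otimes>\<^bsub>R\<^esub> c' p q r)"
    if "i < n" "j < n" "r < n" "g \<in> carrier G" "h \<in> carrier G" for i j r g h
    by (intro R.finsum_cong' refl) (use cl c that in \<open>auto intro!: R.finsum_closed\<close>)
  have 2: "(\<Oplus>\<^bsub>R\<^esub>r\<in>{..<n}. E k l r \<otimes>\<^bsub>R\<^esub> (\<Oplus>\<^bsub>R\<^esub>p\<in>{..<n}. \<Oplus>\<^bsub>R\<^esub>q\<in>{..<n}. E g p i \<otimes>\<^bsub>R\<^esub> E h q j \<otimes>\<^bsub>R\<^esub> c p q r)) =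
      (\<Oplus>\<^bsub>R\<^esub>r\<in>{..<n}. E k l r \<otimes>\<^bsub>R\<^esub> (\<Oplus>\<^bsub>R\<^esub>p\<in>{..<n}. \<Oplus>\<^bsub>R\<^esub>q\<in>{..<n}. E g p i \<otimes>\<^bsub>R\<^esub> E h q j \<otimes>\<^bsub>R\<^esub> c' p q r))"
    if "i < n" "j < n" "l < n" "g \<in> carrier G" "h \<in> carrier G" "k \<in> carrier G" for i j l g h k
  proof (rule R.finsum_cong'[OF refl])
    show "(\<lambda>r. E k l r \<otimes>\<^bsub>R\<^esub> (\<Oplus>\<^bsub>R\<^esub>p\<in>{..<n}. \<Oplus>\<^bsub>R\<^esub>q\<in>{..<n}. E g p i \<otimes>\<^bsub>R\<^esub> E h q j \<otimes>\<^bsub>R\<^esub> c' p q r)) \<in> {..<n} \<rightarrow> carrier R"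
      using cl c that by (intro Pi_I R.m_closed bilinear_sum_closed[OF R]) auto
  qed (use in2 that in auto)
  show ?thesis using E 2 unfolding grad_mat_def by simp
qed

text \<open>
  Matrix equations are preserved by ring homomorphisms, and reflected by jointly injective families
  of ring homomorphisms.
\<close>

locale ring_hom_family =
  fixes R :: "('r, 'm) ring_scheme" and S :: "'x \<Rightarrow> ('s, 'q) ring_scheme" and h :: "'x \<Rightarrow> 'r \<Rightarrow> 's"
  assumes R: "cring R" and S: "\<And>x. cring (S x)" and h: "\<And>x. h x \<in> ring_hom R (S x)"
begin

lemma images:
  "r \<in> carrier R \<Longrightarrow> h x r \<in> carrier (S x)" "h x \<one>\<^bsub>R\<^esub> = \<one>\<^bsub>S x\<^esub>" "h x \<zero>\<^bsub>R\<^esub> = \<zero>\<^bsub>S x\<^esub>"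
  using ring_hom_closed[OF h] ring_hom_one[OF h]
    ring_hom_zero[OF h cring.axioms(1)[OF R] cring.axioms(1)[OF S]] by auto

lemma delta: "h x (if P then \<one>\<^bsub>R\<^esub> else \<zero>\<^bsub>R\<^esub>) = (if P then \<one>\<^bsub>S x\<^esub> else \<zero>\<^bsub>S x\<^esub>)"
  by (simp add: images)

lemmas mult_sum = hom_finsum_mult[OF R S h]
lemmas bil_sum = hom_bilinear_sum[OF R S h]
lemmas bil_closed = bilinear_sum_closed[OF R]

lemma mult_sum_closed:
  assumes "\<And>k. k < n \<Longrightarrow> x k \<in> carrier R" "\<And>k. k < n \<Longrightarrow> y k \<in> carrier R"
  shows "(\<Oplus>\<^bsub>R\<^esub>k\<in>{..<(n::nat)}. x k \<otimes>\<^bsub>R\<^esub> y k) \<in> carrier R"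
proof -
  interpret R: cring R by (rule R)
  show ?thesis using assms by (intro R.finsum_closed) auto
qed

lemma one_zero: "\<one>\<^bsub>R\<^esub> \<in> carrier R" "\<zero>\<^bsub>R\<^esub> \<in> carrier R"
proof -
  interpret R: cring R by (rule R)
  show "\<one>\<^bsub>R\<^esub> \<in> carrier R" "\<zero>\<^bsub>R\<^esub> \<in> carrier R" by auto
qed

lemma sum_hom:
  assumes "\<And>g. g \<in> T \<Longrightarrow> f g \<in> carrier R"
  shows "h x (\<Oplus>\<^bsub>R\<^esub>g\<in>T. f g) = (\<Oplus>\<^bsub>S x\<^esub>g\<in>T. h x (f g))" "(\<Oplus>\<^bsub>R\<^esub>g\<in>T. f g) \<in> carrier R"
proof -
  interpret R: cring R by (rule R)
  interpret Sx: cring "S x" by (rule S)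
  interpret h: ring_hom_cring R "S x" "h x" by unfold_locales (rule h)
  show "h x (\<Oplus>\<^bsub>R\<^esub>g\<in>T. f g) = (\<Oplus>\<^bsub>S x\<^esub>g\<in>T. h x (f g))"
    by (subst h.hom_finsum) (use assms in \<open>auto simp: comp_def\<close>)
  show "(\<Oplus>\<^bsub>R\<^esub>g\<in>T. f g) \<in> carrier R" using assms by (intro R.finsum_closed) auto
qed

lemma aut_mat_push:
  assumes c: "\<And>i j k. i < n \<Longrightarrow> j < n \<Longrightarrow> k < n \<Longrightarrow> c i j k \<in> carrier R" and M: "aut_mat R n c M N"
  shows "aut_mat (S x) n (\<lambda>i j k. h x (c i j k)) (\<lambda>i j. h x (M i j)) (\<lambda>i j. h x (N i j))"
proof -
  have cl: "\<And>i j. i < n \<Longrightarrow> j < n \<Longrightarrow> M i j \<in> carrier R" "\<And>i j. i < n \<Longrightarrow> j < n \<Longrightarrow> N i j \<in> carrier R"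
    and eq: "\<And>i j. i < n \<Longrightarrow> j < n \<Longrightarrow> (\<Oplus>\<^bsub>R\<^esub>k\<in>{..<n}. M i k \<otimes>\<^bsub>R\<^esub> N k j) = (if i = j then \<one>\<^bsub>R\<^esub> else \<zero>\<^bsub>R\<^esub>)"
      "\<And>i j. i < n \<Longrightarrow> j < n \<Longrightarrow> (\<Oplus>\<^bsub>R\<^esub>k\<in>{..<n}. N i k \<otimes>\<^bsub>R\<^esub> M k j) = (if i = j then \<one>\<^bsub>R\<^esub> else \<zero>\<^bsub>R\<^esub>)"
      "\<And>i j l. i < n \<Longrightarrow> j < n \<Longrightarrow> l < n \<Longrightarrow> (\<Oplus>\<^bsub>R\<^esub>k\<in>{..<n}. M l k \<otimes>\<^bsub>R\<^esub> c i j k) =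
       (\<Oplus>\<^bsub>R\<^esub>p\<in>{..<n}. \<Oplus>\<^bsub>R\<^esub>q\<in>{..<n}. M p i \<otimes>\<^bsub>R\<^esub> M q j \<otimes>\<^bsub>R\<^esub> c p q l)"
    using M by (auto simp: aut_mat_def)
  show ?thesis unfolding aut_mat_def
  proof (intro conjI allI impI)
    fix i j assume ij: "i < n" "j < n"
    show "h x (M i j) \<in> carrier (S x)" "h x (N i j) \<in> carrier (S x)" using images(1) cl ij by auto
    show "(\<Oplus>\<^bsub>S x\<^esub>k\<in>{..<n}. h x (M i k) \<otimes>\<^bsub>S x\<^esub> h x (N k j)) = (if i = j then \<one>\<^bsub>S x\<^esub> else \<zero>\<^bsub>S x\<^esub>)"
      using mult_sum[of n "\<lambda>k. M i k" "\<lambda>k. N k j" x] cl ij eq(1)[OF ij] delta by simp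
    show "(\<Oplus>\<^bsub>S x\<^esub>k\<in>{..<n}. h x (N i k) \<otimes>\<^bsub>S x\<^esub> h x (M k j)) = (if i = j then \<one>\<^bsub>S x\<^esub> else \<zero>\<^bsub>S x\<^esub>)"
      using mult_sum[of n "\<lambda>k. N i k" "\<lambda>k. M k j" x] cl ij eq(2)[OF ij] delta by simp
    fix l assume l: "l < n"
    show "(\<Oplus>\<^bsub>S x\<^esub>k\<in>{..<n}. h x (M l k) \<otimes>\<^bsub>S x\<^esub> h x (c i j k)) =
       (\<Oplus>\<^bsub>S x\<^esub>p\<in>{..<n}. \<Oplus>\<^bsub>S x\<^esub>q\<in>{..<n}. h x (M p i) \<otimes>\<^bsub>S x\<^esub> h x (M q j) \<otimes>\<^bsub>S x\<^esub> h x (c p q l))"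
      using mult_sum[of n "\<lambda>k. M l k" "\<lambda>k. c i j k" x] bil_sum[of n "\<lambda>p. M p i" "\<lambda>q. M q j" "\<lambda>p q. c p q l" x]
        cl c ij l eq(3)[OF ij l] by simp
  qed
qed

lemma intertwines_push:
  assumes "\<And>i j. i < n \<Longrightarrow> j < n \<Longrightarrow> M i j \<in> carrier R" "\<And>i j. i < n \<Longrightarrow> j < n \<Longrightarrow> E i j \<in> carrier R"
    "\<And>i j. i < n \<Longrightarrow> j < n \<Longrightarrow> E' i j \<in> carrier R" "intertwines R n M E E'"
  shows "intertwines (S x) n (\<lambda>i j. h x (M i j)) (\<lambda>i j. h x (E i j)) (\<lambda>i j. h x (E' i j))"
  unfolding intertwines_def
proof (intro allI impI)
  fix i j assume ij: "i < n" "j < n"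
  show "(\<Oplus>\<^bsub>S x\<^esub>k\<in>{..<n}. h x (M i k) \<otimes>\<^bsub>S x\<^esub> h x (E k j)) = (\<Oplus>\<^bsub>S x\<^esub>k\<in>{..<n}. h x (E' i k) \<otimes>\<^bsub>S x\<^esub> h x (M k j))"
    using mult_sum[of n "\<lambda>k. M i k" "\<lambda>k. E k j" x] mult_sum[of n "\<lambda>k. E' i k" "\<lambda>k. M k j" x]
      assms ij by (simp add: intertwines_def)
qed

lemma grad_mat_push:
  assumes c: "\<And>i j k. i < n \<Longrightarrow> j < n \<Longrightarrow> k < n \<Longrightarrow> c i j k \<in> carrier R" and E: "grad_mat R n c G T E"
  shows "grad_mat (S x) n (\<lambda>i j k. h x (c i j k)) G T (\<lambda>g i j. h x (E g i j))"
proof -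
  have T: "finite T" "T \<subseteq> carrier G"
    and cl: "\<And>g i j. g \<in> carrier G \<Longrightarrow> i < n \<Longrightarrow> j < n \<Longrightarrow> E g i j \<in> carrier R"
    and z: "\<And>g i j. g \<in> carrier G \<Longrightarrow> i < n \<Longrightarrow> j < n \<Longrightarrow> g \<notin> T \<Longrightarrow> E g i j = \<zero>\<^bsub>R\<^esub>"
    and o: "\<And>g h i j. g \<in> carrier G \<Longrightarrow> h \<in> carrier G \<Longrightarrow> i < n \<Longrightarrow> j < n \<Longrightarrow>
       (\<Oplus>\<^bsub>R\<^esub>k\<in>{..<n}. E g i k \<otimes>\<^bsub>R\<^esub> E h k j) = (if g = h then E g i j else \<zero>\<^bsub>R\<^esub>)"
    and s: "\<And>i j. i < n \<Longrightarrow> j < n \<Longrightarrow> (\<Oplus>\<^bsub>R\<^esub>g\<in>T. E g i j) = (if i = j then \<one>\<^bsub>R\<^esub> else \<zero>\<^bsub>R\<^esub>)"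
    and m: "\<And>g h k i j l. g \<in> carrier G \<Longrightarrow> h \<in> carrier G \<Longrightarrow> k \<in> carrier G \<Longrightarrow> k \<noteq> g \<otimes>\<^bsub>G\<^esub> h \<Longrightarrow>
       i < n \<Longrightarrow> j < n \<Longrightarrow> l < n \<Longrightarrow> (\<Oplus>\<^bsub>R\<^esub>r\<in>{..<n}. E k l r \<otimes>\<^bsub>R\<^esub>
         (\<Oplus>\<^bsub>R\<^esub>p\<in>{..<n}. \<Oplus>\<^bsub>R\<^esub>q\<in>{..<n}. E g p i \<otimes>\<^bsub>R\<^esub> E h q j \<otimes>\<^bsub>R\<^esub> c p q r)) = \<zero>\<^bsub>R\<^esub>"
    using E by (auto simp: grad_mat_def)
  show ?thesis unfolding grad_mat_def
  proof (intro conjI allI ballI impI T)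
    fix g i j assume *: "g \<in> carrier G" "i < n" "j < n"
    show "h x (E g i j) \<in> carrier (S x)" using images(1) cl * by auto
    show "h x (E g i j) = \<zero>\<^bsub>S x\<^esub>" if "g \<notin> T" using z[OF * that] images(3) by simp
  next
    fix g h' i j assume *: "g \<in> carrier G" "h' \<in> carrier G" "i < n" "j < n"
    show "(\<Oplus>\<^bsub>S x\<^esub>k\<in>{..<n}. h x (E g i k) \<otimes>\<^bsub>S x\<^esub> h x (E h' k j)) = (if g = h' then h x (E g i j) else \<zero>\<^bsub>S x\<^esub>)"
      using mult_sum[of n "\<lambda>k. E g i k" "\<lambda>k. E h' k j" x] cl * o[OF *] images(3)
      by (cases "g = h'") auto
  next
    fix i j assume *: "i < n" "j < n"
    show "(\<Oplus>\<^bsub>S x\<^esub>g\<in>T. h x (E g i j)) = (if i = j then \<one>\<^bsub>S x\<^esub> else \<zero>\<^bsub>S x\<^esub>)"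
    proof -
      have "E g i j \<in> carrier R" if "g \<in> T" for g using T(2) cl * that by auto
      then show ?thesis using sum_hom(1)[of T "\<lambda>g. E g i j" x] s[OF *] delta by simp
    qed
  next
    fix g h' k i j l assume *: "g \<in> carrier G" "h' \<in> carrier G" "k \<in> carrier G" "k \<noteq> g \<otimes>\<^bsub>G\<^esub> h'" "i < n" "j < n" "l < n"
    let ?s = "\<lambda>r. (\<Oplus>\<^bsub>R\<^esub>p\<in>{..<n}. \<Oplus>\<^bsub>R\<^esub>q\<in>{..<n}. E g p i \<otimes>\<^bsub>R\<^esub> E h' q j \<otimes>\<^bsub>R\<^esub> c p q r)"
    have sc: "?s r \<in> carrier R" if "r < n" for r using cl c * that by (intro bil_closed) auto
    have sh: "h x (?s r) = (\<Oplus>\<^bsub>S x\<^esub>p\<in>{..<n}. \<Oplus>\<^bsub>S x\<^esub>q\<in>{..<n}. h x (E g p i) \<otimes>\<^bsub>S x\<^esub> h x (E h' q j) \<otimes>\<^bsub>S x\<^esub> h x (c p q r))"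
      if "r < n" for r using cl c * that by (intro bil_sum) auto
    interpret Sx: cring "S x" by (rule S)
    have "(\<Oplus>\<^bsub>S x\<^esub>r\<in>{..<n}. h x (E k l r) \<otimes>\<^bsub>S x\<^esub>
         (\<Oplus>\<^bsub>S x\<^esub>p\<in>{..<n}. \<Oplus>\<^bsub>S x\<^esub>q\<in>{..<n}. h x (E g p i) \<otimes>\<^bsub>S x\<^esub> h x (E h' q j) \<otimes>\<^bsub>S x\<^esub> h x (c p q r)))
       = (\<Oplus>\<^bsub>S x\<^esub>r\<in>{..<n}. h x (E k l r) \<otimes>\<^bsub>S x\<^esub> h x (?s r))"
    proof (rule Sx.finsum_cong'[OF refl])
      show "(\<lambda>r. h x (E k l r) \<otimes>\<^bsub>S x\<^esub> h x (?s r)) \<in> {..<n} \<rightarrow> carrier (S x)"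
        using sc cl * by (intro Pi_I Sx.m_closed images(1)) auto
    qed (use sh in auto)
    also have "\<dots> = h x (\<Oplus>\<^bsub>R\<^esub>r\<in>{..<n}. E k l r \<otimes>\<^bsub>R\<^esub> ?s r)"
      by (rule mult_sum[symmetric]) (use sc cl * in auto)
    also have "\<dots> = \<zero>\<^bsub>S x\<^esub>" using m[OF *] images(3) by simp
    finally show "(\<Oplus>\<^bsub>S x\<^esub>r\<in>{..<n}. h x (E k l r) \<otimes>\<^bsub>S x\<^esub>
         (\<Oplus>\<^bsub>S x\<^esub>p\<in>{..<n}. \<Oplus>\<^bsub>S x\<^esub>q\<in>{..<n}. h x (E g p i) \<otimes>\<^bsub>S x\<^esub> h x (E h' q j) \<otimes>\<^bsub>S x\<^esub> h x (c p q r))) = \<zero>\<^bsub>S x\<^esub>" .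
  qed
qed

end

locale ring_hom_inj_family = ring_hom_family +
  assumes inj: "\<And>a b. a \<in> carrier R \<Longrightarrow> b \<in> carrier R \<Longrightarrow> (\<And>x. h x a = h x b) \<Longrightarrow> a = b"
begin

lemma aut_mat_reflect:
  assumes c: "\<And>i j k. i < n \<Longrightarrow> j < n \<Longrightarrow> k < n \<Longrightarrow> c i j k \<in> carrier R"
    and cl: "\<And>i j. i < n \<Longrightarrow> j < n \<Longrightarrow> M i j \<in> carrier R" "\<And>i j. i < n \<Longrightarrow> j < n \<Longrightarrow> N i j \<in> carrier R"
    and M: "\<And>x. aut_mat (S x) n (\<lambda>i j k. h x (c i j k)) (\<lambda>i j. h x (M i j)) (\<lambda>i j. h x (N i j))"
  shows "aut_mat R n c M N"
proof -
  have eq: "\<And>x i j. i < n \<Longrightarrow> j < n \<Longrightarrow> (\<Oplus>\<^bsub>S x\<^esub>k\<in>{..<n}. h x (M i k) \<otimes>\<^bsub>S x\<^esub> h x (N k j)) = (if i = j then \<one>\<^bsub>S x\<^esub> else \<zero>\<^bsub>S x\<^esub>)"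
      "\<And>x i j. i < n \<Longrightarrow> j < n \<Longrightarrow> (\<Oplus>\<^bsub>S x\<^esub>k\<in>{..<n}. h x (N i k) \<otimes>\<^bsub>S x\<^esub> h x (M k j)) = (if i = j then \<one>\<^bsub>S x\<^esub> else \<zero>\<^bsub>S x\<^esub>)"
      "\<And>x i j l. i < n \<Longrightarrow> j < n \<Longrightarrow> l < n \<Longrightarrow> (\<Oplus>\<^bsub>S x\<^esub>k\<in>{..<n}. h x (M l k) \<otimes>\<^bsub>S x\<^esub> h x (c i j k)) =
       (\<Oplus>\<^bsub>S x\<^esub>p\<in>{..<n}. \<Oplus>\<^bsub>S x\<^esub>q\<in>{..<n}. h x (M p i) \<otimes>\<^bsub>S x\<^esub> h x (M q j) \<otimes>\<^bsub>S x\<^esub> h x (c p q l))"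
    using M by (auto simp: aut_mat_def)
  show ?thesis unfolding aut_mat_def
  proof (intro conjI allI impI)
    fix i j assume ij: "i < n" "j < n"
    show "M i j \<in> carrier R" "N i j \<in> carrier R" using cl ij by auto
    show "(\<Oplus>\<^bsub>R\<^esub>k\<in>{..<n}. M i k \<otimes>\<^bsub>R\<^esub> N k j) = (if i = j then \<one>\<^bsub>R\<^esub> else \<zero>\<^bsub>R\<^esub>)"
      by (rule inj) (use cl ij one_zero eq(1)[OF ij] delta mult_sum[of n "\<lambda>k. M i k" "\<lambda>k. N k j"]
         mult_sum_closed[of n "\<lambda>k. M i k" "\<lambda>k. N k j"] in simp_all)
    show "(\<Oplus>\<^bsub>R\<^esub>k\<in>{..<n}. N i k \<otimes>\<^bsub>R\<^esub> M k j) = (if i = j then \<one>\<^bsub>R\<^esub> else \<zero>\<^bsub>R\<^esub>)"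
      by (rule inj) (use cl ij one_zero eq(2)[OF ij] delta mult_sum[of n "\<lambda>k. N i k" "\<lambda>k. M k j"]
         mult_sum_closed[of n "\<lambda>k. N i k" "\<lambda>k. M k j"] in simp_all)
    fix l assume l: "l < n"
    show "(\<Oplus>\<^bsub>R\<^esub>k\<in>{..<n}. M l k \<otimes>\<^bsub>R\<^esub> c i j k) =
       (\<Oplus>\<^bsub>R\<^esub>p\<in>{..<n}. \<Oplus>\<^bsub>R\<^esub>q\<in>{..<n}. M p i \<otimes>\<^bsub>R\<^esub> M q j \<otimes>\<^bsub>R\<^esub> c p q l)"
      by (rule inj) (use cl c ij l eq(3)[OF ij l] mult_sum[of n "\<lambda>k. M l k" "\<lambda>k. c i j k"]
         mult_sum_closed[of n "\<lambda>k. M l k" "\<lambda>k. c i j k"] bil_sum[of n "\<lambda>p. M p i" "\<lambda>q. M q j" "\<lambda>p q. c p q l"]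
         bil_closed[of n "\<lambda>p. M p i" "\<lambda>q. M q j" "\<lambda>p q. c p q l"] in simp_all)
  qed
qed

lemma intertwines_reflect:
  assumes "\<And>i j. i < n \<Longrightarrow> j < n \<Longrightarrow> M i j \<in> carrier R" "\<And>i j. i < n \<Longrightarrow> j < n \<Longrightarrow> E i j \<in> carrier R"
    "\<And>i j. i < n \<Longrightarrow> j < n \<Longrightarrow> E' i j \<in> carrier R"
    "\<And>x. intertwines (S x) n (\<lambda>i j. h x (M i j)) (\<lambda>i j. h x (E i j)) (\<lambda>i j. h x (E' i j))"
  shows "intertwines R n M E E'"
  unfolding intertwines_def
proof (intro allI impI)
  fix i j assume ij: "i < n" "j < n"
  show "(\<Oplus>\<^bsub>R\<^esub>k\<in>{..<n}. M i k \<otimes>\<^bsub>R\<^esub> E k j) = (\<Oplus>\<^bsub>R\<^esub>k\<in>{..<n}. E' i k \<otimes>\<^bsub>R\<^esub> M k j)"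
    by (rule inj) (use assms ij mult_sum[of n "\<lambda>k. M i k" "\<lambda>k. E k j"] mult_sum[of n "\<lambda>k. E' i k" "\<lambda>k. M k j"]
       mult_sum_closed[of n "\<lambda>k. M i k" "\<lambda>k. E k j"] mult_sum_closed[of n "\<lambda>k. E' i k" "\<lambda>k. M k j"]
       in \<open>simp_all add: intertwines_def\<close>)
qed

lemma grad_mat_reflect:
  assumes c: "\<And>i j k. i < n \<Longrightarrow> j < n \<Longrightarrow> k < n \<Longrightarrow> c i j k \<in> carrier R"
    and cl: "\<And>g i j. g \<in> carrier G \<Longrightarrow> i < n \<Longrightarrow> j < n \<Longrightarrow> E g i j \<in> carrier R"
    and E: "\<And>x. grad_mat (S x) n (\<lambda>i j k. h x (c i j k)) G T (\<lambda>g i j. h x (E g i j))"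
  shows "grad_mat R n c G T E"
proof -
  have T: "finite T" "T \<subseteq> carrier G"
    and z: "\<And>x g i j. g \<in> carrier G \<Longrightarrow> i < n \<Longrightarrow> j < n \<Longrightarrow> g \<notin> T \<Longrightarrow> h x (E g i j) = \<zero>\<^bsub>S x\<^esub>"
    and o: "\<And>x g h' i j. g \<in> carrier G \<Longrightarrow> h' \<in> carrier G \<Longrightarrow> i < n \<Longrightarrow> j < n \<Longrightarrow>
       (\<Oplus>\<^bsub>S x\<^esub>k\<in>{..<n}. h x (E g i k) \<otimes>\<^bsub>S x\<^esub> h x (E h' k j)) = (if g = h' then h x (E g i j) else \<zero>\<^bsub>S x\<^esub>)"
    and s: "\<And>x i j. i < n \<Longrightarrow> j < n \<Longrightarrow> (\<Oplus>\<^bsub>S x\<^esub>g\<in>T. h x (E g i j)) = (if i = j then \<one>\<^bsub>S x\<^esub> else \<zero>\<^bsub>S x\<^esub>)"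
    and m: "\<And>x g h' k i j l. g \<in> carrier G \<Longrightarrow> h' \<in> carrier G \<Longrightarrow> k \<in> carrier G \<Longrightarrow> k \<noteq> g \<otimes>\<^bsub>G\<^esub> h' \<Longrightarrow>
       i < n \<Longrightarrow> j < n \<Longrightarrow> l < n \<Longrightarrow> (\<Oplus>\<^bsub>S x\<^esub>r\<in>{..<n}. h x (E k l r) \<otimes>\<^bsub>S x\<^esub>
         (\<Oplus>\<^bsub>S x\<^esub>p\<in>{..<n}. \<Oplus>\<^bsub>S x\<^esub>q\<in>{..<n}. h x (E g p i) \<otimes>\<^bsub>S x\<^esub> h x (E h' q j) \<otimes>\<^bsub>S x\<^esub> h x (c p q r))) = \<zero>\<^bsub>S x\<^esub>"
    using E by (auto simp: grad_mat_def)
  show ?thesis unfolding grad_mat_def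
  proof (intro conjI allI ballI impI T)
    fix g i j assume *: "g \<in> carrier G" "i < n" "j < n"
    show "E g i j \<in> carrier R" using cl * by auto
    show "E g i j = \<zero>\<^bsub>R\<^esub>" if "g \<notin> T"
      by (rule inj) (use z[OF * that] images(3) cl * one_zero in auto)
  next
    fix g h' i j assume *: "g \<in> carrier G" "h' \<in> carrier G" "i < n" "j < n"
    show "(\<Oplus>\<^bsub>R\<^esub>k\<in>{..<n}. E g i k \<otimes>\<^bsub>R\<^esub> E h' k j) = (if g = h' then E g i j else \<zero>\<^bsub>R\<^esub>)"
      by (rule inj) (use mult_sum[of n "\<lambda>k. E g i k" "\<lambda>k. E h' k j"] mult_sum_closed[of n "\<lambda>k. E g i k" "\<lambda>k. E h' k j"]
         cl * o[OF *] images(3) one_zero in simp_all)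
  next
    fix i j assume *: "i < n" "j < n"
    have cT: "E g i j \<in> carrier R" if "g \<in> T" for g using T(2) cl * that by auto
    show "(\<Oplus>\<^bsub>R\<^esub>g\<in>T. E g i j) = (if i = j then \<one>\<^bsub>R\<^esub> else \<zero>\<^bsub>R\<^esub>)"
      by (rule inj) (use sum_hom[of T "\<lambda>g. E g i j"] cT s[OF *] delta one_zero in simp_all)
  next
    fix g h' k i j l assume *: "g \<in> carrier G" "h' \<in> carrier G" "k \<in> carrier G" "k \<noteq> g \<otimes>\<^bsub>G\<^esub> h'" "i < n" "j < n" "l < n"
    let ?s = "\<lambda>r. (\<Oplus>\<^bsub>R\<^esub>p\<in>{..<n}. \<Oplus>\<^bsub>R\<^esub>q\<in>{..<n}. E g p i \<otimes>\<^bsub>R\<^esub> E h' q j \<otimes>\<^bsub>R\<^esub> c p q r)"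
    have sc: "?s r \<in> carrier R" if "r < n" for r using cl c * that by (intro bil_closed) auto
    show "(\<Oplus>\<^bsub>R\<^esub>r\<in>{..<n}. E k l r \<otimes>\<^bsub>R\<^esub> ?s r) = \<zero>\<^bsub>R\<^esub>"
    proof (rule inj)
      show "(\<Oplus>\<^bsub>R\<^esub>r\<in>{..<n}. E k l r \<otimes>\<^bsub>R\<^esub> ?s r) \<in> carrier R" using sc cl * by (intro mult_sum_closed) auto
      show "\<zero>\<^bsub>R\<^esub> \<in> carrier R" by (rule one_zero)
      fix x
      interpret Sx: cring "S x" by (rule S)
      have sh: "h x (?s r) = (\<Oplus>\<^bsub>S x\<^esub>p\<in>{..<n}. \<Oplus>\<^bsub>S x\<^esub>q\<in>{..<n}. h x (E g p i) \<otimes>\<^bsub>S x\<^esub> h x (E h' q j) \<otimes>\<^bsub>S x\<^esub> h x (c p q r))"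
        if "r < n" for r using cl c * that by (intro bil_sum) auto
      have "h x (\<Oplus>\<^bsub>R\<^esub>r\<in>{..<n}. E k l r \<otimes>\<^bsub>R\<^esub> ?s r) = (\<Oplus>\<^bsub>S x\<^esub>r\<in>{..<n}. h x (E k l r) \<otimes>\<^bsub>S x\<^esub> h x (?s r))"
        by (rule mult_sum) (use sc cl * in auto)
      also have "\<dots> = (\<Oplus>\<^bsub>S x\<^esub>r\<in>{..<n}. h x (E k l r) \<otimes>\<^bsub>S x\<^esub>
         (\<Oplus>\<^bsub>S x\<^esub>p\<in>{..<n}. \<Oplus>\<^bsub>S x\<^esub>q\<in>{..<n}. h x (E g p i) \<otimes>\<^bsub>S x\<^esub> h x (E h' q j) \<otimes>\<^bsub>S x\<^esub> h x (c p q r)))"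
      proof (rule Sx.finsum_cong'[OF refl])
        show "(\<lambda>r. h x (E k l r) \<otimes>\<^bsub>S x\<^esub>
         (\<Oplus>\<^bsub>S x\<^esub>p\<in>{..<n}. \<Oplus>\<^bsub>S x\<^esub>q\<in>{..<n}. h x (E g p i) \<otimes>\<^bsub>S x\<^esub> h x (E h' q j) \<otimes>\<^bsub>S x\<^esub> h x (c p q r))) \<in> {..<n} \<rightarrow> carrier (S x)"
          using images(1) cl c * by (intro Pi_I Sx.m_closed bilinear_sum_closed[OF S]) auto
      qed (use sh in auto)
      also have "\<dots> = \<zero>\<^bsub>S x\<^esub>" by (rule m[OF *])
      finally show "h x (\<Oplus>\<^bsub>R\<^esub>r\<in>{..<n}. E k l r \<otimes>\<^bsub>R\<^esub> ?s r) = h x \<zero>\<^bsub>R\<^esub>" using images(3) by simp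
    qed
  qed
qed

end

section \<open>Lifting along square-zero extensions\<close>

text \<open>
  The \<open>F\<close>-algebra structure on the image of an injective map \<open>j\<close>.
\<close>

definition transport :: "('r \<Rightarrow> 't) \<Rightarrow> ('f, 'r) module \<Rightarrow> ('f, 't) module" where
  "transport j R = \<lparr>carrier = j ` carrier R,
     monoid.mult = (\<lambda>x y. j (inv_into (carrier R) j x \<otimes>\<^bsub>R\<^esub> inv_into (carrier R) j y)), one = j \<one>\<^bsub>R\<^esub>,
     ring.zero = j \<zero>\<^bsub>R\<^esub>, ring.add = (\<lambda>x y. j (inv_into (carrier R) j x \<oplus>\<^bsub>R\<^esub> inv_into (carrier R) j y)),
     smult = (\<lambda>c x. j (c \<odot>\<^bsub>R\<^esub> inv_into (carrier R) j x))\<rparr>"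

lemma transport_algebra:
  assumes "algebra F R" "inj_on j (carrier R)"
  shows "algebra F (transport j R)" "j \<in> algebra_homs F R (transport j R)"
    "inv_into (carrier R) j \<in> algebra_homs F (transport j R) R"
proof -
  interpret R: algebra F R by fact
  let ?S = "transport j R"
  let ?i = "inv_into (carrier R) j"
  have i [simp]: "?i (j x) = x" if "x \<in> carrier R" for x using assms(2) that by simp
  have j: "j \<in> ring_hom R ?S" by (rule ring_hom_memI) (auto simp: transport_def)
  moreover have "bij_betw j (carrier R) (carrier ?S)" using assms(2) by (simp add: bij_betw_def transport_def)
  ultimately have "j \<in> ring_iso R ?S" by (simp add: ring_iso_def)
  then have "cring (?S\<lparr>zero := j \<zero>\<^bsub>R\<^esub>\<rparr>)" by (rule R.ring_iso_imp_img_cring)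
  then have S: "cring ?S" by (simp add: transport_def)
  show "algebra F ?S"
  proof (rule algebraI[OF R.R.is_cring S])
    fix a x assume "a \<in> carrier F" "x \<in> carrier ?S"
    then show "a \<odot>\<^bsub>?S\<^esub> x \<in> carrier ?S" by (auto simp: transport_def)
  qed (auto simp: transport_def R.smult_l_distr R.smult_r_distr R.smult_assoc1 R.smult_assoc2)
  show "j \<in> algebra_homs F R ?S" using j by (auto simp: algebra_homs_def transport_def)
  have "?i \<in> ring_hom ?S R" by (rule ring_hom_memI) (auto simp: transport_def)
  then show "?i \<in> algebra_homs F ?S R" by (auto simp: algebra_homs_def transport_def)
qed

lemma tensor_map_coord:
  fixes F :: "('f, 'm) ring_scheme" and A :: "('f, 'a, 'n) module_scheme"
    and R :: "('f, 'r, 'p) module_scheme" and S :: "('f, 's, 'q) module_scheme"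
  assumes "scalar_ext F A n b c \<kappa> R" "scalar_ext F A n b c \<kappa> S" and h: "h \<in> algebra_homs F R S"
    and t: "t \<in> carrier (extend_scalars F A R)"
  shows "tensor_map F A S h t \<in> carrier (extend_scalars F A S)"
    "\<And>i. i < n \<Longrightarrow> scalar_ext.coordT A \<kappa> S (tensor_map F A S h t) i = h (scalar_ext.coordT A \<kappa> R t i)"
    "\<And>a r. a \<in> carrier A \<Longrightarrow> r \<in> carrier R \<Longrightarrow> tensor_map F A S h (pure_tensor F A R a r) = pure_tensor F A S a (h r)"
proof -
  interpret R: scalar_ext F A n b c \<kappa> R by fact
  interpret S: scalar_ext F A n b c \<kappa> S by fact
  have hr: "h \<in> ring_hom R S" using h by (simp add: algebra_homs_def)
  have hl: "h (x \<odot>\<^bsub>R\<^esub> r) = x \<odot>\<^bsub>S\<^esub> h r" if "x \<in> carrier F" "r \<in> carrier R" for x r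
    using h that by (simp add: algebra_homs_def)
  interpret h: ring_hom_cring R S h
    by (intro ring_hom_cring.intro ring_hom_cring_axioms.intro R.RR.is_cring S.RR.is_cring hr)
  have fm: "frag_map2 h u \<in> carrier S.Fr \<and> (\<forall>i<n. S.kf i (frag_map2 h u) = h (R.kf i u))"
    if "u \<in> carrier R.Fr" for u
    using that
  proof (induction u rule: R.Fr_induct)
    case zero
    then show ?case by (simp add: R.frag_map2_simps S.Fr_closed S.kf_simps R.kf_simps)
  next
    case (diff x y)
    then show ?case
      by (simp add: R.frag_map2_simps S.Fr_closed S.kf_simps R.kf_simps R.RR.minus_eq S.RR.minus_eq)
  next
    case (one a r)
    then show ?case
      by (simp add: R.frag_map2_simps S.Fr_closed S.kf R.kf hl R.coord_closed)
  qed
  have cls: "tensor_map F A S h (R.cls u) = S.cls (frag_map2 h u)" if u: "u \<in> carrier R.Fr" for u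
    unfolding tensor_map_def
  proof (rule R.cls_Union[OF u])
    fix u' assume u': "u' \<in> carrier R.Fr" "R.cls u' = R.cls u"
    then have "\<forall>i<n. R.kf i u' = R.kf i u" using R.cls_eq_iff[OF u'(1) u] by simp
    then show "S.cls (frag_map2 h u') = S.cls (frag_map2 h u)"
      using fm[OF u] fm[OF u'(1)] by (simp add: S.cls_eq_iff)
  qed
  obtain u where u: "u \<in> carrier R.Fr" "t = R.cls u" using t unfolding R.T_carrier by blast
  show "tensor_map F A S h t \<in> carrier S.T" using fm[OF u(1)] cls[OF u(1)] u(2) by (simp add: S.T_carrier)
  show "S.coordT (tensor_map F A S h t) i = h (R.coordT t i)" if "i < n" for i
    using fm[OF u(1)] cls[OF u(1)] u that by (simp add: S.coordT_cls R.coordT_cls)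
  show "tensor_map F A S h (pure_tensor F A R a r) = pure_tensor F A S a (h r)"
    if "a \<in> carrier A" "r \<in> carrier R" for a r
    using cls[OF R.Fr_closed(4)[OF that]] by (simp add: pure_tensor_def R.frag_map2_simps)
qed

lemma lift_aut_mat_test:
  fixes F :: "('f, 'm) ring_scheme" and A :: "('f, 'a, 'n) module_scheme"
    and R :: "('f, 'r, 'p) module_scheme" and S :: "('f, 's, 'q) module_scheme"
  assumes "scalar_ext F A n b c \<kappa> R" "scalar_ext F A n b c \<kappa> S" and h: "h \<in> algebra_homs F R S"
    and lift: "\<And>\<psi>. \<psi> \<in> Aut_scheme F A S \<Longrightarrow> \<exists>\<phi>. Aut_scheme_map F A R S h \<phi> \<psi>"
    and M: "aut_mat S n (\<lambda>i j k. c i j k \<odot>\<^bsub>S\<^esub> \<one>\<^bsub>S\<^esub>) M N"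
  shows "\<exists>M' N'. aut_mat R n (\<lambda>i j k. c i j k \<odot>\<^bsub>R\<^esub> \<one>\<^bsub>R\<^esub>) M' N' \<and> (\<forall>i<n. \<forall>j<n. h (M' i j) = M i j)"
proof -
  interpret R: scalar_ext F A n b c \<kappa> R by fact
  interpret S: scalar_ext F A n b c \<kappa> S by fact
  interpret TR: based_alg R R.T n R.bT R.c' R.coordT by (rule R.T_based)
  interpret TS: based_alg S S.T n S.bT S.c' S.coordT by (rule S.T_based)
  have M': "aut_mat S n S.c' M N" using M by (simp add: S.emb_def[abs_def])
  define \<psi> where "\<psi> = restrict (TS.lin M) (carrier S.T)"
  have "\<psi> \<in> Aut_scheme F A S" unfolding \<psi>_def Aut_scheme_def by (rule TS.aut_mat_aut[OF M'])
  then obtain \<phi> where "Aut_scheme_map F A R S h \<phi> \<psi>" using lift by blast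
  then have \<phi>: "\<phi> \<in> algebra_auts R R.T" "\<And>t. t \<in> carrier R.T \<Longrightarrow> \<psi> (tensor_map F A S h t) = tensor_map F A S h (\<phi> t)"
    by (auto simp: Aut_scheme_map_def Aut_scheme_def)
  obtain M1 N1 where 1: "aut_mat R n R.c' M1 N1" "\<And>v. v \<in> carrier R.T \<Longrightarrow> TR.lin M1 v = \<phi> v"
    using TR.aut_mat_exists[OF \<phi>(1)] by blast
  have Mc: "TS.mclosed M" using M' by (simp add: TS.aut_mat_iff)
  have M1c: "TR.mclosed M1" using 1(1) by (simp add: TR.aut_mat_iff)
  note tm = tensor_map_coord[OF assms(1,2) h]
  have h1: "h \<one>\<^bsub>R\<^esub> = \<one>\<^bsub>S\<^esub>" using h ring_hom_one by (auto simp: algebra_homs_def)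
  have "h (M1 i j) = M i j" if ij: "i < n" "j < n" for i j
  proof -
    have bj: "R.bT j \<in> carrier R.T" "S.bT j \<in> carrier S.T" using TR.b_closed TS.b_closed ij by auto
    have t: "tensor_map F A S h (R.bT j) = S.bT j"
      using tm(3)[OF bj(1) R.b_closed[OF ij(2)] R.RR.one_closed] h1 by simp
    have "M i j = S.coordT (\<psi> (S.bT j)) i"
      using TS.lin_basis[OF Mc ij] bj(2) by (simp add: \<psi>_def)
    also have "\<dots> = S.coordT (tensor_map F A S h (\<phi> (R.bT j))) i" using \<phi>(2)[OF bj(1)] t by simp
    also have "\<dots> = h (R.coordT (\<phi> (R.bT j)) i)"
      using tm(2)[OF _ ij(1), of "\<phi> (R.bT j)"] TR.lin_closed[OF M1c bj(1)] 1(2)[OF bj(1)] by simp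
    also have "\<dots> = h (M1 i j)" using TR.lin_basis[OF M1c ij] 1(2)[OF bj(1)] by simp
    finally show ?thesis by simp
  qed
  moreover have "aut_mat R n (\<lambda>i j k. c i j k \<odot>\<^bsub>R\<^esub> \<one>\<^bsub>R\<^esub>) M1 N1" using 1(1) by (simp add: R.emb_def[abs_def])
  ultimately show ?thesis by blast
qed

text \<open>
  Smoothness is stated for test algebras with elements in one type. By transport of structure it gives the lifting
  property for all algebras whose carriers inject into that type.
\<close>

theorem lift_aut_mat:
  fixes F :: "('f, 'm) ring_scheme" and A :: "('f, 'a, 'n) module_scheme"
    and R :: "('f, 'r) module" and S :: "('f, 's) module"
    and jR :: "'r \<Rightarrow> (nat multiset \<Rightarrow> 'f) set" and jS :: "'s \<Rightarrow> (nat multiset \<Rightarrow> 'f) set"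
  assumes A: "based_alg F A n b c \<kappa>" and smooth: "smooth_Aut_scheme F A"
    and R: "algebra F R" and S: "algebra F S" and h: "h \<in> algebra_homs F R S" "h ` carrier R = carrier S"
    and sq: "\<And>x y. x \<in> carrier R \<Longrightarrow> y \<in> carrier R \<Longrightarrow> h x = \<zero>\<^bsub>S\<^esub> \<Longrightarrow> h y = \<zero>\<^bsub>S\<^esub> \<Longrightarrow> x \<otimes>\<^bsub>R\<^esub> y = \<zero>\<^bsub>R\<^esub>"
    and jR: "inj_on jR (carrier R)" and jS: "inj_on jS (carrier S)"
    and M: "aut_mat S n (\<lambda>i j k. c i j k \<odot>\<^bsub>S\<^esub> \<one>\<^bsub>S\<^esub>) M N"
  shows "\<exists>M' N'. aut_mat R n (\<lambda>i j k. c i j k \<odot>\<^bsub>R\<^esub> \<one>\<^bsub>R\<^esub>) M' N' \<and> (\<forall>i<n. \<forall>j<n. h (M' i j) = M i j)"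
proof -
  interpret A: based_alg F A n b c \<kappa> by fact
  interpret R: algebra F R by fact
  interpret S: algebra F S by fact
  let ?R = "transport jR R" and ?S = "transport jS S"
  let ?iR = "inv_into (carrier R) jR" and ?iS = "inv_into (carrier S) jS"
  note tR = transport_algebra[OF R jR] and tS = transport_algebra[OF S jS]
  have hom: "f \<in> ring_hom X1 X2" "\<And>x r. x \<in> carrier F \<Longrightarrow> r \<in> carrier X1 \<Longrightarrow> f (x \<odot>\<^bsub>X1\<^esub> r) = x \<odot>\<^bsub>X2\<^esub> f r"
    if "f \<in> algebra_homs F X1 X2" for f and X1 :: "('f, 'u) module" and X2 :: "('f, 'v) module"
    using that by (auto simp: algebra_homs_def)
  have carR: "carrier ?R = jR ` carrier R" and carS: "carrier ?S = jS ` carrier S" by (simp_all add: transport_def)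
  have zR: "\<zero>\<^bsub>?R\<^esub> = jR \<zero>\<^bsub>R\<^esub>" and zS: "\<zero>\<^bsub>?S\<^esub> = jS \<zero>\<^bsub>S\<^esub>" by (simp_all add: transport_def)
  have hc: "h r \<in> carrier S" if "r \<in> carrier R" for r using h(2) that by blast
  define h' where "h' = (\<lambda>x. jS (h (?iR x)))"
  have h'j: "h' (jR r) = jS (h r)" if "r \<in> carrier R" for r using that jR by (simp add: h'_def)
  have h': "h' \<in> algebra_homs F ?R ?S"
  proof -
    have "h' \<in> ring_hom ?R ?S" unfolding h'_def
      using ring_hom_comp[OF ring_hom_comp[OF hom(1)[OF tR(3)] hom(1)[OF h(1)]] hom(1)[OF tS(2)]] .
    moreover have "h' (x \<odot>\<^bsub>?R\<^esub> r) = x \<odot>\<^bsub>?S\<^esub> h' r" if "x \<in> carrier F" "r \<in> carrier ?R" for x r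
    proof -
      have "?iR r \<in> carrier R" using ring_hom_closed[OF hom(1)[OF tR(3)] that(2)] .
      then show ?thesis unfolding h'_def
        using hom(2)[OF tR(3) that] hom(2)[OF h(1) that(1)] hom(2)[OF tS(2) that(1)] hc by simp
    qed
    ultimately show ?thesis by (simp add: algebra_homs_def)
  qed
  have h's: "h' ` carrier ?R = carrier ?S"
    unfolding carR carS h(2)[symmetric] image_image by (rule image_cong) (simp_all add: h'j)
  have "x \<otimes>\<^bsub>?R\<^esub> y = \<zero>\<^bsub>?R\<^esub>" if xy: "x \<in> carrier ?R" "y \<in> carrier ?R" "h' x = \<zero>\<^bsub>?S\<^esub>" "h' y = \<zero>\<^bsub>?S\<^esub>" for x y
  proof -
    obtain r s where r: "r \<in> carrier R" "x = jR r" and s: "s \<in> carrier R" "y = jR s" using xy(1,2) carR by auto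
    have "h r = \<zero>\<^bsub>S\<^esub>" "h s = \<zero>\<^bsub>S\<^esub>"
      using xy(3,4) r s h'j zS hc inj_onD[OF jS] by auto
    then have "r \<otimes>\<^bsub>R\<^esub> s = \<zero>\<^bsub>R\<^esub>" using sq r s by simp
    then show ?thesis using r s ring_hom_mult[OF hom(1)[OF tR(2)] r(1) s(1)] zR by simp
  qed
  then have lift: "\<exists>\<phi>. Aut_scheme_map F A ?R ?S h' \<phi> \<psi>" if "\<psi> \<in> Aut_scheme F A ?S" for \<psi>
    using smooth[unfolded smooth_Aut_scheme_def, rule_format, OF tR(1) tS(1) h' h's _ that] by blast
  have sR: "scalar_ext F A n b c \<kappa> ?R" and sS: "scalar_ext F A n b c \<kappa> ?S"
    using A tR(1) tS(1) by (simp_all add: scalar_ext_def)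
  have crS: "cring ?S" and crR: "cring ?R"
    using tR(1) tS(1) by (simp_all add: algebra_def)
  interpret fS: ring_hom_family S "\<lambda>_::unit. ?S" "\<lambda>_. jS"
    by (rule ring_hom_family.intro) (rule S.is_cring crS hom(1)[OF tS(2)])+
  interpret fR: ring_hom_family ?R "\<lambda>_::unit. R" "\<lambda>_. ?iR"
    by (rule ring_hom_family.intro) (rule R.is_cring crR hom(1)[OF tR(3)])+
  have jc: "jS (c i j k \<odot>\<^bsub>S\<^esub> \<one>\<^bsub>S\<^esub>) = c i j k \<odot>\<^bsub>?S\<^esub> \<one>\<^bsub>?S\<^esub>" if "i < n" "j < n" "k < n" for i j k
    using hom(2)[OF tS(2) A.c_closed[OF that] S.one_closed] fS.images(2) by simp
  have ic: "?iR (c i j k \<odot>\<^bsub>?R\<^esub> \<one>\<^bsub>?R\<^esub>) = c i j k \<odot>\<^bsub>R\<^esub> \<one>\<^bsub>R\<^esub>" if "i < n" "j < n" "k < n" for i j k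
    using hom(2)[OF tR(3) A.c_closed[OF that] fR.one_zero(1)] fR.images(2) by simp
  have MS: "aut_mat ?S n (\<lambda>i j k. c i j k \<odot>\<^bsub>?S\<^esub> \<one>\<^bsub>?S\<^esub>) (\<lambda>i j. jS (M i j)) (\<lambda>i j. jS (N i j))"
  proof (rule aut_mat_cong)
    show "cring ?S" using tS(1) by (simp add: algebra_def)
    show "aut_mat ?S n (\<lambda>i j k. jS (c i j k \<odot>\<^bsub>S\<^esub> \<one>\<^bsub>S\<^esub>)) (\<lambda>i j. jS (M i j)) (\<lambda>i j. jS (N i j))"
      by (rule fS.aut_mat_push[OF _ M]) (use A.c_closed in auto)
    show "jS (c i j k \<odot>\<^bsub>S\<^esub> \<one>\<^bsub>S\<^esub>) = c i j k \<odot>\<^bsub>?S\<^esub> \<one>\<^bsub>?S\<^esub>" if "i < n" "j < n" "k < n" for i j k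
      using jc that by blast
    show "c i j k \<odot>\<^bsub>?S\<^esub> \<one>\<^bsub>?S\<^esub> \<in> carrier ?S" if "i < n" "j < n" "k < n" for i j k
      unfolding jc[OF that, symmetric] using fS.images(1) A.c_closed[OF that] by simp
  qed
  obtain M1 N1 where 1: "aut_mat ?R n (\<lambda>i j k. c i j k \<odot>\<^bsub>?R\<^esub> \<one>\<^bsub>?R\<^esub>) M1 N1"
    "\<forall>i<n. \<forall>j<n. h' (M1 i j) = jS (M i j)"
    using lift_aut_mat_test[OF sR sS h' lift MS] by blast
  interpret R': algebra F ?R by (rule tR(1))
  have "aut_mat R n (\<lambda>i j k. ?iR (c i j k \<odot>\<^bsub>?R\<^esub> \<one>\<^bsub>?R\<^esub>)) (\<lambda>i j. ?iR (M1 i j)) (\<lambda>i j. ?iR (N1 i j))"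
    by (rule fR.aut_mat_push[OF _ 1(1)]) (use A.c_closed fR.one_zero in \<open>auto intro!: R'.smult_closed\<close>)
  then have "aut_mat R n (\<lambda>i j k. c i j k \<odot>\<^bsub>R\<^esub> \<one>\<^bsub>R\<^esub>) (\<lambda>i j. ?iR (M1 i j)) (\<lambda>i j. ?iR (N1 i j))"
    by (rule aut_mat_cong[OF R.is_cring, rotated 2]) (use ic A.c_closed in auto)
  moreover have "h (?iR (M1 i j)) = M i j" if ij: "i < n" "j < n" for i j
  proof -
    have m: "M1 i j \<in> carrier ?R" "M i j \<in> carrier S" using 1(1) M ij by (auto simp: aut_mat_def)
    have "?iR (M1 i j) \<in> carrier R" using fR.images(1)[OF m(1)] .
    then show ?thesis using 1(2) ij inj_onD[OF jS, of "h (?iR (M1 i j))" "M i j"] hc m(2) by (simp add: h'_def)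
  qed
  ultimately show ?thesis by blast
qed

context based_alg
begin

lemma grad_ops_conj:
  assumes e: "grad_ops G T e" and M: "aut_mat R n c M N"
  shows "grad_ops G T (\<lambda>g v. lin M (e g (lin N v)))"
proof -
  note eD = grad_opsD[OF e]
  have Mc: "mclosed M" "mclosed N" and inv: "\<And>v. v \<in> carrier V \<Longrightarrow> lin M (lin N v) = v" "\<And>v. v \<in> carrier V \<Longrightarrow> lin N (lin M v) = v"
    and mult: "\<And>v w. v \<in> carrier V \<Longrightarrow> w \<in> carrier V \<Longrightarrow> lin M (v \<otimes>\<^bsub>V\<^esub> w) = lin M v \<otimes>\<^bsub>V\<^esub> lin M w"
    using M unfolding aut_mat_iff by auto
  note lM = lin_linear[OF Mc(1)] and lN = lin_linear[OF Mc(2)]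
  note cM = linear_mapD(1)[OF lM] and cN = linear_mapD(1)[OF lN]
  show ?thesis unfolding grad_ops_def
  proof (intro conjI ballI impI eD(1,2))
    fix g assume "g \<in> carrier G"
    then show "linear_map (\<lambda>v. lin M (e g (lin N v)))"
      by (intro linear_map_comp[OF lM linear_map_comp[OF eD(3) lN]])
  next
    fix g v assume "g \<in> carrier G - T" "v \<in> carrier V"
    then show "lin M (e g (lin N v)) = \<zero>\<^bsub>V\<^esub>" using eD(5) cN linear_map_zero[OF lM] by simp
  next
    fix g h v assume *: "g \<in> carrier G" "h \<in> carrier G" "v \<in> carrier V"
    show "lin M (e g (lin N (lin M (e h (lin N v))))) = (if g = h then lin M (e g (lin N v)) else \<zero>\<^bsub>V\<^esub>)"
      using inv(2)[OF eD(4)[OF *(2) cN[OF *(3)]]] eD(6)[OF *(1,2) cN[OF *(3)]] linear_map_zero[OF lM] by simp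
  next
    fix v assume v: "v \<in> carrier V"
    have "(\<lambda>g. e g (lin N v)) \<in> T \<rightarrow> carrier V" using eD(2,4) cN[OF v] by auto
    from linear_map_finsum[OF lM this] show "(\<Oplus>\<^bsub>V\<^esub>g\<in>T. lin M (e g (lin N v))) = v"
      using eD(7)[OF cN[OF v]] inv(1)[OF v] by simp
  next
    fix g h k v w assume *: "g \<in> carrier G" "h \<in> carrier G" "k \<in> carrier G" "k \<noteq> g \<otimes>\<^bsub>G\<^esub> h" "v \<in> carrier V" "w \<in> carrier V"
    have c: "e g (lin N v) \<in> carrier V" "e h (lin N w) \<in> carrier V" using eD(4) * cN by auto
    have "lin N (lin M (e g (lin N v)) \<otimes>\<^bsub>V\<^esub> lin M (e h (lin N w))) = e g (lin N v) \<otimes>\<^bsub>V\<^esub> e h (lin N w)"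
      using mult[OF c] inv(2)[OF prod_closed[OF c]] by simp
    then show "lin M (e k (lin N (lin M (e g (lin N v)) \<otimes>\<^bsub>V\<^esub> lin M (e h (lin N w))))) = \<zero>\<^bsub>V\<^esub>"
      using eD(8)[OF *(1-4) cN[OF *(5)] cN[OF *(6)]] linear_map_zero[OF lM] by simp
  qed
qed

text \<open>
  The elements with all coordinates in a set \<open>I\<close> of scalars.
\<close>

definition coords_in :: "'a set \<Rightarrow> 'c set" where
  "coords_in I = {v \<in> carrier V. \<forall>i<n. \<kappa> v i \<in> I}"

lemma linear_map_diff:
  assumes "linear_map \<phi>" "linear_map \<psi>" shows "linear_map (\<lambda>v. \<phi> v \<ominus>\<^bsub>V\<^esub> \<psi> v)"
proof (rule linear_mapI)
  note f = linear_mapD[OF assms(1)] and g = linear_mapD[OF assms(2)]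
  show "\<phi> v \<ominus>\<^bsub>V\<^esub> \<psi> v \<in> carrier V" if "v \<in> carrier V" for v using f(1) g(1) that by simp
  show "\<phi> (v \<oplus>\<^bsub>V\<^esub> w) \<ominus>\<^bsub>V\<^esub> \<psi> (v \<oplus>\<^bsub>V\<^esub> w) = (\<phi> v \<ominus>\<^bsub>V\<^esub> \<psi> v) \<oplus>\<^bsub>V\<^esub> (\<phi> w \<ominus>\<^bsub>V\<^esub> \<psi> w)"
    if "v \<in> carrier V" "w \<in> carrier V" for v w
    using f g that by (simp add: M.minus_eq M.minus_add M.a_ac)
  show "\<phi> (r \<odot>\<^bsub>V\<^esub> v) \<ominus>\<^bsub>V\<^esub> \<psi> (r \<odot>\<^bsub>V\<^esub> v) = r \<odot>\<^bsub>V\<^esub> (\<phi> v \<ominus>\<^bsub>V\<^esub> \<psi> v)"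
    if "r \<in> carrier R" "v \<in> carrier V" for r v
    using f g that by (simp add: M.minus_eq smult_r_distr smult_r_minus)
qed

lemma coord_linear:
  assumes "linear_map \<phi>" "v \<in> carrier V" "i < n"
  shows "\<kappa> (\<phi> v) i = (\<Oplus>j\<in>{..<n}. \<kappa> (\<phi> (b j)) i \<otimes> \<kappa> v j)"
  using lin_coord[OF mat_closed[OF assms(1)] assms(2,3)] lin_mat[OF assms(1,2)] by (simp add: mat_def)

lemma square_zero_prod:
  assumes "I \<subseteq> carrier R" "\<And>x y. x \<in> I \<Longrightarrow> y \<in> I \<Longrightarrow> x \<otimes> y = \<zero>" "v \<in> coords_in I" "w \<in> coords_in I"
  shows "v \<otimes>\<^bsub>V\<^esub> w = \<zero>\<^bsub>V\<^esub>"
proof (rule coord_inj)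
  have v: "v \<in> carrier V" "\<And>i. i < n \<Longrightarrow> \<kappa> v i \<in> I" and w: "w \<in> carrier V" "\<And>i. i < n \<Longrightarrow> \<kappa> w i \<in> I"
    using assms(3,4) by (auto simp: coords_in_def)
  show "v \<otimes>\<^bsub>V\<^esub> w \<in> carrier V" using v w prod_closed by simp
  fix k assume k: "k < n"
  have "\<kappa> (v \<otimes>\<^bsub>V\<^esub> w) k = (\<Oplus>i\<in>{..<n}. \<Oplus>j\<in>{..<n}. \<zero>)"
    unfolding coord_mult[OF v(1) w(1) k]
    by (intro R.finsum_cong' refl) (use v w assms(2) c_closed k in auto)
  then show "\<kappa> (v \<otimes>\<^bsub>V\<^esub> w) k = \<kappa> \<zero>\<^bsub>V\<^esub> k" using k by (simp add: coord_zero)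
qed simp

lemma square_zero_linear:
  assumes "I \<subseteq> carrier R" "\<And>x y. x \<in> I \<Longrightarrow> y \<in> I \<Longrightarrow> x \<otimes> y = \<zero>" "linear_map \<phi>"
    "\<And>j. j < n \<Longrightarrow> \<phi> (b j) \<in> coords_in I" "w \<in> coords_in I"
  shows "\<phi> w = \<zero>\<^bsub>V\<^esub>"
proof (rule coord_inj)
  have w: "w \<in> carrier V" "\<And>i. i < n \<Longrightarrow> \<kappa> w i \<in> I" using assms(5) by (auto simp: coords_in_def)
  show "\<phi> w \<in> carrier V" using linear_mapD(1)[OF assms(3) w(1)] .
  fix i assume i: "i < n"
  have "\<kappa> (\<phi> w) i = (\<Oplus>j\<in>{..<n}. \<zero>)"
    unfolding coord_linear[OF assms(3) w(1) i]
    by (rule R.finsum_cong'[OF refl]) (use w assms(2,4) i in \<open>auto simp: coords_in_def\<close>)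
  then show "\<kappa> (\<phi> w) i = \<kappa> \<zero>\<^bsub>V\<^esub> i" using i by (simp add: coord_zero)
qed simp

end

text \<open>
  Two gradings over \<open>R\<close> that become isomorphic over \<open>S\<close>, where \<open>R \<rightarrow> S\<close> is surjective with square-zero kernel,
  are isomorphic. Smoothness lifts the isomorphism to an automorphism; after conjugation with it the two gradings agree
  modulo the kernel, and the map of the comparison of two such gradings is an isomorphism between them.
\<close>

lemma lift_isomorphism:
  fixes F :: "('f, 'm) ring_scheme" and A :: "('f, 'a, 'n) module_scheme"
    and R :: "('f, 'r) module" and S :: "('f, 's) module"
    and jR :: "'r \<Rightarrow> (nat multiset \<Rightarrow> 'f) set" and jS :: "'s \<Rightarrow> (nat multiset \<Rightarrow> 'f) set"
  assumes A: "based_alg F A n b c \<kappa>" and smooth: "smooth_Aut_scheme F A" and G: "group G"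
    and R: "algebra F R" and S: "algebra F S" and h: "h \<in> algebra_homs F R S" "h ` carrier R = carrier S"
    and sq: "\<And>x y. x \<in> carrier R \<Longrightarrow> y \<in> carrier R \<Longrightarrow> h x = \<zero>\<^bsub>S\<^esub> \<Longrightarrow> h y = \<zero>\<^bsub>S\<^esub> \<Longrightarrow> x \<otimes>\<^bsub>R\<^esub> y = \<zero>\<^bsub>R\<^esub>"
    and jR: "inj_on jR (carrier R)" and jS: "inj_on jS (carrier S)"
    and E0: "grad_mat R n (\<lambda>i j k. c i j k \<odot>\<^bsub>R\<^esub> \<one>\<^bsub>R\<^esub>) G T E0" and E: "grad_mat R n (\<lambda>i j k. c i j k \<odot>\<^bsub>R\<^esub> \<one>\<^bsub>R\<^esub>) G T E"
    and M: "aut_mat S n (\<lambda>i j k. c i j k \<odot>\<^bsub>S\<^esub> \<one>\<^bsub>S\<^esub>) M N"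
    and int: "\<And>g. g \<in> carrier G \<Longrightarrow> intertwines S n M (\<lambda>i j. h (E0 g i j)) (\<lambda>i j. h (E g i j))"
  shows "\<exists>M N. aut_mat R n (\<lambda>i j k. c i j k \<odot>\<^bsub>R\<^esub> \<one>\<^bsub>R\<^esub>) M N \<and> (\<forall>g \<in> carrier G. intertwines R n M (E0 g) (E g))"
proof -
  interpret R: scalar_ext F A n b c \<kappa> R using A R by (simp add: scalar_ext_def)
  interpret V: based_alg R R.T n R.bT R.c' R.coordT by (rule R.T_based)
  have ce: "(\<lambda>i j k. c i j k \<odot>\<^bsub>R\<^esub> \<one>\<^bsub>R\<^esub>) = R.c'" by (simp add: R.emb_def fun_eq_iff)
  note E0' = E0[unfolded ce] and E' = E[unfolded ce]
  obtain M1 N1 where 1: "aut_mat R n R.c' M1 N1" and hM: "\<And>i j. i < n \<Longrightarrow> j < n \<Longrightarrow> h (M1 i j) = M i j"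
    using lift_aut_mat[OF A smooth R S h sq jR jS M] unfolding ce by blast
  have hr: "h \<in> ring_hom R S" using h(1) by (simp add: algebra_homs_def)
  have Rc: "cring R" and Sc: "cring S" using R S by (simp_all add: algebra_def)
  interpret hh: ring_hom_cring R S h
    by (intro ring_hom_cring.intro ring_hom_cring_axioms.intro Rc Sc hr)
  define I where "I = {x \<in> carrier R. h x = \<zero>\<^bsub>S\<^esub>}"
  have I: "I \<subseteq> carrier R" "\<And>x y. x \<in> I \<Longrightarrow> y \<in> I \<Longrightarrow> x \<otimes>\<^bsub>R\<^esub> y = \<zero>\<^bsub>R\<^esub>" using sq by (auto simp: I_def)
  let ?W = "V.coords_in I"
  have W: "?W \<subseteq> carrier R.T" by (auto simp: V.coords_in_def)
  define e where "e = (\<lambda>g. V.lin (E g))"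
  define e0 where "e0 = (\<lambda>g. V.lin (E0 g))"
  define e' where "e' = (\<lambda>g v. V.lin M1 (e0 g (V.lin N1 v)))"
  have ge: "V.grad_ops G T e" unfolding e_def using V.grad_mat_ops[OF E'] .
  have ge0: "V.grad_ops G T e0" unfolding e0_def using V.grad_mat_ops[OF E0'] .
  have ge': "V.grad_ops G T e'" unfolding e'_def using V.grad_ops_conj[OF ge0 1] .
  note eD = V.grad_opsD[OF ge] and e0D = V.grad_opsD[OF ge0] and e'D = V.grad_opsD[OF ge']
  have Mc: "V.mclosed M1" "V.mclosed N1" and inv: "\<And>v. v \<in> carrier R.T \<Longrightarrow> V.lin M1 (V.lin N1 v) = v" "\<And>v. v \<in> carrier R.T \<Longrightarrow> V.lin N1 (V.lin M1 v) = v"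
    and mult: "\<And>v w. v \<in> carrier R.T \<Longrightarrow> w \<in> carrier R.T \<Longrightarrow> V.lin M1 (v \<otimes>\<^bsub>R.T\<^esub> w) = V.lin M1 v \<otimes>\<^bsub>R.T\<^esub> V.lin M1 w"
    using 1 unfolding V.aut_mat_iff by auto
  note lM = V.lin_linear[OF Mc(1)] and lN = V.lin_linear[OF Mc(2)]
  note cM = V.linear_mapD(1)[OF lM] and cN = V.linear_mapD(1)[OF lN]
  have Ec: "V.mclosed (E g)" "V.mclosed (E0 g)" if "g \<in> carrier G" for g
    using V.grad_mat_closed[OF E' that] V.grad_mat_closed[OF E0' that] by auto
  have inW: "v \<ominus>\<^bsub>R.T\<^esub> w \<in> ?W" if "v \<in> carrier R.T" "w \<in> carrier R.T" "\<And>i. i < n \<Longrightarrow> h (R.coordT v i) = h (R.coordT w i)" for v w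
  proof -
    have "R.coordT (v \<ominus>\<^bsub>R.T\<^esub> w) i \<in> I" if i: "i < n" for i
    proof -
      have v: "R.coordT v i \<in> carrier R" "R.coordT w i \<in> carrier R" "R.coordT (v \<ominus>\<^bsub>R.T\<^esub> w) i \<in> carrier R"
        using V.coord_closed that(1) \<open>v \<in> carrier R.T\<close> \<open>w \<in> carrier R.T\<close> by auto
      have "v = v \<ominus>\<^bsub>R.T\<^esub> w \<oplus>\<^bsub>R.T\<^esub> w"
        using \<open>v \<in> carrier R.T\<close> \<open>w \<in> carrier R.T\<close> by (simp add: V.M.minus_eq V.M.a_assoc V.M.l_neg)
      then have "R.coordT v i = R.coordT (v \<ominus>\<^bsub>R.T\<^esub> w) i \<oplus>\<^bsub>R\<^esub> R.coordT w i"
        using V.coord_add[OF _ _ i, of "v \<ominus>\<^bsub>R.T\<^esub> w" w] \<open>v \<in> carrier R.T\<close> \<open>w \<in> carrier R.T\<close> by simp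
      then have "h (R.coordT v i) = h (R.coordT (v \<ominus>\<^bsub>R.T\<^esub> w) i) \<oplus>\<^bsub>S\<^esub> h (R.coordT w i)" using v by simp
      then show ?thesis using \<open>\<And>i. i < n \<Longrightarrow> h (R.coordT v i) = h (R.coordT w i)\<close>[OF i] v by (simp add: I_def)
    qed
    then show ?thesis using that(1,2) by (simp add: V.coords_in_def)
  qed
  \<comment> \<open>modulo the kernel of \<open>h\<close>, the lifted automorphism intertwines the two gradings\<close>
  have basis: "h (R.coordT (V.lin M1 (e0 g (R.bT j))) i) = h (R.coordT (e g (V.lin M1 (R.bT j))) i)"
    if g: "g \<in> carrier G" and ij: "i < n" "j < n" for g i j
  proof -
    have mc: "\<And>i j. i < n \<Longrightarrow> j < n \<Longrightarrow> M1 i j \<in> carrier R" "\<And>i j. i < n \<Longrightarrow> j < n \<Longrightarrow> E g i j \<in> carrier R"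
      "\<And>i j. i < n \<Longrightarrow> j < n \<Longrightarrow> E0 g i j \<in> carrier R"
      using Mc Ec[OF g] by (auto simp: V.mclosed_def)
    have "h (R.coordT (V.lin M1 (e0 g (R.bT j))) i) = h (\<Oplus>\<^bsub>R\<^esub>k\<in>{..<n}. M1 i k \<otimes>\<^bsub>R\<^esub> E0 g k j)"
      unfolding e0_def using V.lin_lin_coord[OF Mc(1) Ec(2)[OF g] ij] by simp
    also have "\<dots> = (\<Oplus>\<^bsub>S\<^esub>k\<in>{..<n}. h (M1 i k) \<otimes>\<^bsub>S\<^esub> h (E0 g k j))"
      by (rule hom_finsum_mult[OF Rc Sc hr]) (use mc ij in auto)
    also have "\<dots> = (\<Oplus>\<^bsub>S\<^esub>k\<in>{..<n}. M i k \<otimes>\<^bsub>S\<^esub> h (E0 g k j))"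
      by (rule hh.S.finsum_cong'[OF refl]) (use mc ij hM M in \<open>auto simp: aut_mat_def\<close>)
    also have "\<dots> = (\<Oplus>\<^bsub>S\<^esub>k\<in>{..<n}. h (E g i k) \<otimes>\<^bsub>S\<^esub> M k j)"
      using int[OF g] ij by (simp add: intertwines_def)
    also have "\<dots> = (\<Oplus>\<^bsub>S\<^esub>k\<in>{..<n}. h (E g i k) \<otimes>\<^bsub>S\<^esub> h (M1 k j))"
      by (rule hh.S.finsum_cong'[OF refl]) (use mc ij hM M in \<open>auto simp: aut_mat_def\<close>)
    also have "\<dots> = h (\<Oplus>\<^bsub>R\<^esub>k\<in>{..<n}. E g i k \<otimes>\<^bsub>R\<^esub> M1 k j)"
      by (rule hom_finsum_mult[OF Rc Sc hr, symmetric]) (use mc ij in auto)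
    also have "\<dots> = h (R.coordT (e g (V.lin M1 (R.bT j))) i)"
      unfolding e_def using V.lin_lin_coord[OF Ec(1)[OF g] Mc(1) ij] by simp
    finally show ?thesis .
  qed
  have ext: "h (R.coordT (\<phi> v) i) = h (R.coordT (\<psi> v) i)"
    if "V.linear_map \<phi>" "V.linear_map \<psi>" "\<And>i j. i < n \<Longrightarrow> j < n \<Longrightarrow> h (R.coordT (\<phi> (R.bT j)) i) = h (R.coordT (\<psi> (R.bT j)) i)"
      "v \<in> carrier R.T" "i < n" for \<phi> \<psi> v i
  proof -
    have cc: "R.coordT (\<phi> (R.bT j)) i \<in> carrier R" "R.coordT (\<psi> (R.bT j)) i \<in> carrier R" "R.coordT v j \<in> carrier R" if j: "j < n" for j
      using V.coord_closed V.linear_mapD(1)[OF \<open>V.linear_map \<phi>\<close>] V.linear_mapD(1)[OF \<open>V.linear_map \<psi>\<close>] V.b_closed[OF j] \<open>v \<in> carrier R.T\<close> \<open>i < n\<close> j by auto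
    have "h (R.coordT (\<phi> v) i) = (\<Oplus>\<^bsub>S\<^esub>j\<in>{..<n}. h (R.coordT (\<phi> (R.bT j)) i) \<otimes>\<^bsub>S\<^esub> h (R.coordT v j))"
      unfolding V.coord_linear[OF that(1,4,5)] by (rule hom_finsum_mult[OF Rc Sc hr]) (use cc in auto)
    also have "\<dots> = (\<Oplus>\<^bsub>S\<^esub>j\<in>{..<n}. h (R.coordT (\<psi> (R.bT j)) i) \<otimes>\<^bsub>S\<^esub> h (R.coordT v j))"
      by (rule hh.S.finsum_cong'[OF refl]) (use cc that(3,5) in auto)
    also have "\<dots> = h (R.coordT (\<psi> v) i)"
      unfolding V.coord_linear[OF that(2,4,5)] by (rule hom_finsum_mult[OF Rc Sc hr, symmetric]) (use cc in auto)
    finally show ?thesis .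
  qed
  have close0: "h (R.coordT (e' g v) i) = h (R.coordT (e g v) i)" if g: "g \<in> carrier G" and v: "v \<in> carrier R.T" and i: "i < n" for g v i
  proof -
    have "h (R.coordT (V.lin M1 (e0 g u)) i) = h (R.coordT (e g (V.lin M1 u)) i)" if "u \<in> carrier R.T" for u
      by (rule ext[of "\<lambda>u. V.lin M1 (e0 g u)" "\<lambda>u. e g (V.lin M1 u)"])
         (use that i basis[OF g] in \<open>auto intro!: V.linear_map_comp[OF lM e0D(3)[OF g]] V.linear_map_comp[OF eD(3)[OF g] lM]\<close>)
    from this[OF cN[OF v]] show ?thesis using inv(1)[OF v] by (simp add: e'_def)
  qed
  have close: "e g v \<ominus>\<^bsub>R.T\<^esub> e' g v \<in> ?W" "e' g v \<ominus>\<^bsub>R.T\<^esub> e g v \<in> ?W" if g: "g \<in> carrier G" and v: "v \<in> carrier R.T" for g v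
    using inW[OF eD(4)[OF that] e'D(4)[OF that]] inW[OF e'D(4)[OF that] eD(4)[OF that]] close0[OF that] by auto
  have sqW: "e g w = e' g w" if g: "g \<in> carrier G" and w: "w \<in> ?W" for g w
  proof -
    have wV: "w \<in> carrier R.T" using w W by blast
    have "e g w \<ominus>\<^bsub>R.T\<^esub> e' g w = \<zero>\<^bsub>R.T\<^esub>"
      by (rule V.square_zero_linear[OF I V.linear_map_diff[OF eD(3)[OF g] e'D(3)[OF g]] close(1)[OF g V.b_closed] w])
    then show ?thesis using V.minus_zeroD[OF eD(4)[OF g wV] e'D(4)[OF g wV]] by simp
  qed
  have sqW': "e' g w = e g w" if "g \<in> carrier G" "w \<in> ?W" for g w using sqW[OF that] by simp
  define \<phi> where "\<phi> = V.gtrans T e e'"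
  define \<phi>' where "\<phi>' = V.gtrans T e' e"
  have l\<phi>: "V.linear_map \<phi>" and l\<phi>': "V.linear_map \<phi>'"
    unfolding \<phi>_def \<phi>'_def using V.gtrans_linear ge ge' by auto
  note c\<phi> = V.linear_mapD(1)[OF l\<phi>] and c\<phi>' = V.linear_mapD(1)[OF l\<phi>']
  have i1: "\<phi> (\<phi>' v) = v" if "v \<in> carrier R.T" for v
    unfolding \<phi>_def \<phi>'_def by (rule V.gtrans_inverse[OF ge ge' close(1) W sqW that])
  have i2: "\<phi>' (\<phi> v) = v" if "v \<in> carrier R.T" for v
    unfolding \<phi>_def \<phi>'_def by (rule V.gtrans_inverse[OF ge' ge close(2) W sqW' that])
  have \<phi>m: "\<phi> (v \<otimes>\<^bsub>R.T\<^esub> w) = \<phi> v \<otimes>\<^bsub>R.T\<^esub> \<phi> w" if "v \<in> carrier R.T" "w \<in> carrier R.T" for v w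
    unfolding \<phi>_def by (rule V.gtrans_mult[OF G ge ge' close(2) W V.square_zero_prod[OF I] that])
  let ?\<Phi> = "\<lambda>v. \<phi> (V.lin M1 v)" and ?\<Psi> = "\<lambda>v. V.lin N1 (\<phi>' v)"
  have l1: "V.linear_map ?\<Phi>" and l2: "V.linear_map ?\<Psi>"
    using V.linear_map_comp[OF l\<phi> lM] V.linear_map_comp[OF lN l\<phi>'] by auto
  note lin1 = V.lin_mat[OF l1] and lin2 = V.lin_mat[OF l2]
  have "aut_mat R n R.c' (V.mat ?\<Phi>) (V.mat ?\<Psi>)"
    unfolding V.aut_mat_iff
    using V.mat_closed[OF l1] V.mat_closed[OF l2] lin1 lin2 cM cN c\<phi> c\<phi>' inv i1 i2 mult \<phi>m V.prod_closed by simp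
  moreover have "intertwines R n (V.mat ?\<Phi>) (E0 g) (E g)" if g: "g \<in> carrier G" for g
    unfolding V.intertwines_iff[OF V.mat_closed[OF l1] Ec(2)[OF g] Ec(1)[OF g]]
  proof
    fix v assume v: "v \<in> carrier R.T"
    have "\<phi> (V.lin M1 (e0 g v)) = \<phi> (e' g (V.lin M1 v))" using inv(2)[OF v] by (simp add: e'_def)
    also have "\<dots> = e g (\<phi> (V.lin M1 v))"
      unfolding \<phi>_def by (rule V.gtrans_intertwines[OF ge ge' g cM[OF v]])
    finally show "V.lin (V.mat ?\<Phi>) (V.lin (E0 g) v) = V.lin (E g) (V.lin (V.mat ?\<Phi>) v)"
      using lin1 v e0D(4)[OF g v] by (simp add: e0_def e_def)
  qed
  ultimately show ?thesis unfolding ce by blast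
qed

section \<open>Finite dimensional algebras have a basis\<close>

lemma additive_finsum:
  assumes "abelian_monoid A" "abelian_monoid B" "f \<zero>\<^bsub>A\<^esub> = \<zero>\<^bsub>B\<^esub>"
    and "\<And>x. x \<in> carrier A \<Longrightarrow> f x \<in> carrier B"
    and "\<And>x y. x \<in> carrier A \<Longrightarrow> y \<in> carrier A \<Longrightarrow> f (x \<oplus>\<^bsub>A\<^esub> y) = f x \<oplus>\<^bsub>B\<^esub> f y"
    and "finite I" "\<And>i. i \<in> I \<Longrightarrow> u i \<in> carrier A"
  shows "f (\<Oplus>\<^bsub>A\<^esub>i\<in>I. u i) = (\<Oplus>\<^bsub>B\<^esub>i\<in>I. f (u i))"
proof -
  interpret A: abelian_monoid A by fact
  interpret B: abelian_monoid B by fact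
  show ?thesis using assms(6,7)
  proof (induction I)
    case (insert i I)
    have 1: "u \<in> I \<rightarrow> carrier A" "(\<lambda>i. f (u i)) \<in> I \<rightarrow> carrier B" "f (u i) \<in> carrier B" using insert assms(4) by auto
    then show ?case using insert assms(4,5) A.finsum_closed[OF 1(1)] by (simp add: A.finsum_insert B.finsum_insert)
  qed (simp add: assms)
qed

text \<open>
  \<open>S\<close> is a finite spanning set of \<open>A\<close>.
\<close>

definition spans :: "('f, 'm) ring_scheme \<Rightarrow> ('f, 'a, 'n) module_scheme \<Rightarrow> 'a set \<Rightarrow> bool" where
  "spans F A S \<longleftrightarrow> finite S \<and> S \<subseteq> carrier A \<and>
     (\<forall>a \<in> carrier A. \<exists>c \<in> S \<rightarrow> carrier F. a = (\<Oplus>\<^bsub>A\<^esub>s\<in>S. c s \<odot>\<^bsub>A\<^esub> s))"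

text \<open>
  A relation with a nonzero coefficient at \<open>t\<close> makes \<open>t\<close> superfluous, so in a smallest spanning set
  coordinates are unique.
\<close>

lemma spans_remove:
  assumes "field F" "module F A" "spans F A S" and c: "c \<in> S \<rightarrow> carrier F" and d: "d \<in> S \<rightarrow> carrier F"
    and eq: "(\<Oplus>\<^bsub>A\<^esub>s\<in>S. c s \<odot>\<^bsub>A\<^esub> s) = (\<Oplus>\<^bsub>A\<^esub>s\<in>S. d s \<odot>\<^bsub>A\<^esub> s)" and t: "t \<in> S" "c t \<noteq> d t"
  shows "spans F A (S - {t})"
proof -
  interpret F: field F by fact
  interpret A: module F A by fact
  have S: "finite S" "S \<subseteq> carrier A" using assms(3) by (auto simp: spans_def)
  have tA: "t \<in> carrier A" using t S by auto
  let ?S = "S - {t}"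
  have cd: "c s \<in> carrier F" "d s \<in> carrier F" "s \<in> carrier A" if "s \<in> S" for s using c d S that by auto
  define e where "e = inv\<^bsub>F\<^esub> (c t \<ominus>\<^bsub>F\<^esub> d t)"
  have "c t \<ominus>\<^bsub>F\<^esub> d t \<noteq> \<zero>\<^bsub>F\<^esub>" using t cd[OF t(1)] by simp
  then have u: "c t \<ominus>\<^bsub>F\<^esub> d t \<in> Units F" using cd[OF t(1)] by (simp add: F.field_Units)
  have e: "e \<in> carrier F" "e \<otimes>\<^bsub>F\<^esub> (c t \<ominus>\<^bsub>F\<^esub> d t) = \<one>\<^bsub>F\<^esub>" using u by (simp_all add: e_def)
  have split: "(\<Oplus>\<^bsub>A\<^esub>s\<in>S. f s \<odot>\<^bsub>A\<^esub> s) = f t \<odot>\<^bsub>A\<^esub> t \<oplus>\<^bsub>A\<^esub> (\<Oplus>\<^bsub>A\<^esub>s\<in>?S. f s \<odot>\<^bsub>A\<^esub> s)" if f: "f \<in> S \<rightarrow> carrier F" for f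
  proof -
    have "(\<Oplus>\<^bsub>A\<^esub>s\<in>insert t ?S. f s \<odot>\<^bsub>A\<^esub> s) = f t \<odot>\<^bsub>A\<^esub> t \<oplus>\<^bsub>A\<^esub> (\<Oplus>\<^bsub>A\<^esub>s\<in>?S. f s \<odot>\<^bsub>A\<^esub> s)"
      by (rule A.finsum_insert) (use S t f tA in auto)
    then show ?thesis using t(1) by (simp add: insert_absorb)
  qed
  have cl: "(\<Oplus>\<^bsub>A\<^esub>s\<in>?S. f s \<odot>\<^bsub>A\<^esub> s) \<in> carrier A" if "f \<in> S \<rightarrow> carrier F" for f
    by (rule A.finsum_closed) (use that S in auto)
  define w where "w = (\<lambda>s. e \<otimes>\<^bsub>F\<^esub> (d s \<ominus>\<^bsub>F\<^esub> c s))"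
  have w: "w \<in> S \<rightarrow> carrier F" using e cd by (auto simp: w_def)
  have add: "(\<Oplus>\<^bsub>A\<^esub>s\<in>?S. f s \<odot>\<^bsub>A\<^esub> s) \<oplus>\<^bsub>A\<^esub> (\<Oplus>\<^bsub>A\<^esub>s\<in>?S. g s \<odot>\<^bsub>A\<^esub> s) = (\<Oplus>\<^bsub>A\<^esub>s\<in>?S. (f s \<oplus>\<^bsub>F\<^esub> g s) \<odot>\<^bsub>A\<^esub> s)"
    if "f \<in> S \<rightarrow> carrier F" "g \<in> S \<rightarrow> carrier F" for f g
  proof -
    note fg = funcset_mem[OF that(1)] funcset_mem[OF that(2)] cd(3)
    have "(\<Oplus>\<^bsub>A\<^esub>s\<in>?S. f s \<odot>\<^bsub>A\<^esub> s) \<oplus>\<^bsub>A\<^esub> (\<Oplus>\<^bsub>A\<^esub>s\<in>?S. g s \<odot>\<^bsub>A\<^esub> s) = (\<Oplus>\<^bsub>A\<^esub>s\<in>?S. f s \<odot>\<^bsub>A\<^esub> s \<oplus>\<^bsub>A\<^esub> g s \<odot>\<^bsub>A\<^esub> s)"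
      by (rule A.finsum_addf[symmetric]) (use that S in auto)
    also have "\<dots> = (\<Oplus>\<^bsub>A\<^esub>s\<in>?S. (f s \<oplus>\<^bsub>F\<^esub> g s) \<odot>\<^bsub>A\<^esub> s)"
      by (rule A.finsum_cong'[OF refl]) (use fg in \<open>auto simp: A.smult_l_distr\<close>)
    finally show ?thesis .
  qed
  have sc: "r \<odot>\<^bsub>A\<^esub> (\<Oplus>\<^bsub>A\<^esub>s\<in>?S. f s \<odot>\<^bsub>A\<^esub> s) = (\<Oplus>\<^bsub>A\<^esub>s\<in>?S. (r \<otimes>\<^bsub>F\<^esub> f s) \<odot>\<^bsub>A\<^esub> s)"
    if f: "f \<in> S \<rightarrow> carrier F" and r: "r \<in> carrier F" for f r
  proof -
    note fg = funcset_mem[OF f] cd(3) r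
    have "r \<odot>\<^bsub>A\<^esub> (\<Oplus>\<^bsub>A\<^esub>s\<in>?S. f s \<odot>\<^bsub>A\<^esub> s) = (\<Oplus>\<^bsub>A\<^esub>s\<in>?S. r \<odot>\<^bsub>A\<^esub> (f s \<odot>\<^bsub>A\<^esub> s))"
      by (rule A.finsum_smult_ldistr) (use S fg in auto)
    also have "\<dots> = (\<Oplus>\<^bsub>A\<^esub>s\<in>?S. (r \<otimes>\<^bsub>F\<^esub> f s) \<odot>\<^bsub>A\<^esub> s)"
      by (rule A.finsum_cong'[OF refl]) (use fg in \<open>auto simp: A.smult_assoc1\<close>)
    finally show ?thesis .
  qed
  \<comment> \<open>the two expansions express \<open>t\<close> through the remaining elements\<close>
  have tw: "t = (\<Oplus>\<^bsub>A\<^esub>s\<in>?S. w s \<odot>\<^bsub>A\<^esub> s)"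
  proof -
    let ?C = "\<Oplus>\<^bsub>A\<^esub>s\<in>?S. c s \<odot>\<^bsub>A\<^esub> s" and ?D = "\<Oplus>\<^bsub>A\<^esub>s\<in>?S. d s \<odot>\<^bsub>A\<^esub> s"
    let ?W = "\<Oplus>\<^bsub>A\<^esub>s\<in>?S. (d s \<ominus>\<^bsub>F\<^esub> c s) \<odot>\<^bsub>A\<^esub> s"
    have ct: "c t \<in> carrier F" "d t \<in> carrier F" using cd t by auto
    have dc: "(\<lambda>s. d s \<ominus>\<^bsub>F\<^esub> c s) \<in> S \<rightarrow> carrier F" using cd by auto
    have CD: "?C \<in> carrier A" "?D \<in> carrier A" "?W \<in> carrier A" using cl[OF c] cl[OF d] cl[OF dc] by auto
    have "?W \<oplus>\<^bsub>A\<^esub> ?C = ?D"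
      unfolding add[OF dc c]
      by (rule A.finsum_cong'[OF refl])
         (use cd in \<open>auto simp: F.minus_eq F.a_assoc F.l_neg\<close>)
    moreover have "c t \<odot>\<^bsub>A\<^esub> t \<oplus>\<^bsub>A\<^esub> ?C = d t \<odot>\<^bsub>A\<^esub> t \<oplus>\<^bsub>A\<^esub> ?D" using eq split[OF c] split[OF d] by simp
    ultimately have "c t \<odot>\<^bsub>A\<^esub> t \<oplus>\<^bsub>A\<^esub> ?C = (d t \<odot>\<^bsub>A\<^esub> t \<oplus>\<^bsub>A\<^esub> ?W) \<oplus>\<^bsub>A\<^esub> ?C"
      using CD ct tA by (simp add: A.a_assoc)
    then have "c t \<odot>\<^bsub>A\<^esub> t = d t \<odot>\<^bsub>A\<^esub> t \<oplus>\<^bsub>A\<^esub> ?W" using CD ct tA by simp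
    moreover have "c t \<odot>\<^bsub>A\<^esub> t = d t \<odot>\<^bsub>A\<^esub> t \<oplus>\<^bsub>A\<^esub> (c t \<ominus>\<^bsub>F\<^esub> d t) \<odot>\<^bsub>A\<^esub> t"
    proof -
      have "c t = d t \<oplus>\<^bsub>F\<^esub> (c t \<ominus>\<^bsub>F\<^esub> d t)" using ct F.a_lcomm[of "d t" "c t" "\<ominus>\<^bsub>F\<^esub> d t"] by (simp add: F.minus_eq F.r_neg)
      then show ?thesis using A.smult_l_distr[of "d t" "c t \<ominus>\<^bsub>F\<^esub> d t" t] ct tA by simp
    qed
    ultimately have "(c t \<ominus>\<^bsub>F\<^esub> d t) \<odot>\<^bsub>A\<^esub> t = ?W" using CD ct tA by simp
    then have "e \<odot>\<^bsub>A\<^esub> ((c t \<ominus>\<^bsub>F\<^esub> d t) \<odot>\<^bsub>A\<^esub> t) = (\<Oplus>\<^bsub>A\<^esub>s\<in>?S. w s \<odot>\<^bsub>A\<^esub> s)"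
      unfolding w_def using sc[OF dc e(1)] by simp
    then show ?thesis using e ct tA by (simp add: A.smult_assoc1[symmetric])
  qed
  have "\<exists>f \<in> ?S \<rightarrow> carrier F. a = (\<Oplus>\<^bsub>A\<^esub>s\<in>?S. f s \<odot>\<^bsub>A\<^esub> s)" if a: "a \<in> carrier A" for a
  proof -
    obtain f where f: "f \<in> S \<rightarrow> carrier F" "a = (\<Oplus>\<^bsub>A\<^esub>s\<in>S. f s \<odot>\<^bsub>A\<^esub> s)" using assms(3) a by (auto simp: spans_def)
    have ft: "f t \<in> carrier F" and ftw: "(\<lambda>s. f t \<otimes>\<^bsub>F\<^esub> w s) \<in> S \<rightarrow> carrier F" using f t w by auto
    have "a = f t \<odot>\<^bsub>A\<^esub> (\<Oplus>\<^bsub>A\<^esub>s\<in>?S. w s \<odot>\<^bsub>A\<^esub> s) \<oplus>\<^bsub>A\<^esub> (\<Oplus>\<^bsub>A\<^esub>s\<in>?S. f s \<odot>\<^bsub>A\<^esub> s)"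
      using f(2) split[OF f(1)] tw[symmetric] by simp
    also have "\<dots> = (\<Oplus>\<^bsub>A\<^esub>s\<in>?S. (f t \<otimes>\<^bsub>F\<^esub> w s \<oplus>\<^bsub>F\<^esub> f s) \<odot>\<^bsub>A\<^esub> s)"
      using sc[OF w ft] add[OF ftw f(1)] by simp
    finally show ?thesis using f(1) ftw by (intro bexI[of _ "\<lambda>s. f t \<otimes>\<^bsub>F\<^esub> w s \<oplus>\<^bsub>F\<^esub> f s"]) auto
  qed
  then show ?thesis using S by (auto simp: spans_def)
qed

lemma exists_unique_coordinates:
  assumes "field F" "module F A" "fin_dim F A"
  obtains S where "spans F A S"
    "\<And>c d. c \<in> S \<rightarrow> carrier F \<Longrightarrow> d \<in> S \<rightarrow> carrier F \<Longrightarrow>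
      (\<Oplus>\<^bsub>A\<^esub>s\<in>S. c s \<odot>\<^bsub>A\<^esub> s) = (\<Oplus>\<^bsub>A\<^esub>s\<in>S. d s \<odot>\<^bsub>A\<^esub> s) \<Longrightarrow> (\<And>s. s \<in> S \<Longrightarrow> c s = d s)"
proof -
  have "\<exists>S. spans F A S" using assms(3) by (simp add: fin_dim_def spans_def)
  then obtain S where S: "spans F A S" "\<And>S'. spans F A S' \<Longrightarrow> card S \<le> card S'"
    using ex_has_least_nat[of "spans F A" _ card] by blast
  have fin: "finite S" using S(1) by (simp add: spans_def)
  show ?thesis
  proof (rule that[OF S(1)], rule ccontr)
    fix c d s assume "c \<in> S \<rightarrow> carrier F" "d \<in> S \<rightarrow> carrier F"
      "(\<Oplus>\<^bsub>A\<^esub>s\<in>S. c s \<odot>\<^bsub>A\<^esub> s) = (\<Oplus>\<^bsub>A\<^esub>s\<in>S. d s \<odot>\<^bsub>A\<^esub> s)" "s \<in> S" "c s \<noteq> d s"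
    then have "card S \<le> card (S - {s})" using S(2)[OF spans_remove[OF assms(1,2) S(1)]] by blast
    then show False using card_Diff1_less[OF fin \<open>s \<in> S\<close>] by linarith
  qed
qed

lemma basis_exists:
  assumes F: "field F" and A: "nonassoc_algebra F A" and "fin_dim F A"
  shows "\<exists>n b c \<kappa>. based_alg F A n b c \<kappa>"
proof -
  interpret F: field F by fact
  interpret A: nonassoc_algebra F A by fact
  obtain S where S: "spans F A S" and uniq: "\<And>c d s. c \<in> S \<rightarrow> carrier F \<Longrightarrow> d \<in> S \<rightarrow> carrier F \<Longrightarrow>
      (\<Oplus>\<^bsub>A\<^esub>s\<in>S. c s \<odot>\<^bsub>A\<^esub> s) = (\<Oplus>\<^bsub>A\<^esub>s\<in>S. d s \<odot>\<^bsub>A\<^esub> s) \<Longrightarrow> s \<in> S \<Longrightarrow> c s = d s"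
    using exists_unique_coordinates[OF F A.module_axioms assms(3)] by blast
  have fin: "finite S" "S \<subseteq> carrier A" using S by (auto simp: spans_def)
  obtain b where b: "bij_betw b {0..<card S} S" using ex_bij_betw_nat_finite[OF fin(1)] by blast
  define n where "n = card S"
  have b: "bij_betw b {..<n} S" using b by (simp add: n_def lessThan_atLeast0)
  have bS: "b i \<in> S" if "i < n" for i using bij_betwE[OF b] that by auto
  have bA: "b i \<in> carrier A" if "i < n" for i using bS[OF that] fin by auto
  have binj: "i = j" if "i < n" "j < n" "b i = b j" for i j
    using bij_betw_imp_inj_on[OF b] that by (auto dest: inj_onD)
  have Sb: "\<exists>i<n. s = b i" if "s \<in> S" for s using b that by (auto simp: bij_betw_def)
  have "\<forall>v \<in> carrier A. \<exists>c. c \<in> S \<rightarrow> carrier F \<and> v = (\<Oplus>\<^bsub>A\<^esub>s\<in>S. c s \<odot>\<^bsub>A\<^esub> s)"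
    using S unfolding spans_def Bex_def by blast
  then obtain \<kappa>0 where "\<forall>v \<in> carrier A. \<kappa>0 v \<in> S \<rightarrow> carrier F \<and> v = (\<Oplus>\<^bsub>A\<^esub>s\<in>S. \<kappa>0 v s \<odot>\<^bsub>A\<^esub> s)"
    by (rule bchoice[THEN exE])
  then have \<kappa>0: "\<kappa>0 v \<in> S \<rightarrow> carrier F" "v = (\<Oplus>\<^bsub>A\<^esub>s\<in>S. \<kappa>0 v s \<odot>\<^bsub>A\<^esub> s)" if "v \<in> carrier A" for v
    using that by (blast, blast)
  have \<kappa>0I: "\<kappa>0 v s = c s" if "c \<in> S \<rightarrow> carrier F" "v = (\<Oplus>\<^bsub>A\<^esub>s\<in>S. c s \<odot>\<^bsub>A\<^esub> s)" "s \<in> S" for v c s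
  proof -
    have "v \<in> carrier A" unfolding that(2) by (rule A.finsum_closed) (use that(1) fin in auto)
    from uniq[OF \<kappa>0(1)[OF this] that(1) _ that(3)] \<kappa>0(2)[OF this] that(2) show ?thesis by simp
  qed
  have cl: "\<kappa>0 v s \<in> carrier F" "s \<in> carrier A" if "v \<in> carrier A" "s \<in> S" for v s using \<kappa>0(1)[OF that(1)] that fin by auto
  have add: "\<kappa>0 (v \<oplus>\<^bsub>A\<^esub> w) s = \<kappa>0 v s \<oplus>\<^bsub>F\<^esub> \<kappa>0 w s" if vw: "v \<in> carrier A" "w \<in> carrier A" and s: "s \<in> S" for v w s
  proof (rule \<kappa>0I[OF _ _ s])
    have "v \<oplus>\<^bsub>A\<^esub> w = (\<Oplus>\<^bsub>A\<^esub>s\<in>S. \<kappa>0 v s \<odot>\<^bsub>A\<^esub> s) \<oplus>\<^bsub>A\<^esub> (\<Oplus>\<^bsub>A\<^esub>s\<in>S. \<kappa>0 w s \<odot>\<^bsub>A\<^esub> s)"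
      using \<kappa>0(2)[OF vw(1)] \<kappa>0(2)[OF vw(2)] by simp
    also have "\<dots> = (\<Oplus>\<^bsub>A\<^esub>s\<in>S. \<kappa>0 v s \<odot>\<^bsub>A\<^esub> s \<oplus>\<^bsub>A\<^esub> \<kappa>0 w s \<odot>\<^bsub>A\<^esub> s)"
      by (rule A.finsum_addf[symmetric]) (use cl vw in auto)
    also have "\<dots> = (\<Oplus>\<^bsub>A\<^esub>s\<in>S. (\<kappa>0 v s \<oplus>\<^bsub>F\<^esub> \<kappa>0 w s) \<odot>\<^bsub>A\<^esub> s)"
      by (rule A.finsum_cong'[OF refl]) (use cl vw in \<open>auto simp: A.smult_l_distr\<close>)
    finally show "v \<oplus>\<^bsub>A\<^esub> w = (\<Oplus>\<^bsub>A\<^esub>s\<in>S. (\<kappa>0 v s \<oplus>\<^bsub>F\<^esub> \<kappa>0 w s) \<odot>\<^bsub>A\<^esub> s)" .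
  qed (use cl vw in auto)
  have smult: "\<kappa>0 (r \<odot>\<^bsub>A\<^esub> v) s = r \<otimes>\<^bsub>F\<^esub> \<kappa>0 v s" if v: "r \<in> carrier F" "v \<in> carrier A" and s: "s \<in> S" for r v s
  proof (rule \<kappa>0I[OF _ _ s])
    have "r \<odot>\<^bsub>A\<^esub> v = r \<odot>\<^bsub>A\<^esub> (\<Oplus>\<^bsub>A\<^esub>s\<in>S. \<kappa>0 v s \<odot>\<^bsub>A\<^esub> s)" using \<kappa>0(2)[OF v(2)] by simp
    also have "\<dots> = (\<Oplus>\<^bsub>A\<^esub>s\<in>S. r \<odot>\<^bsub>A\<^esub> (\<kappa>0 v s \<odot>\<^bsub>A\<^esub> s))"
      by (rule A.finsum_smult_ldistr) (use fin v cl in auto)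
    also have "\<dots> = (\<Oplus>\<^bsub>A\<^esub>s\<in>S. (r \<otimes>\<^bsub>F\<^esub> \<kappa>0 v s) \<odot>\<^bsub>A\<^esub> s)"
      by (rule A.finsum_cong'[OF refl]) (use v cl in \<open>auto simp: A.smult_assoc1\<close>)
    finally show "r \<odot>\<^bsub>A\<^esub> v = (\<Oplus>\<^bsub>A\<^esub>s\<in>S. (r \<otimes>\<^bsub>F\<^esub> \<kappa>0 v s) \<odot>\<^bsub>A\<^esub> s)" .
  qed (use v cl in auto)
  have zero: "\<kappa>0 \<zero>\<^bsub>A\<^esub> s = \<zero>\<^bsub>F\<^esub>" if "s \<in> S" for s
  proof -
    have "\<kappa>0 (\<zero>\<^bsub>F\<^esub> \<odot>\<^bsub>A\<^esub> \<zero>\<^bsub>A\<^esub>) s = \<zero>\<^bsub>F\<^esub> \<otimes>\<^bsub>F\<^esub> \<kappa>0 \<zero>\<^bsub>A\<^esub> s" by (rule smult) (use that in auto)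
    then show ?thesis using cl[OF A.M.zero_closed that] by simp
  qed
  have basis: "\<kappa>0 s t = (if t = s then \<one>\<^bsub>F\<^esub> else \<zero>\<^bsub>F\<^esub>)" if st: "s \<in> S" "t \<in> S" for s t
  proof (rule \<kappa>0I[OF _ _ st(2)])
    have "(\<Oplus>\<^bsub>A\<^esub>t\<in>S. (if t = s then \<one>\<^bsub>F\<^esub> else \<zero>\<^bsub>F\<^esub>) \<odot>\<^bsub>A\<^esub> t) = (\<Oplus>\<^bsub>A\<^esub>t\<in>S. if s = t then t else \<zero>\<^bsub>A\<^esub>)"
      by (rule A.finsum_cong'[OF refl]) (use fin in auto)
    also have "\<dots> = s" by (rule A.finsum_singleton) (use fin st in auto)
    finally show "s = (\<Oplus>\<^bsub>A\<^esub>t\<in>S. (if t = s then \<one>\<^bsub>F\<^esub> else \<zero>\<^bsub>F\<^esub>) \<odot>\<^bsub>A\<^esub> t)" by simp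
  qed auto
  have fsum: "\<kappa>0 (\<Oplus>\<^bsub>A\<^esub>i\<in>{..<n}. u i) s = (\<Oplus>\<^bsub>F\<^esub>i\<in>{..<n}. \<kappa>0 (u i) s)" if "\<And>i. i < n \<Longrightarrow> u i \<in> carrier A" "s \<in> S" for u s
    by (rule additive_finsum[OF A.abelian_monoid_axioms F.abelian_monoid_axioms, where f = "\<lambda>v. \<kappa>0 v s"])
       (use that zero add cl in auto)
  have exp: "v = (\<Oplus>\<^bsub>A\<^esub>i\<in>{..<n}. \<kappa>0 v (b i) \<odot>\<^bsub>A\<^esub> b i)" if "v \<in> carrier A" for v
  proof -
    have "(\<Oplus>\<^bsub>A\<^esub>s\<in>S. \<kappa>0 v s \<odot>\<^bsub>A\<^esub> s) = (\<Oplus>\<^bsub>A\<^esub>s\<in>b ` {..<n}. \<kappa>0 v s \<odot>\<^bsub>A\<^esub> s)" using b by (simp add: bij_betw_def)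
    also have "\<dots> = (\<Oplus>\<^bsub>A\<^esub>i\<in>{..<n}. \<kappa>0 v (b i) \<odot>\<^bsub>A\<^esub> b i)"
      by (rule A.finsum_reindex) (use b cl that in \<open>auto simp: bij_betw_def\<close>)
    finally show ?thesis using \<kappa>0(2)[OF that] by simp
  qed
  have term_cl: "\<kappa>0 v (b i) \<odot>\<^bsub>A\<^esub> b i \<in> carrier A" if "v \<in> carrier A" "i < n" for v i
    using cl[OF that(1) bS[OF that(2)]] by simp
  have zl: "\<zero>\<^bsub>A\<^esub> \<otimes>\<^bsub>A\<^esub> w = \<zero>\<^bsub>A\<^esub>" "w \<otimes>\<^bsub>A\<^esub> \<zero>\<^bsub>A\<^esub> = \<zero>\<^bsub>A\<^esub>" if "w \<in> carrier A" for w
    using A.prod_smult_l[of "\<zero>\<^bsub>F\<^esub>" "\<zero>\<^bsub>A\<^esub>" w] A.prod_smult_r[of "\<zero>\<^bsub>F\<^esub>" w "\<zero>\<^bsub>A\<^esub>"] that A.prod_closed[OF A.M.zero_closed that]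
      A.prod_closed[OF that A.M.zero_closed] by simp_all
  have mult: "\<kappa>0 (v \<otimes>\<^bsub>A\<^esub> w) s =
    (\<Oplus>\<^bsub>F\<^esub>i\<in>{..<n}. \<Oplus>\<^bsub>F\<^esub>j\<in>{..<n}. \<kappa>0 v (b i) \<otimes>\<^bsub>F\<^esub> \<kappa>0 w (b j) \<otimes>\<^bsub>F\<^esub> \<kappa>0 (b i \<otimes>\<^bsub>A\<^esub> b j) s)"
    if v: "v \<in> carrier A" and w: "w \<in> carrier A" and s: "s \<in> S" for v w s
  proof -
    let ?v = "\<lambda>i. \<kappa>0 v (b i)" and ?w = "\<lambda>j. \<kappa>0 w (b j)"
    have cv: "?v i \<in> carrier F" "?w i \<in> carrier F" if "i < n" for i using cl[OF v] cl[OF w] bS[OF that] by auto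
    have "\<kappa>0 (v \<otimes>\<^bsub>A\<^esub> w) s = \<kappa>0 ((\<Oplus>\<^bsub>A\<^esub>i\<in>{..<n}. ?v i \<odot>\<^bsub>A\<^esub> b i) \<otimes>\<^bsub>A\<^esub> w) s" using exp[OF v] by simp
    also have "\<dots> = (\<Oplus>\<^bsub>F\<^esub>i\<in>{..<n}. \<kappa>0 ((?v i \<odot>\<^bsub>A\<^esub> b i) \<otimes>\<^bsub>A\<^esub> w) s)"
      by (rule additive_finsum[OF A.abelian_monoid_axioms F.abelian_monoid_axioms, where f = "\<lambda>x. \<kappa>0 (x \<otimes>\<^bsub>A\<^esub> w) s"])
         (use zl w s zero cl add A.prod_closed A.prod_l_distr term_cl[OF v] in auto)
    also have "\<dots> = (\<Oplus>\<^bsub>F\<^esub>i\<in>{..<n}. \<Oplus>\<^bsub>F\<^esub>j\<in>{..<n}. ?v i \<otimes>\<^bsub>F\<^esub> ?w j \<otimes>\<^bsub>F\<^esub> \<kappa>0 (b i \<otimes>\<^bsub>A\<^esub> b j) s)"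
    proof (rule F.finsum_cong'[OF refl])
      show "(\<lambda>i. \<Oplus>\<^bsub>F\<^esub>j\<in>{..<n}. ?v i \<otimes>\<^bsub>F\<^esub> ?w j \<otimes>\<^bsub>F\<^esub> \<kappa>0 (b i \<otimes>\<^bsub>A\<^esub> b j) s) \<in> {..<n} \<rightarrow> carrier F"
        using cv cl A.prod_closed bA s by (auto intro!: F.finsum_closed)
      fix i assume i: "i \<in> {..<n}"
      let ?x = "?v i \<odot>\<^bsub>A\<^esub> b i"
      have x: "?x \<in> carrier A" using term_cl[OF v] i by simp
      have "\<kappa>0 (?x \<otimes>\<^bsub>A\<^esub> w) s = \<kappa>0 (?x \<otimes>\<^bsub>A\<^esub> (\<Oplus>\<^bsub>A\<^esub>j\<in>{..<n}. ?w j \<odot>\<^bsub>A\<^esub> b j)) s" using exp[OF w] by simp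
      also have "\<dots> = (\<Oplus>\<^bsub>F\<^esub>j\<in>{..<n}. \<kappa>0 (?x \<otimes>\<^bsub>A\<^esub> (?w j \<odot>\<^bsub>A\<^esub> b j)) s)"
        by (rule additive_finsum[OF A.abelian_monoid_axioms F.abelian_monoid_axioms, where f = "\<lambda>y. \<kappa>0 (?x \<otimes>\<^bsub>A\<^esub> y) s"])
           (use zl[OF x] x s zero cl add A.prod_closed A.prod_r_distr term_cl[OF w] in auto)
      also have "\<dots> = (\<Oplus>\<^bsub>F\<^esub>j\<in>{..<n}. ?v i \<otimes>\<^bsub>F\<^esub> ?w j \<otimes>\<^bsub>F\<^esub> \<kappa>0 (b i \<otimes>\<^bsub>A\<^esub> b j) s)"
      proof (rule F.finsum_cong'[OF refl])
        show "(\<lambda>j. ?v i \<otimes>\<^bsub>F\<^esub> ?w j \<otimes>\<^bsub>F\<^esub> \<kappa>0 (b i \<otimes>\<^bsub>A\<^esub> b j) s) \<in> {..<n} \<rightarrow> carrier F"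
          using i cv cl A.prod_closed bA s by auto
        fix j assume j: "j \<in> {..<n}"
        have ij: "i < n" "j < n" using i j by auto
        have "?x \<otimes>\<^bsub>A\<^esub> (?w j \<odot>\<^bsub>A\<^esub> b j) = ?v i \<odot>\<^bsub>A\<^esub> (?w j \<odot>\<^bsub>A\<^esub> (b i \<otimes>\<^bsub>A\<^esub> b j))"
          using A.prod_smult_l[OF cv(1)[OF ij(1)] bA[OF ij(1)] term_cl[OF w ij(2)]]
            A.prod_smult_r[OF cv(2)[OF ij(2)] bA[OF ij(1)] bA[OF ij(2)]] by simp
        then show "\<kappa>0 (?x \<otimes>\<^bsub>A\<^esub> (?w j \<odot>\<^bsub>A\<^esub> b j)) s = ?v i \<otimes>\<^bsub>F\<^esub> ?w j \<otimes>\<^bsub>F\<^esub> \<kappa>0 (b i \<otimes>\<^bsub>A\<^esub> b j) s"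
          using ij cv bA A.prod_closed s cl(1)[OF A.prod_closed[OF bA[OF ij(1)] bA[OF ij(2)]] s]
          by (simp add: smult F.m_assoc)
      qed
      finally show "\<kappa>0 (?x \<otimes>\<^bsub>A\<^esub> w) s = (\<Oplus>\<^bsub>F\<^esub>j\<in>{..<n}. ?v i \<otimes>\<^bsub>F\<^esub> ?w j \<otimes>\<^bsub>F\<^esub> \<kappa>0 (b i \<otimes>\<^bsub>A\<^esub> b j) s)" .
    qed
    finally show ?thesis .
  qed
  have "based_alg F A n b (\<lambda>i j k. \<kappa>0 (b i \<otimes>\<^bsub>A\<^esub> b j) (b k)) (\<lambda>v i. \<kappa>0 v (b i))"
  proof (rule based_algI[OF F.is_cring])
    fix v w assume "v \<in> carrier A" "w \<in> carrier A" and eq: "\<And>i. i < n \<Longrightarrow> \<kappa>0 v (b i) = \<kappa>0 w (b i)"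
    moreover have "(\<Oplus>\<^bsub>A\<^esub>i\<in>{..<n}. \<kappa>0 v (b i) \<odot>\<^bsub>A\<^esub> b i) = (\<Oplus>\<^bsub>A\<^esub>i\<in>{..<n}. \<kappa>0 w (b i) \<odot>\<^bsub>A\<^esub> b i)"
      by (rule A.finsum_cong'[OF refl]) (use eq term_cl \<open>w \<in> carrier A\<close> in auto)
    ultimately show "v = w" using exp[of v] exp[of w] by simp
  next
    fix i j k assume "i < n" "j < n" "k < n"
    then show "\<kappa>0 (b i \<otimes>\<^bsub>A\<^esub> b j) (b k) \<in> carrier F"
      by (intro cl(1) A.prod_closed bA bS)
  next
    fix i j assume ij: "i < n" "j < n"
    show "\<kappa>0 (b j) (b i) = (if i = j then \<one>\<^bsub>F\<^esub> else \<zero>\<^bsub>F\<^esub>)"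
      using basis[OF bS[OF ij(2)] bS[OF ij(1)]] binj[OF ij] by auto
  qed (use bA bS cl add smult mult zero A.prod_closed in auto)
  then show ?thesis by blast
qed

section \<open>Finitely generated subalgebras of a field\<close>

lemma algebra_over_hom:
  assumes "cring F" "cring P" "\<phi> \<in> ring_hom F P"
  shows "algebra F \<lparr>carrier = carrier P, monoid.mult = (\<otimes>\<^bsub>P\<^esub>), one = \<one>\<^bsub>P\<^esub>, ring.zero = \<zero>\<^bsub>P\<^esub>,
    ring.add = (\<oplus>\<^bsub>P\<^esub>), smult = (\<lambda>c x. \<phi> c \<otimes>\<^bsub>P\<^esub> x)\<rparr>" (is "algebra F ?R")
proof -
  interpret F: cring F by fact
  interpret P: cring P by fact
  have R: "cring ?R"
  proof (rule cringI)
    show "abelian_group ?R"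
      by (rule abelian_groupI) (auto simp: P.a_ac intro: P.a_inv_closed P.l_neg)
    show "comm_monoid ?R"
      by (rule comm_monoidI) (auto simp: P.m_ac)
  qed (auto simp: P.l_distr)
  note hom = ring_hom_closed[OF assms(3)] ring_hom_add[OF assms(3)] ring_hom_mult[OF assms(3)] ring_hom_one[OF assms(3)]
  show ?thesis
    by (rule algebraI[OF assms(1) R]) (auto simp: hom P.l_distr P.r_distr P.m_assoc)
qed

text \<open>
  The structure map \<open>F \<rightarrow> K\<close> of an \<open>F\<close>-algebra \<open>K\<close>.
\<close>

definition scal :: "('f, 'k, 'n) module_scheme \<Rightarrow> 'f \<Rightarrow> 'k" where
  "scal K x = x \<odot>\<^bsub>K\<^esub> \<one>\<^bsub>K\<^esub>"

lemma scal_hom: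
  assumes "algebra F K" shows "scal K \<in> ring_hom F K"
proof -
  interpret algebra F K by fact
  show ?thesis
  proof (rule ring_hom_memI)
    fix x y assume "x \<in> carrier F" "y \<in> carrier F"
    then show "scal K (x \<otimes>\<^bsub>F\<^esub> y) = scal K x \<otimes>\<^bsub>K\<^esub> scal K y"
      using smult_assoc2[of x "\<one>\<^bsub>K\<^esub>" "scal K y"] by (simp add: scal_def smult_assoc1)
  qed (simp_all add: scal_def smult_l_distr)
qed

text \<open>
  The quotient of the subalgebra \<open>B\<close> of \<open>K\<close> by the ideal \<open>I\<close> of \<open>B\<close>, as an \<open>F\<close>-algebra.
\<close>

definition quot_alg :: "('f, 'k) module \<Rightarrow> 'k set \<Rightarrow> 'k set \<Rightarrow> ('f, 'k set) module" where
  "quot_alg K B I = (let Q = K\<lparr>carrier := B\<rparr> Quot I in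
     \<lparr>carrier = carrier Q, monoid.mult = (\<otimes>\<^bsub>Q\<^esub>), one = \<one>\<^bsub>Q\<^esub>, ring.zero = \<zero>\<^bsub>Q\<^esub>,
      ring.add = (\<oplus>\<^bsub>Q\<^esub>), smult = (\<lambda>c x. (I +>\<^bsub>K\<lparr>carrier := B\<rparr>\<^esub> scal K c) \<otimes>\<^bsub>Q\<^esub> x)\<rparr>)"

lemma quot_alg_props:
  assumes K: "algebra F K" and B: "subring B K" "scal K ` carrier F \<subseteq> B" and I: "ideal I (K\<lparr>carrier := B\<rparr>)"
  defines "p \<equiv> (\<lambda>x. I +>\<^bsub>K\<lparr>carrier := B\<rparr>\<^esub> x)"
  shows "algebra F (quot_alg K B I)" "p \<in> ring_hom (K\<lparr>carrier := B\<rparr>) (quot_alg K B I)"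
    "p ` B = carrier (quot_alg K B I)" "\<And>x. x \<in> B \<Longrightarrow> p x = \<zero>\<^bsub>quot_alg K B I\<^esub> \<longleftrightarrow> x \<in> I"
    "\<And>x. x \<in> carrier F \<Longrightarrow> x \<odot>\<^bsub>quot_alg K B I\<^esub> \<one>\<^bsub>quot_alg K B I\<^esub> = p (scal K x)"
    "\<And>U. U \<in> carrier (quot_alg K B I) \<Longrightarrow> U \<subseteq> B"
proof -
  interpret K: algebra F K by fact
  let ?P = "K\<lparr>carrier := B\<rparr>"
  let ?Q = "?P Quot I"
  have Kc: "cring K" using K by (simp add: algebra_def)
  interpret P: cring ?P using cring_subring[OF Kc B(1)] .
  interpret I: ideal I ?P by fact
  have Q: "cring ?Q" using I.quotient_is_cring[OF P.is_cring] .
  interpret Q: cring ?Q by (rule Q)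
  have p: "p \<in> ring_hom ?P ?Q" unfolding p_def by (rule I.rcos_ring_hom)
  have s: "scal K \<in> ring_hom F ?P"
    using scal_hom[OF K] B(2) by (auto simp: ring_hom_def)
  have "algebra F \<lparr>carrier = carrier ?Q, monoid.mult = (\<otimes>\<^bsub>?Q\<^esub>), one = \<one>\<^bsub>?Q\<^esub>, ring.zero = \<zero>\<^bsub>?Q\<^esub>,
    ring.add = (\<oplus>\<^bsub>?Q\<^esub>), smult = (\<lambda>c x. p (scal K c) \<otimes>\<^bsub>?Q\<^esub> x)\<rparr>"
    by (rule algebra_over_hom[OF K.R.is_cring Q ring_hom_comp[OF s p]])
  then show "algebra F (quot_alg K B I)" unfolding p_def quot_alg_def Let_def .
  show "p \<in> ring_hom ?P (quot_alg K B I)"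
    using p by (simp add: ring_hom_def quot_alg_def Let_def)
  have "carrier (quot_alg K B I) = a_rcosets\<^bsub>?P\<^esub> I" by (simp add: quot_alg_def Let_def FactRing_def)
  also have "\<dots> = p ` B" unfolding A_RCOSETS_def' p_def by auto
  finally have car: "carrier (quot_alg K B I) = p ` B" .
  then show "p ` B = carrier (quot_alg K B I)" ..
  show "p x = \<zero>\<^bsub>quot_alg K B I\<^esub> \<longleftrightarrow> x \<in> I" if x: "x \<in> B" for x
  proof -
    have z: "\<zero>\<^bsub>quot_alg K B I\<^esub> = I" by (simp add: quot_alg_def Let_def FactRing_zero)
    show ?thesis unfolding z p_def
    proof
      assume "I +>\<^bsub>?P\<^esub> x = I"
      then show "x \<in> I" by (rule I.rcos_const_imp_mem[rotated]) (use x in simp)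
    next
      assume "x \<in> I"
      then show "I +>\<^bsub>?P\<^esub> x = I" by (rule I.a_rcos_const)
    qed
  qed
  show "x \<odot>\<^bsub>quot_alg K B I\<^esub> \<one>\<^bsub>quot_alg K B I\<^esub> = p (scal K x)" if "x \<in> carrier F" for x
    using Q.r_one[OF ring_hom_closed[OF ring_hom_comp[OF s p] that]] unfolding p_def quot_alg_def Let_def by simp
  show "U \<subseteq> B" if U: "U \<in> carrier (quot_alg K B I)" for U
  proof -
    obtain x where x: "x \<in> B" "U = I +>\<^bsub>?P\<^esub> x"
      using U[unfolded car] unfolding p_def by (elim imageE) (rule that)
    have "I +>\<^bsub>?P\<^esub> x \<subseteq> carrier ?P" by (rule P.a_r_coset_subset_G) (use x I.a_subset in auto)
    then show ?thesis using x by simp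
  qed
qed

text \<open>
  A finitely generated \<open>F\<close>-algebra is the image of the type of coefficient functions \<open>nat multiset \<Rightarrow> 'f\<close>. So its
  quotients, whose elements are sets, have carriers that inject into the type of test algebras. For one generator,
  a sequence of coefficient functions is coded by one such function: the code of the pair of
  \<open>k\<close> and \<open>m\<close> has \<open>k\<close> times the element \<open>0\<close>, next to the elements of \<open>m\<close> shifted by one.
\<close>

lemma adjoin_encoding:
  fixes e :: "(nat multiset \<Rightarrow> 'f) \<Rightarrow> 'k"
  assumes "B \<subseteq> range e"
  shows "\<exists>e' :: (nat multiset \<Rightarrow> 'f) \<Rightarrow> 'k. adjoin D B z \<subseteq> range e'"
proof -
  let ?code = "\<lambda>k m. image_mset Suc m + replicate_mset k 0"
  let ?ev = "UnivPoly.eval (D\<lparr>carrier := B\<rparr>) D id z"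
  define e' where "e' = (\<lambda>p :: nat multiset \<Rightarrow> 'f. ?ev (\<lambda>k. e (\<lambda>m. p (?code k m))))"
  have "?ev f \<in> range e'" if f: "f \<in> carrier (UP (D\<lparr>carrier := B\<rparr>))" for f
  proof -
    have "f k \<in> B" for k using f by (auto simp: UP_def up_def)
    then have "\<exists>q. f k = e q" for k using assms by (auto simp: subset_iff image_iff)
    then obtain q where q: "\<And>k. f k = e (q k)" by metis
    define p where "p = (\<lambda>M. q (count M 0) (image_mset (\<lambda>x. x - 1) (filter_mset (\<lambda>x. x \<noteq> 0) M)))"
    have "p (?code k m) = q k m" for k m
    proof -
      have 1: "count (image_mset Suc m) 0 = 0" by (simp add: count_eq_zero_iff)
      have 2: "filter_mset (\<lambda>x. x \<noteq> 0) (image_mset Suc m) = image_mset Suc m"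
        by (induction m) simp_all
      have 3: "filter_mset (\<lambda>x. x \<noteq> 0) (replicate_mset k (0::nat)) = {#}"
        by (rule multiset_eqI) (simp only: count_filter_mset count_replicate_mset count_empty, argo)
      have 4: "image_mset (\<lambda>x. x - 1) (image_mset Suc m) = m"
        by (induction m) simp_all
      show ?thesis unfolding p_def count_union count_replicate_mset filter_union_mset 1 2 3
        by (simp only: add_0_right add_0_left empty_neutral 4 simp_thms if_True)
    qed
    then have "e' p = ?ev f" unfolding e'_def by (simp only: q[symmetric])
    then show ?thesis by (intro range_eqI[of _ _ p]) (rule sym)
  qed
  then have "?ev ` carrier (UP (D\<lparr>carrier := B\<rparr>)) \<subseteq> range e'" by (rule image_subsetI)
  then show ?thesis unfolding adjoin_def by (intro exI[of _ e'])
qed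

lemma adjoins_encoding:
  fixes K :: "('f, 'k) module"
  shows "\<exists>e :: (nat multiset \<Rightarrow> 'f) \<Rightarrow> 'k. adjoins K (scal K ` Y) zs \<subseteq> range e"
proof (induction zs)
  case Nil
  have "scal K ` Y \<subseteq> range (\<lambda>p :: nat multiset \<Rightarrow> 'f. scal K (p {#}))"
  proof
    fix y assume "y \<in> scal K ` Y"
    then obtain x where "y = scal K x" by auto
    then show "y \<in> range (\<lambda>p :: nat multiset \<Rightarrow> 'f. scal K (p {#}))"
      by (intro range_eqI[of _ _ "\<lambda>_. x"])
  qed
  then show ?case unfolding adjoins.simps by (intro exI[of _ "\<lambda>p :: nat multiset \<Rightarrow> 'f. scal K (p {#})"])
next
  case (Cons z zs)
  then obtain e :: "(nat multiset \<Rightarrow> 'f) \<Rightarrow> 'k" where "adjoins K (scal K ` Y) zs \<subseteq> range e" by (rule exE)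
  then show ?case unfolding adjoins.simps by (rule adjoin_encoding)
qed

lemma scalar_subfield:
  assumes "field F" "algebra F K" "field K"
  shows "subfield (scal K ` carrier F) K" "inj_on (scal K) (carrier F)"
proof -
  interpret F: field F by fact
  interpret K: field K by fact
  interpret s: ring_hom_ring F K "scal K" by unfold_locales (rule scal_hom[OF assms(2)])
  show "subfield (scal K ` carrier F) K" "inj_on (scal K) (carrier F)"
    using s.img_is_subfield[OF F.carrier_is_subfield K.one_not_zero] by auto
qed

text \<open>
  A finitely generated subalgebra of a field extension of an algebraically closed field \<open>F\<close> has an \<open>F\<close>-point
  (a form of the Nullstellensatz).
\<close>

lemma specialization:
  fixes F :: "('f, 'm) ring_scheme" and K :: "('f, 'k, 'n) module_scheme"
  assumes F: "algebraically_closed F" and FK: "algebra F K" and K: "field K" and zs: "set zs \<subseteq> carrier K"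
  shows "\<exists>\<epsilon> \<in> ring_hom (K\<lparr>carrier := adjoins K (scal K ` carrier F) zs\<rparr>) F. \<forall>x \<in> carrier F. \<epsilon> (scal K x) = x"
proof -
  interpret F: algebraically_closed F by fact
  interpret K: field K by fact
  let ?B = "scal K ` carrier F"
  note sub = scalar_subfield[OF F.field_axioms FK K]
  have sr: "subring ?B K" using subfieldE(1)[OF sub(1)] .
  have z0: "scal K \<zero>\<^bsub>F\<^esub> = \<zero>\<^bsub>K\<^esub>" using ring_hom_zero[OF scal_hom[OF FK] F.ring_axioms K.ring_axioms] .
  have "\<exists>h \<in> ring_hom (K\<lparr>carrier := ?B\<rparr>) F. \<forall>p \<in> carrier F. h (scal K p) = id p"
  proof (rule ring_hom_factor[OF F.ring_axioms K.ring_axioms F.ring_axioms scal_hom[OF FK]])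
    show "id \<in> ring_hom F F" by (simp add: ring_hom_def)
    fix p assume "p \<in> carrier F" "scal K p = \<zero>\<^bsub>K\<^esub>"
    then show "id p = \<zero>\<^bsub>F\<^esub>" using inj_onD[OF sub(2), of p "\<zero>\<^bsub>F\<^esub>"] z0 by simp
  qed
  then obtain h where h: "h \<in> ring_hom (K\<lparr>carrier := ?B\<rparr>) F" "\<And>p. p \<in> carrier F \<Longrightarrow> h (scal K p) = p" by auto
  have one: "\<one>\<^bsub>K\<^esub> \<in> adjoins K ?B zs" using subringE(3)[OF adjoins_subring[OF K.is_cring sr zs]] .
  obtain d where d: "d \<in> ?B" "d \<noteq> \<zero>\<^bsub>K\<^esub>" "h d \<noteq> \<zero>\<^bsub>F\<^esub> \<Longrightarrow>
    (\<exists>h' \<in> ring_hom (K\<lparr>carrier := adjoins K ?B zs\<rparr>) F. (\<forall>x \<in> ?B. h' x = h x) \<and> h' \<one>\<^bsub>K\<^esub> \<noteq> \<zero>\<^bsub>F\<^esub>)"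
    using extend_hom[OF K.domain_axioms sr zs one K.one_not_zero, where 'l = 'f and 'n = 'm] F h(1) by blast
  have "h d \<noteq> \<zero>\<^bsub>F\<^esub>" using d(1,2) h(2) z0 by auto
  from d(3)[OF this] obtain h' where "h' \<in> ring_hom (K\<lparr>carrier := adjoins K ?B zs\<rparr>) F" "\<forall>x \<in> ?B. h' x = h x" by blast
  then show ?thesis by (intro bexI[of _ h'] ballI) (simp_all add: h(2))
qed

lemma intertwines_cong:
  assumes "cring R" "\<And>i j. i < n \<Longrightarrow> j < n \<Longrightarrow> M i j \<in> carrier R"
    "\<And>i j. i < n \<Longrightarrow> j < n \<Longrightarrow> E i j = D i j" "\<And>i j. i < n \<Longrightarrow> j < n \<Longrightarrow> E' i j = D' i j"
    "\<And>i j. i < n \<Longrightarrow> j < n \<Longrightarrow> D i j \<in> carrier R" "\<And>i j. i < n \<Longrightarrow> j < n \<Longrightarrow> D' i j \<in> carrier R"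
    "intertwines R n M E E'"
  shows "intertwines R n M D D'"
proof -
  interpret R: cring R by fact
  have 1: "(\<Oplus>\<^bsub>R\<^esub>k\<in>{..<n}. M i k \<otimes>\<^bsub>R\<^esub> E k j) = (\<Oplus>\<^bsub>R\<^esub>k\<in>{..<n}. M i k \<otimes>\<^bsub>R\<^esub> D k j)" if "i < n" "j < n" for i j
    by (rule R.finsum_cong'[OF refl]) (simp_all add: assms(2,3,5) that)
  have 2: "(\<Oplus>\<^bsub>R\<^esub>k\<in>{..<n}. E' i k \<otimes>\<^bsub>R\<^esub> M k j) = (\<Oplus>\<^bsub>R\<^esub>k\<in>{..<n}. D' i k \<otimes>\<^bsub>R\<^esub> M k j)" if "i < n" "j < n" for i j
    by (rule R.finsum_cong'[OF refl]) (simp_all add: assms(2,4,6) that)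
  show ?thesis using assms(7) 1 2 by (simp add: intertwines_def)
qed

section \<open>Descent of isomorphisms and of gradings\<close>

lemma ring_hom_restrict: "h \<in> ring_hom F K \<Longrightarrow> h ` carrier F \<subseteq> B \<Longrightarrow> h \<in> ring_hom F (K\<lparr>carrier := B\<rparr>)"
  by (auto simp: ring_hom_def)

text \<open>
  The entries of an isomorphism over \<open>K\<close> and of its inverse generate a finitely generated \<open>F\<close>-algebra, and an
  \<open>F\<close>-point of it sends the isomorphism to one over \<open>F\<close>.
\<close>

theorem isomorphism_descends:
  fixes F :: "('f, 'm) ring_scheme" and K :: "('f, 'k, 'p) module_scheme"
  assumes F: "algebraically_closed F" and FK: "algebra F K" and K: "field K"
    and c: "\<And>i j k. i < n \<Longrightarrow> j < n \<Longrightarrow> k < n \<Longrightarrow> c i j k \<in> carrier F"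
    and E: "\<And>g i j. g \<in> carrier G \<Longrightarrow> i < n \<Longrightarrow> j < n \<Longrightarrow> E g i j \<in> carrier F"
    and E': "\<And>g i j. g \<in> carrier G \<Longrightarrow> i < n \<Longrightarrow> j < n \<Longrightarrow> E' g i j \<in> carrier F"
    and M: "aut_mat K n (\<lambda>i j k. scal K (c i j k)) M N"
    and int: "\<And>g. g \<in> carrier G \<Longrightarrow> intertwines K n M (\<lambda>i j. scal K (E g i j)) (\<lambda>i j. scal K (E' g i j))"
  shows "\<exists>M N. aut_mat F n c M N \<and> (\<forall>g \<in> carrier G. intertwines F n M (E g) (E' g))"
proof -
  interpret F: algebraically_closed F by fact
  interpret K: field K by fact
  let ?F = "scal K ` carrier F"
  have sr: "subring ?F K" using subfieldE(1)[OF scalar_subfield(1)[OF F.field_axioms FK K]] .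
  have Mc: "M i j \<in> carrier K" "N i j \<in> carrier K" if "i < n" "j < n" for i j using M that by (auto simp: aut_mat_def)
  obtain zs where zs: "set zs = (\<lambda>(i, j). M i j) ` ({..<n} \<times> {..<n}) \<union> (\<lambda>(i, j). N i j) ` ({..<n} \<times> {..<n})"
    using finite_list[of "(\<lambda>(i, j). M i j) ` ({..<n} \<times> {..<n}) \<union> (\<lambda>(i, j). N i j) ` ({..<n} \<times> {..<n})"] by auto
  have zK: "set zs \<subseteq> carrier K" unfolding zs using Mc by auto
  define B where "B = adjoins K ?F zs"
  let ?D = "K\<lparr>carrier := B\<rparr>"
  have srB: "subring B K" unfolding B_def by (rule adjoins_subring[OF K.is_cring sr zK])
  have incl: "?F \<union> set zs \<subseteq> B" unfolding B_def by (rule adjoins_incl[OF K.is_cring sr zK])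
  have D: "cring ?D" by (rule cring_subring[OF K.is_cring srB])
  have MB: "M i j \<in> B" "N i j \<in> B" if "i < n" "j < n" for i j using incl that by (auto simp: zs)
  have sB: "scal K x \<in> B" if "x \<in> carrier F" for x using incl that by auto
  obtain \<epsilon> where \<epsilon>: "\<epsilon> \<in> ring_hom ?D F" "\<And>x. x \<in> carrier F \<Longrightarrow> \<epsilon> (scal K x) = x"
    using specialization[OF F FK K zK] unfolding B_def by blast
  interpret i: ring_hom_inj_family ?D "\<lambda>_::unit. K" "\<lambda>_. id"
    by (intro ring_hom_inj_family.intro ring_hom_family.intro ring_hom_inj_family_axioms.intro D K.is_cring id_subring_hom[OF srB], simp)
  interpret e: ring_hom_family ?D "\<lambda>_::unit. F" "\<lambda>_. \<epsilon>"
    by (intro ring_hom_family.intro D F.is_cring \<epsilon>(1))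
  have MD: "aut_mat ?D n (\<lambda>i j k. scal K (c i j k)) M N"
    by (rule i.aut_mat_reflect) (simp_all add: M MB sB c)
  have intD: "intertwines ?D n M (\<lambda>i j. scal K (E g i j)) (\<lambda>i j. scal K (E' g i j))" if g: "g \<in> carrier G" for g
    by (rule i.intertwines_reflect) (simp_all add: MB sB E[OF g] E'[OF g] int[OF g])
  have "aut_mat F n (\<lambda>i j k. \<epsilon> (scal K (c i j k))) (\<lambda>i j. \<epsilon> (M i j)) (\<lambda>i j. \<epsilon> (N i j))"
    by (rule e.aut_mat_push[OF _ MD]) (simp add: sB c)
  then have "aut_mat F n c (\<lambda>i j. \<epsilon> (M i j)) (\<lambda>i j. \<epsilon> (N i j))"
    by (rule aut_mat_cong[OF F.is_cring, rotated 2]) (simp_all add: \<epsilon> c)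
  moreover have "intertwines F n (\<lambda>i j. \<epsilon> (M i j)) (E g) (E' g)" if g: "g \<in> carrier G" for g
  proof (rule intertwines_cong[OF F.is_cring])
    show "intertwines F n (\<lambda>i j. \<epsilon> (M i j)) (\<lambda>i j. \<epsilon> (scal K (E g i j))) (\<lambda>i j. \<epsilon> (scal K (E' g i j)))"
      by (rule e.intertwines_push[OF _ _ _ intD[OF g]]) (simp_all add: MB sB E[OF g] E'[OF g])
    show "\<epsilon> (M i j) \<in> carrier F" if "i < n" "j < n" for i j
      using e.images(1)[of "M i j"] MB[OF that] by simp
  qed (simp_all add: \<epsilon> E[OF g] E'[OF g])
  ultimately show ?thesis by blast
qed

lemma (in based_alg) identity_matrix:
  "\<exists>M N. aut_mat R n c M N \<and> (\<forall>E. mclosed E \<longrightarrow> intertwines R n M E E)"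
proof -
  have l: "linear_map (\<lambda>v. v)" by (simp add: linear_map_def)
  note m = mat_closed[OF l] lin_mat[OF l]
  have "aut_mat R n c (mat (\<lambda>v. v)) (mat (\<lambda>v. v))"
    unfolding aut_mat_iff using m prod_closed by simp
  moreover have "intertwines R n (mat (\<lambda>v. v)) E E" if "mclosed E" for E
    unfolding intertwines_iff[OF m(1) that that] using m lin_closed[OF that] by simp
  ultimately show ?thesis by blast
qed

text \<open>
  Let \<open>B\<close> be the \<open>F\<close>-algebra generated by the entries of the projections \<open>E g\<close> of a grading over \<open>K\<close>, let \<open>\<epsilon>\<close> be an \<open>F\<close>-point
  of \<open>B\<close>, and let \<open>I\<close> be its kernel. The grading \<open>E0\<close> over \<open>F\<close> is the image of \<open>E\<close> under \<open>\<epsilon>\<close>. The two gradings agree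
  modulo \<open>I\<close>, so by induction with \<open>lift_isomorphism\<close> they are isomorphic over all \<open>B / I\<^sup>m\<close>. By Krull's
  theorem the maps from \<open>B\<close> to these rings are jointly injective, so the two gradings are isomorphic over \<open>K\<close>.
\<close>

theorem grading_descends:
  fixes F :: "('f, 'm) ring_scheme" and A :: "('f, 'a, 'n) module_scheme" and K :: "('f, 'k) module"
  assumes F: "algebraically_closed F" and A: "based_alg F A n b c \<kappa>" and smooth: "smooth_Aut_scheme F A"
    and FK: "algebra F K" and K: "algebraically_closed K" and G: "group G"
    and E: "grad_mat K n (\<lambda>i j k. scal K (c i j k)) G T E"
  shows "\<exists>E0 M N. grad_mat F n c G T E0 \<and> aut_mat K n (\<lambda>i j k. scal K (c i j k)) M N \<and>
    (\<forall>g \<in> carrier G. intertwines K n M (\<lambda>i j. scal K (E0 g i j)) (E g))"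
proof -
  interpret F: algebraically_closed F by fact
  interpret K: algebraically_closed K by fact
  interpret A: based_alg F A n b c \<kappa> by fact
  let ?F = "scal K ` carrier F"
  have sf: "subfield ?F K" and sinj: "inj_on (scal K) (carrier F)"
    using scalar_subfield[OF F.field_axioms FK K.field_axioms] by auto
  have sr: "subring ?F K" using subfieldE(1)[OF sf] .
  have T: "finite T" "T \<subseteq> carrier G"
    and Ec: "\<And>g i j. g \<in> carrier G \<Longrightarrow> i < n \<Longrightarrow> j < n \<Longrightarrow> E g i j \<in> carrier K"
    and E0: "\<And>g i j. g \<in> carrier G \<Longrightarrow> g \<notin> T \<Longrightarrow> i < n \<Longrightarrow> j < n \<Longrightarrow> E g i j = \<zero>\<^bsub>K\<^esub>"
    using E by (auto simp: grad_mat_def)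
  let ?Z = "(\<lambda>(g, i, j). E g i j) ` (T \<times> {..<n} \<times> {..<n})"
  obtain zs where zs: "set zs = ?Z" using finite_list[of ?Z] T by auto
  have zmem: "E g i j \<in> set zs" if "g \<in> T" "i < n" "j < n" for g i j
    unfolding zs by (rule image_eqI[of _ _ "(g, i, j)"]) (simp_all add: that)
  have zK: "set zs \<subseteq> carrier K" unfolding zs using Ec T by auto
  define B where "B = adjoins K ?F zs"
  let ?D = "K\<lparr>carrier := B\<rparr>"
  have srB: "subring B K" unfolding B_def by (rule adjoins_subring[OF K.is_cring sr zK])
  have incl: "?F \<union> set zs \<subseteq> B" unfolding B_def by (rule adjoins_incl[OF K.is_cring sr zK])
  have BK: "B \<subseteq> carrier K" using subringE(1)[OF srB] .
  have D: "cring ?D" by (rule cring_subring[OF K.is_cring srB])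
  interpret D: cring ?D by (rule D)
  have sB: "scal K x \<in> B" if "x \<in> carrier F" for x using incl that by auto
  have EB: "E g i j \<in> B" if "g \<in> carrier G" "i < n" "j < n" for g i j
  proof (cases "g \<in> T")
    case True then show ?thesis using incl zmem that by auto
  next
    case False then show ?thesis using E0[OF that(1) False that(2,3)] subringE(2)[OF srB] by simp
  qed
  obtain \<epsilon> where \<epsilon>: "\<epsilon> \<in> ring_hom ?D F" "\<And>x. x \<in> carrier F \<Longrightarrow> \<epsilon> (scal K x) = x"
    using specialization[OF F FK K.field_axioms zK] unfolding B_def by blast
  have \<epsilon>F: "\<epsilon> x \<in> carrier F" if "x \<in> B" for x using ring_hom_closed[OF \<epsilon>(1)] that by simp
  interpret ee: ring_hom_cring ?D F \<epsilon> by unfold_locales (rule \<epsilon>(1))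
  have sD: "scal K \<in> ring_hom F ?D" using ring_hom_restrict[OF scal_hom[OF FK]] incl by auto
  \<comment> \<open>the point \<open>\<epsilon>\<close> followed by the inclusion of \<open>F\<close>\<close>
  define \<delta> where "\<delta> = (\<lambda>x. scal K (\<epsilon> x))"
  have \<delta>B: "\<delta> x \<in> B" if "x \<in> B" for x unfolding \<delta>_def by (rule sB[OF \<epsilon>F[OF that]])
  \<comment> \<open>generators of the kernel of \<open>\<epsilon>\<close>, which also generate \<open>B\<close>\<close>
  define xs where "xs = map (\<lambda>z. z \<ominus>\<^bsub>K\<^esub> \<delta> z) zs"
  have diffB: "x \<ominus>\<^bsub>K\<^esub> y \<in> B" if "x \<in> B" "y \<in> B" for x y
    using that subringE(5,7)[OF srB] by (simp add: K.minus_eq)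
  have xsB: "set xs \<subseteq> B" using incl diffB \<delta>B by (auto simp: xs_def)
  have xsK: "set xs \<subseteq> carrier K" using xsB BK by auto
  have B_eq: "B = adjoins K ?F xs"
  proof
    have s: "subring (adjoins K ?F xs) K" "?F \<union> set xs \<subseteq> adjoins K ?F xs"
      using adjoins_subring[OF K.is_cring sr xsK] adjoins_incl[OF K.is_cring sr xsK] by auto
    have "z \<in> adjoins K ?F xs" if z: "z \<in> set zs" for z
    proof -
      have zB: "z \<in> B" "z \<in> carrier K" "\<delta> z \<in> carrier K" using incl z \<delta>B[of z] BK by auto
      have "z \<ominus>\<^bsub>K\<^esub> \<delta> z \<in> adjoins K ?F xs" "\<delta> z \<in> adjoins K ?F xs"
        using s(2) z \<epsilon>F[OF zB(1)] by (auto simp: xs_def \<delta>_def)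
      then have "z \<ominus>\<^bsub>K\<^esub> \<delta> z \<oplus>\<^bsub>K\<^esub> \<delta> z \<in> adjoins K ?F xs" by (rule subringE(7)[OF s(1)])
      moreover have "z \<ominus>\<^bsub>K\<^esub> \<delta> z \<oplus>\<^bsub>K\<^esub> \<delta> z = z" using zB by (simp add: K.minus_eq K.a_assoc K.l_neg)
      ultimately show ?thesis by simp
    qed
    then show "B \<subseteq> adjoins K ?F xs"
      unfolding B_def by (intro adjoins_minimal[OF K.is_cring sr zK s(1)]) (use s(2) in auto)
    show "adjoins K ?F xs \<subseteq> B"
      by (rule adjoins_minimal[OF K.is_cring sr xsK srB]) (use incl xsB in auto)
  qed
  \<comment> \<open>the index is shifted: the ring \<open>R m\<close> below is \<open>B / I\<^bsup>m+1\<^esup>\<close>, so that \<open>R 0\<close> is the residue field\<close>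
  define J where "J = (\<lambda>m. ipow K (set xs) B (Suc m))"
  note ip = ipow_sideal[OF K.is_cring srB xsB]
  have J: "ideal (J m) ?D" for m unfolding J_def by (rule sideal_ideal[OF K.is_cring srB ip])
  have JB: "J m \<subseteq> B" for m unfolding J_def using ip[of "Suc m"] by (simp add: sideal_def)
  \<comment> \<open>the generators, and with them the ideal \<open>J 0\<close>, are killed by the specialization\<close>
  have \<epsilon>0: "\<epsilon> x = \<zero>\<^bsub>F\<^esub>" if "x \<in> J 0" for x
    using that unfolding J_def ipow_simps
  proof (induction)
    case zero
    show ?case using ee.hom_zero by simp
  next
    case (step x y s)
    have xB: "x \<in> B" "y \<in> B" using step xsB by auto
    have sB': "s \<in> B" using step(3) JB[of 0] unfolding J_def ipow_simps by auto
    obtain z where z: "z \<in> set zs" "x = z \<ominus>\<^bsub>K\<^esub> \<delta> z" using step(1) by (auto simp: xs_def)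
    have zB: "z \<in> B" "\<delta> z \<in> B" using z incl \<delta>B[of z] by auto
    have "x \<oplus>\<^bsub>K\<^esub> \<delta> z = z"
      using z(2) zB BK by (simp add: K.minus_eq K.a_assoc K.l_neg subset_iff)
    then have "\<epsilon> x \<oplus>\<^bsub>F\<^esub> \<epsilon> (\<delta> z) = \<epsilon> z" using ring_hom_add[OF \<epsilon>(1), of x "\<delta> z"] xB zB by simp
    moreover have "\<epsilon> (\<delta> z) = \<epsilon> z" using \<epsilon>(2)[OF \<epsilon>F[OF zB(1)]] by (simp add: \<delta>_def)
    ultimately have "\<epsilon> x = \<zero>\<^bsub>F\<^esub>" using \<epsilon>F[OF xB(1)] \<epsilon>F[OF zB(1)] F.add.r_cancel_one'[of "\<epsilon> x" "\<epsilon> z"] by auto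
    then have "\<epsilon> (x \<otimes>\<^bsub>K\<^esub> y) = \<zero>\<^bsub>F\<^esub>" using ring_hom_mult[OF \<epsilon>(1), of x y] xB \<epsilon>F by simp
    then show ?case
      using ring_hom_add[OF \<epsilon>(1), of "x \<otimes>\<^bsub>K\<^esub> y" s] subringE(6)[OF srB xB] sB' step(4) by simp
  qed
  have proper: "\<one>\<^bsub>K\<^esub> \<notin> ipow K (set xs) B 1"
  proof
    assume "\<one>\<^bsub>K\<^esub> \<in> ipow K (set xs) B 1"
    then have "\<epsilon> \<one>\<^bsub>K\<^esub> = \<zero>\<^bsub>F\<^esub>" by (intro \<epsilon>0) (simp add: J_def)
    then show False using ee.hom_one by simp
  qed
  define R where "R m = quot_alg K B (J m)" for m
  define p where "p m = a_r_coset ?D (J m)" for m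
  have FB: "?F \<subseteq> B" using incl by auto
  note Q = quot_alg_props[OF FK srB FB J, folded R_def p_def]
  have Rc: "cring (R m)" for m using Q(1)[of m] by (simp add: algebra_def)
  interpret R: cring "R m" for m by (rule Rc)
  interpret pp: ring_hom_family ?D R p
    by (intro ring_hom_family.intro D Rc Q(2))
  define cR where "cR = (\<lambda>m i j k. c i j k \<odot>\<^bsub>R m\<^esub> \<one>\<^bsub>R m\<^esub>)"
  have cR: "cR m i j k = p m (scal K (c i j k))" if "i < n" "j < n" "k < n" for m i j k
    unfolding cR_def by (rule Q(5)[OF A.c_closed[OF that]])
  have cRc: "cR m i j k \<in> carrier (R m)" if "i < n" "j < n" "k < n" for m i j k
    unfolding cR[OF that] using pp.images(1) sB[OF A.c_closed[OF that]] by simp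
  \<comment> \<open>the given grading and its specialization, both over \<open>B\<close>\<close>
  interpret i: ring_hom_inj_family ?D "\<lambda>_::unit. K" "\<lambda>_. id"
    by (intro ring_hom_inj_family.intro ring_hom_family.intro ring_hom_inj_family_axioms.intro D K.is_cring id_subring_hom[OF srB], simp)
  interpret e: ring_hom_family ?D "\<lambda>_::unit. F" "\<lambda>_. \<epsilon>"
    by (intro ring_hom_family.intro D F.is_cring \<epsilon>(1))
  interpret s: ring_hom_family F "\<lambda>_::unit. ?D" "\<lambda>_. scal K"
    by (intro ring_hom_family.intro D F.is_cring sD)
  define E0 where "E0 = (\<lambda>g i j. \<epsilon> (E g i j))"
  have scB: "scal K (c i j k) \<in> B" if "i < n" "j < n" "k < n" for i j k by (rule sB[OF A.c_closed[OF that]])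
  have E0c: "E0 g i j \<in> carrier F" if "g \<in> carrier G" "i < n" "j < n" for g i j
    unfolding E0_def by (rule \<epsilon>F[OF EB[OF that]])
  have ED: "grad_mat ?D n (\<lambda>i j k. scal K (c i j k)) G T E"
    by (rule i.grad_mat_reflect) (simp_all add: scB EB E)
  have "grad_mat F n (\<lambda>i j k. \<epsilon> (scal K (c i j k))) G T E0"
    unfolding E0_def by (rule e.grad_mat_push[OF _ ED]) (simp add: scB)
  then have E0F: "grad_mat F n c G T E0"
    by (rule grad_mat_cong[OF F.is_cring, rotated 2]) (simp_all add: \<epsilon> A.c_closed)
  have E0D: "grad_mat ?D n (\<lambda>i j k. scal K (c i j k)) G T (\<lambda>g i j. scal K (E0 g i j))"
    by (rule s.grad_mat_push[OF _ E0F]) (simp add: A.c_closed)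
  have grR: "grad_mat (R m) n (cR m) G T (\<lambda>g i j. p m (H g i j))"
    if "grad_mat ?D n (\<lambda>i j k. scal K (c i j k)) G T H" for m H
  proof (rule grad_mat_cong[OF Rc])
    show "grad_mat (R m) n (\<lambda>i j k. p m (scal K (c i j k))) G T (\<lambda>g i j. p m (H g i j))"
      by (rule pp.grad_mat_push[OF _ that]) (simp add: scB)
  qed (simp_all add: cR[symmetric] cRc)
  define Sol where "Sol = (\<lambda>m M N. aut_mat (R m) n (cR m) M N \<and>
    (\<forall>g \<in> carrier G. intertwines (R m) n M (\<lambda>i j. p m (scal K (E0 g i j))) (\<lambda>i j. p m (E g i j))))"
  obtain e :: "(nat multiset \<Rightarrow> 'f) \<Rightarrow> 'k" where e: "B \<subseteq> range e"
    using adjoins_encoding[of K "carrier F" zs] unfolding B_def by blast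
  \<comment> \<open>a coset is determined by the set of codes of its elements\<close>
  define enc where "enc = (\<lambda>U. {q. e q \<in> U})"
  have enc: "inj_on enc (carrier (R m))" for m
  proof (rule inj_onI)
    fix U V assume U: "U \<in> carrier (R m)" "V \<in> carrier (R m)" "enc U = enc V"
    have "W = e ` enc W" if "W \<subseteq> B" for W using that e by (auto simp: enc_def)
    from this[of U] this[of V] show "U = V" using Q(6)[OF U(1)] Q(6)[OF U(2)] U(3) by simp
  qed
  have "\<exists>M N. Sol m M N" for m
  proof (induction m)
    case 0
    interpret s0: scalar_ext F A n b c \<kappa> "R 0" using A Q(1) by (simp add: scalar_ext_def)
    interpret V: based_alg "R 0" s0.T n s0.bT s0.c' s0.coordT by (rule s0.T_based)
    have ce: "cR 0 = s0.c'" by (simp add: cR_def s0.emb_def fun_eq_iff)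
    obtain M N where MN: "aut_mat (R 0) n s0.c' M N" "\<And>E. V.mclosed E \<Longrightarrow> intertwines (R 0) n M E E"
      using V.identity_matrix by blast
    have eq: "p 0 (scal K (E0 g i j)) = p 0 (E g i j)" if g: "g \<in> carrier G" "i < n" "j < n" for g i j
    proof -
      have cl: "E g i j \<in> B" "\<delta> (E g i j) \<in> B" using EB[OF g] \<delta>B by auto
      have J0: "E g i j \<ominus>\<^bsub>K\<^esub> \<delta> (E g i j) \<in> J 0"
      proof (cases "g \<in> T")
        case True
        then have "E g i j \<ominus>\<^bsub>K\<^esub> \<delta> (E g i j) \<in> set xs"
          unfolding xs_def set_map by (intro image_eqI[of _ _ "E g i j"]) (simp_all add: zmem g)
        from mgen.step[where D = K, OF this subringE(3)[OF srB] mgen.zero] show ?thesis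
          using cl diffB BK by (simp add: J_def subset_iff)
      next
        case False
        have "\<delta> \<zero>\<^bsub>K\<^esub> = \<zero>\<^bsub>K\<^esub>" using ee.hom_zero s.images(3) by (simp add: \<delta>_def)
        then show ?thesis using E0[OF g(1) False g(2,3)] ip[of 1] by (simp add: J_def sideal_def K.minus_eq)
      qed
      have "p 0 (E g i j \<ominus>\<^bsub>K\<^esub> \<delta> (E g i j)) = \<zero>\<^bsub>R 0\<^esub>" using Q(4)[of "E g i j \<ominus>\<^bsub>K\<^esub> \<delta> (E g i j)" 0] J0 JB by auto
      moreover have "E g i j = E g i j \<ominus>\<^bsub>K\<^esub> \<delta> (E g i j) \<oplus>\<^bsub>K\<^esub> \<delta> (E g i j)"
        using cl BK by (simp add: K.minus_eq K.a_assoc K.l_neg subset_iff)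
      ultimately have "p 0 (E g i j) = \<zero>\<^bsub>R 0\<^esub> \<oplus>\<^bsub>R 0\<^esub> p 0 (\<delta> (E g i j))"
        using ring_hom_add[OF Q(2)[of 0], of "E g i j \<ominus>\<^bsub>K\<^esub> \<delta> (E g i j)" "\<delta> (E g i j)"] diffB[OF cl] cl by simp
      then show ?thesis using pp.images(1)[of "\<delta> (E g i j)" 0] cl by (simp add: \<delta>_def E0_def)
    qed
    have "intertwines (R 0) n M (\<lambda>i j. p 0 (scal K (E0 g i j))) (\<lambda>i j. p 0 (E g i j))" if g: "g \<in> carrier G" for g
    proof (rule intertwines_cong[OF Rc])
      show "intertwines (R 0) n M (\<lambda>i j. p 0 (E g i j)) (\<lambda>i j. p 0 (E g i j))"
        by (rule MN(2)) (simp add: V.mclosed_def pp.images(1) EB[OF g])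
      show "M i j \<in> carrier (R 0)" if "i < n" "j < n" for i j using MN(1) that by (simp add: aut_mat_def)
    qed (simp_all add: eq g pp.images(1) EB)
    then show ?case using MN(1) unfolding Sol_def ce by blast
  next
    case (Suc m)
    then obtain M N where MN: "Sol m M N" by blast
    have Jm: "J (Suc m) \<subseteq> J m" unfolding J_def by (rule ipow_Suc[OF K.is_cring srB xsB])
    have p0: "p k x = \<zero>\<^bsub>R k\<^esub> \<longleftrightarrow> x \<in> J k" if "x \<in> B" for k x using Q(4)[OF that] .
    have surj: "p k ` carrier ?D = carrier (R k)" for k using Q(3) by simp
    have "\<exists>h \<in> ring_hom (R (Suc m)\<lparr>carrier := p (Suc m) ` carrier ?D\<rparr>) (R m). \<forall>x \<in> carrier ?D. h (p (Suc m) x) = p m x"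
      by (rule ring_hom_factor[OF D.ring_axioms R.ring_axioms R.ring_axioms Q(2) Q(2)]) (use p0 Jm in auto)
    then obtain h where h: "h \<in> ring_hom (R (Suc m)) (R m)" "\<And>x. x \<in> B \<Longrightarrow> h (p (Suc m) x) = p m x"
      unfolding surj by (auto simp: ring_hom_def)
    have smp: "x \<odot>\<^bsub>R k\<^esub> p k u = p k (scal K x \<otimes>\<^bsub>K\<^esub> u)" if "x \<in> carrier F" "u \<in> B" for k x u
    proof -
      interpret Rk: algebra F "R k" by (rule Q(1))
      have pu: "p k u \<in> carrier (R k)" using pp.images(1)[of u k] that by simp
      have "x \<odot>\<^bsub>R k\<^esub> p k u = (x \<odot>\<^bsub>R k\<^esub> \<one>\<^bsub>R k\<^esub>) \<otimes>\<^bsub>R k\<^esub> p k u"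
        using Rk.smult_assoc2[OF that(1) R.one_closed pu] pu by simp
      also have "\<dots> = p k (scal K x \<otimes>\<^bsub>K\<^esub> u)"
        unfolding Q(5)[OF that(1)] using ring_hom_mult[OF Q(2)[of k], of "scal K x" u] sB that by simp
      finally show ?thesis .
    qed
    have "h (x \<odot>\<^bsub>R (Suc m)\<^esub> U) = x \<odot>\<^bsub>R m\<^esub> h U" if x: "x \<in> carrier F" and U: "U \<in> carrier (R (Suc m))" for x U
    proof -
      obtain u where u: "u \<in> B" "U = p (Suc m) u" using U unfolding Q(3)[symmetric] by blast
      have "h (p (Suc m) (scal K x \<otimes>\<^bsub>K\<^esub> u)) = p m (scal K x \<otimes>\<^bsub>K\<^esub> u)"
        by (rule h(2)[OF subringE(6)[OF srB sB[OF x] u(1)]])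
      then show ?thesis unfolding u(2) by (simp add: smp[OF x u(1)] h(2)[OF u(1)])
    qed
    then have hhom: "h \<in> algebra_homs F (R (Suc m)) (R m)" using h(1) by (simp add: algebra_homs_def)
    have hsurj: "h ` carrier (R (Suc m)) = carrier (R m)"
      unfolding Q(3)[symmetric] image_image by (rule image_cong) (simp_all add: h(2))
    have sq: "x \<otimes>\<^bsub>R (Suc m)\<^esub> y = \<zero>\<^bsub>R (Suc m)\<^esub>"
      if xy: "x \<in> carrier (R (Suc m))" "y \<in> carrier (R (Suc m))" "h x = \<zero>\<^bsub>R m\<^esub>" "h y = \<zero>\<^bsub>R m\<^esub>" for x y
    proof -
      obtain u v where u: "u \<in> B" "x = p (Suc m) u" and v: "v \<in> B" "y = p (Suc m) v"
        using xy(1,2) unfolding Q(3)[symmetric] by blast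
      have "u \<in> J m" "v \<in> J m" using xy(3,4) u v h(2) p0 by auto
      then have "u \<otimes>\<^bsub>K\<^esub> v \<in> ipow K (set xs) B (Suc m + Suc m)"
        unfolding J_def by (rule ipow_mult[OF K.is_cring srB xsB])
      then have "u \<otimes>\<^bsub>K\<^esub> v \<in> J (Suc m)"
        unfolding J_def using ipow_antimono[OF K.is_cring srB xsB, of "Suc (Suc m)" "Suc m + Suc m"] by auto
      then have "p (Suc m) (u \<otimes>\<^bsub>K\<^esub> v) = \<zero>\<^bsub>R (Suc m)\<^esub>" using p0[OF subringE(6)[OF srB u(1) v(1)]] by simp
      then show ?thesis using ring_hom_mult[OF Q(2)[of "Suc m"], of u v] u v by simp
    qed
    have "\<exists>M N. aut_mat (R (Suc m)) n (cR (Suc m)) M N \<and>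
      (\<forall>g \<in> carrier G. intertwines (R (Suc m)) n M (\<lambda>i j. p (Suc m) (scal K (E0 g i j))) (\<lambda>i j. p (Suc m) (E g i j)))"
      unfolding cR_def
    proof (rule lift_isomorphism[OF A smooth G Q(1) Q(1) hhom hsurj sq enc enc grR[OF E0D, unfolded cR_def] grR[OF ED, unfolded cR_def]])
      show "aut_mat (R m) n (\<lambda>i j k. c i j k \<odot>\<^bsub>R m\<^esub> \<one>\<^bsub>R m\<^esub>) M N" using MN by (simp add: Sol_def cR_def)
      have Mc: "M i j \<in> carrier (R m)" if "i < n" "j < n" for i j using MN that by (simp add: Sol_def aut_mat_def)
      fix g assume g: "g \<in> carrier G"
      show "intertwines (R m) n M (\<lambda>i j. h (p (Suc m) (scal K (E0 g i j)))) (\<lambda>i j. h (p (Suc m) (E g i j)))"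
      proof (rule intertwines_cong[OF Rc Mc])
        show "intertwines (R m) n M (\<lambda>i j. p m (scal K (E0 g i j))) (\<lambda>i j. p m (E g i j))"
          using MN g by (simp add: Sol_def)
      qed (simp_all add: h(2) sB E0c[OF g] EB[OF g] pp.images(1))
    qed
    then show ?case unfolding Sol_def .
  qed
  then obtain M N where MN: "\<And>m. Sol m (M m) (N m)" by metis
  have inj: "b = \<zero>\<^bsub>K\<^esub>" if b: "b \<in> B" "\<And>m. p m b = \<zero>\<^bsub>R m\<^esub>" for b
  proof (rule krull_intersection[OF K.domain_axioms sf xsK B_eq proper])
    fix m
    have "b \<in> J m" for m using Q(4)[OF b(1)] b(2) by blast
    then show "b \<in> ipow K (set xs) B m" using b(1) by (cases m) (simp_all only: J_def ipow_simps(1))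
  qed
  \<comment> \<open>the entries of all \<open>M m\<close> and \<open>N m\<close> as one family, the first index telling the two apart\<close>
  define a where "a = (\<lambda>m (t, i, j). if t then M m i j else N m i j)"
  have Mc: "M m i j \<in> carrier (R m)" "N m i j \<in> carrier (R m)" if "i < n" "j < n" for m i j
    using MN[of m] that by (simp_all add: Sol_def aut_mat_def)
  let ?I = "(UNIV :: bool set) \<times> {..<n} \<times> {..<n}"
  have fI: "finite ?I" by simp
  have aI: "a m x \<in> carrier (R m)" if "x \<in> ?I" for m x using that Mc by (auto simp: a_def)
  obtain S :: "(nat \<Rightarrow> 'k set) ring" and q :: "nat \<Rightarrow> (nat \<Rightarrow> 'k set) \<Rightarrow> 'k set" and z \<beta> \<gamma>
    where S: "cring S" and q: "\<And>n. q n \<in> ring_hom S (R n)"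
      and qinj: "\<And>x y. x \<in> carrier S \<Longrightarrow> y \<in> carrier S \<Longrightarrow> (\<And>n. q n x = q n y) \<Longrightarrow> x = y"
      and z: "\<And>i. i \<in> ?I \<Longrightarrow> z i \<in> carrier S" "\<And>n i. q n (z i) = a n i"
      and \<beta>: "\<beta> \<in> ring_hom ?D S" "\<And>n b. q n (\<beta> b) = p n b"
      and \<gamma>: "\<gamma> \<in> ring_hom S K" "\<And>b. b \<in> B \<Longrightarrow> \<gamma> (\<beta> b) = b"
  proof (rule combine_points[OF K srB Rc Q(2) inj fI aI])
    fix S :: "(nat \<Rightarrow> 'k set) ring" and q :: "nat \<Rightarrow> (nat \<Rightarrow> 'k set) \<Rightarrow> 'k set" and z \<beta> \<gamma>
    assume "cring S" "\<And>n. q n \<in> ring_hom S (R n)"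
      "\<And>x y. x \<in> carrier S \<Longrightarrow> y \<in> carrier S \<Longrightarrow> (\<And>n. q n x = q n y) \<Longrightarrow> x = y"
      "\<And>i. i \<in> ?I \<Longrightarrow> z i \<in> carrier S" "\<And>n i. q n (z i) = a n i"
      "\<beta> \<in> ring_hom ?D S" "\<And>n b. q n (\<beta> b) = p n b"
      "\<gamma> \<in> ring_hom S K" "\<And>b. b \<in> B \<Longrightarrow> \<gamma> (\<beta> b) = b"
    note h = this
    show thesis by (rule that[OF h])
  qed
  define M' where "M' = (\<lambda>i j. z (True, i, j))"
  define N' where "N' = (\<lambda>i j. z (False, i, j))"
  have M': "i < n \<Longrightarrow> j < n \<Longrightarrow> M' i j \<in> carrier S" "i < n \<Longrightarrow> j < n \<Longrightarrow> N' i j \<in> carrier S"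
    "q m (M' i j) = M m i j" "q m (N' i j) = N m i j" for m i j
    using z by (simp_all add: M'_def N'_def a_def)
  have \<beta>c: "\<beta> x \<in> carrier S" if "x \<in> B" for x using ring_hom_closed[OF \<beta>(1)] that by simp
  interpret qq: ring_hom_inj_family S R q
    by (intro ring_hom_inj_family.intro ring_hom_family.intro S Rc q,
        unfold ring_hom_inj_family_axioms_def, use qinj in blast)
  interpret gg: ring_hom_family S "\<lambda>_::unit. K" "\<lambda>_. \<gamma>"
    by (intro ring_hom_family.intro S K.is_cring \<gamma>(1))
  have MS: "aut_mat S n (\<lambda>i j k. \<beta> (scal K (c i j k))) M' N'"
  proof (rule qq.aut_mat_reflect)
    fix m
    have "aut_mat (R m) n (\<lambda>i j k. p m (scal K (c i j k))) (M m) (N m)"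
    proof (rule aut_mat_cong[OF Rc])
      show "aut_mat (R m) n (cR m) (M m) (N m)" using MN by (simp add: Sol_def)
    qed (simp_all add: cR[symmetric] cRc)
    then show "aut_mat (R m) n (\<lambda>i j k. q m (\<beta> (scal K (c i j k)))) (\<lambda>i j. q m (M' i j)) (\<lambda>i j. q m (N' i j))"
      by (simp only: \<beta>(2) M'(3,4))
  qed (simp_all add: \<beta>c scB M'(1,2))
  have intS: "intertwines S n M' (\<lambda>i j. \<beta> (scal K (E0 g i j))) (\<lambda>i j. \<beta> (E g i j))" if g: "g \<in> carrier G" for g
  proof (rule qq.intertwines_reflect)
    fix m
    have "intertwines (R m) n (M m) (\<lambda>i j. p m (scal K (E0 g i j))) (\<lambda>i j. p m (E g i j))"
      using MN g by (simp add: Sol_def)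
    then show "intertwines (R m) n (\<lambda>i j. q m (M' i j)) (\<lambda>i j. q m (\<beta> (scal K (E0 g i j)))) (\<lambda>i j. q m (\<beta> (E g i j)))"
      by (simp only: \<beta>(2) M'(3))
  qed (simp_all add: \<beta>c sB M'(1) E0c[OF g] EB[OF g])
  have "aut_mat K n (\<lambda>i j k. \<gamma> (\<beta> (scal K (c i j k)))) (\<lambda>i j. \<gamma> (M' i j)) (\<lambda>i j. \<gamma> (N' i j))"
    by (rule gg.aut_mat_push[OF _ MS]) (simp add: \<beta>c scB)
  then have "aut_mat K n (\<lambda>i j k. scal K (c i j k)) (\<lambda>i j. \<gamma> (M' i j)) (\<lambda>i j. \<gamma> (N' i j))"
    by (rule aut_mat_cong[OF K.is_cring, rotated 2]) (use \<gamma>(2) scB BK in auto)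
  moreover have "intertwines K n (\<lambda>i j. \<gamma> (M' i j)) (\<lambda>i j. scal K (E0 g i j)) (E g)" if g: "g \<in> carrier G" for g
  proof (rule intertwines_cong[OF K.is_cring])
    show "intertwines K n (\<lambda>i j. \<gamma> (M' i j)) (\<lambda>i j. \<gamma> (\<beta> (scal K (E0 g i j)))) (\<lambda>i j. \<gamma> (\<beta> (E g i j)))"
      by (rule gg.intertwines_push[OF _ _ _ intS[OF g]]) (simp_all add: M' \<beta>c sB E0c[OF g] EB[OF g])
    show "\<gamma> (M' i j) \<in> carrier K" if "i < n" "j < n" for i j using gg.images(1)[OF M'(1)[OF that]] .
    show "scal K (E0 g i j) \<in> carrier K" if "i < n" "j < n" for i j using sB[OF E0c[OF g that]] BK by auto
  qed (simp_all add: \<gamma>(2) sB E0c[OF g] EB[OF g] Ec[OF g])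
  ultimately show ?thesis using E0F by blast
qed

section \<open>Isomorphism classes\<close>

text \<open>
  A map that preserves and reflects equivalence, and reaches every class, induces a bijection of classes.
\<close>

lemma quotient_map_bij:
  assumes A: "equiv A r" and B: "equiv B s" and f: "\<And>x. x \<in> A \<Longrightarrow> f x \<in> B"
    and iff: "\<And>x y. x \<in> A \<Longrightarrow> y \<in> A \<Longrightarrow> (f x, f y) \<in> s \<longleftrightarrow> (x, y) \<in> r"
    and surj: "\<And>z. z \<in> B \<Longrightarrow> \<exists>x \<in> A. (f x, z) \<in> s"
  shows "\<forall>x \<in> A. (\<Union>y\<in>r `` {x}. s `` {f y}) = s `` {f x}"
    "bij_betw (\<lambda>C. \<Union>y\<in>C. s `` {f y}) (A // r) (B // s)"
proof -
  have eq: "(\<Union>y\<in>r `` {x}. s `` {f y}) = s `` {f x}" if x: "x \<in> A" for x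
  proof -
    have "s `` {f y} = s `` {f x}" if y: "y \<in> r `` {x}" for y
    proof -
      have xy: "(x, y) \<in> r" using y by simp
      then have yA: "y \<in> A" using equiv_type[OF A] by auto
      show ?thesis using equiv_class_eq[OF B, of "f x" "f y"] iff[OF x yA] xy by simp
    qed
    then show ?thesis using equiv_class_self[OF A x] by blast
  qed
  then show "\<forall>x \<in> A. (\<Union>y\<in>r `` {x}. s `` {f y}) = s `` {f x}" by blast
  show "bij_betw (\<lambda>C. \<Union>y\<in>C. s `` {f y}) (A // r) (B // s)"
  proof (rule bij_betw_imageI)
    show "inj_on (\<lambda>C. \<Union>y\<in>C. s `` {f y}) (A // r)"
    proof (rule inj_onI)
    fix C D assume C: "C \<in> A // r" and D: "D \<in> A // r" and CD: "(\<Union>y\<in>C. s `` {f y}) = (\<Union>y\<in>D. s `` {f y})"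
    obtain x where x: "x \<in> A" "C = r `` {x}" using C by (rule quotientE)
    obtain y where y: "y \<in> A" "D = r `` {y}" using D by (rule quotientE)
    have "s `` {f x} = s `` {f y}" using CD unfolding x(2) y(2) eq[OF x(1)] eq[OF y(1)] .
    then have "(f x, f y) \<in> s" by (rule eq_equiv_class[OF _ B f[OF y(1)]])
    then show "C = D" unfolding x(2) y(2) using equiv_class_eq[OF A] iff[OF x(1) y(1)] by blast
    qed
    show "(\<lambda>C. \<Union>y\<in>C. s `` {f y}) ` (A // r) = B // s"
    proof (intro equalityI subsetI)
    fix U assume "U \<in> (\<lambda>C. \<Union>y\<in>C. s `` {f y}) ` (A // r)"
    then obtain x where "x \<in> A" "U = (\<Union>y\<in>r `` {x}. s `` {f y})" by (elim imageE quotientE) blast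
    then show "U \<in> B // s" using eq f by (auto intro: quotientI)
  next
    fix U assume "U \<in> B // s"
    then obtain z where z: "z \<in> B" "U = s `` {z}" by (rule quotientE)
    obtain x where x: "x \<in> A" "(f x, z) \<in> s" using surj[OF z(1)] by blast
    have "U = (\<Union>y\<in>r `` {x}. s `` {f y})" unfolding eq[OF x(1)] z(2) using equiv_class_eq[OF B x(2)] by simp
    then show "U \<in> (\<lambda>C. \<Union>y\<in>C. s `` {f y}) ` (A // r)" by (rule image_eqI) (rule quotientI[OF x(1)])
    qed
  qed
qed

lemma grading_iso_equiv:
  assumes "nonassoc_algebra R V"
  shows "equiv (gradings G R V) (grading_iso G R V)"
proof (rule equivI)
  interpret nonassoc_algebra R V by fact
  have sub: "\<Gamma> g \<subseteq> carrier V" if "\<Gamma> \<in> gradings G R V" "g \<in> carrier G" for \<Gamma> g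
    using that by (intro submoduleE(1)) (simp add: gradings_def)
  show "grading_iso G R V \<subseteq> gradings G R V \<times> gradings G R V" by (auto simp: grading_iso_def)
  show "refl_on (gradings G R V) (grading_iso G R V)"
  proof (rule refl_onI)
    fix \<Gamma> assume \<Gamma>: "\<Gamma> \<in> gradings G R V"
    let ?i = "\<lambda>x \<in> carrier V. x"
    have "?i \<in> algebra_auts R V"
      using id_Bij[of "carrier V"] prod_closed by (simp add: algebra_auts_def)
    moreover have "?i ` \<Gamma> g = \<Gamma> g" if "g \<in> carrier G" for g
      using sub[OF \<Gamma> that] by force
    ultimately show "(\<Gamma>, \<Gamma>) \<in> grading_iso G R V" using \<Gamma> unfolding grading_iso_def by blast
  qed
  show "sym (grading_iso G R V)"
  proof (rule symI)
    fix \<Gamma> \<Delta> assume "(\<Gamma>, \<Delta>) \<in> grading_iso G R V"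
    then obtain \<phi> where gr: "\<Gamma> \<in> gradings G R V" "\<Delta> \<in> gradings G R V" and \<phi>: "\<phi> \<in> algebra_auts R V"
      and im: "\<And>g. g \<in> carrier G \<Longrightarrow> \<phi> ` \<Gamma> g = \<Delta> g" by (auto simp: grading_iso_def)
    have B: "\<phi> \<in> Bij (carrier V)" and bij: "bij_betw \<phi> (carrier V) (carrier V)" using \<phi> by (auto simp: algebra_auts_def Bij_def)
    let ?\<psi> = "restrict (inv_into (carrier V) \<phi>) (carrier V)"
    have cl: "?\<psi> x \<in> carrier V" "\<phi> (?\<psi> x) = x" "?\<psi> (\<phi> x) = x" "\<phi> x \<in> carrier V" if "x \<in> carrier V" for x
      using that bij_betwE[OF bij_betw_inv_into[OF bij]] bij_betw_inv_into_right[OF bij] bij_betw_inv_into_left[OF bij] bij_betwE[OF bij]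
      by auto
    have eqI: "x = y" if "x \<in> carrier V" "y \<in> carrier V" "\<phi> x = \<phi> y" for x y
      using bij that by (auto simp: bij_betw_def dest: inj_onD)
    have hom: "\<phi> (x \<oplus>\<^bsub>V\<^esub> y) = \<phi> x \<oplus>\<^bsub>V\<^esub> \<phi> y" "\<phi> (x \<otimes>\<^bsub>V\<^esub> y) = \<phi> x \<otimes>\<^bsub>V\<^esub> \<phi> y" "r \<in> carrier R \<Longrightarrow> \<phi> (r \<odot>\<^bsub>V\<^esub> x) = r \<odot>\<^bsub>V\<^esub> \<phi> x"
      if "x \<in> carrier V" "y \<in> carrier V" for x y r using \<phi> that by (auto simp: algebra_auts_def)
    have "?\<psi> \<in> algebra_auts R V"
      unfolding algebra_auts_def
    proof (intro CollectI conjI ballI)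
      show "?\<psi> \<in> Bij (carrier V)" by (rule restrict_inv_into_Bij[OF B])
      fix x y assume xy: "x \<in> carrier V" "y \<in> carrier V"
      show "?\<psi> (x \<oplus>\<^bsub>V\<^esub> y) = ?\<psi> x \<oplus>\<^bsub>V\<^esub> ?\<psi> y"
        by (rule eqI) (use cl[OF xy(1)] cl[OF xy(2)] cl[OF M.a_closed[OF xy]] hom(1)[OF cl(1)[OF xy(1)] cl(1)[OF xy(2)]] in \<open>simp_all del: restrict_apply\<close>)
      show "?\<psi> (x \<otimes>\<^bsub>V\<^esub> y) = ?\<psi> x \<otimes>\<^bsub>V\<^esub> ?\<psi> y"
        by (rule eqI) (use cl[OF xy(1)] cl[OF xy(2)] cl[OF prod_closed[OF xy]] hom(2)[OF cl(1)[OF xy(1)] cl(1)[OF xy(2)]] prod_closed in \<open>simp_all del: restrict_apply\<close>)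
    next
      fix r x assume rx: "r \<in> carrier R" "x \<in> carrier V"
      show "?\<psi> (r \<odot>\<^bsub>V\<^esub> x) = r \<odot>\<^bsub>V\<^esub> ?\<psi> x"
        by (rule eqI) (use cl[OF rx(2)] cl[OF smult_closed[OF rx]] hom(3)[OF cl(1)[OF rx(2)] cl(1)[OF rx(2)] rx(1)] rx(1) in \<open>simp_all del: restrict_apply\<close>)
    qed
    moreover have "?\<psi> ` \<Delta> g = \<Gamma> g" if g: "g \<in> carrier G" for g
    proof -
      have "?\<psi> ` \<Delta> g = (\<lambda>x. ?\<psi> (\<phi> x)) ` \<Gamma> g" unfolding im[OF g, symmetric] image_image ..
      also have "\<dots> = (\<lambda>x. x) ` \<Gamma> g" by (rule image_cong[OF refl]) (use cl(3) sub[OF gr(1) g] in blast)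
      finally show ?thesis by simp
    qed
    ultimately show "(\<Delta>, \<Gamma>) \<in> grading_iso G R V" using gr by (auto simp: grading_iso_def simp del: restrict_apply)
  qed
  show "trans (grading_iso G R V)"
  proof (rule transI)
    fix \<Gamma> \<Delta> \<Theta> assume "(\<Gamma>, \<Delta>) \<in> grading_iso G R V" "(\<Delta>, \<Theta>) \<in> grading_iso G R V"
    then obtain \<phi> \<psi> where gr: "\<Gamma> \<in> gradings G R V" "\<Theta> \<in> gradings G R V" and \<phi>: "\<phi> \<in> algebra_auts R V" and \<psi>: "\<psi> \<in> algebra_auts R V"
      and im: "\<And>g. g \<in> carrier G \<Longrightarrow> \<phi> ` \<Gamma> g = \<Delta> g" "\<And>g. g \<in> carrier G \<Longrightarrow> \<psi> ` \<Delta> g = \<Theta> g"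
      by (auto simp: grading_iso_def)
    have B: "\<phi> \<in> Bij (carrier V)" "\<psi> \<in> Bij (carrier V)" using \<phi> \<psi> by (auto simp: algebra_auts_def)
    have cl: "\<phi> x \<in> carrier V" if "x \<in> carrier V" for x using B(1) that by (auto simp: Bij_def dest: bij_betwE)
    have "compose (carrier V) \<psi> \<phi> \<in> algebra_auts R V"
      using compose_Bij[OF B(2,1)] \<phi> \<psi> cl prod_closed by (simp add: algebra_auts_def compose_eq)
    moreover have "compose (carrier V) \<psi> \<phi> ` \<Gamma> g = \<Theta> g" if g: "g \<in> carrier G" for g
    proof -
      have "compose (carrier V) \<psi> \<phi> ` \<Gamma> g = (\<lambda>x. \<psi> (\<phi> x)) ` \<Gamma> g"
        by (rule image_cong[OF refl]) (use sub[OF gr(1) g] in \<open>auto simp: compose_eq\<close>)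
      also have "\<dots> = \<Theta> g" unfolding im(2)[OF g, symmetric] im(1)[OF g, symmetric] image_image ..
      finally show ?thesis .
    qed
    ultimately show "(\<Gamma>, \<Theta>) \<in> grading_iso G R V" using gr by (auto simp: grading_iso_def)
  qed
qed

theorem theorem4:
  fixes F :: "'f ring"
    and A :: "('f, 'a) module"
    and K :: "('f, 'k) module"
    and G :: "'g monoid"
  assumes "algebraically_closed F"
    and "nonassoc_algebra F A"
    and "fin_dim F A"
    and "smooth_Aut_scheme F A"
    and "algebra F K"
    and "algebraically_closed K"
    and "comm_group G"
    and "finitely_generated_group G"
  shows "(\<forall>\<Gamma> \<in> gradings G F A.
            extend_class G F A K (grading_iso G F A `` {\<Gamma>}) =
            grading_iso G K (extend_scalars F A K) `` {extend_grading G F A K \<Gamma>}) \<and>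
         bij_betw (extend_class G F A K)
           (grading_classes G F A)
           (grading_classes G K (extend_scalars F A K))"
proof -
  interpret F: algebraically_closed F by fact
  interpret K: algebraically_closed K by fact
  have G: "group G" using assms(7) by (simp add: comm_group_def)
  obtain n b c \<kappa> where A: "based_alg F A n b c \<kappa>" using basis_exists[OF F.field_axioms assms(2,3)] by blast
  interpret A: based_alg F A n b c \<kappa> by (rule A)
  interpret E: scalar_ext F A n b c \<kappa> K using A assms(5) by (simp add: scalar_ext_def)
  interpret V: based_alg K E.T n E.bT E.c' E.coordT by (rule E.T_based)
  have emb: "E.emb = scal K" by (simp add: fun_eq_iff E.emb_def scal_def)
  have c': "E.c' = (\<lambda>i j k. scal K (c i j k))" by (simp add: fun_eq_iff emb)
  interpret h: ring_hom_family F "\<lambda>_::unit. K" "\<lambda>_. scal K"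
    by (intro ring_hom_family.intro F.is_cring K.is_cring scal_hom[OF assms(5)])
  have push: "grad_mat K n E.c' G T (\<lambda>g i j. scal K (D g i j))" if "grad_mat F n c G T D" for T D
    unfolding c' by (rule h.grad_mat_push[OF _ that]) (simp add: A.c_closed)
  have ext: "extend_grading G F A K (A.mgrading G D) = V.mgrading G (\<lambda>g i j. scal K (D g i j))"
    if "grad_mat F n c G T D" for T D
    using E.extend_mgrading[OF G that] unfolding emb .
  let ?ext = "extend_grading G F A K"
  let ?r = "grading_iso G F A" and ?s = "grading_iso G K E.T"
  have cl: "?ext \<Gamma> \<in> gradings G K E.T" if \<Gamma>: "\<Gamma> \<in> gradings G F A" for \<Gamma>
  proof -
    obtain T D where D: "grad_mat F n c G T D" "\<Gamma> = A.mgrading G D" using A.grading_mgrading[OF G \<Gamma>] by blast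
    show ?thesis unfolding D(2) ext[OF D(1)] by (rule V.mgrading_grading[OF G push[OF D(1)]])
  qed
  have iff: "(?ext \<Gamma>, ?ext \<Delta>) \<in> ?s \<longleftrightarrow> (\<Gamma>, \<Delta>) \<in> ?r"
    if \<Gamma>: "\<Gamma> \<in> gradings G F A" and \<Delta>: "\<Delta> \<in> gradings G F A" for \<Gamma> \<Delta>
  proof -
    obtain T D where D: "grad_mat F n c G T D" "\<Gamma> = A.mgrading G D" using A.grading_mgrading[OF G \<Gamma>] by blast
    obtain T' D' where D': "grad_mat F n c G T' D'" "\<Delta> = A.mgrading G D'" using A.grading_mgrading[OF G \<Delta>] by blast
    have Dc: "D g i j \<in> carrier F" "D' g i j \<in> carrier F" if "g \<in> carrier G" "i < n" "j < n" for g i j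
      using D(1) D'(1) that by (auto simp: grad_mat_def)
    show ?thesis
      unfolding D(2) D'(2) ext[OF D(1)] ext[OF D'(1)] V.grading_iso_iff[OF G push[OF D(1)] push[OF D'(1)]]
        A.grading_iso_iff[OF G D(1) D'(1)] c'
    proof
      assume "\<exists>M N. aut_mat K n (\<lambda>i j k. scal K (c i j k)) M N \<and>
        (\<forall>g \<in> carrier G. intertwines K n M (\<lambda>i j. scal K (D g i j)) (\<lambda>i j. scal K (D' g i j)))"
      then obtain M N where M: "aut_mat K n (\<lambda>i j k. scal K (c i j k)) M N"
        "\<And>g. g \<in> carrier G \<Longrightarrow> intertwines K n M (\<lambda>i j. scal K (D g i j)) (\<lambda>i j. scal K (D' g i j))" by blast
      show "\<exists>M N. aut_mat F n c M N \<and> (\<forall>g \<in> carrier G. intertwines F n M (D g) (D' g))"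
        by (rule isomorphism_descends[OF assms(1,5) K.field_axioms _ _ _ M]) (simp_all add: A.c_closed Dc)
    next
      assume "\<exists>M N. aut_mat F n c M N \<and> (\<forall>g \<in> carrier G. intertwines F n M (D g) (D' g))"
      then obtain M N where M: "aut_mat F n c M N" "\<And>g. g \<in> carrier G \<Longrightarrow> intertwines F n M (D g) (D' g)" by blast
      have Mc: "M i j \<in> carrier F" if "i < n" "j < n" for i j using M(1) that by (auto simp: aut_mat_def)
      have "aut_mat K n (\<lambda>i j k. scal K (c i j k)) (\<lambda>i j. scal K (M i j)) (\<lambda>i j. scal K (N i j))"
        by (rule h.aut_mat_push[OF _ M(1)]) (simp add: A.c_closed)
      moreover have "intertwines K n (\<lambda>i j. scal K (M i j)) (\<lambda>i j. scal K (D g i j)) (\<lambda>i j. scal K (D' g i j))"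
        if g: "g \<in> carrier G" for g
        by (rule h.intertwines_push[OF _ _ _ M(2)[OF g]]) (simp_all add: Mc Dc g)
      ultimately show "\<exists>M N. aut_mat K n (\<lambda>i j k. scal K (c i j k)) M N \<and>
        (\<forall>g \<in> carrier G. intertwines K n M (\<lambda>i j. scal K (D g i j)) (\<lambda>i j. scal K (D' g i j)))" by blast
    qed
  qed
  have surj: "\<exists>\<Gamma> \<in> gradings G F A. (?ext \<Gamma>, \<Delta>) \<in> ?s" if \<Delta>: "\<Delta> \<in> gradings G K E.T" for \<Delta>
  proof -
    obtain T D where D: "grad_mat K n E.c' G T D" "\<Delta> = V.mgrading G D" using V.grading_mgrading[OF G \<Delta>] by blast
    obtain D0 M N where D0: "grad_mat F n c G T D0" and M: "aut_mat K n E.c' M N"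
      "\<forall>g \<in> carrier G. intertwines K n M (\<lambda>i j. scal K (D0 g i j)) (D g)"
      using grading_descends[OF assms(1) A assms(4-6) G D(1)[unfolded c']] unfolding c' by blast
    have "(?ext (A.mgrading G D0), \<Delta>) \<in> ?s"
      unfolding ext[OF D0] D(2) V.grading_iso_iff[OF G push[OF D0] D(1)] using M by blast
    then show ?thesis using A.mgrading_grading[OF G D0] by blast
  qed
  have "nonassoc_algebra K E.T" by (rule V.nonassoc_algebra_axioms)
  note Q = quotient_map_bij[OF grading_iso_equiv[OF assms(2)] grading_iso_equiv[OF this], where f = ?ext, OF cl iff surj]
  show ?thesis
    using Q unfolding extend_class_def by blast
qed

end
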